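(* Let $\Bbbk$ be a field, let $X$ be a finite set, and let $I\subseteq\Bbbk[X]$ be the Stanley--Reisner ideal of a simplicial complex $\Delta$ with vertex set $X$. For every $s\in\mathbb{N}$, the ideal $\mathcal{P}_s(I)$ of principal $s$-jets of $I$ is the Stanley--Reisner ideal of a simplicial complex $\Gamma_s$ with vertex set $\mathcal{J}_s(X)$. Writing $\Bbbk[\Delta]=\Bbbk[X]/I$ and $\Bbbk[\Gamma_s]=\Bbbk[\mathcal{J}_s(X)]/\mathcal{P}_s(I)$, the Betti numbers of $\Bbbk[\Gamma_s]$ and $\Bbbk[\Delta]$ are related by $$[\beta_{k-i,k}(\Bbbk[\Gamma_s])]_{0\le i\le k}=[\beta_{j-i,j}(\Bbbk[\Delta])]_{0\le i\le j}\,L_s,$$ where $L_s$ is the order $s$ lifting matrix. In particular, $\Bbbk[\mathcal{J}_s(X)]/\mathcal{P}_s(I)$ has the same Castelnuovo--Mumford regularity as $\Bbbk[X]/I$.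
   Context: $\mathbb{N}$ includes $0$. $\Bbbk[X]$ is the standard graded polynomial ring with the elements of $X$ as variables. A simplicial complex $\Delta$ with vertex set $X$ is a family of subsets of $X$ (faces) closed under taking subsets and containing $\varnothing$. Its Stanley--Reisner ideal $I$ is the squarefree monomial ideal such that the faces of $\Delta$ are exactly the supports (sets of variables dividing the monomial) of the squarefree monomials not in $I$. For a homogeneous ideal $I$ in a standard graded polynomial ring $R$ over $\Bbbk$, $\beta_{i,j}(R/I)=\dim_\Bbbk\operatorname{Tor}^R_i(R/I,\Bbbk)_j$, and the regularity of $R/I$ is $\max\{j-i:\beta_{i,j}(R/I)\ne0\}$. The symbol $[\beta_{j-i,j}]_{0\le i\le j}$ denotes the upper-triangular (infinite) matrix with rows $i\ge0$ and columns $j\ge0$ having entry $\beta_{j-i,j}$ at $(i,j)$ if $i\le j$ and $0$ otherwise. Lifting matrix: for $j,k\in\mathbb{N}$ put $$\ell_s(j,k)=\sum_{a\in\mathbb{Z}_+^j,\ a_1+\dots+a_j=k}\ \prod_{h=1}^j\binom{s+1}{a_h}$$ ($\mathbb{Z}_+$ the positive integers; for $j=0$, $\ell_s(0,0)=1$ and $\ell_s(0,k)=0$ for $k>0$). $L_s$ is the infinite matrix with entry $\ell_s(j,k)$ in row $j\ge0$ and column $k\ge 0$. For $s\in\mathbb{N}$ let $\mathcal{J}_s(X)=\bigcup_{x\in X}\{x_0,\dots,x_s\}$ (new distinct variables). Let $\phi_s\colon\Bbbk[X]\to\Bbbk[\mathcal{J}_s(X)][t]/\langle t^{s+1}\rangle$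 be the $\Bbbk$-algebra homomorphism with $\phi_s(x)=\sum_{j=0}^s x_jt^j$. For an ideal $J=\langle g_1,\dots,g_r\rangle$ of $\Bbbk[X]$, the ideal of $s$-jets $\mathcal{J}_s(J)\subseteq\Bbbk[\mathcal{J}_s(X)]$ is generated by the $g_{i,j}$ determined by $\phi_s(g_i)=\sum_{j=0}^s g_{i,j}t^j$. Ideal of principal $s$-jets: for an ideal $I$ of $\Bbbk[X]$, let $Z$ be the vanishing locus of $I$ in $\mathbb{A}^{|X|}_\Bbbk=\operatorname{Spec}\Bbbk[X]$ with its reduced structure, $Z_{\text{sing}}$ its singular locus, and write $\mathbb{I}(\cdot)$ for the ideal of polynomials vanishing on a subset of affine space (so $\mathbb{I}(Z)=\sqrt I$). The jet scheme $\mathcal{J}_s(\mathbb{A}^{|X|}_\Bbbk)$ is $\operatorname{Spec}\Bbbk[\mathcal{J}_s(X)]$, $\mathcal{J}_s(Z)$ is the vanishing locus in it of $\mathcal{J}_s(\mathbb{I}(Z))$, and $\pi_s\colon\mathcal{J}_s(\mathbb{A}^{|X|}_\Bbbk)\to\mathbb{A}^{|X|}_\Bbbk$ is the projection corresponding to $x\mapsto x_0$. Then $\mathcal{P}_s(I)=\mathbb{I}\bigl(\overline{\mathcal{J}_s(Z)\setminus\pi_s^{-1}(Z_{\text{sing}})}\bigr)\subseteq\Bbbk[\mathcal{J}_s(X)]$, the bar denoting Zariski closure. *)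

theory Defs
  imports
    "HOL-Algebra.Ring_Divisibility"
    "HOL-Library.Poly_Mapping"
    "HOL-Library.Extended_Nat"
    "HOL-Library.Function_Algebras"
    "HOL-Library.Groups_Big_Fun"
    "HOL-Computational_Algebra.Polynomial"
begin

section \<open>Polynomial rings\<close>

text \<open>
  A monomial is an exponent vector, that is, a finitely supported function from the
  variables to the natural numbers; a polynomial is a finitely supported function from
  monomials to coefficients, multiplied by convolution.  The type \<open>'x\<close> may contain more
  elements than the variable set \<open>X\<close>, so the ring in the variables \<open>X\<close> is cut out
  as the carrier of a ring record.
\<close>

type_synonym 'x mon = "'x \<Rightarrow>\<^sub>0 nat"
type_synonym ('x, 'k) mpoly = "'x mon \<Rightarrow>\<^sub>0 'k"

abbreviation keys :: "('a \<Rightarrow>\<^sub>0 'b::zero) \<Rightarrow> 'a set" where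
  "keys \<equiv> Poly_Mapping.keys"

abbreviation lookup :: "('a \<Rightarrow>\<^sub>0 'b::zero) \<Rightarrow> 'a \<Rightarrow> 'b" where
  "lookup \<equiv> Poly_Mapping.lookup"

definition poly_ring :: "'x set \<Rightarrow> ('x, 'k::comm_ring_1) mpoly ring" where
  "poly_ring X =
     \<lparr>carrier = {p. \<forall>m \<in> keys p. keys m \<subseteq> X}, mult = (*), one = 1, zero = 0, add = (+)\<rparr>"

definition monomial_poly :: "'x mon \<Rightarrow> ('x, 'k::comm_ring_1) mpoly" where
  "monomial_poly m = Poly_Mapping.single m 1"

definition var :: "'x \<Rightarrow> ('x, 'k::comm_ring_1) mpoly" where
  "var x = monomial_poly (Poly_Mapping.single x 1)"

definition const :: "'k \<Rightarrow> ('x, 'k::comm_ring_1) mpoly" where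
  "const c = Poly_Mapping.single 0 c"

definition mon_degree :: "'x mon \<Rightarrow> nat" where
  "mon_degree m = (\<Sum>x \<in> keys m. lookup m x)"

text \<open>
  The homomorphism that acts as \<open>c\<close> on coefficients and sends the variable \<open>x\<close> to \<open>h x\<close>.
\<close>

definition subst_poly ::
    "('k \<Rightarrow> 'b::comm_semiring_1) \<Rightarrow> ('x \<Rightarrow> 'b) \<Rightarrow> ('x, 'k::comm_ring_1) mpoly \<Rightarrow> 'b" where
  "subst_poly c h p =
     (\<Sum>m \<in> keys p. c (lookup p m) * (\<Prod>x \<in> keys m. h x ^ lookup m x))"


section \<open>Stanley--Reisner ideals\<close>

definition simplicial_complex :: "'x set \<Rightarrow> 'x set set \<Rightarrow> bool" where
  "simplicial_complex X \<Delta> \<longleftrightarrow>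
     \<Delta> \<subseteq> Pow X \<and> {} \<in> \<Delta> \<and> (\<forall>\<sigma> \<in> \<Delta>. \<forall>\<tau>. \<tau> \<subseteq> \<sigma> \<longrightarrow> \<tau> \<in> \<Delta>)"

definition squarefree_mon :: "'x mon \<Rightarrow> bool" where
  "squarefree_mon m \<longleftrightarrow> (\<forall>x. lookup m x \<le> 1)"

definition squarefree_monomial_ideal ::
    "'x set \<Rightarrow> ('x, 'k::comm_ring_1) mpoly set \<Rightarrow> bool" where
  "squarefree_monomial_ideal X I \<longleftrightarrow>
     (\<exists>M. (\<forall>m \<in> M. squarefree_mon m \<and> keys m \<subseteq> X) \<and>
          I = genideal (poly_ring X) (monomial_poly ` M))"

definition is_stanley_reisner_ideal ::
    "'x set \<Rightarrow> 'x set set \<Rightarrow> ('x, 'k::comm_ring_1) mpoly set \<Rightarrow> bool" where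
  "is_stanley_reisner_ideal X \<Delta> I \<longleftrightarrow>
     squarefree_monomial_ideal X I \<and>
     \<Delta> = {keys m | m. squarefree_mon m \<and> keys m \<subseteq> X \<and> monomial_poly m \<notin> I}"


section \<open>Graded Betti numbers and regularity\<close>

text \<open>
  A complex of finitely generated graded free modules
  \<open>F\<^sub>i = \<Oplus>\<^bsub>a < rk F i\<^esub> R(- shift F i a)\<close>, with an augmentation of \<open>F\<^sub>0\<close>.
  \<open>bnd F i\<close> is the matrix of \<open>F\<^bsub>i+1\<^esub> \<rightarrow> F\<^sub>i\<close> and
  \<open>aug F a\<close> represents the image of the \<open>a\<close>-th basis element of \<open>F\<^sub>0\<close> in \<open>R/I\<close>.
\<close>

record (overloaded) ('x, 'k) free_complex =
  rk :: "nat \<Rightarrow> nat"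
  shift :: "nat \<Rightarrow> nat \<Rightarrow> nat"
  bnd :: "nat \<Rightarrow> nat \<Rightarrow> nat \<Rightarrow> ('x, 'k) mpoly"
  aug :: "nat \<Rightarrow> ('x, 'k) mpoly"

definition free_mod :: "'x set \<Rightarrow> nat \<Rightarrow> (nat \<Rightarrow> ('x, 'k::comm_ring_1) mpoly) set" where
  "free_mod X n =
     {v. (\<forall>a < n. v a \<in> carrier (poly_ring X)) \<and> (\<forall>a \<ge> n. v a = 0)}"

definition mat_apply ::
    "nat \<Rightarrow> nat \<Rightarrow> (nat \<Rightarrow> nat \<Rightarrow> 'a) \<Rightarrow> (nat \<Rightarrow> 'a) \<Rightarrow> nat \<Rightarrow> 'a::comm_ring_1" where
  "mat_apply n m A v = (\<lambda>a. if a < n then (\<Sum>b < m. A a b * v b) else 0)"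

definition graded_free_resolution ::
    "'x set \<Rightarrow> ('x, 'k::comm_ring_1) mpoly set \<Rightarrow> ('x, 'k) free_complex \<Rightarrow> bool" where
  "graded_free_resolution X I F \<longleftrightarrow>
     \<comment> \<open>the maps are defined over the ring and homogeneous of degree 0\<close>
     (\<forall>a < rk F 0. aug F a \<in> carrier (poly_ring X) \<and>
        (\<forall>m \<in> keys (aug F a). mon_degree m = shift F 0 a)) \<and>
     (\<forall>i. \<forall>a < rk F i. \<forall>b < rk F (Suc i).
        bnd F i a b \<in> carrier (poly_ring X) \<and>
        (\<forall>m \<in> keys (bnd F i a b). mon_degree m + shift F i a = shift F (Suc i) b)) \<and>
     \<comment> \<open>exactness at \<open>R/I\<close>, at \<open>F\<^sub>0\<close>, and at \<open>F\<^bsub>i+1\<^esub>\<close>\<close>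
     (\<forall>f \<in> carrier (poly_ring X). \<exists>v \<in> free_mod X (rk F 0).
        f - (\<Sum>a < rk F 0. v a * aug F a) \<in> I) \<and>
     {v \<in> free_mod X (rk F 0). (\<Sum>a < rk F 0. v a * aug F a) \<in> I} =
       mat_apply (rk F 0) (rk F 1) (bnd F 0) ` free_mod X (rk F 1) \<and>
     (\<forall>i. {v \<in> free_mod X (rk F (Suc i)).
            mat_apply (rk F i) (rk F (Suc i)) (bnd F i) v = (\<lambda>_. 0)} =
          mat_apply (rk F (Suc i)) (rk F (Suc (Suc i))) (bnd F (Suc i))
            ` free_mod X (rk F (Suc (Suc i))))"

text \<open>
  The complex \<open>F \<otimes>\<^sub>R \<k>\<close>, where the residue field \<open>\<k> = R/\<langle>X\<rangle>\<close> sits in degree 0.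
  Since \<open>R(-d) \<otimes>\<^sub>R \<k> = \<k>(-d)\<close>, its \<open>i\<close>-th term in degree \<open>j\<close> has as basis the
  basis elements of \<open>F\<^sub>i\<close> of degree \<open>j\<close>, and its matrices are those of
  \<open>F\<close> reduced modulo \<open>\<langle>X\<rangle>\<close>, that is, replaced by their constant terms.
\<close>

definition residue_term :: "('x, 'k::field) free_complex \<Rightarrow> nat \<Rightarrow> nat \<Rightarrow> (nat \<Rightarrow> 'k) set" where
  "residue_term F i j = {v. \<forall>a. \<not> (a < rk F i \<and> shift F i a = j) \<longrightarrow> v a = 0}"

definition residue_bnd ::
    "('x, 'k::field) free_complex \<Rightarrow> nat \<Rightarrow> (nat \<Rightarrow> 'k) \<Rightarrow> nat \<Rightarrow> 'k" where
  "residue_bnd F i = mat_apply (rk F i) (rk F (Suc i)) (\<lambda>a b. lookup (bnd F i a b) 0)"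

definition residue_cycles ::
    "('x, 'k::field) free_complex \<Rightarrow> nat \<Rightarrow> nat \<Rightarrow> (nat \<Rightarrow> 'k) set" where
  "residue_cycles F i j =
     {v \<in> residue_term F i j. case i of 0 \<Rightarrow> True | Suc h \<Rightarrow> residue_bnd F h v = (\<lambda>_. 0)}"

definition residue_boundaries ::
    "('x, 'k::field) free_complex \<Rightarrow> nat \<Rightarrow> nat \<Rightarrow> (nat \<Rightarrow> 'k) set" where
  "residue_boundaries F i j = residue_bnd F i ` residue_term F (Suc i) j"

definition kdim :: "(nat \<Rightarrow> 'k::field) set \<Rightarrow> nat" where
  "kdim = vector_space.dim (\<lambda>c v a. c * v a)"

text \<open>
  \<open>betti X I i j\<close> is the \<open>\<k>\<close>-dimension of \<open>Tor\<^sub>i(R/I, \<k>)\<^sub>j\<close>, the homology of \<open>F \<otimes>\<^sub>R \<k>\<close>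
  at \<open>i\<close> in degree \<open>j\<close>, for any graded free resolution \<open>F\<close> of \<open>R/I\<close>.  The cycles are
  finite-dimensional and contain the boundaries, so the dimension of the quotient is
  the difference of the dimensions.
\<close>

definition betti :: "'x set \<Rightarrow> ('x, 'k::field) mpoly set \<Rightarrow> nat \<Rightarrow> nat \<Rightarrow> nat" where
  "betti X I i j =
     (let F = (SOME F. graded_free_resolution X I F)
      in kdim (residue_cycles F i j) - kdim (residue_boundaries F i j))"

definition regularity :: "'x set \<Rightarrow> ('x, 'k::field) mpoly set \<Rightarrow> int" where
  "regularity X I = Max {int j - int i | i j. betti X I i j \<noteq> 0}"

definition betti_matrix :: "'x set \<Rightarrow> ('x, 'k::field) mpoly set \<Rightarrow> nat \<Rightarrow> nat \<Rightarrow> nat" where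
  "betti_matrix X I i j = (if i \<le> j then betti X I (j - i) j else 0)"


section \<open>The lifting matrix\<close>

definition lifting_matrix :: "nat \<Rightarrow> nat \<Rightarrow> nat \<Rightarrow> nat" where
  "lifting_matrix s j k =
     (\<Sum>a \<in> {a :: nat list. length a = j \<and> (\<forall>e \<in> set a. 0 < e) \<and> sum_list a = k}.
        \<Prod>h < j. (s + 1) choose (a ! h))"

text \<open>
  The product of infinite matrices; \<open>Sum_any\<close> sums over the indices with nonzero
  summand.  The lifting matrix is upper triangular, so there are finitely many of those
  in every product with it on the right.
\<close>

definition inf_mat_mult ::
    "(nat \<Rightarrow> nat \<Rightarrow> nat) \<Rightarrow> (nat \<Rightarrow> nat \<Rightarrow> nat) \<Rightarrow> nat \<Rightarrow> nat \<Rightarrow> nat" where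
  "inf_mat_mult A B = (\<lambda>i k. Sum_any (\<lambda>j. A i j * B j k))"

lemma lifting_matrix_upper:
  assumes "k < j"
  shows "lifting_matrix s j k = 0"
proof -
  have "length a \<le> sum_list a" if "\<forall>e \<in> set a. 0 < e" for a :: "nat list"
    using that by (induction a) auto
  then have "\<not> (length a = j \<and> (\<forall>e \<in> set a. 0 < e) \<and> sum_list a = k)" for a :: "nat list"
    using assms by (metis not_le)
  then have "{a :: nat list. length a = j \<and> (\<forall>e \<in> set a. 0 < e) \<and> sum_list a = k} = {}"
    by (simp only: Collect_empty_eq simp_thms)
  then show ?thesis
    by (simp only: lifting_matrix_def sum.empty)
qed

lemma inf_mat_mult_lifting:
  "inf_mat_mult A (lifting_matrix s) i k = (\<Sum>j \<le> k. A i j * lifting_matrix s j k)"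
proof -
  have "j \<le> k" if "A i j * lifting_matrix s j k \<noteq> 0" for j
    using that lifting_matrix_upper[of k j s] by (cases "k < j") auto
  then have "{j. A i j * lifting_matrix s j k \<noteq> 0} \<subseteq> {..k}"
    by blast
  then show ?thesis
    unfolding inf_mat_mult_def by (intro Sum_any.expand_superset) auto
qed


section \<open>Prime spectra\<close>

text \<open>
  Points of affine schemes are prime ideals: over an arbitrary field the rational points
  do not determine the vanishing locus.
\<close>

definition Spec :: "('a, 'm) ring_scheme \<Rightarrow> 'a set set" where
  "Spec R = {P. primeideal P R}"

definition vanishing_locus :: "('a, 'm) ring_scheme \<Rightarrow> 'a set \<Rightarrow> 'a set set" where
  "vanishing_locus R S = {P \<in> Spec R. S \<subseteq> P}"

definition vanishing_ideal :: "('a, 'm) ring_scheme \<Rightarrow> 'a set set \<Rightarrow> 'a set" where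
  "vanishing_ideal R Y = {f \<in> carrier R. \<forall>P \<in> Y. f \<in> P}"

definition zariski_closure :: "('a, 'm) ring_scheme \<Rightarrow> 'a set set \<Rightarrow> 'a set set" where
  "zariski_closure R Y =
     \<Inter> {vanishing_locus R S | S. S \<subseteq> carrier R \<and> Y \<subseteq> vanishing_locus R S}"


section \<open>Regular local rings and the singular locus\<close>

definition loc_rel :: "('a, 'm) ring_scheme \<Rightarrow> 'a set \<Rightarrow> (('a \<times> 'a) \<times> ('a \<times> 'a)) set" where
  "loc_rel R S =
     {((a, s), (b, t)) | a s b t. a \<in> carrier R \<and> s \<in> S \<and> b \<in> carrier R \<and> t \<in> S \<and>
        (\<exists>u \<in> S. u \<otimes>\<^bsub>R\<^esub> (t \<otimes>\<^bsub>R\<^esub> a) = u \<otimes>\<^bsub>R\<^esub> (s \<otimes>\<^bsub>R\<^esub> b))}"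

definition loc_frac :: "('a, 'm) ring_scheme \<Rightarrow> 'a set \<Rightarrow> 'a \<Rightarrow> 'a \<Rightarrow> ('a \<times> 'a) set" where
  "loc_frac R S a s = loc_rel R S `` {(a, s)}"

text \<open>
  The ring of fractions with denominators in a multiplicative set.  The unions below
  range over representatives and consist of a single class each.
\<close>

definition localization :: "('a, 'm) ring_scheme \<Rightarrow> 'a set \<Rightarrow> ('a \<times> 'a) set ring" where
  "localization R S =
     \<lparr>carrier = (carrier R \<times> S) // loc_rel R S,
      mult = (\<lambda>A B. \<Union>(a, s) \<in> A. \<Union>(b, t) \<in> B. loc_frac R S (a \<otimes>\<^bsub>R\<^esub> b) (s \<otimes>\<^bsub>R\<^esub> t)),
      one = loc_frac R S \<one>\<^bsub>R\<^esub> \<one>\<^bsub>R\<^esub>,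
      zero = loc_frac R S \<zero>\<^bsub>R\<^esub> \<one>\<^bsub>R\<^esub>,
      add = (\<lambda>A B. \<Union>(a, s) \<in> A. \<Union>(b, t) \<in> B.
               loc_frac R S ((t \<otimes>\<^bsub>R\<^esub> a) \<oplus>\<^bsub>R\<^esub> (s \<otimes>\<^bsub>R\<^esub> b)) (s \<otimes>\<^bsub>R\<^esub> t))\<rparr>"

definition krull_dim :: "('a, 'm) ring_scheme \<Rightarrow> enat" where
  "krull_dim R =
     Sup {enat n | n. \<exists>P :: nat \<Rightarrow> 'a set.
            (\<forall>i \<le> n. primeideal (P i) R) \<and> (\<forall>i < n. P i \<subset> P (Suc i))}"

text \<open>
  A Noetherian local ring is regular if its maximal ideal can be generated by as many
  elements as the Krull dimension (it can never be generated by fewer).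
\<close>

definition regular_local_ring :: "('a, 'm) ring_scheme \<Rightarrow> bool" where
  "regular_local_ring R \<longleftrightarrow>
     cring R \<and> noetherian_ring R \<and> (\<exists>!M. maximalideal M R) \<and>
     (\<exists>A. finite A \<and> A \<subseteq> carrier R \<and> maximalideal (genideal R A) R \<and>
          enat (card A) = krull_dim R)"

text \<open>
  The local ring at the point \<open>P\<close> of the closed subset \<open>Z\<close> with its reduced structure is the
  localization of \<open>R/\<I>(Z)\<close> at the image of \<open>P\<close>.
\<close>

definition local_ring_at ::
    "('a, 'm) ring_scheme \<Rightarrow> 'a set set \<Rightarrow> 'a set \<Rightarrow> ('a set \<times> 'a set) set ring" where
  "local_ring_at R Z P =
     (let J = vanishing_ideal R Z
      in localization (R Quot J) (carrier (R Quot J) - (\<lambda>f. J +>\<^bsub>R\<^esub> f) ` P))"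

definition singular_locus :: "('a, 'm) ring_scheme \<Rightarrow> 'a set set \<Rightarrow> 'a set set" where
  "singular_locus R Z = {P \<in> Z. \<not> regular_local_ring (local_ring_at R Z P)}"


section \<open>Jets and principal jets\<close>

text \<open>The variable \<open>x\<^sub>j\<close> is the pair \<open>(x, j)\<close>.\<close>

definition jet_vars :: "nat \<Rightarrow> 'x set \<Rightarrow> ('x \<times> nat) set" where
  "jet_vars s X = X \<times> {..s}"

text \<open>
  \<open>jet_hom s g\<close> is a lift to \<open>\<k>[\<J>\<^sub>s(X)][t]\<close> of \<open>\<phi>\<^sub>s(g)\<close>.  Modulo \<open>t\<^bsup>s+1\<^esup>\<close> it is
  given by its coefficients of index at most \<open>s\<close>.
\<close>

definition jet_hom ::
    "nat \<Rightarrow> ('x, 'k::comm_ring_1) mpoly \<Rightarrow> ('x \<times> nat, 'k) mpoly Polynomial.poly" where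
  "jet_hom s = subst_poly (\<lambda>c. [:const c:]) (\<lambda>x. \<Sum>j \<le> s. Polynomial.monom (var (x, j)) j)"

text \<open>
  The ideal of jets does not depend on the generators of \<open>J\<close>, because \<open>\<phi>\<^sub>s\<close> is a
  homomorphism; here the generating set is \<open>J\<close> itself.
\<close>

definition jet_ideal ::
    "nat \<Rightarrow> 'x set \<Rightarrow> ('x, 'k::comm_ring_1) mpoly set \<Rightarrow> ('x \<times> nat, 'k) mpoly set" where
  "jet_ideal s X J =
     genideal (poly_ring (jet_vars s X))
       {Polynomial.coeff (jet_hom s g) j | g j. g \<in> J \<and> j \<le> s}"

text \<open>
  The projection \<open>\<pi>\<^sub>s\<close> on points: the preimage of a prime under the homomorphism
  that sends \<open>x\<close> to \<open>x\<^sub>0\<close>.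
\<close>

definition jet_proj ::
    "'x set \<Rightarrow> ('x \<times> nat, 'k::comm_ring_1) mpoly set \<Rightarrow> ('x, 'k) mpoly set" where
  "jet_proj X Q = {f \<in> carrier (poly_ring X). subst_poly const (\<lambda>x. var (x, 0)) f \<in> Q}"

definition jet_locus ::
    "nat \<Rightarrow> 'x set \<Rightarrow> ('x, 'k::field) mpoly set set \<Rightarrow> ('x \<times> nat, 'k) mpoly set set" where
  "jet_locus s X Z =
     vanishing_locus (poly_ring (jet_vars s X))
       (jet_ideal s X (vanishing_ideal (poly_ring X) Z))"

definition principal_jets ::
    "nat \<Rightarrow> 'x set \<Rightarrow> ('x, 'k::field) mpoly set \<Rightarrow> ('x \<times> nat, 'k) mpoly set" where
  "principal_jets s X I =
     (let R = poly_ring X;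
          S = poly_ring (jet_vars s X);
          Z = vanishing_locus R I
      in vanishing_ideal S
           (zariski_closure S
              (jet_locus s X Z - {Q \<in> Spec S. jet_proj X Q \<in> singular_locus R Z})))"

end

theory Submission
  imports Defs
begin

text \<open>
  The variety \<open>Z\<close> is a union of coordinate subspaces, one for each facet of \<open>\<Delta>\<close>.  It is regular at the
  generic points of these subspaces, and at a regular point \<open>P\<close> only one of them passes through \<open>P\<close>:
  otherwise the bottom of a maximal chain of primes at \<open>P\<close> contains a variable \<open>w\<close> that is not in
  the square of the maximal ideal, \<open>w\<close> replaces one of the \<open>d\<close> parameters, and the chain of
  length \<open>d\<close> contradicts Krull's height theorem modulo its bottom.  A jet over a regular point
  therefore lies in the jets of a single coordinate subspace, and \<open>\<P>\<^sub>s(I)\<close> is the Stanley--Reisner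
  ideal of the complex of all \<open>\<sigma>\<close> whose projection to \<open>X\<close> is a face of \<open>\<Delta>\<close>.

  Comparing a resolution with the Koszul complex writes \<open>\<beta>\<^bsub>i,j\<^esub>\<close> as the sum over the \<open>j\<close>-sets \<open>\<tau>\<close> of
  the \<open>i\<close>-th homology of the sets \<open>\<sigma> \<subseteq> \<tau>\<close> with \<open>\<tau> - \<sigma> \<in> \<Delta>\<close> (Hochster's formula).  In the complex of
  jets two lifts of the same variable dominate each other, and deleting one of them from \<open>\<tau>\<close>
  shifts the homology by one degree.  Hence the contribution of \<open>\<tau>\<close> to a row of the Betti matrix depends only
  on the projection of \<open>\<tau>\<close>, and \<open>\<ell>\<^sub>s(j,k)\<close> counts the \<open>k\<close>-sets that project onto a given \<open>j\<close>-set.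
  The diagonal of the lifting matrix is positive, so no nonzero row is lost.
\<close>

section \<open>Polynomials\<close>

text \<open>The resolution behind the Betti numbers is picked by \<open>SOME\<close>. So one must be
  exhibited (Taylor's, on all nonfaces), and the computation must work for an arbitrary resolution
  F: in the double complex of F with the Koszul complex, rows and columns are exact, the rows
  augmented to F tensored with the residue field, the columns to the Koszul complex of R/I. The
  latter splits over multidegrees into chain complexes on set systems. Homology is compared through
  relations between cycles instead of quotient maps, and the height theorem treats local rings
  through saturated ideals of R. At a regular point P some prime of the local ring lies in the
  extension of an ideal K that contains I and the products of elements of P. Here K consists of the
  f in P that have no first-order term, modulo P, along any variable w that extends the face V of
  variables outside P. If these w did not form a face, their product would be in I and one of them
  would be in that prime, although its first-order term along itself is 1. First-order terms come
  from substituting an indeterminate for w, which is meaningful in every characteristic.\<close>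

lemma carrier_poly_ring: "p \<in> carrier (poly_ring X) \<longleftrightarrow> (\<forall>m \<in> keys p. keys m \<subseteq> X)"
  by (simp add: poly_ring_def)

lemma poly_ring_simps [simp]:
  "mult (poly_ring X) = (*)" "one (poly_ring X) = 1" "zero (poly_ring X) = 0" "add (poly_ring X) = (+)"
  by (simp_all add: poly_ring_def)

lemma keys_mon_add: "keys (m + n) = keys m \<union> keys (n :: 'x mon)"
  by (auto simp: in_keys_iff lookup_add)

lemma keys_uminus [simp]: "keys (- p :: 'a \<Rightarrow>\<^sub>0 'b::ab_group_add) = keys p"
  by (auto simp: in_keys_iff)

lemma poly_sum_singles: "(p :: 'a \<Rightarrow>\<^sub>0 'b::comm_monoid_add) = (\<Sum>m\<in>keys p. Poly_Mapping.single m (lookup p m))"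
  by (rule poly_mapping_eqI)
    (simp add: lookup_sum lookup_single when_def in_keys_iff cong: sum.cong)

lemma poly_induct [case_names single add]:
  assumes "\<And>m c. P (Poly_Mapping.single m c)" and "\<And>p q. P p \<Longrightarrow> P q \<Longrightarrow> P (p + q)"
  shows "P (p :: 'a \<Rightarrow>\<^sub>0 'b::comm_monoid_add)"
proof -
  have "P 0" using assms(1)[of undefined 0] by simp
  have "P (\<Sum>m\<in>A. Poly_Mapping.single m (lookup p m))" if "finite A" for A
    using that by (induction A) (auto intro: assms \<open>P 0\<close>)
  then show ?thesis using poly_sum_singles[of p] by (metis finite_keys)
qed

lemma in_keys_mult: "m \<in> keys (p * q) \<Longrightarrow> \<exists>a b. a \<in> keys p \<and> b \<in> keys q \<and> m = a + b"
  using keys_mult[of p q] by blast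

lemma in_keys_addD: "m \<in> keys (p + q) \<Longrightarrow> m \<in> keys p \<or> m \<in> keys q"
  using keys_add[of p q] by blast

lemma in_keys_sumD: "m \<in> keys (sum f A) \<Longrightarrow> \<exists>a\<in>A. m \<in> keys (f a)"
proof (induction A rule: infinite_finite_induct)
  case (insert x F)
  then show ?case using in_keys_addD[of m "f x" "sum f F"] by auto
qed auto

lemma poly_ring_zero [simp]: "0 \<in> carrier (poly_ring X)"
  and poly_ring_one [simp]: "1 \<in> carrier (poly_ring X)"
  by (auto simp: carrier_poly_ring)

lemma poly_ring_add: "p \<in> carrier (poly_ring X) \<Longrightarrow> q \<in> carrier (poly_ring X) \<Longrightarrow> p + q \<in> carrier (poly_ring X)"
  unfolding carrier_poly_ring by (blast dest: in_keys_addD)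

lemma poly_ring_mult: "p \<in> carrier (poly_ring X) \<Longrightarrow> q \<in> carrier (poly_ring X) \<Longrightarrow> p * q \<in> carrier (poly_ring X)"
  unfolding carrier_poly_ring by (fastforce dest!: in_keys_mult simp: keys_mon_add)

lemma poly_ring_uminus: "p \<in> carrier (poly_ring X) \<Longrightarrow> - p \<in> carrier (poly_ring X)"
  by (simp add: carrier_poly_ring)

lemma poly_ring_sum: "(\<And>a. a \<in> A \<Longrightarrow> f a \<in> carrier (poly_ring X)) \<Longrightarrow> sum f A \<in> carrier (poly_ring X)"
  by (induction A rule: infinite_finite_induct) (auto intro: poly_ring_add)

lemma poly_ring_prod: "(\<And>a. a \<in> A \<Longrightarrow> f a \<in> carrier (poly_ring X)) \<Longrightarrow> prod f A \<in> carrier (poly_ring X)"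
  by (induction A rule: infinite_finite_induct) (auto intro: poly_ring_mult)

lemma poly_ring_single: "keys m \<subseteq> X \<Longrightarrow> Poly_Mapping.single m c \<in> carrier (poly_ring X)"
  by (auto simp: carrier_poly_ring)

lemma poly_ring_const: "const c \<in> carrier (poly_ring X)"
  by (simp add: const_def poly_ring_single)

lemma poly_ring_var: "x \<in> X \<Longrightarrow> var x \<in> carrier (poly_ring X)"
  by (simp add: var_def monomial_poly_def poly_ring_single)

lemma cring_poly_ring: "cring (poly_ring X)"
proof (rule cringI)
  show "abelian_group (poly_ring X)"
    by (rule abelian_groupI)
      (auto intro: poly_ring_add poly_ring_uminus simp: algebra_simps intro!: bexI[of _ "- _"])
  show "Group.comm_monoid (poly_ring X)"
    by (rule comm_monoidI) (auto intro: poly_ring_mult simp: algebra_simps)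
qed (auto simp: algebra_simps)

text \<open>Negation is multiplication by the ring element \<open>- 1\<close>, so closure under
  addition and scaling gives a subgroup.\<close>

lemma ideal_poly_ringI:
  assumes "L \<subseteq> carrier (poly_ring X)" "0 \<in> L" "\<And>a b. a \<in> L \<Longrightarrow> b \<in> L \<Longrightarrow> a + b \<in> L"
    and "\<And>a r. a \<in> L \<Longrightarrow> r \<in> carrier (poly_ring X) \<Longrightarrow> r * a \<in> L"
  shows "ideal L (poly_ring X :: ('x,'k::comm_ring_1) mpoly ring)"
proof -
  interpret cring "poly_ring X :: ('x,'k) mpoly ring" by (rule cring_poly_ring)
  show ?thesis
  proof (rule idealI)
    show "ring (poly_ring X :: ('x,'k) mpoly ring)" by (rule ring_axioms)
    show "subgroup L (add_monoid (poly_ring X))"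
    proof (rule group.subgroupI)
      show "group (add_monoid (poly_ring X :: ('x,'k) mpoly ring))" by (rule a_group)
      fix a assume a: "a \<in> L"
      have "a_inv (poly_ring X) a = - a"
        using minus_equality[of "- a" a] a assms(1) poly_ring_uminus[of a] by auto
      then show "inv\<^bsub>add_monoid (poly_ring X)\<^esub> a \<in> L"
        using assms(4)[OF a, of "- 1"] by (simp add: a_inv_def poly_ring_uminus)
    qed (use assms in auto)
  qed (use assms in \<open>auto simp: mult.commute\<close>)
qed

lemma primeideal_poly_ring_iff:
  "primeideal P (poly_ring X :: ('x,'k::comm_ring_1) mpoly ring) \<longleftrightarrow>
    ideal P (poly_ring X) \<and> 1 \<notin> P \<and>
    (\<forall>a\<in>carrier (poly_ring X). \<forall>b\<in>carrier (poly_ring X). a * b \<in> P \<longrightarrow> a \<in> P \<or> b \<in> P)"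
  (is "?L \<longleftrightarrow> ?R")
proof
  assume L: ?L
  then interpret primeideal P "poly_ring X" .
  show ?R using I_prime one_imp_carrier I_notcarr is_ideal by auto
next
  assume R: ?R
  then show ?L by (intro primeidealI) (auto simp: cring_poly_ring)
qed

locale poly_prime =
  fixes X :: "'x set" and P :: "('x,'k::comm_ring_1) mpoly set"
  assumes prime: "primeideal P (poly_ring X)"
begin

lemma carrier: "a \<in> P \<Longrightarrow> a \<in> carrier (poly_ring X)"
  using ideal.Icarr[of P "poly_ring X"] prime by (simp add: primeideal_def)

lemma zero: "0 \<in> P"
  using prime additive_subgroup.zero_closed[of P "poly_ring X"]
  by (simp add: primeideal_def ideal_def)

lemma add: "a \<in> P \<Longrightarrow> b \<in> P \<Longrightarrow> a + b \<in> P"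
  using prime additive_subgroup.a_closed[of P "poly_ring X" a b]
  by (simp add: primeideal_def ideal_def)

lemma mult: "a \<in> P \<Longrightarrow> b \<in> carrier (poly_ring X) \<Longrightarrow> b * a \<in> P"
  using prime ideal.I_l_closed[of P "poly_ring X" a b] by (simp add: primeideal_def)

lemma mult': "a \<in> P \<Longrightarrow> b \<in> carrier (poly_ring X) \<Longrightarrow> a * b \<in> P"
  using mult by (simp add: mult.commute)

lemma one: "1 \<notin> P" using prime by (simp add: primeideal_poly_ring_iff)

lemma primeD: "a * b \<in> P \<Longrightarrow> a \<in> carrier (poly_ring X) \<Longrightarrow> b \<in> carrier (poly_ring X) \<Longrightarrow> a \<in> P \<or> b \<in> P"
  using prime by (simp add: primeideal_poly_ring_iff)

lemma uminus: "a \<in> P \<Longrightarrow> - a \<in> P"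
  using mult[of a "- 1"] by (simp add: poly_ring_uminus)

lemma diff: "a \<in> P \<Longrightarrow> b \<in> P \<Longrightarrow> a - b \<in> P"
  using add[of a "- b"] uminus by simp

lemma sum: "(\<And>i. i \<in> A \<Longrightarrow> f i \<in> P) \<Longrightarrow> sum f A \<in> P"
  by (induction A rule: infinite_finite_induct) (auto intro: add zero)

lemma prod_notin:
  assumes "\<And>i. i \<in> A \<Longrightarrow> f i \<in> carrier (poly_ring X) - P"
  shows "prod f A \<in> carrier (poly_ring X) - P"
  using assms
proof (induction A rule: infinite_finite_induct)
  case (insert x F)
  then show ?case using primeD[of "f x" "prod f F"] poly_ring_mult by auto
qed (auto simp: one)

end

subsection \<open>Substitution\<close>

definition eval_mon :: "('x \<Rightarrow> 'b::comm_semiring_1) \<Rightarrow> 'x mon \<Rightarrow> 'b" where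
  "eval_mon h m = (\<Prod>x \<in> keys m. h x ^ lookup m x)"

lemma eval_mon_superset:
  assumes "finite A" "keys m \<subseteq> A"
  shows "eval_mon h m = (\<Prod>x\<in>A. h x ^ lookup m x)"
  unfolding eval_mon_def using assms
  by (intro prod.mono_neutral_left) (auto simp: in_keys_iff)

lemma eval_mon_add: "eval_mon h (m + n) = eval_mon h m * eval_mon h n"
proof -
  let ?A = "keys m \<union> keys n"
  have "eval_mon h (m + n) = (\<Prod>x\<in>?A. h x ^ lookup (m + n) x)"
    by (rule eval_mon_superset) (auto simp: keys_mon_add)
  also have "\<dots> = (\<Prod>x\<in>?A. h x ^ lookup m x) * (\<Prod>x\<in>?A. h x ^ lookup n x)"
    by (simp add: lookup_add power_add prod.distrib)
  finally show ?thesis by (simp add: eval_mon_superset[of ?A])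
qed

lemma eval_mon_zero [simp]: "eval_mon h 0 = 1"
  by (simp add: eval_mon_def)

lemma eval_mon_single [simp]: "eval_mon h (Poly_Mapping.single x n) = h x ^ n"
  by (cases "n = 0") (simp_all add: eval_mon_def)

text \<open>Two coefficient maps occur: constants of a polynomial ring, for the map behind the
  projection of jets, and constants of polynomials in a further variable \<open>t\<close>, for jets
  and for first-order terms. One proof of multiplicativity serves both.\<close>

locale coeff_hom =
  fixes c :: "'k::comm_ring_1 \<Rightarrow> 'b::comm_ring_1"
  assumes c_add: "c (a + b) = c a + c b" and c_mult: "c (a * b) = c a * c b"
    and c_one: "c 1 = 1"
begin

lemma c_zero [simp]: "c 0 = 0" using c_add[of 0 0] by simp

lemma subst_superset:
  assumes "finite A" "keys p \<subseteq> A"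
  shows "subst_poly c h p = (\<Sum>m\<in>A. c (lookup p m) * eval_mon h m)"
  unfolding subst_poly_def eval_mon_def[symmetric] using assms
  by (intro sum.mono_neutral_left) (auto simp: in_keys_iff)

lemma subst_add: "subst_poly c h (p + q) = subst_poly c h p + subst_poly c h q"
proof -
  let ?A = "keys p \<union> keys q"
  have "subst_poly c h (p + q) = (\<Sum>m\<in>?A. c (lookup (p + q) m) * eval_mon h m)"
    by (rule subst_superset) (auto dest: in_keys_addD)
  also have "\<dots> = (\<Sum>m\<in>?A. c (lookup p m) * eval_mon h m) + (\<Sum>m\<in>?A. c (lookup q m) * eval_mon h m)"
    by (simp add: lookup_add c_add algebra_simps sum.distrib)
  finally show ?thesis by (simp add: subst_superset[of ?A])
qed

lemma subst_single: "subst_poly c h (Poly_Mapping.single m a) = c a * eval_mon h m"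
  by (subst subst_superset[of "{m}"]) auto

lemma subst_zero [simp]: "subst_poly c h 0 = 0"
  by (simp add: subst_poly_def)

lemma subst_one [simp]: "subst_poly c h 1 = 1"
  using subst_single[of h 0 1] by (simp add: c_one)

lemma subst_mult: "subst_poly c h (p * q) = subst_poly c h p * subst_poly c h q"
proof (induction p rule: poly_induct)
  case (single m a)
  then show ?case
  proof (induction q rule: poly_induct)
    case (single n b)
    then show ?case by (simp add: mult_single subst_single c_mult eval_mon_add)
  qed (simp add: subst_add algebra_simps)
qed (simp add: subst_add algebra_simps)

lemma subst_var: "subst_poly c h (var x) = h x"
  by (simp add: var_def monomial_poly_def subst_single c_one)

end

interpretation const_hom: coeff_hom const
  by unfold_locales (simp_all add: const_def single_add mult_single)

interpretation pconst_hom: coeff_hom "\<lambda>c. [:const c:]"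
  by unfold_locales (simp_all add: const_hom.c_add const_hom.c_mult const_hom.c_one)

lemma monomial_poly_mult: "monomial_poly (m + n) = monomial_poly m * monomial_poly n"
  by (simp add: monomial_poly_def mult_single)

text \<open>Multiplying by a monomial shifts exponents by \<open>n\<close>; the truncated difference
  \<open>m - n\<close> is read only where \<open>n\<close> divides \<open>m\<close>.\<close>

lemma lookup_monomial_mult:
  "lookup (monomial_poly n * p) m = (if \<exists>l. m = n + l then lookup p (m - n) else 0)"
proof (induction p rule: poly_induct)
  case (single k c)
  show ?case
  proof (cases "\<exists>l. m = n + l")
    case True
    then obtain l where "m = n + l" by blast
    then show ?thesis by (auto simp: monomial_poly_def mult_single lookup_single when_def)
  next
    case False
    then have "n + k \<noteq> m" by blast
    with False show ?thesis by (simp add: monomial_poly_def mult_single lookup_single when_def)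
  qed
next
  case (add p q)
  then show ?case by (simp add: distrib_left lookup_add)
qed

lemma mon_dvd_iff: "(\<exists>l. m = n + l) \<longleftrightarrow> (\<forall>x. lookup n x \<le> lookup (m :: 'x mon) x)"
proof
  assume "\<forall>x. lookup n x \<le> lookup m x"
  then have "m = n + (m - n)"
    by (intro poly_mapping_eqI) (simp add: lookup_add lookup_minus)
  then show "\<exists>l. m = n + l" by blast
qed (auto simp: lookup_add)

lemma lookup_const_mult: "lookup (const c * p) m = c * lookup p m"
proof (induction p rule: poly_induct)
  case (single k d)
  show ?case by (auto simp: const_def mult_single lookup_single when_def)
next
  case (add p q)
  then show ?case by (simp add: distrib_left lookup_add)
qed

subsection \<open>Squarefree monomials and Stanley--Reisner ideals\<close>

text \<open>For infinite \<open>A\<close> the indicator function has no finite support and the value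
  is unspecified, so the rules for this monomial assume \<open>A\<close> finite.\<close>

definition sqf :: "'x set \<Rightarrow> 'x mon" where
  "sqf A = Abs_poly_mapping (\<lambda>x. if x \<in> A then 1 else 0)"

lemma lookup_sqf: "finite A \<Longrightarrow> lookup (sqf A) x = (if x \<in> A then 1 else 0)"
  unfolding sqf_def by (subst lookup_Abs_poly_mapping) (auto elim: rev_finite_subset)

lemma keys_sqf: "finite A \<Longrightarrow> keys (sqf A) = A"
  by (auto simp: in_keys_iff lookup_sqf split: if_splits)

lemma squarefree_sqf: "finite A \<Longrightarrow> squarefree_mon (sqf A)"
  by (auto simp: squarefree_mon_def lookup_sqf)

lemma squarefree_mon_eq: "squarefree_mon m \<Longrightarrow> m = sqf (keys m)"
proof (rule poly_mapping_eqI)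
  fix x assume "squarefree_mon m"
  then have "lookup m x \<le> 1" by (simp add: squarefree_mon_def)
  then show "lookup m x = lookup (sqf (keys m)) x"
    by (auto simp: lookup_sqf in_keys_iff)
qed

lemma mon_degree_superset:
  "finite A \<Longrightarrow> keys m \<subseteq> A \<Longrightarrow> mon_degree m = (\<Sum>x\<in>A. lookup m x)"
  unfolding mon_degree_def by (rule sum.mono_neutral_left) (auto simp: in_keys_iff)

lemma mon_degree_add: "mon_degree (m + n) = mon_degree m + mon_degree n"
proof -
  let ?A = "keys m \<union> keys n"
  have "mon_degree (m + n) = (\<Sum>x\<in>?A. lookup (m + n) x)"
    by (rule mon_degree_superset) (auto simp: keys_mon_add)
  then show ?thesis by (simp add: lookup_add sum.distrib mon_degree_superset[of ?A])
qed

lemma mon_degree_zero_iff: "mon_degree m = 0 \<longleftrightarrow> m = 0"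
  unfolding mon_degree_def
  by (auto simp: in_keys_iff intro!: poly_mapping_eqI)

lemma mon_degree_sqf: "finite A \<Longrightarrow> mon_degree (sqf A) = card A"
  by (simp add: mon_degree_def keys_sqf lookup_sqf)

text \<open>The Stanley--Reisner ideal by coefficients: a monomial ideal contains a polynomial
  exactly when it contains every monomial occurring in it, and a monomial is outside exactly when
  its support is a face. The later arguments use this form.\<close>

definition sr_ideal :: "'x set \<Rightarrow> 'x set set \<Rightarrow> ('x, 'k::comm_ring_1) mpoly set" where
  "sr_ideal X \<Delta> = {f \<in> carrier (poly_ring X). \<forall>m \<in> keys f. keys m \<notin> \<Delta>}"

text \<open>Divisibility by some generator is inherited by sums and multiples, which gives one
  inclusion; for the other, a polynomial is the sum of its terms, each a multiple of a
  generator.\<close>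

lemma genideal_monomials:
  assumes "\<And>m. m \<in> M \<Longrightarrow> keys m \<subseteq> X"
  shows "genideal (poly_ring X) (monomial_poly ` M :: ('x,'k::comm_ring_1) mpoly set) =
    {f \<in> carrier (poly_ring X). \<forall>m \<in> keys f. \<exists>n \<in> M. \<exists>l. m = n + l}" (is "?L = ?R")
proof
  interpret cring "poly_ring X :: ('x,'k) mpoly ring" by (rule cring_poly_ring)
  have "ideal ?R (poly_ring X :: ('x,'k) mpoly ring)"
  proof (rule ideal_poly_ringI)
    fix a b :: "('x,'k) mpoly" assume "a \<in> ?R" "b \<in> ?R"
    then show "a + b \<in> ?R" using in_keys_addD[of _ a b] poly_ring_add[of a X b] by blast
  next
    fix a r :: "('x,'k) mpoly" assume ar: "a \<in> ?R" "r \<in> carrier (poly_ring X)"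
    have "\<exists>n\<in>M. \<exists>l. m = n + l" if m: "m \<in> keys (r * a)" for m
    proof -
      from in_keys_mult[OF m] obtain s t where "s \<in> keys r" "t \<in> keys a" "m = s + t" by blast
      moreover from this ar obtain n l where "n \<in> M" "t = n + l" by blast
      ultimately have "m = n + (l + s)" by (simp add: algebra_simps)
      then show ?thesis using \<open>n \<in> M\<close> by blast
    qed
    then show "r * a \<in> ?R" using ar poly_ring_mult[of r X a] by auto
  qed auto
  moreover have "monomial_poly ` M \<subseteq> ?R"
  proof (intro image_subsetI)
    fix m assume "m \<in> M"
    then show "monomial_poly m \<in> ?R" using assms[of m]
      by (auto simp: monomial_poly_def poly_ring_single intro!: bexI[of _ m] exI[of _ 0])
  qed
  ultimately show "?L \<subseteq> ?R" by (rule genideal_minimal)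
  show "?R \<subseteq> ?L"
  proof
    fix f :: "('x,'k) mpoly" assume f: "f \<in> ?R"
    have sub: "(monomial_poly ` M :: ('x,'k) mpoly set) \<subseteq> carrier (poly_ring X)"
      using assms by (auto simp: monomial_poly_def poly_ring_single)
    interpret L: ideal ?L "poly_ring X :: ('x,'k) mpoly ring" by (rule genideal_ideal[OF sub])
    have "Poly_Mapping.single m (lookup f m) \<in> ?L" if m: "m \<in> keys f" for m
    proof -
      obtain n l where n: "n \<in> M" "m = n + l" using f m by blast
      have "keys m \<subseteq> X" using m f by (auto simp: carrier_poly_ring)
      then have "keys l \<subseteq> X" unfolding n(2) keys_mon_add by simp
      then have "Poly_Mapping.single l (lookup f m) * monomial_poly n \<in> ?L"
        using L.I_l_closed[of "monomial_poly n" "Poly_Mapping.single l (lookup f m)"]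
          genideal_self[OF sub] n by (auto simp: poly_ring_single)
      then show ?thesis using n by (simp add: monomial_poly_def mult_single add.commute)
    qed
    note single_mem = this
    have "A \<subseteq> keys f \<longrightarrow> (\<Sum>m\<in>A. Poly_Mapping.single m (lookup f m)) \<in> ?L"
      if "finite A" for A
      using that
    proof (induction A)
      case empty
      then show ?case using L.zero_closed by simp
    next
      case (insert x A)
      then show ?case using L.a_closed single_mem by simp
    qed
    from this[of "keys f"] have "(\<Sum>m\<in>keys f. Poly_Mapping.single m (lookup f m)) \<in> ?L" by simp
    then show "f \<in> ?L" using poly_sum_singles[of f] by simp
  qed
qed

lemma sqf_dvd_iff: "squarefree_mon n \<Longrightarrow> (\<exists>l. m = n + l) \<longleftrightarrow> keys n \<subseteq> keys m"
  unfolding mon_dvd_iff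
proof safe
  fix x assume "\<forall>x. lookup n x \<le> lookup m x" "x \<in> keys n"
  then show "x \<in> keys m" by (metis in_keys_iff le_zero_eq)
next
  fix x assume "squarefree_mon n" "keys n \<subseteq> keys m"
  moreover from this have "lookup n x \<le> 1" by (simp add: squarefree_mon_def)
  ultimately show "lookup n x \<le> lookup m x"
    by (cases "x \<in> keys n") (force simp: in_keys_iff subset_iff dest: spec[of _ x])+
qed

lemma stanley_reisner_eq_sr_ideal:
  assumes "finite X" "simplicial_complex X \<Delta>"
    and "is_stanley_reisner_ideal X \<Delta> (I :: ('x,'k::field) mpoly set)"
  shows "I = sr_ideal X \<Delta>"
proof -
  obtain M where M: "\<And>m. m \<in> M \<Longrightarrow> squarefree_mon m \<and> keys m \<subseteq> X"
    and I: "I = genideal (poly_ring X) (monomial_poly ` M)"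
    using assms(3) by (auto simp: is_stanley_reisner_ideal_def squarefree_monomial_ideal_def)
  have I': "I = {f \<in> carrier (poly_ring X). \<forall>m \<in> keys f. \<exists>n \<in> M. keys n \<subseteq> keys m}"
    unfolding I using M by (subst genideal_monomials) (auto simp: sqf_dvd_iff)
  have mem: "monomial_poly m \<in> I \<longleftrightarrow> keys m \<subseteq> X \<and> (\<exists>n\<in>M. keys n \<subseteq> keys m)" for m
    unfolding I' by (auto simp: monomial_poly_def carrier_poly_ring)
  have \<Delta>: "\<Delta> = {keys m | m. squarefree_mon m \<and> keys m \<subseteq> X \<and> monomial_poly m \<notin> I}"
    using assms(3) by (simp add: is_stanley_reisner_ideal_def)
  have "A \<in> \<Delta> \<longleftrightarrow> \<not> (\<exists>n\<in>M. keys n \<subseteq> A)" if "A \<subseteq> X" for A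
  proof -
    have "finite A" using that assms(1) finite_subset by auto
    then have "A = keys (sqf A)" "squarefree_mon (sqf A)" by (auto simp: keys_sqf squarefree_sqf)
    moreover have "monomial_poly (sqf A) \<in> I \<longleftrightarrow> (\<exists>n\<in>M. keys n \<subseteq> A)"
      using mem[of "sqf A"] that \<open>A = keys (sqf A)\<close> by auto
    ultimately show ?thesis unfolding \<Delta>
      using that mem by (smt (verit, best) mem_Collect_eq)
  qed
  then show ?thesis unfolding I' sr_ideal_def by (auto simp: carrier_poly_ring)
qed

lemma is_stanley_reisner_sr_ideal:
  assumes "finite X" "simplicial_complex X \<Delta>"
  shows "is_stanley_reisner_ideal X \<Delta> (sr_ideal X \<Delta> :: ('x,'k::field) mpoly set)"
proof -
  have down: "B \<in> \<Delta>" if "A \<in> \<Delta>" "B \<subseteq> A" for A B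
    using assms(2) that by (auto simp: simplicial_complex_def)
  have sub: "A \<subseteq> X" if "A \<in> \<Delta>" for A using assms(2) that by (auto simp: simplicial_complex_def)
  have fin: "finite A" if "A \<subseteq> X" for A using that assms(1) finite_subset by auto
  define M where "M = sqf ` (Pow X - \<Delta>)"
  have M: "squarefree_mon m \<and> keys m \<subseteq> X" if "m \<in> M" for m
    using that fin by (auto simp: M_def squarefree_sqf keys_sqf)
  have "(\<exists>n\<in>M. keys n \<subseteq> keys m) \<longleftrightarrow> keys m \<notin> \<Delta>" if "keys m \<subseteq> X" for m
  proof
    assume "keys m \<notin> \<Delta>"
    then have "sqf (keys m) \<in> M" using that by (auto simp: M_def)
    then show "\<exists>n\<in>M. keys n \<subseteq> keys m" by (auto simp: keys_sqf intro!: bexI[of _ "sqf (keys m)"])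
  qed (use down fin in \<open>auto simp: M_def keys_sqf\<close>)
  then have "sr_ideal X \<Delta> = {f \<in> carrier (poly_ring X). \<forall>m \<in> keys f. \<exists>n \<in> M. keys n \<subseteq> keys m}"
    unfolding sr_ideal_def carrier_poly_ring by blast
  also have "\<dots> = genideal (poly_ring X) (monomial_poly ` M :: ('x,'k) mpoly set)"
    using M by (subst genideal_monomials) (auto simp: sqf_dvd_iff)
  finally have "sr_ideal X \<Delta> = genideal (poly_ring X) (monomial_poly ` M :: ('x,'k) mpoly set)" .
  then have 1: "squarefree_monomial_ideal X (sr_ideal X \<Delta> :: ('x,'k) mpoly set)"
    unfolding squarefree_monomial_ideal_def using M by blast
  have mem: "monomial_poly m \<notin> (sr_ideal X \<Delta> :: ('x,'k) mpoly set) \<longleftrightarrow> keys m \<in> \<Delta>"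
    if "keys m \<subseteq> X" for m
    using that by (auto simp: sr_ideal_def monomial_poly_def carrier_poly_ring)
  have "\<Delta> = {keys m | m. squarefree_mon m \<and> keys m \<subseteq> X \<and>
      monomial_poly m \<notin> (sr_ideal X \<Delta> :: ('x,'k) mpoly set)}" (is "_ = ?S")
  proof
    show "\<Delta> \<subseteq> ?S"
    proof
      fix A assume A: "A \<in> \<Delta>"
      then have "A = keys (sqf A)" "squarefree_mon (sqf A)" "keys (sqf A) \<subseteq> X"
        using fin[OF sub] sub by (auto simp: keys_sqf squarefree_sqf)
      then show "A \<in> ?S" using mem[of "sqf A"] A by fastforce
    qed
    show "?S \<subseteq> \<Delta>" using mem by auto
  qed
  with 1 show ?thesis unfolding is_stanley_reisner_ideal_def by blast
qed

lemma ideal_sr_ideal: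
  assumes "simplicial_complex X \<Delta>"
  shows "ideal (sr_ideal X \<Delta>) (poly_ring X :: ('x,'k::comm_ring_1) mpoly ring)"
proof (rule ideal_poly_ringI)
  fix a b :: "('x,'k) mpoly" assume "a \<in> sr_ideal X \<Delta>" "b \<in> sr_ideal X \<Delta>"
  then show "a + b \<in> sr_ideal X \<Delta>"
    unfolding sr_ideal_def using in_keys_addD[of _ a b] poly_ring_add[of a X b] by blast
next
  fix a r :: "('x,'k) mpoly" assume ar: "a \<in> sr_ideal X \<Delta>" "r \<in> carrier (poly_ring X)"
  have "keys m \<notin> \<Delta>" if m: "m \<in> keys (r * a)" for m
  proof -
    from in_keys_mult[OF m] obtain s t where "s \<in> keys r" "t \<in> keys a" "m = s + t" by blast
    moreover from this ar have "keys t \<notin> \<Delta>" by (auto simp: sr_ideal_def)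
    moreover have "keys t \<subseteq> keys m" using \<open>m = s + t\<close> by (simp add: keys_mon_add)
    ultimately show ?thesis using assms by (auto simp: simplicial_complex_def)
  qed
  then show "r * a \<in> sr_ideal X \<Delta>" using ar poly_ring_mult[of r X a] by (auto simp: sr_ideal_def)
qed (auto simp: sr_ideal_def)

section \<open>Homology dimensions\<close>

abbreviation fscale :: "'k::field \<Rightarrow> ('i \<Rightarrow> 'k) \<Rightarrow> 'i \<Rightarrow> 'k" where
  "fscale c v \<equiv> (\<lambda>a. c * v a)"

interpretation fs: vector_space "fscale :: 'k::field \<Rightarrow> ('i \<Rightarrow> 'k) \<Rightarrow> 'i \<Rightarrow> 'k"
  by unfold_locales (auto simp: algebra_simps fun_eq_iff)

text \<open>\<open>fs.dim\<close> is a natural number for every set and measures a space only when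
  finitely many vectors span it; differences of dimensions are taken under this condition.\<close>

definition fin_dim :: "('i \<Rightarrow> 'k::field) set \<Rightarrow> bool" where
  "fin_dim Z \<longleftrightarrow> (\<exists>S. finite S \<and> Z \<subseteq> fs.span S)"

lemma sum_fun_apply: "(\<Sum>i\<in>A. f i) x = (\<Sum>i\<in>A. f i x)"
  by (induction A rule: infinite_finite_induct) auto

lemma fin_dim_support:
  assumes "finite A" and "\<And>v a. v \<in> Z \<Longrightarrow> a \<notin> A \<Longrightarrow> v a = (0::'k::field)"
  shows "fin_dim Z"
proof -
  define e where "e a = (\<lambda>b. if b = a then 1 else (0::'k))" for a :: 'a
  have "v \<in> fs.span (e ` A)" if "v \<in> Z" for v
  proof -
    have "v = (\<Sum>a\<in>A. fscale (v a) (e a))"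
      using assms(1) assms(2)[OF that] by (auto simp: fun_eq_iff sum_fun_apply e_def if_distrib cong: if_cong)
    also have "\<dots> \<in> fs.span (e ` A)" by (intro fs.span_sum fs.span_scale fs.span_base) auto
    finally show ?thesis .
  qed
  then show ?thesis unfolding fin_dim_def using assms(1) by blast
qed

text \<open>The family \<open>f\<close> maps to a basis of the quotient \<open>Z/B\<close>,
  expressed without forming the quotient: no nontrivial combination falls into \<open>B\<close>, and
  every vector is a combination up to \<open>B\<close>. Indexing by \<open>T\<close> lets one index
  set describe two quotients.\<close>

definition relative_basis ::
    "('i \<Rightarrow> 'k::field) set \<Rightarrow> ('i \<Rightarrow> 'k) set \<Rightarrow> 't set \<Rightarrow> ('t \<Rightarrow> 'i \<Rightarrow> 'k) \<Rightarrow> bool" where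
  "relative_basis Z B T f \<longleftrightarrow> finite T \<and> f ` T \<subseteq> Z \<and>
     (\<forall>u. (\<Sum>i\<in>T. fscale (u i) (f i)) \<in> B \<longrightarrow> (\<forall>i\<in>T. u i = 0)) \<and>
     (\<forall>z\<in>Z. \<exists>u. z - (\<Sum>i\<in>T. fscale (u i) (f i)) \<in> B)"

lemma span_image_sum:
  assumes "finite T" "x \<in> fs.span (f ` T)"
  shows "\<exists>u. x = (\<Sum>i\<in>T. fscale (u i) (f i))"
proof -
  let ?S = "{y. \<exists>u. y = (\<Sum>i\<in>T. fscale (u i) (f i))}"
  have "fs.subspace ?S"
  proof (rule fs.subspaceI)
    show "0 \<in> ?S" by (auto simp: fun_eq_iff sum_fun_apply intro!: exI[of _ "\<lambda>_. 0"])
    fix y z assume "y \<in> ?S" "z \<in> ?S"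
    then obtain u v where "y = (\<Sum>i\<in>T. fscale (u i) (f i))" "z = (\<Sum>i\<in>T. fscale (v i) (f i))" by blast
    then have "y + z = (\<Sum>i\<in>T. fscale (u i + v i) (f i))"
      by (simp add: fun_eq_iff sum_fun_apply sum.distrib algebra_simps)
    then show "y + z \<in> ?S" by (intro CollectI exI)
  next
    fix c y assume "y \<in> ?S"
    then obtain u where u: "y = (\<Sum>i\<in>T. fscale (u i) (f i))" by blast
    have "fscale c y = (\<Sum>i\<in>T. fscale (c * u i) (f i))"
    proof
      fix a show "fscale c y a = (\<Sum>i\<in>T. fscale (c * u i) (f i)) a"
        unfolding u sum_fun_apply sum_distrib_left by (simp add: mult.assoc)
    qed
    then show "fscale c y \<in> ?S" by (intro CollectI exI)
  qed
  moreover have "f ` T \<subseteq> ?S"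
  proof safe
    fix i assume "i \<in> T"
    then have "f i = (\<Sum>j\<in>T. fscale (if j = i then 1 else 0) (f j))"
      using assms(1) by (auto simp: fun_eq_iff sum_fun_apply if_distrib[where f = "\<lambda>x. x * _"] cong: if_cong)
    then show "\<exists>u. f i = (\<Sum>j\<in>T. fscale (u j) (f j))"
      by (intro exI[of _ "\<lambda>j. if j = i then 1 else 0"]) simp
  qed
  ultimately have "fs.span (f ` T) \<subseteq> ?S" by (intro fs.span_minimal)
  then show ?thesis using assms(2) by auto
qed

text \<open>A basis \<open>b\<close> of \<open>B\<close> extends to a basis \<open>c\<close> of
  \<open>Z\<close>; the added vectors \<open>c - b\<close> form the family.\<close>

lemma relative_basis_exists:
  fixes Z B :: "('i \<Rightarrow> 'k::field) set"
  assumes "fs.subspace Z" "fs.subspace B" "B \<subseteq> Z" "fin_dim Z"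
  obtains T where "relative_basis Z B T (\<lambda>v. v)"
proof -
  obtain b where b: "b \<subseteq> B" "fs.independent b" "B \<subseteq> fs.span b"
    using fs.basis_exists[of B] by metis
  obtain c where c: "b \<subseteq> c" "c \<subseteq> Z" "fs.independent c" "Z \<subseteq> fs.span c"
    using fs.maximal_independent_subset_extend[of b Z] b assms(3) by (metis subset_trans)
  obtain S where S: "finite S" "Z \<subseteq> fs.span S" using assms(4) by (auto simp: fin_dim_def)
  have fin: "finite c" using fs.independent_span_bound[of S c] S c by blast
  define T where "T = c - b"
  have finT: "finite T" "finite b" using fin c(1) finite_subset by (auto simp: T_def)
  have spanb: "fs.span b = B"
    using fs.span_minimal[OF b(1) assms(2)] b(3) by (rule subset_antisym)
  have cbT: "c = b \<union> T" "b \<inter> T = {}" using c(1) by (auto simp: T_def)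
  have "relative_basis Z B T (\<lambda>v. v)" unfolding relative_basis_def
  proof (intro conjI allI impI ballI)
    show "(\<lambda>v. v) ` T \<subseteq> Z" using c by (auto simp: T_def)
    fix u i assume u: "(\<Sum>i\<in>T. fscale (u i) i) \<in> B" and i: "i \<in> T"
    then obtain w where w: "(\<Sum>i\<in>T. fscale (u i) i) = (\<Sum>i\<in>b. fscale (w i) i)"
      using span_image_sum[of b _ "\<lambda>v. v"] finT spanb by auto
    \<comment> \<open>A combination of \<open>T\<close> that equals a combination of
      \<open>b\<close> is a linear relation on the independent set \<open>c\<close>.\<close>
    define g where "g i = (if i \<in> T then u i else - w i)" for i
    have "(\<Sum>i\<in>c. fscale (g i) i) = (\<Sum>i\<in>b. fscale (g i) i) + (\<Sum>i\<in>T. fscale (g i) i)"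
      unfolding cbT(1) using finT cbT(2) by (simp add: sum.union_disjoint)
    also have "(\<Sum>i\<in>T. fscale (g i) i) = (\<Sum>i\<in>T. fscale (u i) i)"
      by (rule sum.cong) (auto simp: g_def)
    also have "(\<Sum>i\<in>b. fscale (g i) i) = (\<Sum>i\<in>b. - fscale (w i) i)"
      using cbT(2) by (intro sum.cong) (auto simp: g_def fun_eq_iff)
    finally have "(\<Sum>i\<in>c. fscale (g i) i) = 0" unfolding w by (simp add: sum_negf zero_fun_def)
    then have "g i = 0" using c(3) fin i cbT unfolding fs.dependent_finite[OF fin] by blast
    then show "u i = 0" using i by (simp add: g_def)
  next
    fix z assume "z \<in> Z"
    then have "z \<in> fs.span ((\<lambda>v. v) ` c)" using c(4) by auto
    from span_image_sum[OF fin this] obtain g where g: "z = (\<Sum>i\<in>c. fscale (g i) i)" by blast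
    also have "\<dots> = (\<Sum>i\<in>b. fscale (g i) i) + (\<Sum>i\<in>T. fscale (g i) i)"
      unfolding cbT(1) using finT cbT(2) by (simp add: sum.union_disjoint)
    finally have "z - (\<Sum>i\<in>T. fscale (g i) i) = (\<Sum>i\<in>b. fscale (g i) i)" by simp
    also have "\<dots> \<in> B" unfolding spanb[symmetric] by (intro fs.span_sum fs.span_scale fs.span_base)
    finally show "\<exists>u. z - (\<Sum>i\<in>T. fscale (u i) i) \<in> B" by blast
  qed (rule finT)
  then show ?thesis using that by blast
qed

text \<open>Joining the family to a basis of \<open>B\<close> gives a basis of \<open>Z\<close>.
  Adding one index at a time proves independence together with the cardinality, since the images
  under \<open>f\<close> must also be distinct.\<close>

lemma relative_basis_card:
  assumes "fs.subspace Z" "fs.subspace B" "B \<subseteq> Z" "fin_dim (Z :: ('i \<Rightarrow> 'k::field) set)"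
    and rel: "relative_basis Z B T f"
  shows "card T = fs.dim Z - fs.dim B"
proof -
  obtain b where b: "b \<subseteq> B" "fs.independent b" "B \<subseteq> fs.span b" "card b = fs.dim B"
    using fs.basis_exists[of B] by metis
  obtain S where S: "finite S" "Z \<subseteq> fs.span S" using assms(4) by (auto simp: fin_dim_def)
  have finb: "finite b" using fs.independent_span_bound[of S b] S b assms(3) by blast
  have spanb: "fs.span b = B"
    using fs.span_minimal[OF b(1) assms(2)] b(3) by (rule subset_antisym)
  have T: "finite T" "f ` T \<subseteq> Z" and ind: "\<And>u. (\<Sum>i\<in>T. fscale (u i) (f i)) \<in> B \<Longrightarrow> \<forall>i\<in>T. u i = 0"
    and spn: "\<And>z. z \<in> Z \<Longrightarrow> \<exists>u. z - (\<Sum>i\<in>T. fscale (u i) (f i)) \<in> B"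
    using rel by (auto simp: relative_basis_def)
  have step: "fs.independent (b \<union> f ` A) \<and> card (b \<union> f ` A) = card b + card A" if "A \<subseteq> T" for A
  proof -
    have "finite A" using that T finite_subset by blast
    then show ?thesis using that
    proof (induction A)
      case (insert i A)
      have "f i \<notin> fs.span (b \<union> f ` A)"
      proof
        assume "f i \<in> fs.span (b \<union> f ` A)"
        then obtain \<beta> \<gamma> where \<beta>: "\<beta> \<in> B" and \<gamma>: "\<gamma> \<in> fs.span (f ` A)" and eq: "f i = \<beta> + \<gamma>"
          unfolding fs.span_Un spanb by blast
        obtain u where u: "\<gamma> = (\<Sum>j\<in>A. fscale (u j) (f j))"
          using span_image_sum[OF insert(1) \<gamma>] by blast
        define g where "g j = (if j = i then 1 else if j \<in> A then - u j else 0)" for j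
        have "(\<Sum>j\<in>T. fscale (g j) (f j)) = (\<Sum>j\<in>insert i A. fscale (g j) (f j))"
          using insert.prems T(1) by (intro sum.mono_neutral_right) (auto simp: g_def fun_eq_iff)
        also have "\<dots> = f i + (\<Sum>j\<in>A. fscale (g j) (f j))" using insert by (simp add: g_def)
        also have "(\<Sum>j\<in>A. fscale (g j) (f j)) = (\<Sum>j\<in>A. - fscale (u j) (f j))"
          using insert by (intro sum.cong) (auto simp: g_def fun_eq_iff)
        also have "f i + \<dots> = \<beta>" unfolding eq u by (simp add: sum_negf)
        finally have "(\<Sum>j\<in>T. fscale (g j) (f j)) \<in> B" using \<beta> by simp
        then have "g i = 0" using ind insert.prems by blast
        then show False by (simp add: g_def)
      qed
      moreover from this have "f i \<notin> b \<union> f ` A" using fs.span_base[of "f i" "b \<union> f ` A"] by auto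
      moreover have "fs.independent (b \<union> f ` A)" "card (b \<union> f ` A) = card b + card A"
        using insert by auto
      ultimately show ?case using insert(1,2) finb fs.independent_insertI[of "f i" "b \<union> f ` A"] by simp
    qed (use b in simp)
  qed
  have "Z \<subseteq> fs.span (b \<union> f ` T)"
  proof
    fix z assume "z \<in> Z"
    then obtain u where u: "z - (\<Sum>i\<in>T. fscale (u i) (f i)) \<in> fs.span b" using spn spanb by blast
    have "(\<Sum>i\<in>T. fscale (u i) (f i)) \<in> fs.span (f ` T)"
      by (intro fs.span_sum fs.span_scale fs.span_base) auto
    then have "z - (\<Sum>i\<in>T. fscale (u i) (f i)) + (\<Sum>i\<in>T. fscale (u i) (f i)) \<in> fs.span (b \<union> f ` T)"
      using u by (intro fs.span_add) (auto intro: fs.span_mono[THEN subsetD])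
    then show "z \<in> fs.span (b \<union> f ` T)" by simp
  qed
  moreover have "b \<union> f ` T \<subseteq> Z" using b assms(3) T by auto
  ultimately have "fs.span (b \<union> f ` T) = fs.span Z"
    by (metis fs.span_mono fs.span_span subset_antisym)
  then have "fs.dim Z = card (b \<union> f ` T)" using step[of T] fs.dim_eq_card by blast
  then show ?thesis using step[of T] b by simp
qed

text \<open>
  An additive relation that is total on both sides and matches \<open>B\<close> with \<open>B'\<close> induces an
  isomorphism \<open>Z/B \<cong> Z'/B'\<close>.
\<close>

lemma codim_eq_relation:
  fixes Z B :: "('i \<Rightarrow> 'k::field) set" and Z' B' :: "('l \<Rightarrow> 'k) set"
  assumes Z: "fs.subspace Z" "fs.subspace B" "B \<subseteq> Z" "fin_dim Z"
    and Z': "fs.subspace Z'" "fs.subspace B'" "B' \<subseteq> Z'" "fin_dim Z'"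
    and add: "\<And>z w z' w'. \<rho> z z' \<Longrightarrow> \<rho> w w' \<Longrightarrow> \<rho> (z + w) (z' + w')"
    and scale: "\<And>c z z'. \<rho> z z' \<Longrightarrow> \<rho> (fscale c z) (fscale c z')"
    and left: "\<And>z. z \<in> Z \<Longrightarrow> \<exists>z'\<in>Z'. \<rho> z z'" and right: "\<And>z'. z' \<in> Z' \<Longrightarrow> \<exists>z\<in>Z. \<rho> z z'"
    and eq: "\<And>z z'. z \<in> Z \<Longrightarrow> z' \<in> Z' \<Longrightarrow> \<rho> z z' \<Longrightarrow> z \<in> B \<longleftrightarrow> z' \<in> B'"
  shows "fs.dim Z - fs.dim B = fs.dim Z' - fs.dim B'"
proof -
  obtain T :: "('i \<Rightarrow> 'k) set" where T: "relative_basis Z B T (\<lambda>v. v)"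
    using relative_basis_exists[OF Z] by blast
  have TZ: "finite T" "T \<subseteq> Z" using T by (auto simp: relative_basis_def)
  then obtain f where f: "\<And>v. v \<in> T \<Longrightarrow> f v \<in> Z' \<and> \<rho> v (f v)" using left by (metis subsetD)
  \<comment> \<open>Whatever vector corresponds to 0, scaling the pair by 0 gives the pair of zero
    vectors, the start of the induction on sums.\<close>
  obtain z0 where "\<rho> 0 z0" using left[of 0] fs.subspace_0[OF Z(1)] by blast
  from scale[OF this, of 0] have "\<rho> 0 0" by (simp add: zero_fun_def)
  have sum_fscale: "\<rho> (\<Sum>i\<in>T. fscale (u i) i) (\<Sum>i\<in>T. fscale (u i) (f i))"
    and sum_mem: "(\<Sum>i\<in>T. fscale (u i) i) \<in> Z" "(\<Sum>i\<in>T. fscale (u i) (f i)) \<in> Z'" for u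
  proof -
    have "A \<subseteq> T \<Longrightarrow> \<rho> (\<Sum>i\<in>A. fscale (u i) i) (\<Sum>i\<in>A. fscale (u i) (f i))" if "finite A" for A
      using that by (induction A) (use \<open>\<rho> 0 0\<close> f in \<open>auto intro!: add scale\<close>)
    then show "\<rho> (\<Sum>i\<in>T. fscale (u i) i) (\<Sum>i\<in>T. fscale (u i) (f i))" using TZ by blast
    show "(\<Sum>i\<in>T. fscale (u i) i) \<in> Z"
      using TZ by (intro fs.subspace_sum[OF Z(1)] fs.subspace_scale[OF Z(1)]) auto
    show "(\<Sum>i\<in>T. fscale (u i) (f i)) \<in> Z'"
      using f by (intro fs.subspace_sum[OF Z'(1)] fs.subspace_scale[OF Z'(1)]) auto
  qed
  have "relative_basis Z' B' T f" unfolding relative_basis_def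
  proof (intro conjI allI ballI impI)
    fix u i assume "(\<Sum>i\<in>T. fscale (u i) (f i)) \<in> B'" "i \<in> T"
    then show "u i = 0"
      using eq[OF sum_mem sum_fscale] T by (auto simp: relative_basis_def)
  next
    fix z' assume z': "z' \<in> Z'"
    then obtain z where z: "z \<in> Z" "\<rho> z z'" using right by blast
    then obtain u where u: "z - (\<Sum>i\<in>T. fscale (u i) i) \<in> B"
      using T by (auto simp: relative_basis_def)
    have "\<rho> (z + fscale (-1) (\<Sum>i\<in>T. fscale (u i) i)) (z' + fscale (-1) (\<Sum>i\<in>T. fscale (u i) (f i)))"
      using z by (intro add scale sum_fscale)
    moreover have minus: "v + fscale (-1) w = v - w" for v w :: "'z \<Rightarrow> 'k"
      by (simp add: fun_eq_iff)
    ultimately have "\<rho> (z - (\<Sum>i\<in>T. fscale (u i) i)) (z' - (\<Sum>i\<in>T. fscale (u i) (f i)))"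
      by (simp only: minus)
    then have "z' - (\<Sum>i\<in>T. fscale (u i) (f i)) \<in> B'"
      using eq[of "z - (\<Sum>i\<in>T. fscale (u i) i)" "z' - (\<Sum>i\<in>T. fscale (u i) (f i))"] u z z'
        fs.subspace_diff[OF Z(1)] fs.subspace_diff[OF Z'(1)] sum_mem by blast
    then show "\<exists>u. z' - (\<Sum>i\<in>T. fscale (u i) (f i)) \<in> B'" by blast
  qed (use TZ f in auto)
  then show ?thesis using relative_basis_card[OF Z T] relative_basis_card[OF Z'] by metis
qed

text \<open>The direct sum of the spaces \<open>Z b\<close>, encoded by functions on pairs so that
  it is again a space of functions.\<close>

definition fun_product :: "'b set \<Rightarrow> ('b \<Rightarrow> ('s \<Rightarrow> 'k::field) set) \<Rightarrow> ('b \<times> 's \<Rightarrow> 'k) set" where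
  "fun_product A Z = {g. \<forall>b. if b \<in> A then (\<lambda>s. g (b, s)) \<in> Z b else (\<forall>s. g (b, s) = 0)}"

lemma fun_productD: "g \<in> fun_product A Z \<Longrightarrow> b \<in> A \<Longrightarrow> (\<lambda>s. g (b, s)) \<in> Z b"
  unfolding fun_product_def mem_Collect_eq by (drule spec[of _ b]) simp

lemma subspace_fun_product:
  assumes "\<And>b. b \<in> A \<Longrightarrow> fs.subspace (Z b)"
  shows "fs.subspace (fun_product A Z)"
proof (rule fs.subspaceI)
  show "0 \<in> fun_product A Z"
    using fs.subspace_0[OF assms] by (auto simp: fun_product_def zero_fun_def)
  show "x + y \<in> fun_product A Z" if "x \<in> fun_product A Z" "y \<in> fun_product A Z" for x y
    using that fs.subspace_add[OF assms] by (force simp: fun_product_def plus_fun_def)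
  show "fscale c x \<in> fun_product A Z" if "x \<in> fun_product A Z" for c x
    using that fs.subspace_scale[OF assms] by (force simp: fun_product_def)
qed

text \<open>Relative bases of the summands, each placed in its own slot, form a relative basis of
  the direct sum indexed by \<open>Sigma A T\<close>.\<close>

lemma codim_fun_product:
  fixes Z B :: "'b \<Rightarrow> ('s \<Rightarrow> 'k::field) set"
  assumes "finite A" and "\<And>b. b \<in> A \<Longrightarrow> fs.subspace (Z b)" "\<And>b. b \<in> A \<Longrightarrow> fs.subspace (B b)"
    and "\<And>b. b \<in> A \<Longrightarrow> B b \<subseteq> Z b"
    and fd: "\<And>b. b \<in> A \<Longrightarrow> fin_dim (Z b)" "fin_dim (fun_product A Z)"
  shows "fs.dim (fun_product A Z) - fs.dim (fun_product A B) = (\<Sum>b\<in>A. fs.dim (Z b) - fs.dim (B b))"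
proof -
  have "\<exists>T. relative_basis (Z b) (B b) T (\<lambda>v. v)" if "b \<in> A" for b
    using relative_basis_exists assms(2-4)[OF that] fd(1)[OF that] by metis
  then obtain T where T: "\<And>b. b \<in> A \<Longrightarrow> relative_basis (Z b) (B b) (T b) (\<lambda>v. v)" by metis
  then have T1: "\<And>b. b \<in> A \<Longrightarrow> finite (T b)" "\<And>b. b \<in> A \<Longrightarrow> T b \<subseteq> Z b"
    by (auto simp: relative_basis_def)
  define f :: "'b \<times> ('s \<Rightarrow> 'k) \<Rightarrow> 'b \<times> 's \<Rightarrow> 'k" where "f = (\<lambda>(b, v) (b', s). if b' = b then v s else (0::'k))"
  have slice: "(\<lambda>s. (\<Sum>i\<in>Sigma A T. fscale (u i) (f i)) (b, s)) =
      (if b \<in> A then \<Sum>v\<in>T b. fscale (u (b, v)) v else 0)" for u b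
  proof
    fix s
    have "(\<Sum>i\<in>Sigma A T. fscale (u i) (f i)) (b, s) = (\<Sum>b'\<in>A. \<Sum>v\<in>T b'. u (b', v) * f (b', v) (b, s))"
      using assms(1) T1(1) by (simp add: sum_fun_apply sum.Sigma split_def)
    also have "\<dots> = (\<Sum>b'\<in>A. if b' = b then \<Sum>v\<in>T b. u (b, v) * v s else 0)"
      by (intro sum.cong) (auto simp: f_def)
    finally show "(\<Sum>i\<in>Sigma A T. fscale (u i) (f i)) (b, s) = (if b \<in> A then \<Sum>v\<in>T b. fscale (u (b, v)) v else 0) s"
      using assms(1) by (simp add: sum_fun_apply)
  qed
  have "relative_basis (fun_product A Z) (fun_product A B) (Sigma A T) f" unfolding relative_basis_def
  proof (intro conjI allI ballI impI)
    show "finite (Sigma A T)" using assms(1) T1 by auto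
    show "f ` Sigma A T \<subseteq> fun_product A Z"
    proof safe
      fix b v assume "b \<in> A" "v \<in> T b"
      moreover have "(\<lambda>s. 0) \<in> Z b'" if "b' \<in> A" for b'
        using fs.subspace_0[OF assms(2)[OF that]] by (simp add: zero_fun_def)
      moreover have "(\<lambda>s. f (b, v) (b', s)) = (if b' = b then v else (\<lambda>s. 0))" for b'
        by (simp add: f_def)
      ultimately show "f (b, v) \<in> fun_product A Z" using T1(2)[of b]
        by (auto simp: fun_product_def f_def)
    qed
    fix u i assume u: "(\<Sum>i\<in>Sigma A T. fscale (u i) (f i)) \<in> fun_product A B" and i: "i \<in> Sigma A T"
    obtain b v where bv: "i = (b, v)" "b \<in> A" "v \<in> T b" using i by auto
    have "(\<lambda>s. (\<Sum>i\<in>Sigma A T. fscale (u i) (f i)) (b, s)) \<in> B b"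
      using u bv(2) by (rule fun_productD)
    then have "(\<Sum>v\<in>T b. fscale (u (b, v)) v) \<in> B b" unfolding slice using bv by simp
    moreover have "\<forall>w. (\<Sum>v\<in>T b. fscale (w v) v) \<in> B b \<longrightarrow> (\<forall>v\<in>T b. w v = 0)"
      using T[OF bv(2)] by (simp add: relative_basis_def)
    ultimately have "\<forall>v\<in>T b. u (b, v) = 0" by (auto dest: spec[of _ "\<lambda>v. u (b, v)"])
    then show "u i = 0" using bv by simp
  next
    fix z assume z: "z \<in> fun_product A Z"
    have "\<exists>u. (\<lambda>s. z (b, s)) - (\<Sum>v\<in>T b. fscale (u v) v) \<in> B b" if "b \<in> A" for b
      using T[OF that] fun_productD[OF z that] by (simp add: relative_basis_def)
    then have "\<forall>b\<in>A. \<exists>u. (\<lambda>s. z (b, s)) - (\<Sum>v\<in>T b. fscale (u v) v) \<in> B b"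
      by (rule ballI)
    from bchoice[OF this] obtain u
      where "\<forall>b\<in>A. (\<lambda>s. z (b, s)) - (\<Sum>v\<in>T b. fscale (u b v) v) \<in> B b" by (rule exE)
    then have u: "(\<lambda>s. z (b, s)) - (\<Sum>v\<in>T b. fscale (u b v) v) \<in> B b" if "b \<in> A" for b
      using that by (rule bspec)
    define u' where "u' = (\<lambda>(b, v). u b v)"
    have eq: "(\<lambda>s. (z - (\<Sum>i\<in>Sigma A T. fscale (u' i) (f i))) (b, s)) =
       (\<lambda>s. z (b, s)) - (if b \<in> A then \<Sum>v\<in>T b. fscale (u b v) v else 0)" for b
      using slice[of u' b] by (auto simp: fun_eq_iff u'_def)
    have "z - (\<Sum>i\<in>Sigma A T. fscale (u' i) (f i)) \<in> fun_product A B"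
      unfolding fun_product_def
    proof (rule CollectI, rule allI)
      fix b
      show "if b \<in> A then (\<lambda>s. (z - (\<Sum>i\<in>Sigma A T. fscale (u' i) (f i))) (b, s)) \<in> B b
        else (\<forall>s. (z - (\<Sum>i\<in>Sigma A T. fscale (u' i) (f i))) (b, s) = 0)"
      proof (cases "b \<in> A")
        case True
        then show ?thesis using eq[of b] u[OF True] by simp
      next
        case False
        then have "z (b, s) = 0" for s using z by (auto simp: fun_product_def)
        then show ?thesis using False eq[of b] by (simp add: fun_eq_iff)
      qed
    qed
    then show "\<exists>u. z - (\<Sum>i\<in>Sigma A T. fscale (u i) (f i)) \<in> fun_product A B" by blast
  qed
  moreover have "fun_product A B \<subseteq> fun_product A Z"
    using assms(4) by (force simp: fun_product_def split: if_splits)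
  ultimately have "card (Sigma A T) = fs.dim (fun_product A Z) - fs.dim (fun_product A B)"
    by (intro relative_basis_card subspace_fun_product assms fd)
  moreover have "card (T b) = fs.dim (Z b) - fs.dim (B b)" if "b \<in> A" for b
    by (rule relative_basis_card[OF _ _ _ _ T[OF that]]) (intro assms fd that)+
  ultimately show ?thesis using assms(1) T1(1) by (simp add: card_SigmaI)
qed

subsection \<open>Balancing a double complex with exact rows and columns\<close>

text \<open>One half of the axioms of a first-quadrant double complex: \<open>D p q\<close> with
  \<open>dh\<close> lowering \<open>p\<close> is an exact row, augmented by
  \<open>\<epsilon>\<close> onto \<open>E q\<close>. The other half is the same locale with the two
  indices exchanged.\<close>

locale augmented_rows =
  fixes D :: "nat \<Rightarrow> nat \<Rightarrow> 'd::ab_group_add set"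
    and E :: "nat \<Rightarrow> 'e::ab_group_add set"
    and dh dv :: "nat \<Rightarrow> 'd \<Rightarrow> 'd" and dE :: "nat \<Rightarrow> 'e \<Rightarrow> 'e" and \<epsilon> :: "'d \<Rightarrow> 'e"
  assumes dh_add: "dh p (a + b) = dh p a + dh p b"
    and \<epsilon>_add: "\<epsilon> (a + b) = \<epsilon> a + \<epsilon> b"
    and dE_add: "dE q (e + e') = dE q e + dE q e'"
    and D_diff: "a \<in> D p q \<Longrightarrow> b \<in> D p q \<Longrightarrow> a - b \<in> D p q"
    and D_add: "a \<in> D p q \<Longrightarrow> b \<in> D p q \<Longrightarrow> a + b \<in> D p q"
    and dh_mem: "a \<in> D (Suc p) q \<Longrightarrow> dh p a \<in> D p q"
    and \<epsilon>_mem: "a \<in> D 0 q \<Longrightarrow> \<epsilon> a \<in> E q"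
    and \<epsilon>_dv: "a \<in> D 0 (Suc q) \<Longrightarrow> \<epsilon> (dv q a) = dE q (\<epsilon> a)"
    and dh_exact: "a \<in> D (Suc p) q \<Longrightarrow> dh p a = 0 \<Longrightarrow> \<exists>b\<in>D (Suc (Suc p)) q. dh (Suc p) b = a"
    and \<epsilon>_exact: "a \<in> D 0 q \<Longrightarrow> \<epsilon> a = 0 \<Longrightarrow> \<exists>b\<in>D (Suc 0) q. dh 0 b = a"
    and \<epsilon>_surj: "e \<in> E q \<Longrightarrow> \<exists>a\<in>D 0 q. \<epsilon> a = e"
    and dh_dh: "a \<in> D (Suc (Suc p)) q \<Longrightarrow> dh p (dh (Suc p) a) = 0"
    and \<epsilon>_dh: "a \<in> D (Suc 0) q \<Longrightarrow> \<epsilon> (dh 0 a) = 0"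

context augmented_rows begin

lemma dh_diff: "dh p (a - b) = dh p a - dh p b"
  using dh_add[of p "a - b" b] by (simp add: algebra_simps)

lemma \<epsilon>_diff: "\<epsilon> (a - b) = \<epsilon> a - \<epsilon> b"
  using \<epsilon>_add[of "a - b" b] by (simp add: algebra_simps)

lemma \<epsilon>_zero: "\<epsilon> 0 = 0"
  using \<epsilon>_add[of 0 0] by simp

end

text \<open>The two differentials commute rather than anticommute; accordingly neighbours in a
  zigzag are compared without signs.\<close>

locale balanced_complex =
  R: augmented_rows D E dh dv dE \<epsilon> + C: augmented_rows "\<lambda>q p. D p q" G dv dh dG \<eta>
  for D :: "nat \<Rightarrow> nat \<Rightarrow> 'd::ab_group_add set" and E :: "nat \<Rightarrow> 'e::ab_group_add set"
    and G :: "nat \<Rightarrow> 'g::ab_group_add set" and dh dv dE dG \<epsilon> \<eta> +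
  assumes dh_dv: "a \<in> D (Suc p) (Suc q) \<Longrightarrow> dh p (dv q a) = dv q (dh p a)"
begin

text \<open>A cycle of the total complex up to signs: entries on the antidiagonal
  \<open>p + q = i\<close> whose neighbours have the same image. Its ends in \<open>D 0 i\<close>
  and \<open>D i 0\<close> map to the cycles \<open>z\<close> and \<open>w\<close> that it
  connects.\<close>

definition zigzag :: "nat \<Rightarrow> (nat \<Rightarrow> nat \<Rightarrow> 'd) \<Rightarrow> 'e \<Rightarrow> 'g \<Rightarrow> bool" where
  "zigzag i c z w \<longleftrightarrow> (\<forall>p q. p + q = i \<longrightarrow> c p q \<in> D p q) \<and>
     (\<forall>p q. Suc (p + q) = i \<longrightarrow> dv q (c p (Suc q)) = dh p (c (Suc p) q)) \<and>
     \<epsilon> (c 0 i) = z \<and> \<eta> (c i 0) = w"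

lemma zigzag_flip: "zigzag i c z w \<Longrightarrow>
  balanced_complex.zigzag (\<lambda>q p. D p q) dv dh \<eta> \<epsilon> i (\<lambda>p q. c q p) w z"
proof -
  assume z: "zigzag i c z w"
  interpret F: balanced_complex "\<lambda>q p. D p q" G E dv dh dG dE \<eta> \<epsilon>
    by (unfold_locales) (simp add: dh_dv)
  show ?thesis using z unfolding F.zigzag_def zigzag_def by (auto simp: add.commute)
qed

text \<open>The entries are found one after another: the vertical image of the last entry is a
  horizontal cycle, so exactness of the row provides the next one. At \<open>p = 0\<close> this uses
  that \<open>z\<close> is a cycle.\<close>

lemma zigzag_exists:
  assumes z: "z \<in> E i" and cyc: "\<And>h. i = Suc h \<Longrightarrow> dE h z = 0"
  shows "\<exists>c w. zigzag i c z w \<and> w \<in> G i \<and> (\<forall>h. i = Suc h \<longrightarrow> dG h w = 0)"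
proof -
  have "\<exists>c. (\<forall>p q. p + q = i \<and> p \<le> n \<longrightarrow> c p q \<in> D p q) \<and>
     (\<forall>p q. Suc (p + q) = i \<and> p < n \<longrightarrow> dv q (c p (Suc q)) = dh p (c (Suc p) q)) \<and>
     \<epsilon> (c 0 i) = z" (is "\<exists>c. ?P n c") if "n \<le> i" for n using that
  proof (induction n)
    case 0
    obtain a where "a \<in> D 0 i" "\<epsilon> a = z" using R.\<epsilon>_surj[OF z] by blast
    then show ?case by (intro exI[of _ "\<lambda>_ _. a"]) auto
  next
    case (Suc n)
    then obtain c where c: "?P n c" by auto
    obtain q where q: "i = n + Suc q" using Suc.prems by (metis add_Suc_right le_Suc_ex add_Suc)
    have cn: "c n (Suc q) \<in> D n (Suc q)" using c q by auto
    have "\<exists>b\<in>D (Suc n) q. dh n b = dv q (c n (Suc q))"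
    proof (cases n)
      case 0
      have "\<epsilon> (dv q (c 0 (Suc q))) = dE q z" using R.\<epsilon>_dv[of "c 0 (Suc q)" q] cn c q 0 by simp
      then show ?thesis using R.\<epsilon>_exact[OF C.dh_mem] cn cyc q 0 by auto
    next
      case (Suc m)
      have "dh m (dv q (c n (Suc q))) = dv q (dh m (c n (Suc q)))" using dh_dv cn Suc by simp
      also have "dh m (c n (Suc q)) = dv (Suc q) (c m (Suc (Suc q)))"
        using c Suc q by auto
      also have "dv q \<dots> = 0"
      proof (rule C.dh_dh)
        show "c m (Suc (Suc q)) \<in> D m (Suc (Suc q))" using c Suc q by auto
      qed
      finally have "dh m (dv q (c n (Suc q))) = 0" .
      moreover have "dv q (c n (Suc q)) \<in> D (Suc m) q" using C.dh_mem[OF cn] Suc by simp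
      ultimately show ?thesis using R.dh_exact Suc by blast
    qed
    then obtain b where b: "b \<in> D (Suc n) q" "dh n b = dv q (c n (Suc q))" by blast
    then show ?case using c q
      by (intro exI[of _ "\<lambda>p' q'. if p' = Suc n then b else c p' q'"]) (auto simp: less_Suc_eq)
  qed
  from this[of i] obtain c where c: "\<forall>p q. p + q = i \<and> p \<le> i \<longrightarrow> c p q \<in> D p q"
     "\<forall>p q. Suc (p + q) = i \<and> p < i \<longrightarrow> dv q (c p (Suc q)) = dh p (c (Suc p) q)" "\<epsilon> (c 0 i) = z"
    by auto
  have "zigzag i c z (\<eta> (c i 0))" using c by (auto simp: zigzag_def)
  moreover have "dG h (\<eta> (c i 0)) = 0" if h: "i = Suc h" for h
  proof -
    have "dG h (\<eta> (c i 0)) = \<eta> (dh h (c i 0))" using C.\<epsilon>_dv[of "c i 0" h] c h by simp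
    also have "dh h (c i 0) = dv 0 (c h (Suc 0))" using c(2)[rule_format, of h 0] h by simp
    finally show ?thesis using C.\<epsilon>_dh[of "c h (Suc 0)" h] c h by simp
  qed
  moreover have "\<eta> (c i 0) \<in> G i" using C.\<epsilon>_mem[of "c i 0" i] c by simp
  ultimately show ?thesis by blast
qed

text \<open>Working back from \<open>D i 0\<close>, each entry is a vertical plus a horizontal
  boundary: if the entry at \<open>(p+1, q)\<close> has vertical part \<open>dv q b\<close>, then
  the entry at \<open>(p, q+1)\<close> minus \<open>dh p b\<close> is a vertical cycle, hence a
  vertical boundary. In \<open>D 0 i\<close> the horizontal part is killed by
  \<open>\<epsilon>\<close>.\<close>

lemma zigzag_boundary:
  assumes zz: "zigzag i c z w" and w: "w \<in> dG i ` G (Suc i)"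
  shows "z \<in> dE i ` E (Suc i)"
proof -
  have c: "\<And>p q. p + q = i \<Longrightarrow> c p q \<in> D p q"
    "\<And>p q. Suc (p + q) = i \<Longrightarrow> dv q (c p (Suc q)) = dh p (c (Suc p) q)"
    "\<epsilon> (c 0 i) = z" "\<eta> (c i 0) = w" using zz by (auto simp: zigzag_def)
  have "\<exists>b\<in>D p (Suc q). \<exists>b'\<in>D (Suc p) q. c p q = dv q b + dh p b'" if "p + q = i" for p q
    using that
  proof (induction q arbitrary: p)
    case 0
    obtain w' where "w' \<in> G (Suc i)" "w = dG i w'" using w by blast
    then obtain b' where b': "b' \<in> D (Suc i) 0" "w = dG i (\<eta> b')" using C.\<epsilon>_surj by blast
    then have "\<eta> (c i 0 - dh i b') = 0" using c(4) C.\<epsilon>_dv[OF b'(1)] by (simp add: C.\<epsilon>_diff)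
    moreover have "c i 0 - dh i b' \<in> D i 0" using c(1)[of i 0] R.dh_mem[OF b'(1)] by (simp add: R.D_diff)
    ultimately obtain b where "b \<in> D i (Suc 0)" "dv 0 b = c i 0 - dh i b'" using C.\<epsilon>_exact by blast
    then show ?case using b' 0 by (intro bexI[of _ b] bexI[of _ b']) auto
  next
    case (Suc q)
    then obtain b b' where b: "b \<in> D (Suc p) (Suc q)" "b' \<in> D (Suc (Suc p)) q"
      "c (Suc p) q = dv q b + dh (Suc p) b'" using Suc.IH[of "Suc p"] by auto
    have "dv q (c p (Suc q)) = dh p (c (Suc p) q)" using c(2)[of p q] Suc.prems by simp
    also have "\<dots> = dv q (dh p b)" unfolding b(3) R.dh_add using dh_dv[OF b(1)] R.dh_dh[OF b(2)] by simp
    finally have "dv q (c p (Suc q) - dh p b) = 0" by (simp add: C.dh_diff)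
    moreover have "c p (Suc q) - dh p b \<in> D p (Suc q)"
      using c(1)[of p "Suc q"] Suc.prems R.dh_mem[OF b(1)] by (simp add: R.D_diff)
    ultimately obtain b'' where "b'' \<in> D p (Suc (Suc q))" "dv (Suc q) b'' = c p (Suc q) - dh p b"
      using C.dh_exact by blast
    then show ?case using b by (intro bexI[of _ b''] bexI[of _ b]) auto
  qed
  from this[of 0 i] obtain b b' where b: "b \<in> D 0 (Suc i)" "b' \<in> D (Suc 0) i" "c 0 i = dv i b + dh 0 b'"
    by auto
  then have "z = dE i (\<epsilon> b)" using c(3) R.\<epsilon>_dv[OF b(1)] R.\<epsilon>_dh[OF b(2)] by (simp add: R.\<epsilon>_add)
  then show ?thesis using R.\<epsilon>_mem[OF b(1)] by blast
qed

end

text \<open>Zigzags relate every cycle of either complex to one of the other and match boundaries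
  with boundaries. \<open>sc\<close> is the action of scalars on \<open>D\<close>, which is only an
  abelian group. In degree 0 the condition on \<open>h\<close> is empty, so every element is a
  cycle.\<close>

lemma balanced_codim:
  fixes E :: "nat \<Rightarrow> ('i \<Rightarrow> 'k::field) set" and G :: "nat \<Rightarrow> ('l \<Rightarrow> 'k) set"
  assumes bal: "balanced_complex D E G dh dv dE dG \<epsilon> \<eta>"
    and sc: "\<And>c a p q. a \<in> D p q \<Longrightarrow> sc c a \<in> D p q" "\<And>c a p. dh p (sc c a) = sc c (dh p a)"
      "\<And>c a q. dv q (sc c a) = sc c (dv q a)" "\<And>c a. \<epsilon> (sc c a) = fscale c (\<epsilon> a)"
      "\<And>c a. \<eta> (sc c a) = fscale c (\<eta> a)"
    and scE: "\<And>c e q. dE q (fscale c e) = fscale c (dE q e)"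
    and scG: "\<And>c e p. dG p (fscale c e) = fscale c (dG p e)"
    and E: "\<And>q. fs.subspace (E q)" "\<And>q. fin_dim (E q)"
    and G: "\<And>q. fs.subspace (G q)" "\<And>q. fin_dim (G q)"
  shows "fs.dim {z \<in> E i. \<forall>h. i = Suc h \<longrightarrow> dE h z = 0} - fs.dim (dE i ` E (Suc i)) =
    fs.dim {z \<in> G i. \<forall>h. i = Suc h \<longrightarrow> dG h z = 0} - fs.dim (dG i ` G (Suc i))"
proof -
  interpret balanced_complex D E G dh dv dE dG \<epsilon> \<eta> by fact
  interpret F: balanced_complex "\<lambda>q p. D p q" G E dv dh dG dE \<eta> \<epsilon>
    by (unfold_locales) (simp add: dh_dv)
  have sub: "fs.subspace {z \<in> E i. \<forall>h. i = Suc h \<longrightarrow> dE h z = 0}"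
    if "\<And>q. fs.subspace (E q)" "\<And>q a b. dE q (a + b) = dE q a + dE q b"
      "\<And>c e q. dE q (fscale c e) = fscale c (dE q e)"
    for E :: "nat \<Rightarrow> ('z \<Rightarrow> 'k) set" and dE and i
  proof (rule fs.subspaceI)
    show "0 \<in> {z \<in> E i. \<forall>h. i = Suc h \<longrightarrow> dE h z = 0}"
      using fs.subspace_0[OF that(1)] that(2)[of _ 0 0] by auto
    fix x assume x: "x \<in> {z \<in> E i. \<forall>h. i = Suc h \<longrightarrow> dE h z = 0}"
    then show "fscale c x \<in> {z \<in> E i. \<forall>h. i = Suc h \<longrightarrow> dE h z = 0}" for c
      using fs.subspace_scale[OF that(1), of x i c] that(3) by (auto simp: fun_eq_iff)
    fix y assume "y \<in> {z \<in> E i. \<forall>h. i = Suc h \<longrightarrow> dE h z = 0}"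
    then show "x + y \<in> {z \<in> E i. \<forall>h. i = Suc h \<longrightarrow> dE h z = 0}"
      using x fs.subspace_add[OF that(1), of x i y] that(2) by auto
  qed
  have im: "fs.subspace (dE i ` E (Suc i))"
    if "\<And>q. fs.subspace (E q)" "\<And>q a b. dE q (a + b) = dE q a + dE q b"
      "\<And>c e q. dE q (fscale c e) = fscale c (dE q e)"
    for E :: "nat \<Rightarrow> ('z \<Rightarrow> 'k) set" and dE and i
  proof (rule fs.subspaceI)
    show "0 \<in> dE i ` E (Suc i)" using fs.subspace_0[OF that(1), of "Suc i"] that(2)[of i 0 0] by (auto simp: image_iff intro!: bexI[of _ 0])
    fix x assume "x \<in> dE i ` E (Suc i)"
    then obtain a where a: "a \<in> E (Suc i)" "x = dE i a" by blast
    have "fscale c x = dE i (fscale c a)" for c unfolding a(2) that(3) ..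
    then show "fscale c x \<in> dE i ` E (Suc i)" for c
      using fs.subspace_scale[OF that(1) a(1), of c] by (metis imageI)
    fix y assume "y \<in> dE i ` E (Suc i)"
    then obtain b where b: "b \<in> E (Suc i)" "y = dE i b" by blast
    then have "x + y = dE i (a + b)" using a that(2) by simp
    then show "x + y \<in> dE i ` E (Suc i)" using fs.subspace_add[OF that(1) a(1) b(1)] by simp
  qed
  have fd: "fin_dim Z" if "fin_dim W" "Z \<subseteq> W" for Z W :: "('z \<Rightarrow> 'k) set"
    using that(1) subset_trans[OF that(2)] unfolding fin_dim_def by auto
  have incE: "dE i ` E (Suc i) \<subseteq> {z \<in> E i. \<forall>h. i = Suc h \<longrightarrow> dE h z = 0}"
  proof (rule image_subsetI, intro CollectI conjI allI impI)
    fix e assume "e \<in> E (Suc i)"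
    then obtain a where a: "a \<in> D 0 (Suc i)" "e = \<epsilon> a" using R.\<epsilon>_surj by blast
    then have e: "dE i e = \<epsilon> (dv i a)" using R.\<epsilon>_dv by simp
    then show "dE i e \<in> E i" using R.\<epsilon>_mem C.dh_mem a by simp
    show "dE h (dE i e) = 0" if "i = Suc h" for h
    proof -
      have "dE h (dE i e) = \<epsilon> (dv h (dv i a))" using e R.\<epsilon>_dv C.dh_mem a that by simp
      then show ?thesis using C.dh_dh a that R.\<epsilon>_zero by simp
    qed
  qed
  have incG: "dG i ` G (Suc i) \<subseteq> {z \<in> G i. \<forall>h. i = Suc h \<longrightarrow> dG h z = 0}"
  proof (rule image_subsetI, intro CollectI conjI allI impI)
    fix e assume "e \<in> G (Suc i)"
    then obtain a where a: "a \<in> D (Suc i) 0" "e = \<eta> a" using C.\<epsilon>_surj by blast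
    then have e: "dG i e = \<eta> (dh i a)" using C.\<epsilon>_dv by simp
    then show "dG i e \<in> G i" using C.\<epsilon>_mem R.dh_mem a by simp
    show "dG h (dG i e) = 0" if "i = Suc h" for h
    proof -
      have "dG h (dG i e) = \<eta> (dh h (dh i a))" using e C.\<epsilon>_dv R.dh_mem a that by simp
      then show ?thesis using R.dh_dh a that C.\<epsilon>_zero by simp
    qed
  qed
  show ?thesis
  proof (rule codim_eq_relation[where \<rho> = "\<lambda>z w. \<exists>c. zigzag i c z w"])
    show "\<exists>c. zigzag i c (z + w) (z' + w')" if zz: "\<exists>c. zigzag i c z z'" "\<exists>c. zigzag i c w w'" for z w z' w'
    proof -
      obtain c d where "zigzag i c z z'" "zigzag i d w w'" using zz by blast
      then have "zigzag i (\<lambda>p q. c p q + d p q) (z + w) (z' + w')"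
        by (auto simp: zigzag_def R.\<epsilon>_add C.\<epsilon>_add R.dh_add C.dh_add intro: R.D_add)
      then show ?thesis by blast
    qed
    show "\<exists>d. zigzag i d (fscale c z) (fscale c z')" if zz: "\<exists>c. zigzag i c z z'" for c z z'
    proof -
      obtain d where "zigzag i d z z'" using zz by blast
      then have "zigzag i (\<lambda>p q. sc c (d p q)) (fscale c z) (fscale c z')"
        by (auto simp: zigzag_def sc)
      then show ?thesis by blast
    qed
    show "\<exists>z'\<in>{z \<in> G i. \<forall>h. i = Suc h \<longrightarrow> dG h z = 0}. \<exists>c. zigzag i c z z'"
      if "z \<in> {z \<in> E i. \<forall>h. i = Suc h \<longrightarrow> dE h z = 0}" for z
      using zigzag_exists[of z i] that by blast
    show "\<exists>z\<in>{z \<in> E i. \<forall>h. i = Suc h \<longrightarrow> dE h z = 0}. \<exists>c. zigzag i c z z'"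
      if z': "z' \<in> {z \<in> G i. \<forall>h. i = Suc h \<longrightarrow> dG h z = 0}" for z'
    proof -
      obtain c z where "F.zigzag i c z' z" "z \<in> E i" "\<forall>h. i = Suc h \<longrightarrow> dE h z = 0"
        using F.zigzag_exists[of z' i] z' by blast
      then show ?thesis using F.zigzag_flip by blast
    qed
    show "z \<in> dE i ` E (Suc i) \<longleftrightarrow> z' \<in> dG i ` G (Suc i)" if zz: "\<exists>c. zigzag i c z z'" for z z'
    proof -
      obtain c where c: "zigzag i c z z'" using zz by blast
      show ?thesis using zigzag_boundary[OF c] F.zigzag_boundary[OF zigzag_flip[OF c]] by blast
    qed
    show "fin_dim {z \<in> E i. \<forall>h. i = Suc h \<longrightarrow> dE h z = 0}" "fin_dim {z \<in> G i. \<forall>h. i = Suc h \<longrightarrow> dG h z = 0}"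
      by (rule fd, rule E(2)[of i] G(2)[of i], blast)+
  qed (intro sub im E G R.dE_add C.dE_add scE scG incE incG)+
qed

section \<open>Chains on set systems\<close>

definition pos_sign :: "('n \<Rightarrow> nat) \<Rightarrow> 'n \<Rightarrow> 'n set \<Rightarrow> 'k::comm_ring_1" where
  "pos_sign e x \<sigma> = (-1) ^ card {z \<in> \<sigma>. e z < e x}"

lemma pos_sign_square [simp]: "pos_sign e x \<sigma> * pos_sign e x \<sigma> = 1"
  by (simp add: pos_sign_def flip: power_add mult_2)

lemma pos_sign_square' [simp]: "pos_sign e x \<sigma> * (pos_sign e x \<sigma> * c) = c"
  by (simp add: mult.assoc[symmetric])

lemma pos_sign_insert:
  assumes "finite \<sigma>" "y \<notin> \<sigma>"
  shows "pos_sign e x (insert y \<sigma>) = (if e y < e x then - pos_sign e x \<sigma> else pos_sign e x \<sigma>)"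
proof -
  have "{z \<in> insert y \<sigma>. e z < e x} = (if e y < e x then insert y {z \<in> \<sigma>. e z < e x} else {z \<in> \<sigma>. e z < e x})"
    by auto
  then show ?thesis using assms by (simp add: pos_sign_def)
qed

text \<open>The simplicial boundary on coefficient functions: the coefficient at
  \<open>\<sigma>\<close> collects the simplices with one more vertex. Coefficients outside
  \<open>S\<close> are discarded, as in a relative chain complex.\<close>

definition bdry :: "'n set \<Rightarrow> ('n \<Rightarrow> nat) \<Rightarrow> 'n set set \<Rightarrow> ('n set \<Rightarrow> 'k::comm_ring_1) \<Rightarrow> 'n set \<Rightarrow> 'k" where
  "bdry N e S g \<sigma> = (if \<sigma> \<in> S then \<Sum>x\<in>N - \<sigma>. pos_sign e x \<sigma> * g (insert x \<sigma>) else 0)"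

lemma bdry_add: "bdry N e S (g + h) = bdry N e S g + bdry N e S h"
  by (auto simp: bdry_def fun_eq_iff distrib_left sum.distrib)

lemma bdry_scale: "bdry N e S (\<lambda>\<sigma>. c * g \<sigma>) = (\<lambda>\<sigma>. c * bdry N e S g \<sigma>)"
  by (auto simp: bdry_def fun_eq_iff sum_distrib_left mult.left_commute)

lemma bdry_zero [simp]: "bdry N e S (\<lambda>_. 0) = (\<lambda>_. 0)"
  by (auto simp: bdry_def)

text \<open>Chains are graded by cardinality, one more than the dimension of a simplex; the empty
  simplex has degree 0.\<close>

definition set_chains :: "'n set set \<Rightarrow> nat \<Rightarrow> ('n set \<Rightarrow> 'k::zero) set" where
  "set_chains S p = {g. \<forall>\<sigma>. g \<sigma> \<noteq> 0 \<longrightarrow> \<sigma> \<in> S \<and> card \<sigma> = p}"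

text \<open>The first argument fixes the coefficient field, which the type of the result does not
  show.\<close>

definition set_homology :: "'k::field itself \<Rightarrow> 'n set \<Rightarrow> ('n \<Rightarrow> nat) \<Rightarrow> 'n set set \<Rightarrow> nat \<Rightarrow> nat" where
  "set_homology _ N e S p =
     fs.dim {g \<in> set_chains S p. bdry N e S g = (\<lambda>_. 0 :: 'k)} -
     fs.dim (bdry N e S ` (set_chains S (Suc p) :: ('n set \<Rightarrow> 'k) set))"

locale vertex_order =
  fixes N :: "'n set" and e :: "'n \<Rightarrow> nat"
  assumes finite_N: "finite N" and inj_e: "inj_on e N"
begin

lemma finite_subset_N: "\<sigma> \<subseteq> N \<Longrightarrow> finite \<sigma>"
  using finite_N finite_subset by blast

text \<open>Coning with apex \<open>x\<close>: a contracting homotopy on families that are stable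
  under adding and removing \<open>x\<close>.\<close>

definition cone_homotopy :: "'n \<Rightarrow> ('n set \<Rightarrow> 'k::comm_ring_1) \<Rightarrow> 'n set \<Rightarrow> 'k" where
  "cone_homotopy x g \<sigma> = (if x \<in> \<sigma> then pos_sign e x (\<sigma> - {x}) * g (\<sigma> - {x}) else 0)"

text \<open>The sets of \<open>S\<close> come in pairs differing in \<open>x\<close>. At
  \<open>\<sigma>\<close> without \<open>x\<close> only the term that adds \<open>x\<close>
  survives. At \<open>\<sigma>\<close> with \<open>x\<close> the cycle condition at
  \<open>\<sigma> - {x}\<close> turns the sum over the other vertices into
  \<open>g \<sigma>\<close>.\<close>

lemma cone_exact:
  assumes S: "S \<subseteq> Pow N" and x: "x \<in> N" and cone: "\<And>\<sigma>. \<sigma> \<subseteq> N \<Longrightarrow> insert x \<sigma> \<in> S \<longleftrightarrow> \<sigma> - {x} \<in> S"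
    and supp: "\<And>\<sigma>. g \<sigma> \<noteq> 0 \<Longrightarrow> \<sigma> \<in> S" and cyc: "bdry N e S g = (\<lambda>_. 0)"
  shows "bdry N e S (cone_homotopy x g) = g"
proof
  fix \<sigma>
  show "bdry N e S (cone_homotopy x g) \<sigma> = g \<sigma>"
  proof (cases "\<sigma> \<in> S")
    case False
    then show ?thesis using supp by (auto simp: bdry_def)
  next
    case \<sigma>: True
    then have fin: "finite \<sigma>" "\<sigma> \<subseteq> N" using S finite_subset_N by auto
    show ?thesis
    proof (cases "x \<in> \<sigma>")
      case False
      have "bdry N e S (cone_homotopy x g) \<sigma> =
          (\<Sum>y\<in>N - \<sigma>. if y = x then pos_sign e x \<sigma> * cone_homotopy x g (insert x \<sigma>) else 0)"
        using \<sigma> False unfolding bdry_def by (auto simp: cone_homotopy_def intro!: sum.cong)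
      also have "\<dots> = pos_sign e x \<sigma> * cone_homotopy x g (insert x \<sigma>)"
        using finite_N x False by simp
      also have "\<dots> = g \<sigma>" using False by (simp add: cone_homotopy_def)
      finally show ?thesis .
    next
      case True
      define \<tau> where "\<tau> = \<sigma> - {x}"
      have \<tau>: "\<sigma> = insert x \<tau>" "x \<notin> \<tau>" "finite \<tau>" "\<tau> \<subseteq> N" using True fin by (auto simp: \<tau>_def)
      have "\<tau> \<in> S" using cone[of \<tau>] \<tau> \<sigma> by simp
      have "bdry N e S (cone_homotopy x g) \<sigma> =
          (\<Sum>y\<in>N - \<sigma>. pos_sign e y \<sigma> * (pos_sign e x (insert y \<tau>) * g (insert y \<tau>)))"
        using \<sigma> \<tau> unfolding bdry_def by (auto simp: cone_homotopy_def insert_Diff_if intro!: sum.cong)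
      also have "\<dots> = (\<Sum>y\<in>N - \<sigma>. - (pos_sign e x \<tau> * (pos_sign e y \<tau> * g (insert y \<tau>))))"
      proof (rule sum.cong[OF refl])
        fix y assume y: "y \<in> N - \<sigma>"
        then have "e y \<noteq> e x" using inj_onD[OF inj_e, of y x] x \<tau> by auto
        \<comment> \<open>Exactly one of the two signs changes, according to which of
          \<open>x\<close> and \<open>y\<close> comes first.\<close>
        then have "pos_sign e y (insert x \<tau>) * pos_sign e x (insert y \<tau>) =
           - (pos_sign e x \<tau> * (pos_sign e y \<tau> :: 'a))"
          using y \<tau> by (auto simp: pos_sign_insert)
        then show "pos_sign e y \<sigma> * (pos_sign e x (insert y \<tau>) * g (insert y \<tau>)) =
            - (pos_sign e x \<tau> * (pos_sign e y \<tau> * g (insert y \<tau>)))"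
          unfolding \<tau>(1) by (metis (no_types, opaque_lifting) mult.assoc mult_minus_left)
      qed
      also have "\<dots> = - (pos_sign e x \<tau> * (\<Sum>y\<in>N - \<sigma>. pos_sign e y \<tau> * g (insert y \<tau>)))"
        by (simp add: sum_negf sum_distrib_left)
      also have "(\<Sum>y\<in>N - \<sigma>. pos_sign e y \<tau> * g (insert y \<tau>)) = - (pos_sign e x \<tau> * g \<sigma>)"
      proof -
        have e1: "N - \<tau> = insert x (N - \<sigma>)" and e2: "x \<notin> N - \<sigma>" using \<tau> x by auto
        have "(\<Sum>y\<in>N - \<tau>. pos_sign e y \<tau> * g (insert y \<tau>)) =
            pos_sign e x \<tau> * g \<sigma> + (\<Sum>y\<in>N - \<sigma>. pos_sign e y \<tau> * g (insert y \<tau>))"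
          unfolding e1 using finite_N e2 by (simp flip: \<tau>(1))
        moreover have "(\<Sum>y\<in>N - \<tau>. pos_sign e y \<tau> * g (insert y \<tau>)) = 0"
          using fun_cong[OF cyc, of \<tau>] \<open>\<tau> \<in> S\<close> by (simp add: bdry_def)
        ultimately show ?thesis by (simp add: eq_neg_iff_add_eq_0 add.commute)
      qed
      finally show ?thesis by simp
    qed
  qed
qed

text \<open>Adding \<open>x\<close> then \<open>y\<close> cancels against adding \<open>y\<close>
  then \<open>x\<close>. The condition \<open>conv\<close> places both intermediate sets in
  \<open>S\<close>, so that neither term is discarded alone.\<close>

lemma bdry_bdry:
  assumes S: "S \<subseteq> Pow N" and conv: "\<And>\<sigma> x y. \<sigma> \<in> S \<Longrightarrow> insert y (insert x \<sigma>) \<in> S \<Longrightarrow> insert x \<sigma> \<in> S"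
    and supp: "\<And>\<sigma>. g \<sigma> \<noteq> 0 \<Longrightarrow> \<sigma> \<in> S"
  shows "bdry N e S (bdry N e S g) = (\<lambda>_. 0)"
proof
  fix \<sigma>
  show "bdry N e S (bdry N e S g) \<sigma> = 0"
  proof (cases "\<sigma> \<in> S")
    case \<sigma>: True
    then have fin: "finite \<sigma>" "\<sigma> \<subseteq> N" using S finite_subset_N by auto
    define T where "T x y = pos_sign e x \<sigma> * (pos_sign e y (insert x \<sigma>) * g (insert y (insert x \<sigma>)))" for x y
    \<comment> \<open>Splitting by the order of \<open>x\<close> and \<open>y\<close> gives two
      double sums that are exchanged, up to sign, by swapping the summation variables.\<close>
    have inner: "pos_sign e x \<sigma> * bdry N e S g (insert x \<sigma>) =
        (\<Sum>y\<in>N - \<sigma>. if e y < e x then T x y else 0) + (\<Sum>y\<in>N - \<sigma>. if e x < e y then T x y else 0)"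
      if x: "x \<in> N - \<sigma>" for x
    proof -
      have "pos_sign e x \<sigma> * bdry N e S g (insert x \<sigma>) = (\<Sum>y\<in>N - insert x \<sigma>. T x y)"
      proof (cases "insert x \<sigma> \<in> S")
        case True
        then show ?thesis by (simp add: bdry_def T_def sum_distrib_left)
      next
        case False
        then have "g (insert y (insert x \<sigma>)) = 0" for y using supp conv[OF \<sigma>] by blast
        then show ?thesis using False by (simp add: bdry_def T_def)
      qed
      also have "\<dots> = (\<Sum>y\<in>N - \<sigma>. if y = x then 0 else T x y)"
        using finite_N by (intro sum.mono_neutral_cong_left) auto
      also have "\<dots> = (\<Sum>y\<in>N - \<sigma>. (if e y < e x then T x y else 0) + (if e x < e y then T x y else 0))"
        using x inj_onD[OF inj_e] by (intro sum.cong) (auto simp: not_less_iff_gr_or_eq)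
      finally show ?thesis by (simp add: sum.distrib)
    qed
    have swap: "T x y = - T y x" if "x \<in> N - \<sigma>" "y \<in> N - \<sigma>" "x \<noteq> y" for x y
    proof -
      have ne: "e x \<noteq> e y" using that inj_onD[OF inj_e, of x y] by auto
      have "pos_sign e x \<sigma> * pos_sign e y (insert x \<sigma>) = - (pos_sign e y \<sigma> * (pos_sign e x (insert y \<sigma>) :: 'a))"
        using ne fin that by (auto simp: pos_sign_insert mult.commute)
      note eq = this
      have "T x y = (pos_sign e x \<sigma> * pos_sign e y (insert x \<sigma>)) * g (insert y (insert x \<sigma>))"
        by (simp add: T_def mult.assoc)
      also have "\<dots> = - T y x" unfolding eq by (simp add: T_def mult.assoc insert_commute)
      finally show ?thesis .
    qed
    have "bdry N e S (bdry N e S g) \<sigma> = (\<Sum>x\<in>N - \<sigma>. pos_sign e x \<sigma> * bdry N e S g (insert x \<sigma>))"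
      using \<sigma> by (simp add: bdry_def[of _ _ _ "bdry N e S g"])
    also have "\<dots> = (\<Sum>x\<in>N - \<sigma>. \<Sum>y\<in>N - \<sigma>. if e y < e x then T x y else 0) +
        (\<Sum>x\<in>N - \<sigma>. \<Sum>y\<in>N - \<sigma>. if e x < e y then T x y else 0)"
      by (simp add: inner sum.distrib)
    also have "(\<Sum>x\<in>N - \<sigma>. \<Sum>y\<in>N - \<sigma>. if e y < e x then T x y else 0) =
        (\<Sum>x\<in>N - \<sigma>. \<Sum>y\<in>N - \<sigma>. - (if e x < e y then T x y else 0))"
    proof (subst sum.swap, intro sum.cong refl)
      fix x y assume "x \<in> N - \<sigma>" "y \<in> N - \<sigma>"
      then show "(if e x < e y then T y x else 0) = - (if e x < e y then T x y else 0)"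
        using swap[of y x] by (cases "x = y") auto
    qed
    finally show ?thesis by (simp add: sum_negf)
  qed (simp add: bdry_def)
qed

end

subsection \<open>Labelled simplices\<close>

definition mon_le :: "'x mon \<Rightarrow> 'x mon \<Rightarrow> bool" where
  "mon_le m n \<longleftrightarrow> (\<forall>x. lookup m x \<le> lookup n x)"

lemma mon_le_trans: "mon_le l m \<Longrightarrow> mon_le m n \<Longrightarrow> mon_le l n"
  unfolding mon_le_def by (intro allI) (erule allE, erule allE, rule le_trans)

lemma mon_le_add [simp]: "mon_le m (n + m)" by (simp add: mon_le_def lookup_add)

lemma mon_le_diff_add: "mon_le m n \<Longrightarrow> n - m + m = n"
  by (intro poly_mapping_eqI) (simp add: mon_le_def lookup_add lookup_minus)

lemma mon_le_sqf: "finite \<sigma> \<Longrightarrow> mon_le (sqf \<sigma>) b \<longleftrightarrow> \<sigma> \<subseteq> keys b"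
  unfolding mon_le_def
  by (auto simp: lookup_sqf in_keys_iff subset_iff Suc_le_eq split: if_splits)

lemma lookup_monomial_mult_le:
  "lookup (monomial_poly n * p) m = (if mon_le n m then lookup p (m - n) else 0)"
  by (simp add: lookup_monomial_mult mon_dvd_iff mon_le_def)

text \<open>The cellular complex of a simplex with monomial labels: free modules on the subsets of
  \<open>N\<close>, with quotients of labels in the differential. The labels
  \<open>sqf \<sigma>\<close> give the Koszul complex, least common multiples of generators the
  Taylor complex.\<close>

locale labelled_simplex = vertex_order N e for N :: "'n set" and e +
  fixes lab :: "'n set \<Rightarrow> 'x mon"
  assumes label_mono: "\<And>\<sigma> x. \<sigma> \<subseteq> N \<Longrightarrow> x \<in> N \<Longrightarrow> mon_le (lab \<sigma>) (lab (insert x \<sigma>))"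
begin

definition label_bdry :: "('n set \<Rightarrow> ('x, 'k::comm_ring_1) mpoly) \<Rightarrow> 'n set \<Rightarrow> ('x, 'k) mpoly" where
  "label_bdry c \<sigma> = (\<Sum>x\<in>N - \<sigma>. const (pos_sign e x \<sigma>) * (monomial_poly (lab (insert x \<sigma>) - lab \<sigma>) * c (insert x \<sigma>)))"

text \<open>The component of \<open>c\<close> in multidegree \<open>b\<close>: the basis element
  \<open>\<sigma>\<close> carries the degree \<open>lab \<sigma>\<close>, so its coefficient is read
  at \<open>b - lab \<sigma>\<close>.\<close>

definition coord :: "('n set \<Rightarrow> ('x, 'k::comm_ring_1) mpoly) \<Rightarrow> 'x mon \<Rightarrow> 'n set \<Rightarrow> 'k" where
  "coord c b \<sigma> = (if mon_le (lab \<sigma>) b then lookup (c \<sigma>) (b - lab \<sigma>) else 0)"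

definition below :: "'x mon \<Rightarrow> 'n set set" where
  "below b = {\<sigma>. \<sigma> \<subseteq> N \<and> mon_le (lab \<sigma>) b}"

lemma lookup_coord: "lookup (c \<sigma>) m = coord c (m + lab \<sigma>) \<sigma>"
  by (simp add: coord_def)

text \<open>Quotients of labels make the differential homogeneous for multidegrees, and only the
  sets whose label divides \<open>b\<close> have a component in multidegree
  \<open>b\<close>.\<close>

lemma coord_label_bdry:
  assumes "\<sigma> \<subseteq> N"
  shows "coord (label_bdry c) b \<sigma> = bdry N e (below b) (coord c b) \<sigma>"
proof (cases "mon_le (lab \<sigma>) b")
  case True
  have "lookup (const (pos_sign e x \<sigma>) * (monomial_poly (lab (insert x \<sigma>) - lab \<sigma>) * c (insert x \<sigma>))) (b - lab \<sigma>)
     = pos_sign e x \<sigma> * coord c b (insert x \<sigma>)" if x: "x \<in> N - \<sigma>" for x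
  proof -
    have le: "lookup (lab \<sigma>) y \<le> lookup (lab (insert x \<sigma>)) y" "lookup (lab \<sigma>) y \<le> lookup b y" for y
      using label_mono[OF assms, of x] x True by (auto simp: mon_le_def)
    have "mon_le (lab (insert x \<sigma>) - lab \<sigma>) (b - lab \<sigma>) \<longleftrightarrow> mon_le (lab (insert x \<sigma>)) b"
    proof -
      have "lookup (lab (insert x \<sigma>)) y - lookup (lab \<sigma>) y \<le> lookup b y - lookup (lab \<sigma>) y \<longleftrightarrow>
          lookup (lab (insert x \<sigma>)) y \<le> lookup b y" for y using le[of y] by arith
      then show ?thesis by (simp add: mon_le_def lookup_minus)
    qed
    moreover have "b - lab \<sigma> - (lab (insert x \<sigma>) - lab \<sigma>) = b - lab (insert x \<sigma>)"
      using le by (intro poly_mapping_eqI) (simp add: lookup_minus)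
    ultimately show ?thesis by (simp add: lookup_const_mult lookup_monomial_mult_le coord_def)
  qed
  then show ?thesis using True assms
    by (simp add: coord_def[of "label_bdry c"] label_bdry_def lookup_sum bdry_def below_def)
next
  case False
  then show ?thesis by (simp add: coord_def[of "label_bdry c"] bdry_def below_def)
qed

lemma label_bdry_outside:
  assumes "\<And>\<sigma>. \<not> \<sigma> \<subseteq> N \<Longrightarrow> c \<sigma> = 0" "\<not> \<sigma> \<subseteq> N"
  shows "label_bdry c \<sigma> = 0"
  unfolding label_bdry_def using assms by (intro sum.neutral) auto

lemma below_convex: "\<sigma> \<in> below b \<Longrightarrow> insert y (insert x \<sigma>) \<in> below b \<Longrightarrow> insert x \<sigma> \<in> below b"
  unfolding below_def using label_mono[of "insert x \<sigma>" y] by (auto intro: mon_le_trans)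

lemma label_bdry_bdry:
  assumes "\<And>\<sigma>. \<not> \<sigma> \<subseteq> N \<Longrightarrow> c \<sigma> = 0"
  shows "label_bdry (label_bdry c) = (\<lambda>_. 0)"
proof (rule ext, rule poly_mapping_eqI)
  fix \<sigma> m
  show "lookup (label_bdry (label_bdry c) \<sigma>) m = lookup 0 m"
  proof (cases "\<sigma> \<subseteq> N")
    case False
    then show ?thesis using label_bdry_outside[of "label_bdry c" \<sigma>] label_bdry_outside[of c] assms by simp
  next
    case \<sigma>: True
    let ?b = "m + lab \<sigma>"
    have "coord (label_bdry c) ?b \<tau> = bdry N e (below ?b) (coord c ?b) \<tau>" for \<tau>
    proof (cases "\<tau> \<subseteq> N")
      case False
      then show ?thesis using label_bdry_outside[of c \<tau>] assms by (simp add: coord_def bdry_def below_def)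
    qed (rule coord_label_bdry)
    then have "coord (label_bdry c) ?b = bdry N e (below ?b) (coord c ?b)" by (rule ext)
    then have "lookup (label_bdry (label_bdry c) \<sigma>) m = bdry N e (below ?b) (bdry N e (below ?b) (coord c ?b)) \<sigma>"
      unfolding lookup_coord coord_label_bdry[OF \<sigma>] by simp
    also have "bdry N e (below ?b) (bdry N e (below ?b) (coord c ?b)) = (\<lambda>_. 0)"
    proof (rule bdry_bdry[OF _ below_convex])
      show "below ?b \<subseteq> Pow N" by (auto simp: below_def)
      show "\<tau> \<in> below ?b" if "coord c ?b \<tau> \<noteq> 0" for \<tau>
        using that assms[of \<tau>] by (cases "\<tau> \<subseteq> N") (auto simp: below_def coord_def split: if_splits)
    qed
    finally show ?thesis by simp
  qed
qed

text \<open>In each multidegree where \<open>c\<close> is nonzero the family \<open>below b\<close>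
  is a cone, and coning produces a preimage there. The last conclusion records from which
  coefficients of \<open>c\<close> a coefficient of the preimage comes; it yields the bounds on
  degrees and variables of \<open>c'\<close>.\<close>

lemma label_bdry_exact:
  assumes supp: "\<And>\<sigma>. \<not> \<sigma> \<subseteq> N \<Longrightarrow> c \<sigma> = 0" and cyc: "label_bdry c = (\<lambda>_. 0)"
    and cone: "\<And>b \<sigma>. coord c b \<sigma> \<noteq> 0 \<Longrightarrow>
      \<exists>x\<in>N. \<forall>\<sigma>. \<sigma> \<subseteq> N \<and> mon_le (lab \<sigma>) b \<longrightarrow> mon_le (lab (insert x \<sigma>)) b"
  shows "\<exists>c'. label_bdry c' = c \<and> (\<forall>\<sigma>. \<not> \<sigma> \<subseteq> N \<longrightarrow> c' \<sigma> = 0) \<and>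
    (\<forall>\<sigma> m. lookup (c' \<sigma>) m \<noteq> 0 \<longrightarrow>
      (\<exists>x\<in>\<sigma>. lookup (c (\<sigma> - {x})) (m + (lab \<sigma> - lab (\<sigma> - {x}))) \<noteq> 0))"
proof -
  \<comment> \<open>One apex for each multidegree, independent of \<open>\<sigma>\<close>.\<close>
  define X where "X b = (SOME x. x \<in> N \<and> (\<forall>\<sigma>. \<sigma> \<subseteq> N \<and> mon_le (lab \<sigma>) b \<longrightarrow> mon_le (lab (insert x \<sigma>)) b))" for b
  have X: "X b \<in> N" "\<And>\<sigma>. \<sigma> \<subseteq> N \<Longrightarrow> mon_le (lab \<sigma>) b \<Longrightarrow> mon_le (lab (insert (X b) \<sigma>)) b"
    if "coord c b \<tau> \<noteq> 0" for b \<tau>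
  proof -
    have "\<exists>x. x \<in> N \<and> (\<forall>\<sigma>. \<sigma> \<subseteq> N \<and> mon_le (lab \<sigma>) b \<longrightarrow> mon_le (lab (insert x \<sigma>)) b)"
      using cone[OF that] by blast
    from someI_ex[OF this] show "X b \<in> N"
      "\<And>\<sigma>. \<sigma> \<subseteq> N \<Longrightarrow> mon_le (lab \<sigma>) b \<Longrightarrow> mon_le (lab (insert (X b) \<sigma>)) b"
      unfolding X_def[symmetric] by auto
  qed
  \<comment> \<open>The coefficient at \<open>\<sigma>\<close> and \<open>m\<close> belongs to the
    multidegree \<open>m + lab \<sigma>\<close> and uses the apex of that degree.\<close>
  define f where "f \<sigma> m = (if \<sigma> \<subseteq> N then cone_homotopy (X (m + lab \<sigma>)) (coord c (m + lab \<sigma>)) \<sigma> else 0)" for \<sigma> m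
  have le: "lookup (lab (\<sigma> - {x})) y \<le> lookup (lab \<sigma>) y" if "\<sigma> \<subseteq> N" "x \<in> \<sigma>" for \<sigma> x y
  proof -
    have "insert x (\<sigma> - {x}) = \<sigma>" using that by auto
    then show ?thesis using label_mono[of "\<sigma> - {x}" x] that by (auto simp: mon_le_def)
  qed
  have f: "\<exists>x\<in>\<sigma>. lookup (c (\<sigma> - {x})) (m + (lab \<sigma> - lab (\<sigma> - {x}))) \<noteq> 0" if nz: "f \<sigma> m \<noteq> 0" for \<sigma> m
  proof -
    let ?x = "X (m + lab \<sigma>)"
    have \<sigma>: "\<sigma> \<subseteq> N" and x: "?x \<in> \<sigma>" and co: "coord c (m + lab \<sigma>) (\<sigma> - {?x}) \<noteq> 0"
      using nz by (auto simp: f_def cone_homotopy_def split: if_splits)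
    have "m + lab \<sigma> - lab (\<sigma> - {?x}) = m + (lab \<sigma> - lab (\<sigma> - {?x}))"
      using le[OF \<sigma> x] by (intro poly_mapping_eqI) (simp add: lookup_add lookup_minus)
    then show ?thesis using co x by (auto simp: coord_def split: if_splits)
  qed
  \<comment> \<open>Each nonzero coefficient at \<open>\<sigma>\<close> comes, for some
    \<open>x\<close> in \<open>\<sigma>\<close>, from one of the finitely many coefficients of
    \<open>c (\<sigma> - {x})\<close> by an injective shift of exponents.\<close>
  have fin: "finite {m. f \<sigma> m \<noteq> 0}" for \<sigma>
  proof (cases "\<sigma> \<subseteq> N")
    case True
    have "{m. f \<sigma> m \<noteq> 0} \<subseteq> (\<Union>x\<in>\<sigma>. (\<lambda>m. m + (lab \<sigma> - lab (\<sigma> - {x}))) -` keys (c (\<sigma> - {x})))"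
      using f by (auto simp: in_keys_iff)
    moreover have "finite \<dots>"
      using finite_subset_N[OF True] by (intro finite_UN_I finite_vimageI) (auto simp: inj_on_def)
    ultimately show ?thesis using finite_subset by blast
  qed (simp add: f_def)
  define c' where "c' \<sigma> = Abs_poly_mapping (f \<sigma>)" for \<sigma>
  have c': "lookup (c' \<sigma>) m = f \<sigma> m" for \<sigma> m using fin by (simp add: c'_def)
  have c'0: "c' \<sigma> = 0" if "\<not> \<sigma> \<subseteq> N" for \<sigma>
    using that by (intro poly_mapping_eqI) (simp add: c' f_def)
  have "label_bdry c' = c"
  proof (rule ext, rule poly_mapping_eqI)
    fix \<sigma> m
    show "lookup (label_bdry c' \<sigma>) m = lookup (c \<sigma>) m"
    proof (cases "\<sigma> \<subseteq> N")
      case False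
      then show ?thesis using label_bdry_outside[of c' \<sigma>] c'0 supp by simp
    next
      case \<sigma>: True
      define b where "b = m + lab \<sigma>"
      let ?g = "coord c b"
      have cyc': "bdry N e (below b) ?g = (\<lambda>_. 0)"
      proof
        fix \<tau>
        show "bdry N e (below b) ?g \<tau> = 0"
          using coord_label_bdry[of \<tau> c b] cyc by (cases "\<tau> \<subseteq> N") (auto simp: coord_def bdry_def below_def)
      qed
      have suppg: "\<tau> \<in> below b" if "?g \<tau> \<noteq> 0" for \<tau>
        using that supp[of \<tau>] by (cases "\<tau> \<subseteq> N") (auto simp: coord_def below_def split: if_splits)
      have "bdry N e (below b) (coord c' b) = ?g"
      proof (cases "\<exists>\<tau>. ?g \<tau> \<noteq> 0")
        case True
        then obtain \<tau>0 where "?g \<tau>0 \<noteq> 0" by blast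
        note Xb = X[OF this]
        have cone': "insert (X b) \<tau> \<in> below b \<longleftrightarrow> \<tau> - {X b} \<in> below b" if "\<tau> \<subseteq> N" for \<tau>
        proof -
          have eq: "insert (X b) (\<tau> - {X b}) = insert (X b) \<tau>" by auto
          have "mon_le (lab (\<tau> - {X b})) (lab (insert (X b) \<tau>))"
            using label_mono[of "\<tau> - {X b}" "X b"] that Xb(1) unfolding eq by blast
          then show ?thesis
            using Xb(1) Xb(2)[of "\<tau> - {X b}"] that unfolding eq below_def by (auto intro: mon_le_trans)
        qed
        have "coord c' b \<tau> = cone_homotopy (X b) ?g \<tau>" for \<tau>
        proof (cases "\<tau> \<in> below b")
          case True
          then have "b - lab \<tau> + lab \<tau> = b" by (simp add: below_def mon_le_diff_add)
          then show ?thesis using True by (simp add: coord_def[of c'] below_def c' f_def)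
        next
          case False
          have "cone_homotopy (X b) ?g \<tau> = 0"
          proof (rule ccontr)
            assume "cone_homotopy (X b) ?g \<tau> \<noteq> 0"
            then have "X b \<in> \<tau>" "?g (\<tau> - {X b}) \<noteq> 0"
              by (auto simp: cone_homotopy_def split: if_splits)
            then have "\<tau> - {X b} \<in> below b" "insert (X b) (\<tau> - {X b}) = \<tau>" using suppg by auto
            then show False using cone'[of "\<tau> - {X b}"] False by (auto simp: below_def)
          qed
          moreover have "coord c' b \<tau> = 0" using False c'0[of \<tau>] by (cases "\<tau> \<subseteq> N") (auto simp: coord_def below_def)
          ultimately show ?thesis by simp
        qed
        then have "coord c' b = cone_homotopy (X b) ?g" by (rule ext)
        moreover have "below b \<subseteq> Pow N" by (auto simp: below_def)
        ultimately show ?thesis using cone_exact[OF _ Xb(1) cone' suppg cyc'] by simp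
      next
        case False
        then have g0: "?g = (\<lambda>_. 0)" by auto
        have "coord c' b \<tau> = 0" for \<tau>
        proof (cases "\<tau> \<in> below b")
          case True
          then have "b - lab \<tau> + lab \<tau> = b" by (simp add: below_def mon_le_diff_add)
          then show ?thesis using g0 by (simp add: coord_def[of c'] c' f_def cone_homotopy_def)
        next
          case False
          then show ?thesis using c'0[of \<tau>] by (cases "\<tau> \<subseteq> N") (auto simp: coord_def below_def)
        qed
        then show ?thesis using g0 by (auto simp: fun_eq_iff bdry_def)
      qed
      then have "coord (label_bdry c') b \<sigma> = coord c b \<sigma>" by (simp add: coord_label_bdry[OF \<sigma>])
      then show ?thesis
        using lookup_coord[of "label_bdry c'" \<sigma> m] lookup_coord[of c \<sigma> m] by (simp add: b_def)
    qed
  qed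
  then show ?thesis
  proof (intro exI[of _ c'] conjI allI impI)
    show "\<exists>x\<in>\<sigma>. lookup (c (\<sigma> - {x})) (m + (lab \<sigma> - lab (\<sigma> - {x}))) \<noteq> 0"
      if "lookup (c' \<sigma>) m \<noteq> 0" for \<sigma> m using f[of \<sigma> m] that c' by simp
  qed (use c'0 in auto)
qed

end

section \<open>Betti numbers of Stanley--Reisner rings\<close>

lemma sqf_empty [simp]: "sqf {} = 0"
  by (rule poly_mapping_eqI) (simp add: lookup_sqf)

text \<open>A sum of exponent vectors vanishes only if both do. This makes reduction modulo the
  variables compatible with the matrices of a complex.\<close>

lemma lookup_mult_zero: "lookup (p * q) (0 :: 'x mon) = lookup p 0 * lookup q 0"
proof (induction p rule: poly_induct)
  case (single m c)
  then show ?case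
  proof (induction q rule: poly_induct)
    case (single n d)
    have "m + n = 0 \<longleftrightarrow> m = 0 \<and> n = 0"
      by (metis add.right_neutral add_is_0 mon_degree_add mon_degree_zero_iff)
    then show ?case by (auto simp: mult_single lookup_single when_def)
  qed (simp add: distrib_left lookup_add)
qed (simp add: distrib_right lookup_add)

lemma finite_monomials_degree:
  assumes "finite V"
  shows "finite {b. keys b \<subseteq> V \<and> mon_degree b = j}"
proof -
  let ?B = "{b. keys b \<subseteq> V \<and> mon_degree b = j}"
  have "lookup b x \<le> j" if "b \<in> ?B" for b x
  proof (cases "x \<in> keys b")
    case True
    then have "lookup b x \<le> mon_degree b" unfolding mon_degree_def
      by (intro member_le_sum) auto
    then show ?thesis using that by simp
  qed (simp add: in_keys_iff)
  then have "lookup ` ?B \<subseteq> {f. \<forall>x. (x \<in> V \<longrightarrow> f x \<in> {..j}) \<and> (x \<notin> V \<longrightarrow> f x = 0)}"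
    by (auto simp: in_keys_iff subset_iff)
  then have "finite (lookup ` ?B)"
    using finite_set_of_finite_funs[OF assms, of "{..j}" 0] finite_subset by blast
  moreover have "inj_on lookup ?B" by (auto intro!: inj_onI poly_mapping_eqI simp: fun_eq_iff)
  ultimately show ?thesis by (rule finite_imageD)
qed

text \<open>The component of degree \<open>n\<close> in the free module with generator in degree
  \<open>s\<close>; the condition is a sum so that no truncated \<open>n - s\<close> occurs.\<close>

definition hom_part :: "nat \<Rightarrow> nat \<Rightarrow> ('x, 'k::comm_ring_1) mpoly \<Rightarrow> ('x, 'k) mpoly" where
  "hom_part n s f = Abs_poly_mapping (\<lambda>m. if mon_degree m + s = n then lookup f m else 0)"

lemma lookup_hom_part: "lookup (hom_part n s f) m = (if mon_degree m + s = n then lookup f m else 0)"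
proof -
  have "{m. (if mon_degree m + s = n then lookup f m else 0) \<noteq> 0} \<subseteq> keys f" by (auto simp: in_keys_iff)
  then show ?thesis unfolding hom_part_def
    by (subst lookup_Abs_poly_mapping) (auto intro: finite_subset)
qed

lemma in_keys_hom_part: "m \<in> keys (hom_part n s f) \<longleftrightarrow> mon_degree m + s = n \<and> m \<in> keys f"
  by (simp add: in_keys_iff lookup_hom_part)

lemma hom_part_add: "hom_part n s (f + g) = hom_part n s f + hom_part n s g"
  by (rule poly_mapping_eqI) (simp add: lookup_hom_part lookup_add)

lemma hom_part_zero [simp]: "hom_part n s 0 = 0"
  by (rule poly_mapping_eqI) (simp add: lookup_hom_part)

lemma hom_part_sum: "hom_part n s (sum f A) = (\<Sum>a\<in>A. hom_part n s (f a))"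
  by (induction A rule: infinite_finite_induct) (auto simp: hom_part_add)

lemma hom_part_id: "(\<And>m. m \<in> keys f \<Longrightarrow> mon_degree m + s = n) \<Longrightarrow> hom_part n s f = f"
  by (rule poly_mapping_eqI) (auto simp: lookup_hom_part in_keys_iff)

text \<open>The entry \<open>A\<close> has degree \<open>t - s\<close>, so it carries degree
  \<open>n\<close> over a generator of degree \<open>t\<close> to degree \<open>n\<close> over one
  of degree \<open>s\<close>; the other terms of \<open>f\<close> land in other degrees.\<close>

lemma hom_part_mult:
  assumes "\<And>m. m \<in> keys A \<Longrightarrow> mon_degree m + s = t"
  shows "hom_part n s (A * f) = A * hom_part n t f"
proof -
  define g where "g = f - hom_part n t f"
  have g: "mon_degree m + t \<noteq> n" if "m \<in> keys g" for m
    using that by (auto simp: g_def in_keys_iff lookup_minus lookup_hom_part)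
  have "f = hom_part n t f + g" by (simp add: g_def)
  then have "hom_part n s (A * f) = hom_part n s (A * hom_part n t f) + hom_part n s (A * g)"
    by (metis distrib_left hom_part_add)
  also have "hom_part n s (A * hom_part n t f) = A * hom_part n t f"
  proof (rule hom_part_id)
    fix m assume "m \<in> keys (A * hom_part n t f)"
    from in_keys_mult[OF this] obtain a b where ab: "a \<in> keys A" "b \<in> keys (hom_part n t f)" "m = a + b"
      by blast
    then show "mon_degree m + s = n"
      using assms[OF ab(1)] by (simp add: in_keys_hom_part mon_degree_add)
  qed
  also have "hom_part n s (A * g) = 0"
  proof (rule poly_mapping_eqI)
    fix m
    have "m \<notin> keys (A * g)" if "mon_degree m + s = n"
    proof
      assume "m \<in> keys (A * g)"
      from in_keys_mult[OF this] obtain a b where ab: "a \<in> keys A" "b \<in> keys g" "m = a + b" by blast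
      then show False using assms[OF ab(1)] g[OF ab(2)] that by (simp add: mon_degree_add)
    qed
    then show "lookup (hom_part n s (A * g)) m = lookup 0 m" by (simp add: lookup_hom_part in_keys_iff)
  qed
  finally show ?thesis by simp
qed

lemma mat_apply_add: "mat_apply n m A (v + w) = mat_apply n m A v + mat_apply n m A w"
  by (auto simp: mat_apply_def fun_eq_iff distrib_left sum.distrib)

lemma mat_apply_scale: "mat_apply n m A (\<lambda>a. c * v a) = (\<lambda>a. c * mat_apply n m A v a)"
  by (auto simp: mat_apply_def fun_eq_iff sum_distrib_left mult.left_commute)

lemma subspace_set_chains: "fs.subspace (set_chains S p :: ('n set \<Rightarrow> 'c::field) set)"
proof (rule fs.subspaceI)
  fix x y :: "'n set \<Rightarrow> 'c" assume xy: "x \<in> set_chains S p" "y \<in> set_chains S p"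
  show "x + y \<in> set_chains S p" unfolding set_chains_def
  proof (intro CollectI allI impI)
    fix \<sigma> assume "(x + y) \<sigma> \<noteq> 0"
    then have "x \<sigma> \<noteq> 0 \<or> y \<sigma> \<noteq> 0" by auto
    then show "\<sigma> \<in> S \<and> card \<sigma> = p" using xy unfolding set_chains_def by blast
  qed
qed (auto simp: set_chains_def)

lemma fun_product_outside: "g \<in> fun_product A Z \<Longrightarrow> b \<notin> A \<Longrightarrow> \<forall>s. g (b, s) = 0"
  unfolding fun_product_def mem_Collect_eq by (drule spec[of _ b]) simp

lemma subspace_cycles: "fs.subspace {g \<in> set_chains S p. bdry N e S g = (\<lambda>_. 0 :: 'c::field)}"
proof (rule fs.subspaceI)
  show "0 \<in> {g \<in> set_chains S p. bdry N e S g = (\<lambda>_. 0 :: 'c)}"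
    using fs.subspace_0[OF subspace_set_chains] bdry_zero[of N e S] by (auto simp: zero_fun_def)
qed (use fs.subspace_add[OF subspace_set_chains] fs.subspace_scale[OF subspace_set_chains]
    in \<open>auto simp: bdry_add bdry_scale fun_eq_iff\<close>)

lemma subspace_boundaries: "fs.subspace (bdry N e S ` (set_chains S p :: ('n set \<Rightarrow> 'c::field) set))"
proof (rule fs.subspaceI)
  show "0 \<in> bdry N e S ` (set_chains S p :: ('n set \<Rightarrow> 'c) set)"
    using fs.subspace_0[OF subspace_set_chains, of S p] bdry_zero[of N e S]
    by (auto simp: zero_fun_def image_iff intro!: bexI[of _ "\<lambda>_. 0"])
  fix x :: "'n set \<Rightarrow> 'c" assume "x \<in> bdry N e S ` set_chains S p"
  then obtain a where a: "a \<in> set_chains S p" "x = bdry N e S a" by blast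
  show "fscale c x \<in> bdry N e S ` set_chains S p" for c
    using fs.subspace_scale[OF subspace_set_chains a(1), of c] unfolding a(2) bdry_scale[symmetric] by (rule imageI)
  fix y :: "'n set \<Rightarrow> 'c" assume "y \<in> bdry N e S ` set_chains S p"
  then obtain b where b: "b \<in> set_chains S p" "y = bdry N e S b" by blast
  show "x + y \<in> bdry N e S ` set_chains S p"
    using fs.subspace_add[OF subspace_set_chains a(1) b(1)] unfolding a(2) b(2) bdry_add[symmetric] by (rule imageI)
qed

lemma boundaries_subset_cycles:
  assumes "finite N" "inj_on e N" "S \<subseteq> Pow N"
    and "\<And>\<sigma> x y. \<sigma> \<in> S \<Longrightarrow> insert y (insert x \<sigma>) \<in> S \<Longrightarrow> insert x \<sigma> \<in> S"
  shows "bdry N e S ` (set_chains S (Suc p) :: ('n set \<Rightarrow> 'c::field) set) \<subseteq>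
    {g \<in> set_chains S p. bdry N e S g = (\<lambda>_. 0)}"
proof (rule image_subsetI, intro CollectI conjI)
  interpret vertex_order N e using assms by unfold_locales
  fix g :: "'n set \<Rightarrow> 'c" assume g: "g \<in> set_chains S (Suc p)"
  show "bdry N e S (bdry N e S g) = (\<lambda>_. 0)"
    using g by (intro bdry_bdry[OF assms(3,4)]) (auto simp: set_chains_def)
  show "bdry N e S g \<in> set_chains S p"
    unfolding set_chains_def
  proof (intro CollectI allI impI)
    fix \<sigma> assume nz: "bdry N e S g \<sigma> \<noteq> 0"
    then have \<sigma>: "\<sigma> \<in> S" by (auto simp: bdry_def split: if_splits)
    then have "(\<Sum>x\<in>N - \<sigma>. pos_sign e x \<sigma> * g (insert x \<sigma>)) \<noteq> 0" using nz by (simp add: bdry_def)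
    then obtain x where x: "x \<in> N - \<sigma>" "pos_sign e x \<sigma> * g (insert x \<sigma>) \<noteq> 0"
      by (rule sum.not_neutral_contains_not_neutral)
    then have "card (insert x \<sigma>) = Suc p" using g by (auto simp: set_chains_def)
    moreover have "finite \<sigma>" using \<sigma> assms(3) finite_subset_N by blast
    ultimately show "\<sigma> \<in> S \<and> card \<sigma> = p" using x \<sigma> by simp
  qed
qed

lemma fin_dim_set_chains: "finite S \<Longrightarrow> fin_dim (set_chains S p :: ('n set \<Rightarrow> 'c::field) set)"
  by (rule fin_dim_support[of S]) (auto simp: set_chains_def)

lemma fin_dim_mono: "fin_dim W \<Longrightarrow> Z \<subseteq> W \<Longrightarrow> fin_dim Z"
  unfolding fin_dim_def by (meson subset_trans)

section \<open>Comparison of a resolution with the Koszul complex\<close>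

locale sr_resolution = vertex_order V e for V :: "'x set" and e +
  fixes \<Delta> :: "'x set set" and F :: "('x, 'k::field) free_complex"
  assumes \<Delta>: "simplicial_complex V \<Delta>"
    and F: "graded_free_resolution V (sr_ideal V \<Delta>) F"
begin

sublocale K: labelled_simplex V e sqf
proof unfold_locales
  fix \<sigma> x assume "\<sigma> \<subseteq> V" "x \<in> V"
  then have "finite \<sigma>" using finite_subset_N by blast
  then show "mon_le (sqf \<sigma>) (sqf (insert x \<sigma>))" by (simp add: mon_le_def lookup_sqf)
qed

lemma
  aug_carrier: "a < rk F 0 \<Longrightarrow> aug F a \<in> carrier (poly_ring V)"
  and aug_degree: "a < rk F 0 \<Longrightarrow> m \<in> keys (aug F a) \<Longrightarrow> mon_degree m = shift F 0 a"
  and bnd_carrier: "a < rk F i \<Longrightarrow> b < rk F (Suc i) \<Longrightarrow> bnd F i a b \<in> carrier (poly_ring V)"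
  and bnd_degree: "a < rk F i \<Longrightarrow> b < rk F (Suc i) \<Longrightarrow> m \<in> keys (bnd F i a b) \<Longrightarrow>
      mon_degree m + shift F i a = shift F (Suc i) b"
  and aug_surj: "f \<in> carrier (poly_ring V) \<Longrightarrow>
      \<exists>v\<in>free_mod V (rk F 0). f - (\<Sum>a<rk F 0. v a * aug F a) \<in> sr_ideal V \<Delta>"
  and aug_exact: "{v \<in> free_mod V (rk F 0). (\<Sum>a<rk F 0. v a * aug F a) \<in> sr_ideal V \<Delta>} =
       mat_apply (rk F 0) (rk F 1) (bnd F 0) ` free_mod V (rk F 1)"
  and bnd_exact: "{v \<in> free_mod V (rk F (Suc i)).
            mat_apply (rk F i) (rk F (Suc i)) (bnd F i) v = (\<lambda>_. 0)} =
          mat_apply (rk F (Suc i)) (rk F (Suc (Suc i))) (bnd F (Suc i))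
            ` free_mod V (rk F (Suc (Suc i)))"
proof -
  note F' = F[unfolded graded_free_resolution_def]
  note 1 = F'[THEN conjunct1] and 2 = F'[THEN conjunct2, THEN conjunct1]
    and 3 = F'[THEN conjunct2, THEN conjunct2, THEN conjunct1]
    and 4 = F'[THEN conjunct2, THEN conjunct2, THEN conjunct2, THEN conjunct1]
    and 5 = F'[THEN conjunct2, THEN conjunct2, THEN conjunct2, THEN conjunct2]
  show "a < rk F 0 \<Longrightarrow> aug F a \<in> carrier (poly_ring V)"
    "a < rk F 0 \<Longrightarrow> m \<in> keys (aug F a) \<Longrightarrow> mon_degree m = shift F 0 a"
    using 1 by blast+
  show "a < rk F i \<Longrightarrow> b < rk F (Suc i) \<Longrightarrow> bnd F i a b \<in> carrier (poly_ring V)"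
    "a < rk F i \<Longrightarrow> b < rk F (Suc i) \<Longrightarrow> m \<in> keys (bnd F i a b) \<Longrightarrow>
      mon_degree m + shift F i a = shift F (Suc i) b"
    using 2 by blast+
  show "f \<in> carrier (poly_ring V) \<Longrightarrow>
      \<exists>v\<in>free_mod V (rk F 0). f - (\<Sum>a<rk F 0. v a * aug F a) \<in> sr_ideal V \<Delta>"
    using 3 by (rule bspec)
  show "{v \<in> free_mod V (rk F 0). (\<Sum>a<rk F 0. v a * aug F a) \<in> sr_ideal V \<Delta>} =
       mat_apply (rk F 0) (rk F 1) (bnd F 0) ` free_mod V (rk F 1)" by (rule 4)
  show "{v \<in> free_mod V (rk F (Suc i)).
            mat_apply (rk F i) (rk F (Suc i)) (bnd F i) v = (\<lambda>_. 0)} =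
          mat_apply (rk F (Suc i)) (rk F (Suc (Suc i))) (bnd F (Suc i))
            ` free_mod V (rk F (Suc (Suc i)))" using 5 by (rule spec)
qed

text \<open>The degree \<open>j\<close> part of the Koszul complex tensored with \<open>F\<close>:
  \<open>c \<sigma> a\<close> is the coefficient at the Koszul basis element
  \<open>\<sigma>\<close>, of degree \<open>p\<close>, and the basis element \<open>a\<close> of
  \<open>F_q\<close>, of degree \<open>shift F q a\<close>.\<close>

definition dbl :: "nat \<Rightarrow> nat \<Rightarrow> nat \<Rightarrow> ('x set \<Rightarrow> nat \<Rightarrow> ('x, 'k) mpoly) set" where
  "dbl j p q = {c. \<forall>\<sigma> a. c \<sigma> a \<noteq> 0 \<longrightarrow> \<sigma> \<subseteq> V \<and> card \<sigma> = p \<and> a < rk F q \<and>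
     (\<forall>m \<in> keys (c \<sigma> a). keys m \<subseteq> V \<and> mon_degree m + (p + shift F q a) = j)}"

definition dh :: "('x set \<Rightarrow> nat \<Rightarrow> ('x, 'k) mpoly) \<Rightarrow> 'x set \<Rightarrow> nat \<Rightarrow> ('x, 'k) mpoly" where
  "dh c = (\<lambda>\<sigma> a. K.label_bdry (\<lambda>\<tau>. c \<tau> a) \<sigma>)"

definition dv :: "nat \<Rightarrow> ('x set \<Rightarrow> nat \<Rightarrow> ('x, 'k) mpoly) \<Rightarrow> 'x set \<Rightarrow> nat \<Rightarrow> ('x, 'k) mpoly" where
  "dv q c = (\<lambda>\<sigma>. mat_apply (rk F q) (rk F (Suc q)) (bnd F q) (c \<sigma>))"

text \<open>The augmentation of a Koszul row onto \<open>F_q\<close> tensored with the residue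
  field.\<close>

definition cterm :: "('x set \<Rightarrow> nat \<Rightarrow> ('x, 'k) mpoly) \<Rightarrow> nat \<Rightarrow> 'k" where
  "cterm c = (\<lambda>a. lookup (c {} a) 0)"

text \<open>The Koszul basis elements that survive in multidegree \<open>b\<close> over the
  Stanley--Reisner ring: the cofactor of \<open>sqf \<sigma>\<close> in \<open>b\<close> must be a
  standard monomial, one whose support is a face.\<close>

definition sys :: "'x mon \<Rightarrow> 'x set set" where
  "sys b = {\<sigma>. \<sigma> \<subseteq> V \<and> \<sigma> \<subseteq> keys b \<and> keys (b - sqf \<sigma>) \<in> \<Delta>}"

definition augm :: "('x set \<Rightarrow> nat \<Rightarrow> ('x, 'k) mpoly) \<Rightarrow> 'x set \<Rightarrow> ('x, 'k) mpoly" where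
  "augm c \<sigma> = (\<Sum>a<rk F 0. c \<sigma> a * aug F a)"

text \<open>The augmentation of a column onto the Koszul complex of the quotient ring, recorded by
  coefficients at standard monomials; the pair consists of the multidegree and the Koszul basis
  element.\<close>

definition aug_coord :: "('x set \<Rightarrow> nat \<Rightarrow> ('x, 'k) mpoly) \<Rightarrow> 'x mon \<times> 'x set \<Rightarrow> 'k" where
  "aug_coord c = (\<lambda>(b, \<sigma>). if \<sigma> \<in> sys b then lookup (augm c \<sigma>) (b - sqf \<sigma>) else 0)"

definition mons :: "nat \<Rightarrow> 'x mon set" where
  "mons j = {b. keys b \<subseteq> V \<and> mon_degree b = j}"

definition kos :: "nat \<Rightarrow> nat \<Rightarrow> ('x mon \<times> 'x set \<Rightarrow> 'k) set" where
  "kos j p = fun_product (mons j) (\<lambda>b. set_chains (sys b) p)"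

definition dG :: "('x mon \<times> 'x set \<Rightarrow> 'k) \<Rightarrow> 'x mon \<times> 'x set \<Rightarrow> 'k" where
  "dG g = (\<lambda>(b, \<sigma>). bdry V e (sys b) (\<lambda>\<sigma>. g (b, \<sigma>)) \<sigma>)"

lemma dblD:
  assumes "c \<in> dbl j p q"
  shows "c \<sigma> a \<noteq> 0 \<Longrightarrow> \<sigma> \<subseteq> V \<and> card \<sigma> = p \<and> a < rk F q"
    and "m \<in> keys (c \<sigma> a) \<Longrightarrow> keys m \<subseteq> V \<and> mon_degree m + (p + shift F q a) = j"
proof -
  show *: "c \<sigma> a \<noteq> 0 \<Longrightarrow> \<sigma> \<subseteq> V \<and> card \<sigma> = p \<and> a < rk F q"
    using assms unfolding dbl_def by blast
  have "m \<in> keys (c \<sigma> a) \<Longrightarrow> c \<sigma> a \<noteq> 0" by auto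
  then show "m \<in> keys (c \<sigma> a) \<Longrightarrow> keys m \<subseteq> V \<and> mon_degree m + (p + shift F q a) = j"
    using assms unfolding dbl_def by blast
qed

lemma dblI:
  assumes "\<And>\<sigma> a m. m \<in> keys (c \<sigma> a) \<Longrightarrow> \<sigma> \<subseteq> V \<and> card \<sigma> = p \<and> a < rk F q \<and>
    keys m \<subseteq> V \<and> mon_degree m + (p + shift F q a) = j"
  shows "c \<in> dbl j p q"
  unfolding dbl_def
proof (intro CollectI allI impI)
  fix \<sigma> a assume "c \<sigma> a \<noteq> 0"
  then have "keys (c \<sigma> a) \<noteq> {}" by simp
  then obtain m where "m \<in> keys (c \<sigma> a)" by blast
  from assms[OF this] show "\<sigma> \<subseteq> V \<and> card \<sigma> = p \<and> a < rk F q \<and>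
     (\<forall>m \<in> keys (c \<sigma> a). keys m \<subseteq> V \<and> mon_degree m + (p + shift F q a) = j)"
    using assms by blast
qed

lemma dbl_keysD:
  assumes "c \<in> dbl j p q" "m \<in> keys (c \<sigma> a)"
  shows "\<sigma> \<subseteq> V \<and> card \<sigma> = p \<and> a < rk F q \<and> keys m \<subseteq> V \<and> mon_degree m + (p + shift F q a) = j"
  using dblD(1)[OF assms(1), of \<sigma> a] dblD(2)[OF assms] assms(2) by fastforce

lemma dbl_free_mod: "c \<in> dbl j p q \<Longrightarrow> c \<sigma> \<in> free_mod V (rk F q)"
  unfolding free_mod_def carrier_poly_ring by (blast dest: dbl_keysD dblD(1) leD)

lemma dbl_add: "c \<in> dbl j p q \<Longrightarrow> d \<in> dbl j p q \<Longrightarrow> c + d \<in> dbl j p q"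
  by (rule dblI, unfold plus_fun_apply, drule in_keys_addD) (blast dest: dbl_keysD)

lemma dbl_uminus: "c \<in> dbl j p q \<Longrightarrow> - c \<in> dbl j p q"
  by (rule dblI, unfold fun_Compl_def keys_uminus) (rule dbl_keysD)

lemma dbl_diff: "c \<in> dbl j p q \<Longrightarrow> d \<in> dbl j p q \<Longrightarrow> c - d \<in> dbl j p q"
  using dbl_add[OF _ dbl_uminus, of c j p q d] by simp

lemma label_bdry_add: "K.label_bdry (\<lambda>\<tau>. c \<tau> + d \<tau>) \<sigma> = K.label_bdry c \<sigma> + K.label_bdry d \<sigma>"
  by (simp add: K.label_bdry_def distrib_left sum.distrib)

text \<open>The Koszul differential is linear over the polynomial ring, hence commutes with the
  matrices of \<open>F\<close>.\<close>

lemma label_bdry_sum: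
  fixes r :: "'b \<Rightarrow> ('x, 'k) mpoly"
  shows "K.label_bdry (\<lambda>\<tau>. \<Sum>b\<in>B. r b * c b \<tau>) \<sigma> = (\<Sum>b\<in>B. r b * K.label_bdry (c b) \<sigma>)"
proof -
  have "s * (t * (\<Sum>b\<in>B. r b * f b)) = (\<Sum>b\<in>B. r b * (s * (t * f b)))" for s t and f :: "'b \<Rightarrow> ('x, 'k) mpoly"
    unfolding sum_distrib_left by (intro sum.cong refl) (simp add: mult_ac)
  then have "K.label_bdry (\<lambda>\<tau>. \<Sum>b\<in>B. r b * c b \<tau>) \<sigma> = (\<Sum>x\<in>V - \<sigma>. \<Sum>b\<in>B. r b *
     (const (pos_sign e x \<sigma>) * (monomial_poly (sqf (insert x \<sigma>) - sqf \<sigma>) * c b (insert x \<sigma>))))"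
    unfolding K.label_bdry_def by (intro sum.cong refl)
  also have "\<dots> = (\<Sum>b\<in>B. r b * K.label_bdry (c b) \<sigma>)"
    by (subst sum.swap) (simp only: K.label_bdry_def sum_distrib_left)
  finally show ?thesis .
qed

lemma sqf_insert_diff:
  "finite \<sigma> \<Longrightarrow> x \<notin> \<sigma> \<Longrightarrow> sqf (insert x \<sigma>) - sqf \<sigma> = Poly_Mapping.single x 1"
  by (intro poly_mapping_eqI) (auto simp: lookup_minus lookup_sqf lookup_single when_def)

lemma mon_degree_single [simp]: "mon_degree (Poly_Mapping.single x n) = n"
  by (simp add: mon_degree_def)

lemma in_keys_label_bdry:
  assumes "\<sigma> \<subseteq> V" "m \<in> keys (K.label_bdry c \<sigma>)"
  obtains x l where "x \<in> V - \<sigma>" "m = Poly_Mapping.single x 1 + l" "l \<in> keys (c (insert x \<sigma>))"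
proof -
  have fin: "finite \<sigma>" using assms(1) finite_subset_N by blast
  from in_keys_sumD[OF assms(2)[unfolded K.label_bdry_def]] obtain x where x: "x \<in> V - \<sigma>"
    and m: "m \<in> keys (const (pos_sign e x \<sigma>) * (monomial_poly (sqf (insert x \<sigma>) - sqf \<sigma>) * c (insert x \<sigma>)))"
    by (rule bexE)
  have eq: "sqf (insert x \<sigma>) - sqf \<sigma> = Poly_Mapping.single x 1" using sqf_insert_diff[OF fin] x by simp
  from m have "m \<in> keys (monomial_poly (Poly_Mapping.single x 1) * c (insert x \<sigma>))"
    unfolding eq in_keys_iff lookup_const_mult by (metis mult_zero_right)
  from in_keys_mult[OF this] show ?thesis using x that
    by (auto simp: monomial_poly_def split: if_splits)
qed

lemma dh_mem:
  assumes "c \<in> dbl j (Suc p) q"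
  shows "dh c \<in> dbl j p q"
proof (rule dblI)
  fix \<sigma> a m assume m: "m \<in> keys (dh c \<sigma> a)"
  have "\<sigma> \<subseteq> V"
  proof (rule ccontr)
    assume "\<not> \<sigma> \<subseteq> V"
    then have "dh c \<sigma> a = 0" unfolding dh_def using dblD(1)[OF assms]
      by (intro K.label_bdry_outside) auto
    then show False using m by simp
  qed
  moreover obtain x l where x: "x \<in> V - \<sigma>" "m = Poly_Mapping.single x 1 + l" "l \<in> keys (c (insert x \<sigma>) a)"
    using in_keys_label_bdry[OF \<open>\<sigma> \<subseteq> V\<close>, of m "\<lambda>\<tau>. c \<tau> a"] m unfolding dh_def by auto
  ultimately show "\<sigma> \<subseteq> V \<and> card \<sigma> = p \<and> a < rk F q \<and> keys m \<subseteq> V \<and> mon_degree m + (p + shift F q a) = j"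
    using dbl_keysD[OF assms x(3)] finite_subset_N[of \<sigma>] by (auto simp: keys_mon_add mon_degree_add)
qed

lemma dv_mem:
  assumes "c \<in> dbl j p (Suc q)"
  shows "dv q c \<in> dbl j p q"
proof (rule dblI)
  fix \<sigma> a m assume m: "m \<in> keys (dv q c \<sigma> a)"
  then have a: "a < rk F q" by (auto simp: dv_def mat_apply_def split: if_splits)
  then have "m \<in> keys (\<Sum>b<rk F (Suc q). bnd F q a b * c \<sigma> b)" using m by (simp add: dv_def mat_apply_def)
  from in_keys_sumD[OF this] obtain b where b: "b < rk F (Suc q)" "m \<in> keys (bnd F q a b * c \<sigma> b)" by auto
  from in_keys_mult[OF b(2)] obtain k l where kl: "k \<in> keys (bnd F q a b)" "l \<in> keys (c \<sigma> b)" "m = k + l"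
    by blast
  show "\<sigma> \<subseteq> V \<and> card \<sigma> = p \<and> a < rk F q \<and> keys m \<subseteq> V \<and> mon_degree m + (p + shift F q a) = j"
    using dbl_keysD[OF assms kl(2)] a bnd_carrier[OF a b(1)] bnd_degree[OF a b(1) kl(1)] kl
    by (auto simp: keys_mon_add mon_degree_add carrier_poly_ring)
qed

lemma dh_dv:
  "dh (dv q c) = dv q (dh c)"
proof (intro ext)
  fix \<sigma> a
  show "dh (dv q c) \<sigma> a = dv q (dh c) \<sigma> a"
  proof (cases "a < rk F q")
    case True
    then show ?thesis
      using label_bdry_sum[of "bnd F q a" "\<lambda>b \<tau>. c \<tau> b" "{..<rk F (Suc q)}" \<sigma>]
      by (simp add: dh_def dv_def mat_apply_def)
  next
    case False
    then show ?thesis by (simp add: dh_def dv_def mat_apply_def K.label_bdry_def)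
  qed
qed

lemma augm_dh: "augm (dh c) \<sigma> = K.label_bdry (augm c) \<sigma>"
  using label_bdry_sum[of "aug F" "\<lambda>b \<tau>. c \<tau> b" "{..<rk F 0}" \<sigma>]
  by (simp add: augm_def[abs_def] dh_def mult.commute)

text \<open>In a multidegree \<open>b\<close> other than 0 the Koszul strand is a cone with any
  variable of \<open>b\<close> as apex; in multidegree 0 only the constant term at the empty set is
  left, and it vanishes by assumption.\<close>

lemma rows_exact:
  assumes c: "c \<in> dbl j p q" and cyc: "dh c = 0" and c0: "cterm c = 0"
  shows "\<exists>d\<in>dbl j (Suc p) q. dh d = c"
proof -
  have "\<exists>d. K.label_bdry d = (\<lambda>\<tau>. c \<tau> a) \<and> (\<forall>\<sigma>. \<not> \<sigma> \<subseteq> V \<longrightarrow> d \<sigma> = 0) \<and>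
    (\<forall>\<sigma> m. lookup (d \<sigma>) m \<noteq> 0 \<longrightarrow>
      (\<exists>x\<in>\<sigma>. lookup (c (\<sigma> - {x}) a) (m + (sqf \<sigma> - sqf (\<sigma> - {x}))) \<noteq> 0))" for a
  proof (rule K.label_bdry_exact)
    show "c \<sigma> a = 0" if "\<not> \<sigma> \<subseteq> V" for \<sigma> using that dblD(1)[OF c] by blast
    show "K.label_bdry (\<lambda>\<tau>. c \<tau> a) = (\<lambda>_. 0)"
      using cyc unfolding dh_def by (simp add: fun_eq_iff)
    fix b \<sigma> assume co: "K.coord (\<lambda>\<tau>. c \<tau> a) b \<sigma> \<noteq> 0"
    then have nz: "lookup (c \<sigma> a) (b - sqf \<sigma>) \<noteq> 0" "mon_le (sqf \<sigma>) b"
      by (auto simp: K.coord_def split: if_splits)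
    then have "b - sqf \<sigma> \<in> keys (c \<sigma> a)" by (simp add: in_keys_iff)
    note k = dbl_keysD[OF c this]
    then have fin: "finite \<sigma>" using finite_subset_N by blast
    have "b = b - sqf \<sigma> + sqf \<sigma>" using mon_le_diff_add[OF nz(2)] by simp
    then have bV: "keys b \<subseteq> V" using k by (metis Un_subset_iff fin keys_mon_add keys_sqf)
    have "b \<noteq> 0"
    proof
      assume "b = 0"
      then have "\<sigma> = {}" using nz(2) fin by (simp add: mon_le_sqf)
      then show False using nz(1) fun_cong[OF c0, of a] \<open>b = 0\<close> by (simp add: cterm_def)
    qed
    then obtain x where x: "x \<in> keys b" by fastforce
    have "mon_le (sqf (insert x \<tau>)) b" if "\<tau> \<subseteq> V" "mon_le (sqf \<tau>) b" for \<tau>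
      using that x finite_subset_N[OF that(1)] by (simp add: mon_le_sqf)
    then show "\<exists>x\<in>V. \<forall>\<sigma>. \<sigma> \<subseteq> V \<and> mon_le (sqf \<sigma>) b \<longrightarrow> mon_le (sqf (insert x \<sigma>)) b"
      using x bV by blast
  qed
  then have "\<forall>a. \<exists>d. K.label_bdry d = (\<lambda>\<tau>. c \<tau> a) \<and> (\<forall>\<sigma>. \<not> \<sigma> \<subseteq> V \<longrightarrow> d \<sigma> = 0) \<and>
    (\<forall>\<sigma> m. lookup (d \<sigma>) m \<noteq> 0 \<longrightarrow>
      (\<exists>x\<in>\<sigma>. lookup (c (\<sigma> - {x}) a) (m + (sqf \<sigma> - sqf (\<sigma> - {x}))) \<noteq> 0))" by (rule allI)
  from choice[OF this] obtain d where "\<forall>a. K.label_bdry (d a) = (\<lambda>\<tau>. c \<tau> a) \<and> (\<forall>\<sigma>. \<not> \<sigma> \<subseteq> V \<longrightarrow> d a \<sigma> = 0) \<and>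
    (\<forall>\<sigma> m. lookup (d a \<sigma>) m \<noteq> 0 \<longrightarrow>
      (\<exists>x\<in>\<sigma>. lookup (c (\<sigma> - {x}) a) (m + (sqf \<sigma> - sqf (\<sigma> - {x}))) \<noteq> 0))" by (rule exE)
  then have d: "\<And>a. K.label_bdry (d a) = (\<lambda>\<tau>. c \<tau> a)" "\<And>a \<sigma>. \<not> \<sigma> \<subseteq> V \<Longrightarrow> d a \<sigma> = 0"
    "\<And>a \<sigma> m. lookup (d a \<sigma>) m \<noteq> 0 \<Longrightarrow>
      \<exists>x\<in>\<sigma>. lookup (c (\<sigma> - {x}) a) (m + (sqf \<sigma> - sqf (\<sigma> - {x}))) \<noteq> 0" by simp_all
  have "(\<lambda>\<sigma> a. d a \<sigma>) \<in> dbl j (Suc p) q"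
  proof (rule dblI)
    fix \<sigma> a m assume m: "m \<in> keys (d a \<sigma>)"
    then have \<sigma>: "\<sigma> \<subseteq> V" using d(2) by fastforce
    obtain x where x: "x \<in> \<sigma>" "m + (sqf \<sigma> - sqf (\<sigma> - {x})) \<in> keys (c (\<sigma> - {x}) a)"
      using d(3)[of a \<sigma> m] m by (auto simp: in_keys_iff)
    have fin: "finite \<sigma>" using finite_subset_N[OF \<sigma>] .
    have "insert x (\<sigma> - {x}) = \<sigma>" using x by auto
    then have "sqf \<sigma> - sqf (\<sigma> - {x}) = Poly_Mapping.single x 1"
      using sqf_insert_diff[of "\<sigma> - {x}" x] fin by simp
    then show "\<sigma> \<subseteq> V \<and> card \<sigma> = Suc p \<and> a < rk F q \<and> keys m \<subseteq> V \<and> mon_degree m + (Suc p + shift F q a) = j"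
      using dbl_keysD[OF c x(2)] x(1) fin \<sigma> card_Suc_Diff1[OF fin x(1)]
      by (auto simp: keys_mon_add mon_degree_add)
  qed
  moreover have "dh (\<lambda>\<sigma> a. d a \<sigma>) = c" using d(1) by (simp add: dh_def fun_eq_iff)
  ultimately show ?thesis by blast
qed

lemma cterm_dv: "cterm (dv q c) = residue_bnd F q (cterm c)"
  by (auto simp: cterm_def dv_def residue_bnd_def mat_apply_def lookup_sum lookup_mult_zero fun_eq_iff)

text \<open>
  Replacing a preimage by its homogeneous components of the right degree.
\<close>

lemma dv_homogeneous_lift:
  assumes u: "\<And>\<sigma>. \<sigma> \<subseteq> V \<Longrightarrow> card \<sigma> = p \<Longrightarrow> u \<sigma> \<in> free_mod V (rk F (Suc q))"
      "\<And>\<sigma>. \<sigma> \<subseteq> V \<Longrightarrow> card \<sigma> = p \<Longrightarrow> c \<sigma> = mat_apply (rk F q) (rk F (Suc q)) (bnd F q) (u \<sigma>)"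
    and c: "c \<in> dbl j p q"
  shows "\<exists>d\<in>dbl j p (Suc q). dv q d = c"
proof -
  define d where "d \<sigma> b = (if \<sigma> \<subseteq> V \<and> card \<sigma> = p then hom_part j (p + shift F (Suc q) b) (u \<sigma> b) else 0)" for \<sigma> b
  have "d \<in> dbl j p (Suc q)"
  proof (rule dblI)
    fix \<sigma> a m assume m: "m \<in> keys (d \<sigma> a)"
    then have \<sigma>: "\<sigma> \<subseteq> V" "card \<sigma> = p" by (auto simp: d_def split: if_splits)
    then have m': "mon_degree m + (p + shift F (Suc q) a) = j" "m \<in> keys (u \<sigma> a)"
      using m by (auto simp: d_def in_keys_hom_part)
    then have "u \<sigma> a \<noteq> 0" by auto
    then show "\<sigma> \<subseteq> V \<and> card \<sigma> = p \<and> a < rk F (Suc q) \<and> keys m \<subseteq> V \<and> mon_degree m + (p + shift F (Suc q) a) = j"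
      using \<sigma> m' u(1)[OF \<sigma>] by (auto simp: free_mod_def carrier_poly_ring not_le[symmetric])
  qed
  moreover have "dv q d \<sigma> a = c \<sigma> a" for \<sigma> a
  proof (cases "\<sigma> \<subseteq> V \<and> card \<sigma> = p \<and> a < rk F q")
    case True
    have "c \<sigma> a = hom_part j (p + shift F q a) (c \<sigma> a)"
      using dbl_keysD[OF c] by (intro hom_part_id[symmetric]) blast
    also have "\<dots> = (\<Sum>b<rk F (Suc q). hom_part j (p + shift F q a) (bnd F q a b * u \<sigma> b))"
      using u(2)[of \<sigma>] True by (simp add: mat_apply_def hom_part_sum)
    also have "\<dots> = (\<Sum>b<rk F (Suc q). bnd F q a b * hom_part j (p + shift F (Suc q) b) (u \<sigma> b))"
    proof (intro sum.cong refl hom_part_mult)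
      fix b m assume "b \<in> {..<rk F (Suc q)}" "m \<in> keys (bnd F q a b)"
      then show "mon_degree m + (p + shift F q a) = p + shift F (Suc q) b"
        using bnd_degree[of a q b m] True by simp
    qed
    also have "\<dots> = dv q d \<sigma> a" using True by (simp add: dv_def mat_apply_def d_def)
    finally show ?thesis by simp
  next
    case False
    then have "c \<sigma> a = 0" using dblD(1)[OF c] by blast
    moreover have "dv q d \<sigma> a = 0"
    proof -
      have "d \<sigma> b = 0" if "a < rk F q" for b using False that unfolding d_def by (subst if_not_P) auto
      then show ?thesis by (simp add: dv_def mat_apply_def)
    qed
    ultimately show ?thesis by simp
  qed
  ultimately show ?thesis by (intro bexI[of _ d]) (auto simp: fun_eq_iff)
qed

text \<open>The Koszul modules are free, so exactness of \<open>F\<close> applies separately at each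
  \<open>\<sigma>\<close>; the preimages are then made homogeneous.\<close>

lemma columns_exact:
  assumes c: "c \<in> dbl j p (Suc q)" and cyc: "dv q c = 0"
  shows "\<exists>d\<in>dbl j p (Suc (Suc q)). dv (Suc q) d = c"
proof -
  have "\<exists>u. u \<in> free_mod V (rk F (Suc (Suc q))) \<and>
      c \<sigma> = mat_apply (rk F (Suc q)) (rk F (Suc (Suc q))) (bnd F (Suc q)) u" for \<sigma>
  proof -
    have "mat_apply (rk F q) (rk F (Suc q)) (bnd F q) (c \<sigma>) = (\<lambda>_. 0)"
      using fun_cong[OF cyc, of \<sigma>] by (simp add: dv_def zero_fun_def)
    then have "c \<sigma> \<in> mat_apply (rk F (Suc q)) (rk F (Suc (Suc q))) (bnd F (Suc q)) ` free_mod V (rk F (Suc (Suc q)))"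
      unfolding bnd_exact[symmetric] using dbl_free_mod[OF c] by simp
    then show ?thesis by blast
  qed
  then obtain u where "\<And>\<sigma>. u \<sigma> \<in> free_mod V (rk F (Suc (Suc q)))"
      "\<And>\<sigma>. c \<sigma> = mat_apply (rk F (Suc q)) (rk F (Suc (Suc q))) (bnd F (Suc q)) (u \<sigma>)" by metis
  then show ?thesis using dv_homogeneous_lift[of p u "Suc q" c j] c by blast
qed

lemma augm_keys:
  assumes "c \<in> dbl j p 0" "m \<in> keys (augm c \<sigma>)"
  shows "\<sigma> \<subseteq> V \<and> card \<sigma> = p \<and> keys m \<subseteq> V \<and> mon_degree m + p = j"
proof -
  from in_keys_sumD[OF assms(2)[unfolded augm_def]] obtain a where a: "a < rk F 0"
    "m \<in> keys (c \<sigma> a * aug F a)" by auto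
  from in_keys_mult[OF a(2)] obtain k l where kl: "k \<in> keys (c \<sigma> a)" "l \<in> keys (aug F a)" "m = k + l" by blast
  then show ?thesis
    using dbl_keysD[OF assms(1) kl(1)] aug_carrier[OF a(1)] aug_degree[OF a(1) kl(2)]
    by (auto simp: keys_mon_add mon_degree_add carrier_poly_ring)
qed

lemma sys_add: "\<sigma> \<subseteq> V \<Longrightarrow> keys m \<in> \<Delta> \<Longrightarrow> \<sigma> \<in> sys (m + sqf \<sigma>)"
  using finite_subset_N[of \<sigma>] by (auto simp: sys_def keys_mon_add keys_sqf)

text \<open>Vanishing at all standard monomials is membership in the ideal, so exactness of
  \<open>F\<close> at its first module applies to each \<open>\<sigma>\<close>.\<close>

lemma augm_exact:
  assumes c: "c \<in> dbl j p 0" and 0: "aug_coord c = 0"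
  shows "\<exists>d\<in>dbl j p (Suc 0). dv 0 d = c"
proof -
  have "\<exists>u. u \<in> free_mod V (rk F (Suc 0)) \<and> c \<sigma> = mat_apply (rk F 0) (rk F (Suc 0)) (bnd F 0) u" for \<sigma>
  proof -
    have "augm c \<sigma> \<in> sr_ideal V \<Delta>" unfolding sr_ideal_def carrier_poly_ring
    proof (intro CollectI conjI ballI)
      fix m assume m: "m \<in> keys (augm c \<sigma>)"
      show "keys m \<subseteq> V" using augm_keys[OF c m] by blast
      show "keys m \<notin> \<Delta>"
      proof
        assume "keys m \<in> \<Delta>"
        then have "\<sigma> \<in> sys (m + sqf \<sigma>)" using augm_keys[OF c m] sys_add by blast
        then have "lookup (augm c \<sigma>) m = 0" using fun_cong[OF 0, of "(m + sqf \<sigma>, \<sigma>)"]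
          by (simp add: aug_coord_def)
        then show False using m by (simp add: in_keys_iff)
      qed
    qed
    then have "c \<sigma> \<in> mat_apply (rk F 0) (rk F 1) (bnd F 0) ` free_mod V (rk F 1)"
      unfolding aug_exact[symmetric] using dbl_free_mod[OF c] by (simp add: augm_def)
    then show ?thesis by auto
  qed
  then obtain u where "\<And>\<sigma>. u \<sigma> \<in> free_mod V (rk F (Suc 0))"
      "\<And>\<sigma>. c \<sigma> = mat_apply (rk F 0) (rk F (Suc 0)) (bnd F 0) (u \<sigma>)" by metis
  then show ?thesis using dv_homogeneous_lift[of p u 0 c j] c by blast
qed

lemma mons_add: "\<sigma> \<in> sys b \<Longrightarrow> b = b - sqf \<sigma> + sqf \<sigma> \<and> finite \<sigma> \<and> mon_le (sqf \<sigma>) b"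
  using finite_subset_N[of \<sigma>] by (simp add: sys_def mon_le_sqf mon_le_diff_add)

lemma sys_mons:
  assumes "\<sigma> \<in> sys b" "mon_degree (b - sqf \<sigma>) + card \<sigma> = j"
  shows "b \<in> mons j"
proof -
  have b: "b = b - sqf \<sigma> + sqf \<sigma>" and fin: "finite \<sigma>" using mons_add[OF assms(1)] by auto
  have "keys (b - sqf \<sigma>) \<subseteq> V" using assms(1) \<Delta> by (auto simp: sys_def simplicial_complex_def)
  then have "keys (b - sqf \<sigma> + sqf \<sigma>) \<subseteq> V" "mon_degree (b - sqf \<sigma> + sqf \<sigma>) = j"
    using assms fin by (auto simp: keys_mon_add keys_sqf mon_degree_add mon_degree_sqf sys_def)
  then show ?thesis using b by (simp add: mons_def)
qed

lemma aug_coord_mem: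
  assumes c: "c \<in> dbl j p 0"
  shows "aug_coord c \<in> kos j p"
  unfolding kos_def fun_product_def
proof (intro CollectI allI)
  fix b
  have nz: "\<sigma> \<in> sys b \<and> card \<sigma> = p \<and> b \<in> mons j" if "aug_coord c (b, \<sigma>) \<noteq> 0" for \<sigma>
  proof -
    have s: "\<sigma> \<in> sys b" and "b - sqf \<sigma> \<in> keys (augm c \<sigma>)"
      using that by (auto simp: aug_coord_def in_keys_iff split: if_splits)
    then show ?thesis using augm_keys[OF c] sys_mons[OF s] by blast
  qed
  then show "if b \<in> mons j then (\<lambda>\<sigma>. aug_coord c (b, \<sigma>)) \<in> set_chains (sys b) p
    else (\<forall>\<sigma>. aug_coord c (b, \<sigma>) = 0)" by (auto simp: set_chains_def)
qed

lemma aug_coord_dh: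
  "aug_coord (dh c) = dG (aug_coord c)"
proof (rule ext, safe)
  fix b \<sigma>
  show "aug_coord (dh c) (b, \<sigma>) = dG (aug_coord c) (b, \<sigma>)"
  proof (cases "\<sigma> \<in> sys b")
    case True
    then have \<sigma>: "\<sigma> \<subseteq> V" "mon_le (sqf \<sigma>) b" using mons_add by (auto simp: sys_def)
    have "aug_coord (dh c) (b, \<sigma>) = K.coord (K.label_bdry (augm c)) b \<sigma>"
      using True \<sigma> by (simp add: aug_coord_def augm_dh K.coord_def)
    also have "\<dots> = bdry V e (K.below b) (K.coord (augm c) b) \<sigma>" by (rule K.coord_label_bdry[OF \<sigma>(1)])
    also have "\<dots> = (\<Sum>x\<in>V - \<sigma>. pos_sign e x \<sigma> * K.coord (augm c) b (insert x \<sigma>))"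
      using \<sigma> by (simp add: bdry_def K.below_def)
    also have "\<dots> = (\<Sum>x\<in>V - \<sigma>. pos_sign e x \<sigma> * aug_coord c (b, insert x \<sigma>))"
    proof (intro sum.cong refl arg_cong2[where f = "(*)"])
      fix x assume x: "x \<in> V - \<sigma>"
      have fin: "finite \<sigma>" using \<sigma> finite_subset_N by blast
      \<comment> \<open>For \<open>x\<close> in the support of \<open>b\<close> the smaller cofactor
        is still standard; for other \<open>x\<close> both sides are zero.\<close>
      show "K.coord (augm c) b (insert x \<sigma>) = aug_coord c (b, insert x \<sigma>)"
      proof (cases "x \<in> keys b")
        case xb: True
        have "keys (b - sqf (insert x \<sigma>)) \<subseteq> keys (b - sqf \<sigma>)"
          using fin by (auto simp: in_keys_iff lookup_minus lookup_sqf split: if_splits)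
        then have "insert x \<sigma> \<in> sys b" using True x xb \<Delta> by (auto simp: sys_def simplicial_complex_def)
        then show ?thesis using mons_add by (simp add: aug_coord_def K.coord_def)
      next
        case False
        then show ?thesis using fin by (simp add: aug_coord_def K.coord_def sys_def mon_le_sqf)
      qed
    qed
    finally show ?thesis using True by (simp add: dG_def bdry_def)
  next
    case False
    then show ?thesis by (simp add: aug_coord_def dG_def bdry_def)
  qed
qed

text \<open>The coefficients \<open>g\<close> at a fixed \<open>\<sigma>\<close> define a
  polynomial. The augmentation of \<open>F\<close> reaches it modulo the ideal, and the degree
  \<open>j\<close> component of the lift suffices because \<open>g\<close> lives in that
  degree.\<close>

lemma aug_coord_surj:
  assumes g: "g \<in> kos j p"
  shows "\<exists>c\<in>dbl j p 0. aug_coord c = g"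
proof -
  have fin: "finite (mons j)" unfolding mons_def by (rule finite_monomials_degree[OF finite_N])
  have g0: "b \<in> mons j \<and> \<sigma> \<in> sys b \<and> card \<sigma> = p" if "g (b, \<sigma>) \<noteq> 0" for b \<sigma>
  proof -
    have "b \<in> mons j" using g that unfolding kos_def fun_product_def by (auto split: if_splits)
    then have "(\<lambda>\<sigma>. g (b, \<sigma>)) \<in> set_chains (sys b) p" using g unfolding kos_def by (intro fun_productD)
    then show ?thesis using that \<open>b \<in> mons j\<close> by (auto simp: set_chains_def)
  qed
  define f where "f \<sigma> = Abs_poly_mapping (\<lambda>m. g (m + sqf \<sigma>, \<sigma>))" for \<sigma>
  have f: "lookup (f \<sigma>) m = g (m + sqf \<sigma>, \<sigma>)" for \<sigma> m
  proof -
    have "{m. g (m + sqf \<sigma>, \<sigma>) \<noteq> 0} \<subseteq> (\<lambda>m. m + sqf \<sigma>) -` mons j" using g0 by auto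
    moreover have "finite ((\<lambda>m. m + sqf \<sigma>) -` mons j)" using fin by (intro finite_vimageI) (auto simp: inj_on_def)
    ultimately show ?thesis unfolding f_def by (subst lookup_Abs_poly_mapping) (auto intro: finite_subset)
  qed
  have "f \<sigma> \<in> carrier (poly_ring V)" for \<sigma>
    unfolding carrier_poly_ring
  proof
    fix m assume "m \<in> keys (f \<sigma>)"
    then have "g (m + sqf \<sigma>, \<sigma>) \<noteq> 0" by (simp add: in_keys_iff f)
    then have "m + sqf \<sigma> \<in> mons j" using g0 by blast
    then show "keys m \<subseteq> V" by (simp add: mons_def keys_mon_add)
  qed
  then have "\<forall>\<sigma>. \<exists>v. v \<in> free_mod V (rk F 0) \<and> f \<sigma> - (\<Sum>a<rk F 0. v a * aug F a) \<in> sr_ideal V \<Delta>"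
    using aug_surj by (simp add: Bex_def)
  from choice[OF this] obtain v where "\<forall>\<sigma>. v \<sigma> \<in> free_mod V (rk F 0) \<and>
    f \<sigma> - (\<Sum>a<rk F 0. v \<sigma> a * aug F a) \<in> sr_ideal V \<Delta>" by (rule exE)
  then have v: "v \<sigma> \<in> free_mod V (rk F 0)"
    "f \<sigma> - (\<Sum>a<rk F 0. v \<sigma> a * aug F a) \<in> sr_ideal V \<Delta>" for \<sigma> by simp_all
  define c where "c \<sigma> a = (if \<sigma> \<subseteq> V \<and> card \<sigma> = p then hom_part j (p + shift F 0 a) (v \<sigma> a) else 0)" for \<sigma> a
  have c: "c \<in> dbl j p 0"
  proof (rule dblI)
    fix \<sigma> a m assume m: "m \<in> keys (c \<sigma> a)"
    then have \<sigma>: "\<sigma> \<subseteq> V" "card \<sigma> = p" by (auto simp: c_def split: if_splits)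
    then have m': "mon_degree m + (p + shift F 0 a) = j" "m \<in> keys (v \<sigma> a)"
      using m by (auto simp: c_def in_keys_hom_part)
    then have "v \<sigma> a \<noteq> 0" by auto
    then show "\<sigma> \<subseteq> V \<and> card \<sigma> = p \<and> a < rk F 0 \<and> keys m \<subseteq> V \<and> mon_degree m + (p + shift F 0 a) = j"
      using \<sigma> m' v(1)[of \<sigma>] by (auto simp: free_mod_def carrier_poly_ring not_le[symmetric])
  qed
  have augm_c: "augm c \<sigma> = hom_part j p (\<Sum>a<rk F 0. v \<sigma> a * aug F a)" if "\<sigma> \<subseteq> V" "card \<sigma> = p" for \<sigma>
  proof -
    have "hom_part j p (\<Sum>a<rk F 0. v \<sigma> a * aug F a) = (\<Sum>a<rk F 0. hom_part j p (aug F a * v \<sigma> a))"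
      by (simp add: hom_part_sum mult.commute)
    also have "\<dots> = (\<Sum>a<rk F 0. aug F a * hom_part j (p + shift F 0 a) (v \<sigma> a))"
      using aug_degree by (intro sum.cong refl hom_part_mult) auto
    finally show ?thesis using that by (simp add: augm_def c_def mult.commute)
  qed
  have "aug_coord c (b, \<sigma>) = g (b, \<sigma>)" for b \<sigma>
  proof (cases "\<sigma> \<in> sys b \<and> card \<sigma> = p")
    case True
    let ?m = "b - sqf \<sigma>"
    have \<sigma>: "\<sigma> \<subseteq> V" and m\<Delta>: "keys ?m \<in> \<Delta>" using True by (auto simp: sys_def)
    have b: "b = ?m + sqf \<sigma>" using mons_add True by blast
    have "?m \<notin> keys (f \<sigma> - (\<Sum>a<rk F 0. v \<sigma> a * aug F a))"
      using v(2)[of \<sigma>] m\<Delta> by (auto simp: sr_ideal_def)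
    \<comment> \<open>The lift differs from \<open>f \<sigma>\<close> by an element of the ideal,
      whose coefficients at standard monomials vanish.\<close>
    then have eq: "lookup (\<Sum>a<rk F 0. v \<sigma> a * aug F a) ?m = g (b, \<sigma>)"
      using b by (simp add: in_keys_iff lookup_minus f)
    have "aug_coord c (b, \<sigma>) = lookup (hom_part j p (\<Sum>a<rk F 0. v \<sigma> a * aug F a)) ?m"
      using True \<sigma> by (simp add: aug_coord_def augm_c)
    also have "\<dots> = (if mon_degree ?m + p = j then g (b, \<sigma>) else 0)" by (simp add: lookup_hom_part eq)
    also have "\<dots> = g (b, \<sigma>)"
    proof (cases "g (b, \<sigma>) = 0")
      case False
      then have "mon_degree b = j" using g0 by (auto simp: mons_def)
      then have "mon_degree ?m + p = j"
        using b True mon_degree_add[of ?m "sqf \<sigma>"] mons_add[of \<sigma> b] by (simp add: mon_degree_sqf)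
      then show ?thesis by simp
    qed simp
    finally show ?thesis .
  next
    case False
    then have "g (b, \<sigma>) = 0" using g0 by blast
    moreover have "aug_coord c (b, \<sigma>) = 0" using False by (auto simp: aug_coord_def augm_def c_def)
    ultimately show ?thesis by simp
  qed
  then show ?thesis using c by (intro bexI[of _ c]) (auto simp: fun_eq_iff)
qed

lemma dh_dh: "c \<in> dbl j p q \<Longrightarrow> dh (dh c) = 0"
proof -
  assume c: "c \<in> dbl j p q"
  have "K.label_bdry (K.label_bdry (\<lambda>\<tau>. c \<tau> a)) = (\<lambda>_. 0)" for a
    using dblD(1)[OF c] by (intro K.label_bdry_bdry) blast
  then show ?thesis by (simp add: dh_def fun_eq_iff)
qed

lemma cterm_dh: "cterm (dh c) = 0"
proof
  fix a
  have "lookup (K.label_bdry (\<lambda>\<tau>. c \<tau> a) {}) 0 = 0"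
  proof (rule ccontr)
    assume "lookup (K.label_bdry (\<lambda>\<tau>. c \<tau> a) {}) 0 \<noteq> 0"
    then have k: "0 \<in> keys (K.label_bdry (\<lambda>\<tau>. c \<tau> a) {})" by (simp add: in_keys_iff)
    obtain x l where "x \<in> V - {}" "0 = Poly_Mapping.single x 1 + l" "l \<in> keys (c (insert x {}) a)"
      by (rule in_keys_label_bdry[OF empty_subsetI k])
    then have "mon_degree (Poly_Mapping.single x 1 + l) = 0" by (simp add: mon_degree_def)
    then show False by (simp add: mon_degree_add)
  qed
  then show "cterm (dh c) a = 0 a" by (simp add: cterm_def dh_def)
qed

lemma dv_dv: "c \<in> dbl j p (Suc (Suc q)) \<Longrightarrow> dv q (dv (Suc q) c) = 0"
proof
  fix \<sigma> assume "c \<in> dbl j p (Suc (Suc q))"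
  then have "mat_apply (rk F (Suc q)) (rk F (Suc (Suc q))) (bnd F (Suc q)) (c \<sigma>) \<in>
    {v \<in> free_mod V (rk F (Suc q)). mat_apply (rk F q) (rk F (Suc q)) (bnd F q) v = (\<lambda>_. 0)}"
    unfolding bnd_exact using dbl_free_mod by blast
  then show "dv q (dv (Suc q) c) \<sigma> = 0 \<sigma>" by (simp add: dv_def zero_fun_def)
qed

lemma aug_coord_dv:
  assumes c: "c \<in> dbl j p (Suc 0)"
  shows "aug_coord (dv 0 c) = 0"
proof (rule ext, safe)
  fix b \<sigma>
  have "mat_apply (rk F 0) (rk F 1) (bnd F 0) (c \<sigma>) \<in> mat_apply (rk F 0) (rk F 1) (bnd F 0) ` free_mod V (rk F 1)"
    using dbl_free_mod[OF c, of \<sigma>] by (intro imageI) simp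
  then have "mat_apply (rk F 0) (rk F 1) (bnd F 0) (c \<sigma>) \<in>
    {v \<in> free_mod V (rk F 0). (\<Sum>a<rk F 0. v a * aug F a) \<in> sr_ideal V \<Delta>}"
    by (simp only: aug_exact)
  then have "augm (dv 0 c) \<sigma> \<in> sr_ideal V \<Delta>" by (simp add: augm_def dv_def)
  then show "aug_coord (dv 0 c) (b, \<sigma>) = 0 (b, \<sigma>)"
    by (auto simp: aug_coord_def sr_ideal_def sys_def in_keys_iff)
qed

lemma aug_coord_add: "aug_coord (c + d) = aug_coord c + aug_coord d"
  by (auto simp: aug_coord_def augm_def fun_eq_iff distrib_right sum.distrib lookup_add)

lemma dG_add: "dG (g + h) = dG g + dG h"
  by (auto simp: dG_def bdry_def fun_eq_iff distrib_left sum.distrib)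

lemma cterm_mem: "c \<in> dbl j 0 q \<Longrightarrow> cterm c \<in> residue_term F q j"
  using dbl_keysD[of c j 0 q 0 "{}"]
  by (auto simp: residue_term_def cterm_def in_keys_iff mon_degree_def)

lemma cterm_surj:
  assumes "z \<in> residue_term F q j"
  shows "\<exists>c\<in>dbl j 0 q. cterm c = z"
proof (intro bexI)
  let ?c = "\<lambda>(\<sigma> :: 'x set) a. if \<sigma> = {} then const (z a) else 0"
  show "cterm ?c = z" by (simp add: cterm_def const_def)
  show "?c \<in> dbl j 0 q"
  proof (rule dblI)
    fix \<sigma> :: "'x set" and a and m :: "'x mon" assume m: "m \<in> keys (if \<sigma> = {} then const (z a) else 0)"
    then have "\<sigma> = {}" "m = 0" "z a \<noteq> 0" by (auto simp: const_def split: if_splits)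
    moreover from this have "a < rk F q \<and> shift F q a = j" using assms unfolding residue_term_def by blast
    ultimately show "\<sigma> \<subseteq> V \<and> card \<sigma> = 0 \<and> a < rk F q \<and> keys m \<subseteq> V \<and> mon_degree m + (0 + shift F q a) = j"
      by (simp add: mon_degree_def)
  qed
qed

lemma balanced: "balanced_complex (dbl j) (\<lambda>q. residue_term F q j) (kos j) (\<lambda>_. dh) dv
    (residue_bnd F) (\<lambda>_. dG) cterm aug_coord"
proof (intro balanced_complex.intro augmented_rows.intro balanced_complex_axioms.intro)
  show "dh (a + b) = dh a + dh b" for a b by (simp add: dh_def fun_eq_iff label_bdry_add)
  show "cterm (a + b) = cterm a + cterm b" for a b by (simp add: cterm_def fun_eq_iff lookup_add)
  show "residue_bnd F q (a + b) = residue_bnd F q a + residue_bnd F q b" for a b q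
    by (simp add: residue_bnd_def mat_apply_add)
  show "dv q (a + b) = dv q a + dv q b" for a b q by (simp add: dv_def mat_apply_add fun_eq_iff)
  show "\<exists>b\<in>dbl j (Suc (Suc p)) q. dh b = a" if "a \<in> dbl j (Suc p) q" "dh a = 0" for a p q
  proof (rule rows_exact[OF that])
    \<comment> \<open>Only sets of positive cardinality carry coefficients here, so the constant
      term at the empty set is zero.\<close>
    have "a {} b = 0" for b using dblD(1)[OF that(1), of "{}" b] by auto
    then show "cterm a = 0" by (simp add: cterm_def fun_eq_iff)
  qed
  show "\<exists>b\<in>dbl j (Suc 0) q. dh b = a" if "a \<in> dbl j 0 q" "cterm a = 0" for a q
  proof (rule rows_exact[OF that(1) _ that(2)])
    show "dh a = 0"
    proof (intro ext)
      fix \<sigma> b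
      \<comment> \<open>In position 0 only the empty set carries coefficients, hence the horizontal
        differential vanishes.\<close>
      have "a (insert x \<sigma>) b = 0" for x
      proof (rule ccontr)
        assume "a (insert x \<sigma>) b \<noteq> 0"
        then have "insert x \<sigma> \<subseteq> V" "card (insert x \<sigma>) = 0" using dblD(1)[OF \<open>a \<in> dbl j 0 q\<close>] by blast+
        then show False using finite_subset_N[of "insert x \<sigma>"] card_0_eq by blast
      qed
      then show "dh a \<sigma> b = 0 \<sigma> b" by (simp add: dh_def K.label_bdry_def)
    qed
  qed
qed (auto intro: dbl_add dbl_diff dh_mem dv_mem cterm_mem cterm_surj dh_dh aug_coord_mem
    aug_coord_surj columns_exact augm_exact dv_dv aug_coord_dv
    simp: cterm_dv cterm_dh aug_coord_add dG_add aug_coord_dh dh_dv)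

lemma bdry_convex_sys: "\<sigma> \<in> sys b \<Longrightarrow> insert y (insert x \<sigma>) \<in> sys b \<Longrightarrow> insert x \<sigma> \<in> sys b"
proof -
  assume s: "\<sigma> \<in> sys b" "insert y (insert x \<sigma>) \<in> sys b"
  have fin: "finite \<sigma>" using mons_add[OF s(1)] by simp
  then have "keys (b - sqf (insert x \<sigma>)) \<subseteq> keys (b - sqf \<sigma>)"
    by (auto simp: in_keys_iff lookup_minus lookup_sqf split: if_splits)
  then show ?thesis using s \<Delta> by (auto simp: sys_def simplicial_complex_def)
qed

text \<open>Balancing replaces the homology of \<open>F\<close> tensored with the residue field by
  that of the Koszul complex over the quotient ring, and the latter is the direct sum of its
  multidegrees.\<close>

lemma homology_dim:
  "kdim (residue_cycles F i j) - kdim (residue_boundaries F i j) =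
    (\<Sum>b\<in>mons j. set_homology TYPE('k) V e (sys b) i)"
proof -
  have fin: "finite (mons j)" unfolding mons_def by (rule finite_monomials_degree[OF finite_N])
  have sysV: "sys b \<subseteq> Pow V" and finsys: "finite (sys b)" for b
    using finite_N by (auto simp: sys_def intro: finite_subset[of _ "Pow V"])
  have fdk: "fin_dim (kos j p)" for p
  proof (rule fin_dim_support[of "mons j \<times> Pow V"])
    show "finite (mons j \<times> Pow V)" using fin finite_N by simp
    fix g :: "'x mon \<times> 'x set \<Rightarrow> 'k" and a assume g: "g \<in> kos j p" "a \<notin> mons j \<times> Pow V"
    obtain b \<sigma> where a: "a = (b, \<sigma>)" by fastforce
    show "g a = 0"
    proof (cases "b \<in> mons j")
      case True
      then have "(\<lambda>\<sigma>. g (b, \<sigma>)) \<in> set_chains (sys b) p" using g(1) unfolding kos_def by (intro fun_productD)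
      moreover have "\<sigma> \<notin> sys b" using g(2) a True sysV by auto
      ultimately show ?thesis using a by (auto simp: set_chains_def)
    next
      case False
      then have "\<forall>\<sigma>. g (b, \<sigma>) = 0" using g(1) unfolding kos_def by (simp add: fun_product_outside)
      then show ?thesis using a by simp
    qed
  qed
  have "fs.dim {z \<in> residue_term F i j. \<forall>h. i = Suc h \<longrightarrow> residue_bnd F h z = 0} -
      fs.dim (residue_bnd F i ` residue_term F (Suc i) j) =
      fs.dim {z \<in> kos j i. \<forall>h. i = Suc h \<longrightarrow> dG z = 0} - fs.dim (dG ` kos j (Suc i))"
  proof (rule balanced_codim[OF balanced, where sc = "\<lambda>c a \<sigma> b. const c * a \<sigma> b"])
    show "(\<lambda>\<sigma> b. const c * a \<sigma> b) \<in> dbl j p q" if "a \<in> dbl j p q" for c a p q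
    proof (rule dblI)
      fix \<sigma> b m assume "m \<in> keys (const c * a \<sigma> b)"
      then have "m \<in> keys (a \<sigma> b)" unfolding in_keys_iff lookup_const_mult by (metis mult_zero_right)
      then show "\<sigma> \<subseteq> V \<and> card \<sigma> = p \<and> b < rk F q \<and> keys m \<subseteq> V \<and> mon_degree m + (p + shift F q b) = j"
        by (rule dbl_keysD[OF that])
    qed
    show "dh (\<lambda>\<sigma> b. const c * a \<sigma> b) = (\<lambda>\<sigma> b. const c * dh a \<sigma> b)" for c a
      using label_bdry_sum[of "\<lambda>_. const c" "\<lambda>_ \<tau>. a \<tau> _" "{()}"]
      by (simp add: dh_def fun_eq_iff)
    show "dv q (\<lambda>\<sigma> b. const c * a \<sigma> b) = (\<lambda>\<sigma> b. const c * dv q a \<sigma> b)" for c a q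
      by (simp add: dv_def mat_apply_scale)
    show "cterm (\<lambda>\<sigma> b. const c * a \<sigma> b) = fscale c (cterm a)" for c a
      by (simp add: cterm_def lookup_const_mult)
    have "augm (\<lambda>\<sigma> b. const c * a \<sigma> b) \<sigma> = const c * augm a \<sigma>" for c a \<sigma>
      by (simp add: augm_def sum_distrib_left mult.assoc)
    then show "aug_coord (\<lambda>\<sigma> b. const c * a \<sigma> b) = fscale c (aug_coord a)" for c a
      by (auto simp: aug_coord_def lookup_const_mult)
    show "residue_bnd F q (fscale c z) = fscale c (residue_bnd F q z)" for c z q
      by (simp add: residue_bnd_def mat_apply_scale)
    show "dG (fscale c z) = fscale c (dG z)" for c z
      by (auto simp: dG_def bdry_scale)
    show "fs.subspace (residue_term F q j)" for q
      by (rule fs.subspaceI) (auto simp: residue_term_def)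
    show "fin_dim (residue_term F q j)" for q
      by (rule fin_dim_support[of "{..<rk F q}"]) (auto simp: residue_term_def)
    show "fs.subspace (kos j q)" for q
      unfolding kos_def by (intro subspace_fun_product subspace_set_chains)
    show "fin_dim (kos j q)" for q by (rule fdk)
  qed
  moreover have "residue_cycles F i j = {z \<in> residue_term F i j. \<forall>h. i = Suc h \<longrightarrow> residue_bnd F h z = 0}"
    by (cases i) (auto simp: residue_cycles_def zero_fun_def)
  moreover have "{z \<in> kos j i. \<forall>h. i = Suc h \<longrightarrow> dG z = 0} =
    fun_product (mons j) (\<lambda>b. {g \<in> set_chains (sys b) i. bdry V e (sys b) g = (\<lambda>_. 0)})" (is "?A = ?B")
  proof
    show "?B \<subseteq> ?A"
    proof
      fix g assume g: "g \<in> ?B"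
      then have "g \<in> kos j i" unfolding kos_def fun_product_def by (auto split: if_splits)
      moreover have "dG g (b, \<sigma>) = 0" for b \<sigma>
      proof (cases "b \<in> mons j")
        case True
        from fun_productD[OF g this] have "bdry V e (sys b) (\<lambda>\<sigma>. g (b, \<sigma>)) = (\<lambda>_. 0)" by simp
        then show ?thesis by (simp add: dG_def fun_eq_iff)
      next
        case False
        then have "\<forall>\<sigma>. g (b, \<sigma>) = 0" using g by (simp add: fun_product_outside)
        then show ?thesis by (simp add: dG_def bdry_def)
      qed
      ultimately show "g \<in> ?A" by (auto simp: fun_eq_iff)
    qed
    show "?A \<subseteq> ?B"
    proof
      fix g assume g: "g \<in> ?A"
      show "g \<in> ?B" unfolding fun_product_def
      proof (intro CollectI allI)
        fix b
        show "if b \<in> mons j then (\<lambda>s. g (b, s)) \<in> {g \<in> set_chains (sys b) i. bdry V e (sys b) g = (\<lambda>_. 0)}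
          else (\<forall>s. g (b, s) = 0)"
        proof (cases "b \<in> mons j")
          case True
          then have gb: "(\<lambda>s. g (b, s)) \<in> set_chains (sys b) i" using g unfolding kos_def by (intro fun_productD) auto
          have "bdry V e (sys b) (\<lambda>s. g (b, s)) \<sigma> = 0" for \<sigma>
          proof (cases i)
            case 0
            \<comment> \<open>For \<open>i = 0\<close> the condition on \<open>h\<close> is empty,
              but chains on the empty set have zero boundary anyway.\<close>
            have "g (b, insert x \<sigma>) = 0" for x
            proof (rule ccontr)
              assume "g (b, insert x \<sigma>) \<noteq> 0"
              then have "insert x \<sigma> \<in> sys b" "card (insert x \<sigma>) = 0"
                using gb 0 unfolding set_chains_def by blast+
              then show False using sysV[of b] finite_subset_N[of "insert x \<sigma>"] card_0_eq by blast
            qed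
            then show ?thesis by (simp add: bdry_def)
          next
            case (Suc h)
            then have "dG g (b, \<sigma>) = 0" using g by simp
            then show ?thesis by (simp add: dG_def)
          qed
          then show ?thesis using True gb by auto
        next
          case False
          have "g \<in> fun_product (mons j) (\<lambda>b. set_chains (sys b) i)" using g by (simp add: kos_def)
          from fun_product_outside[OF this False] show ?thesis using False by simp
        qed
      qed
    qed
  qed
  moreover have "dG ` kos j (Suc i) = fun_product (mons j) (\<lambda>b. bdry V e (sys b) ` set_chains (sys b) (Suc i))"
    (is "?A = ?B")
  proof
    show "?A \<subseteq> ?B"
    proof (rule image_subsetI)
      fix g assume g: "g \<in> kos j (Suc i)"
      show "dG g \<in> ?B" unfolding fun_product_def
      proof (intro CollectI allI)
        fix b
        show "if b \<in> mons j then (\<lambda>s. dG g (b, s)) \<in> bdry V e (sys b) ` set_chains (sys b) (Suc i)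
          else (\<forall>s. dG g (b, s) = 0)"
        proof (cases "b \<in> mons j")
          case True
          then have "(\<lambda>s. g (b, s)) \<in> set_chains (sys b) (Suc i)" using g unfolding kos_def by (intro fun_productD)
          then show ?thesis using True by (auto simp: dG_def)
        next
          case False
          then have "\<forall>\<sigma>. g (b, \<sigma>) = 0" using g unfolding kos_def by (simp add: fun_product_outside)
          then show ?thesis using False by (simp add: dG_def bdry_def)
        qed
      qed
    qed
    show "?B \<subseteq> ?A"
    proof
      fix g assume g: "g \<in> ?B"
      have "\<exists>h. h \<in> set_chains (sys b) (Suc i) \<and> (\<lambda>s. g (b, s)) = bdry V e (sys b) h" if "b \<in> mons j" for b
        using fun_productD[OF g that] by auto
      then have "\<forall>b\<in>mons j. \<exists>h. h \<in> set_chains (sys b) (Suc i) \<and> (\<lambda>s. g (b, s)) = bdry V e (sys b) h" by blast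
      from bchoice[OF this] obtain h where
        h: "\<forall>b\<in>mons j. h b \<in> set_chains (sys b) (Suc i) \<and> (\<lambda>s. g (b, s)) = bdry V e (sys b) (h b)" by (rule exE)
      define k where "k = (\<lambda>(b, s). if b \<in> mons j then h b s else 0)"
      have "k \<in> kos j (Suc i)" using h by (auto simp: kos_def fun_product_def k_def)
      moreover have "g (b, s) = dG k (b, s)" for b s
      proof (cases "b \<in> mons j")
        case True
        then have "g (b, s) = bdry V e (sys b) (h b) s" using h fun_cong[of "\<lambda>s. g (b, s)" _ s] by blast
        then show ?thesis using True by (simp add: dG_def k_def)
      next
        case False
        then have "\<forall>\<sigma>. g (b, \<sigma>) = 0" using g by (simp add: fun_product_outside)
        then show ?thesis using False by (simp add: dG_def k_def bdry_def)
      qed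
      then have "g = dG k" by auto
      ultimately show "g \<in> ?A" by blast
    qed
  qed
  moreover have "fs.dim (fun_product (mons j) (\<lambda>b. {g \<in> set_chains (sys b) i. bdry V e (sys b) g = (\<lambda>_. 0 :: 'k)})) -
      fs.dim (fun_product (mons j) (\<lambda>b. (bdry V e (sys b) ` set_chains (sys b) (Suc i) :: ('x set \<Rightarrow> 'k) set))) =
      (\<Sum>b\<in>mons j. set_homology TYPE('k) V e (sys b) i)"
    unfolding set_homology_def
  proof (rule codim_fun_product[OF fin, where
      Z = "\<lambda>b. {g \<in> set_chains (sys b) i. bdry V e (sys b) g = (\<lambda>_. 0 :: 'k)}" and
      B = "\<lambda>b. bdry V e (sys b) ` set_chains (sys b) (Suc i)"])
    show "fs.subspace {g \<in> set_chains (sys b) i. bdry V e (sys b) g = (\<lambda>_. 0 :: 'k)}" for b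
      by (rule subspace_cycles)
    show "fs.subspace (bdry V e (sys b) ` (set_chains (sys b) (Suc i) :: ('x set \<Rightarrow> 'k) set))" for b
      by (rule subspace_boundaries)
    show "bdry V e (sys b) ` set_chains (sys b) (Suc i) \<subseteq>
      {g \<in> set_chains (sys b) i. bdry V e (sys b) g = (\<lambda>_. 0 :: 'k)}" for b
      by (rule boundaries_subset_cycles[OF finite_N inj_e sysV bdry_convex_sys])
    show "fin_dim {g \<in> set_chains (sys b) i. bdry V e (sys b) g = (\<lambda>_. 0 :: 'k)}" for b
      by (rule fin_dim_mono[OF fin_dim_set_chains[OF finsys]]) blast
    have "fun_product (mons j) (\<lambda>b. {g \<in> set_chains (sys b) i. bdry V e (sys b) g = (\<lambda>_. 0 :: 'k)}) \<subseteq> kos j i"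
      unfolding kos_def fun_product_def by (auto split: if_splits)
    then show "fin_dim (fun_product (mons j) (\<lambda>b. {g \<in> set_chains (sys b) i. bdry V e (sys b) g = (\<lambda>_. 0 :: 'k)}))"
      by (rule fin_dim_mono[OF fdk])
  qed
  ultimately show ?thesis unfolding kdim_def residue_boundaries_def by simp
qed

end

section \<open>Reduction to squarefree multidegrees\<close>

definition face_system :: "'x set set \<Rightarrow> 'x set \<Rightarrow> 'x set set" where
  "face_system \<Delta> \<tau> = {\<sigma>. \<sigma> \<subseteq> \<tau> \<and> \<tau> - \<sigma> \<in> \<Delta>}"

lemma bdry_diff: "bdry N e S (g - h) = bdry N e S g - bdry N e S h"
  by (auto simp: bdry_def fun_eq_iff right_diff_distrib sum_subtractf)

lemma set_homology_cone:
  assumes "finite N" "inj_on e N" and S: "S \<subseteq> Pow N" and x: "x \<in> N"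
    and cone: "\<And>\<sigma>. \<sigma> \<subseteq> N \<Longrightarrow> insert x \<sigma> \<in> S \<longleftrightarrow> \<sigma> - {x} \<in> S"
    and conv: "\<And>\<sigma> x y. \<sigma> \<in> S \<Longrightarrow> insert y (insert x \<sigma>) \<in> S \<Longrightarrow> insert x \<sigma> \<in> S"
  shows "set_homology TYPE('k::field) N e S p = 0"
proof -
  interpret vertex_order N e using assms by unfold_locales
  have "{g \<in> set_chains S p. bdry N e S g = (\<lambda>_. 0 :: 'k)} \<subseteq> bdry N e S ` (set_chains S (Suc p) :: ('a set \<Rightarrow> 'k) set)"
  proof
    fix g :: "'a set \<Rightarrow> 'k" assume g: "g \<in> {g \<in> set_chains S p. bdry N e S g = (\<lambda>_. 0)}"
    then have gS: "\<And>\<sigma>. g \<sigma> \<noteq> 0 \<Longrightarrow> \<sigma> \<in> S" and gc: "\<And>\<sigma>. g \<sigma> \<noteq> 0 \<Longrightarrow> card \<sigma> = p" by (auto simp: set_chains_def)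
    have "bdry N e S g = (\<lambda>_. 0)" using g by simp
    then have "g = bdry N e S (cone_homotopy x g)"
      by (intro cone_exact[OF S x cone, symmetric]) (use gS in auto)
    moreover have "cone_homotopy x g \<in> set_chains S (Suc p)"
      unfolding set_chains_def
    proof (intro CollectI allI impI)
      fix \<sigma> assume "cone_homotopy x g \<sigma> \<noteq> 0"
      then have \<sigma>: "x \<in> \<sigma>" "g (\<sigma> - {x}) \<noteq> 0" by (auto simp: cone_homotopy_def split: if_splits)
      then have "\<sigma> - {x} \<in> S" "card (\<sigma> - {x}) = p" using gS gc by auto
      moreover have "insert x (\<sigma> - {x}) = \<sigma>" using \<sigma> by auto
      moreover have "\<sigma> - {x} \<subseteq> N" using \<open>\<sigma> - {x} \<in> S\<close> S by auto
      moreover have "finite \<sigma>" using finite_subset_N[OF \<open>\<sigma> - {x} \<subseteq> N\<close>] by simp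
      ultimately show "\<sigma> \<in> S \<and> card \<sigma> = Suc p" using cone[of "\<sigma> - {x}"] card_Suc_Diff1[of \<sigma> x] \<sigma> by auto
    qed
    ultimately show "g \<in> bdry N e S ` (set_chains S (Suc p) :: ('a set \<Rightarrow> 'k) set)" by (rule image_eqI)
  qed
  then have "{g \<in> set_chains S p. bdry N e S g = (\<lambda>_. 0 :: 'k)} = bdry N e S ` (set_chains S (Suc p) :: ('a set \<Rightarrow> 'k) set)"
    by (intro equalityI boundaries_subset_cycles[OF assms(1,2) S]) (use conv in blast)+
  then show ?thesis by (simp add: set_homology_def)
qed

context sr_resolution begin

text \<open>If \<open>x\<close> has exponent at least 2, dividing by \<open>x\<close> once leaves
  the support unchanged, so \<open>sys b\<close> is a cone with apex \<open>x\<close>.\<close>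

lemma sys_nonsquarefree:
  assumes b: "keys b \<subseteq> V" and x: "lookup b x \<ge> 2"
  shows "set_homology TYPE('k) V e (sys b) i = 0"
proof (rule set_homology_cone[OF finite_N inj_e _ _ _ bdry_convex_sys])
  have xk: "x \<in> keys b" using x by (simp add: in_keys_iff)
  show "sys b \<subseteq> Pow V" by (auto simp: sys_def)
  show "x \<in> V" using xk b by auto
  fix \<sigma> assume \<sigma>: "\<sigma> \<subseteq> V"
  have "keys (b - sqf (insert x \<sigma>)) = keys (b - sqf (\<sigma> - {x}))"
    using finite_subset_N[OF \<sigma>] x by (auto simp: in_keys_iff lookup_minus lookup_sqf split: if_splits)
  then show "insert x \<sigma> \<in> sys b \<longleftrightarrow> \<sigma> - {x} \<in> sys b"
    using xk b \<sigma> unfolding sys_def by auto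
qed

lemma sys_sqf:
  assumes "\<tau> \<subseteq> V"
  shows "sys (sqf \<tau>) = face_system \<Delta> \<tau>"
proof -
  have fin: "finite \<tau>" using assms finite_subset_N by blast
  have "keys (sqf \<tau> - sqf \<sigma>) = \<tau> - \<sigma>" if "\<sigma> \<subseteq> \<tau>" for \<sigma>
    using finite_subset[OF that fin] fin by (auto simp: in_keys_iff lookup_minus lookup_sqf split: if_splits)
  then show ?thesis using assms fin by (auto simp: sys_def face_system_def keys_sqf)
qed

text \<open>Hochster's formula: passing from \<open>\<sigma>\<close> to
  \<open>\<tau> - \<sigma>\<close> turns chains of degree \<open>i\<close> on the face system into
  cochains of the restriction of \<open>\<Delta>\<close> to \<open>\<tau>\<close> in dimension
  \<open>card \<tau> - i - 1\<close>. Multidegrees that are not squarefree contribute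
  nothing.\<close>

lemma homology_dim_faces:
  "kdim (residue_cycles F i j) - kdim (residue_boundaries F i j) =
    (\<Sum>\<tau> | \<tau> \<subseteq> V \<and> card \<tau> = j. set_homology TYPE('k) V e (face_system \<Delta> \<tau>) i)"
proof -
  let ?T = "{\<tau>. \<tau> \<subseteq> V \<and> card \<tau> = j}"
  have fin: "finite (mons j)" unfolding mons_def by (rule finite_monomials_degree[OF finite_N])
  have "kdim (residue_cycles F i j) - kdim (residue_boundaries F i j) =
    (\<Sum>b\<in>mons j. set_homology TYPE('k) V e (sys b) i)" by (rule homology_dim)
  also have "\<dots> = (\<Sum>b\<in>sqf ` ?T. set_homology TYPE('k) V e (sys b) i)"
  proof (rule sum.mono_neutral_right[OF fin])
    show "sqf ` ?T \<subseteq> mons j"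
      using finite_subset_N by (auto simp: mons_def keys_sqf mon_degree_sqf)
    show "\<forall>b\<in>mons j - sqf ` ?T. set_homology TYPE('k) V e (sys b) i = 0"
    proof
      fix b assume b: "b \<in> mons j - sqf ` ?T"
      have "\<not> squarefree_mon b"
      proof
        assume "squarefree_mon b"
        then have eq: "b = sqf (keys b)" by (rule squarefree_mon_eq)
        then have "card (keys b) = j" using b mon_degree_sqf[of "keys b"] by (simp add: mons_def)
        then show False using b eq by (auto simp: mons_def)
      qed
      then obtain x where "lookup b x > 1" by (auto simp: squarefree_mon_def not_le)
      then have "lookup b x \<ge> 2" by simp
      then show "set_homology TYPE('k) V e (sys b) i = 0"
        using sys_nonsquarefree b by (auto simp: mons_def)
    qed
  qed
  also have "\<dots> = (\<Sum>\<tau>\<in>?T. set_homology TYPE('k) V e (sys (sqf \<tau>)) i)"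
  proof (rule sum.reindex_cong[of sqf])
    show "inj_on sqf ?T"
    proof (rule inj_onI)
      fix \<sigma> \<tau> assume st: "\<sigma> \<in> ?T" "\<tau> \<in> ?T" and eq: "sqf \<sigma> = sqf \<tau>"
      have "finite \<sigma>" "finite \<tau>" using st finite_subset_N by blast+
      then show "\<sigma> = \<tau>" using keys_sqf[of \<sigma>] keys_sqf[of \<tau>] unfolding eq by simp
    qed
  qed auto
  also have "\<dots> = (\<Sum>\<tau>\<in>?T. set_homology TYPE('k) V e (face_system \<Delta> \<tau>) i)"
    by (intro sum.cong refl) (simp add: sys_sqf)
  finally show ?thesis .
qed

end

subsection \<open>Removing a dominated vertex\<close>

text \<open>By \<open>dom\<close> the link of \<open>y\<close> in the restriction of
  \<open>\<Delta>\<close> to \<open>\<tau>\<close> is a cone with apex \<open>z\<close>, so deleting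
  \<open>y\<close> preserves the homology of that restriction. In the complementary grading the
  degree drops by one because \<open>\<tau>\<close> loses a vertex.\<close>

locale dominated_vertex = vertex_order N e for N :: "'n set" and e +
  fixes \<Delta> :: "'n set set" and \<tau> :: "'n set" and y z :: 'n
  assumes down: "\<And>\<alpha> \<beta>. \<alpha> \<in> \<Delta> \<Longrightarrow> \<beta> \<subseteq> \<alpha> \<Longrightarrow> \<beta> \<in> \<Delta>"
    and \<tau>: "\<tau> \<subseteq> N" and y: "y \<in> \<tau>" and z: "z \<in> \<tau>" "y \<noteq> z"
    and dom: "\<And>\<alpha>. \<alpha> \<subseteq> \<tau> \<Longrightarrow> y \<in> \<alpha> \<Longrightarrow> insert z \<alpha> \<in> \<Delta> \<longleftrightarrow> \<alpha> \<in> \<Delta>"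
begin

abbreviation S where "S \<equiv> face_system \<Delta> \<tau>"
abbreviation S' where "S' \<equiv> face_system \<Delta> (\<tau> - {y})"
text \<open>The subcomplex of the sets whose complement in \<open>\<tau>\<close> contains
  \<open>y\<close>; it is a cone with apex \<open>z\<close>, hence acyclic.\<close>

definition S0 where "S0 = {\<sigma> \<in> S. y \<notin> \<sigma>}"

lemma S_sub: "S \<subseteq> Pow N" "S' \<subseteq> Pow N" "S0 \<subseteq> Pow N"
  using \<tau> by (auto simp: face_system_def S0_def)

lemma face_system_convex:
  assumes "\<sigma> \<in> face_system \<Delta> \<rho>" "insert x' (insert x \<sigma>) \<in> face_system \<Delta> \<rho>"
  shows "insert x \<sigma> \<in> face_system \<Delta> \<rho>"
  using assms down[of "\<rho> - \<sigma>" "\<rho> - insert x \<sigma>"] by (auto simp: face_system_def)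

lemma finite_S: "finite S" "finite S'"
  using finite_subset[OF S_sub(1)] finite_subset[OF S_sub(2)] finite_N by auto

lemma insert_S: "y \<notin> \<sigma> \<Longrightarrow> insert y \<sigma> \<in> S \<longleftrightarrow> \<sigma> \<in> S'"
proof -
  assume "y \<notin> \<sigma>"
  then have "insert y \<sigma> \<subseteq> \<tau> \<longleftrightarrow> \<sigma> \<subseteq> \<tau> - {y}" "\<tau> - insert y \<sigma> = \<tau> - {y} - \<sigma>" using y by auto
  then show ?thesis by (simp add: face_system_def)
qed

lemma S'_notin: "\<sigma> \<in> S' \<Longrightarrow> y \<notin> \<sigma>" by (auto simp: face_system_def)

lemma S0_cone: "\<sigma> \<subseteq> N \<Longrightarrow> insert z \<sigma> \<in> S0 \<longleftrightarrow> \<sigma> - {z} \<in> S0"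
proof -
  have "insert z (\<tau> - insert z \<sigma>) = \<tau> - (\<sigma> - {z})" using z by auto
  then have "\<tau> - insert z \<sigma> \<in> \<Delta> \<longleftrightarrow> \<tau> - (\<sigma> - {z}) \<in> \<Delta>" if "y \<notin> \<sigma>"
    using dom[of "\<tau> - insert z \<sigma>"] y z that by auto
  then show ?thesis using z by (auto simp: S0_def face_system_def)
qed

lemma acyclic_without_y:
  fixes g :: "'n set \<Rightarrow> 'k::field"
  assumes g: "g \<in> set_chains S p" and gy: "\<And>\<sigma>. y \<in> \<sigma> \<Longrightarrow> g \<sigma> = 0" and cyc: "bdry N e S g = (\<lambda>_. 0)"
  shows "\<exists>l\<in>set_chains S (Suc p). (\<forall>\<sigma>. y \<in> \<sigma> \<longrightarrow> l \<sigma> = 0) \<and> bdry N e S l = g"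
proof -
  have gS0: "\<sigma> \<in> S0" if "g \<sigma> \<noteq> 0" for \<sigma> using g gy that by (auto simp: set_chains_def S0_def)
  \<comment> \<open>Chains vanishing on all sets with \<open>y\<close> have the same boundary in
    \<open>S\<close> and in \<open>S0\<close>.\<close>
  have eq: "bdry N e S0 h = bdry N e S h" if "\<And>\<sigma>. y \<in> \<sigma> \<Longrightarrow> h \<sigma> = 0" for h :: "'n set \<Rightarrow> 'k"
  proof
    fix \<sigma>
    show "bdry N e S0 h \<sigma> = bdry N e S h \<sigma>"
      using that by (cases "y \<in> \<sigma>") (auto simp: bdry_def S0_def intro!: sum.neutral[symmetric])
  qed
  let ?l = "cone_homotopy z g"
  have ly: "?l \<sigma> = 0" if "y \<in> \<sigma>" for \<sigma> using gy[of "\<sigma> - {z}"] that z by (simp add: cone_homotopy_def)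
  have "bdry N e S0 ?l = g"
    by (rule cone_exact[OF S_sub(3) _ S0_cone gS0]) (use z \<tau> eq[OF gy] cyc in auto)
  then have "bdry N e S ?l = g" using eq[OF ly] by simp
  moreover have "?l \<in> set_chains S (Suc p)" unfolding set_chains_def
  proof (intro CollectI allI impI)
    fix \<sigma> assume "?l \<sigma> \<noteq> 0"
    then have \<sigma>: "z \<in> \<sigma>" "g (\<sigma> - {z}) \<noteq> 0" by (auto simp: cone_homotopy_def split: if_splits)
    then have "\<sigma> - {z} \<in> S0" "card (\<sigma> - {z}) = p" using gS0 g by (auto simp: set_chains_def)
    moreover have "insert z (\<sigma> - {z}) = \<sigma>" using \<sigma> by auto
    moreover have "\<sigma> - {z} \<subseteq> N" using \<open>\<sigma> - {z} \<in> S0\<close> S_sub by auto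
    moreover have "finite \<sigma>" using finite_subset_N[OF \<open>\<sigma> - {z} \<subseteq> N\<close>] by simp
    ultimately have "\<sigma> \<in> S0" "card \<sigma> = Suc p" using S0_cone[of "\<sigma> - {z}"] card_Suc_Diff1[of \<sigma> z] \<sigma> by auto
    then show "\<sigma> \<in> S \<and> card \<sigma> = Suc p" by (simp add: S0_def)
  qed
  ultimately show ?thesis using ly by blast
qed

text \<open>The projection of the chains on \<open>S\<close> modulo those on \<open>S0\<close>,
  identified with chains on \<open>S'\<close> by dropping \<open>y\<close>. The map
  \<open>lift\<close> is a section of it.\<close>

definition res :: "('n set \<Rightarrow> 'k::field) \<Rightarrow> 'n set \<Rightarrow> 'k" where
  "res g \<sigma> = (if \<sigma> \<in> S' then pos_sign e y \<sigma> * g (insert y \<sigma>) else 0)"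

definition lift :: "('n set \<Rightarrow> 'k::field) \<Rightarrow> 'n set \<Rightarrow> 'k" where
  "lift h \<sigma> = (if y \<in> \<sigma> then pos_sign e y (\<sigma> - {y}) * h (\<sigma> - {y}) else 0)"

lemma res_add: "res (g + h) = res g + res h"
  by (auto simp: res_def fun_eq_iff distrib_left)

lemma res_diff: "res (g - h) = res g - res h"
  by (auto simp: res_def fun_eq_iff right_diff_distrib)

lemma res_scale: "res (fscale c g) = fscale c (res g)"
  by (auto simp: res_def fun_eq_iff)

lemma res_chain: "g \<in> set_chains S (Suc p) \<Longrightarrow> res g \<in> set_chains S' p"
  unfolding set_chains_def
proof (intro CollectI allI impI)
  fix \<sigma> assume g: "g \<in> {g. \<forall>\<sigma>. g \<sigma> \<noteq> 0 \<longrightarrow> \<sigma> \<in> S \<and> card \<sigma> = Suc p}" and "res g \<sigma> \<noteq> 0"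
  then have \<sigma>: "\<sigma> \<in> S'" "g (insert y \<sigma>) \<noteq> 0" by (auto simp: res_def split: if_splits)
  then have "finite \<sigma>" using S_sub finite_subset_N by auto
  moreover have "card (insert y \<sigma>) = Suc p" using g \<sigma> by simp
  ultimately show "\<sigma> \<in> S' \<and> card \<sigma> = p" using \<sigma> S'_notin by simp
qed

lemma lift_chain: "h \<in> set_chains S' p \<Longrightarrow> lift h \<in> set_chains S (Suc p)"
  unfolding set_chains_def
proof (intro CollectI allI impI)
  fix \<sigma> assume h: "h \<in> {g. \<forall>\<sigma>. g \<sigma> \<noteq> 0 \<longrightarrow> \<sigma> \<in> S' \<and> card \<sigma> = p}" and "lift h \<sigma> \<noteq> 0"
  then have \<sigma>: "y \<in> \<sigma>" "h (\<sigma> - {y}) \<noteq> 0" by (auto simp: lift_def split: if_splits)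
  then have *: "\<sigma> - {y} \<in> S'" "card (\<sigma> - {y}) = p" using h by auto
  then have "finite \<sigma>" using S_sub finite_subset_N[of "\<sigma> - {y}"] by auto
  moreover have "insert y (\<sigma> - {y}) = \<sigma>" using \<sigma> by auto
  ultimately show "\<sigma> \<in> S \<and> card \<sigma> = Suc p"
    using * insert_S[of "\<sigma> - {y}"] card_Suc_Diff1[of \<sigma> y] \<sigma> by auto
qed

lemma res_lift: "h \<in> set_chains S' p \<Longrightarrow> res (lift h) = h"
proof
  fix \<sigma> assume "h \<in> set_chains S' p"
  then show "res (lift h) \<sigma> = h \<sigma>"
    using S'_notin[of \<sigma>] by (auto simp: res_def lift_def set_chains_def)
qed

lemma res_zeroD:
  assumes g: "g \<in> set_chains S p" and "res g = (\<lambda>_. 0)" and \<sigma>: "y \<in> \<sigma>"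
  shows "g \<sigma> = 0"
proof (rule ccontr)
  assume nz: "g \<sigma> \<noteq> 0"
  then have "\<sigma> \<in> S" using g by (auto simp: set_chains_def)
  moreover have "insert y (\<sigma> - {y}) = \<sigma>" using \<sigma> by auto
  ultimately have "\<sigma> - {y} \<in> S'" using insert_S[of "\<sigma> - {y}"] by auto
  then have "res g (\<sigma> - {y}) = pos_sign e y (\<sigma> - {y}) * g \<sigma>"
    using \<open>insert y (\<sigma> - {y}) = \<sigma>\<close> by (simp add: res_def)
  then have "pos_sign e y (\<sigma> - {y}) * g \<sigma> = 0" using assms(2) by simp
  then show False using nz by (simp add: pos_sign_def)
qed

lemma res_zero: "(\<And>\<sigma>. y \<in> \<sigma> \<Longrightarrow> g \<sigma> = 0) \<Longrightarrow> res g = (\<lambda>_. 0)"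
  by (auto simp: res_def)

text \<open>The sign comes from exchanging \<open>y\<close> with the vertex summed over.\<close>

lemma res_bdry:
  fixes g :: "'n set \<Rightarrow> 'k::field"
  assumes "g \<in> set_chains S q"
  shows "bdry N e S' (res g) = fscale (-1) (res (bdry N e S g))"
proof
  have supp: "\<sigma> \<in> S" if "g \<sigma> \<noteq> 0" for \<sigma> using assms that by (auto simp: set_chains_def)
  fix \<sigma>
  show "bdry N e S' (res g) \<sigma> = fscale (-1) (res (bdry N e S g)) \<sigma>"
  proof (cases "\<sigma> \<in> S'")
    case True
    have fin: "finite \<sigma>" and yn: "y \<notin> \<sigma>" using True S_sub finite_subset_N S'_notin by auto
    have yN: "y \<in> N" using y \<tau> by auto
    have iS: "insert y \<sigma> \<in> S" using True insert_S yn by simp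
    have "bdry N e S' (res g) \<sigma> = (\<Sum>x\<in>N - \<sigma>. pos_sign e x \<sigma> * res g (insert x \<sigma>))"
      using True by (simp add: bdry_def)
    also have "\<dots> = (\<Sum>x\<in>N - insert y \<sigma>. pos_sign e x \<sigma> * res g (insert x \<sigma>))"
    proof (rule sum.mono_neutral_right)
      have "insert y \<sigma> \<notin> S'" using S'_notin by auto
      then show "\<forall>x\<in>N - \<sigma> - (N - insert y \<sigma>). pos_sign e x \<sigma> * res g (insert x \<sigma>) = 0"
        by (auto simp: res_def)
    qed (use finite_N in auto)
    also have "\<dots> = (\<Sum>x\<in>N - insert y \<sigma>. - (pos_sign e y \<sigma> * (pos_sign e x (insert y \<sigma>) * g (insert x (insert y \<sigma>)))))"
    proof (rule sum.cong[OF refl])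
      fix x assume x: "x \<in> N - insert y \<sigma>"
      have ne: "e x \<noteq> e y" using x yN inj_onD[OF inj_e, of x y] by auto
      have sg: "pos_sign e x \<sigma> * pos_sign e y (insert x \<sigma>) = - (pos_sign e y \<sigma> * (pos_sign e x (insert y \<sigma>) :: 'k))"
        using ne fin x yn by (auto simp: pos_sign_insert mult.commute)
      have r: "res g (insert x \<sigma>) = pos_sign e y (insert x \<sigma>) * g (insert x (insert y \<sigma>))"
      proof (cases "insert x \<sigma> \<in> S'")
        case True
        then show ?thesis by (simp add: res_def insert_commute)
      next
        case False
        have "y \<notin> insert x \<sigma>" using x yn by auto
        then have "insert y (insert x \<sigma>) \<notin> S" using False insert_S by blast
        then have "g (insert x (insert y \<sigma>)) = 0" using supp by (auto simp: insert_commute)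
        then show ?thesis using False by (simp add: res_def)
      qed
      have "pos_sign e x \<sigma> * res g (insert x \<sigma>) = (pos_sign e x \<sigma> * pos_sign e y (insert x \<sigma>)) * g (insert x (insert y \<sigma>))"
        unfolding r by (simp only: mult.assoc)
      also have "\<dots> = - (pos_sign e y \<sigma> * (pos_sign e x (insert y \<sigma>) * g (insert x (insert y \<sigma>))))"
        unfolding sg by (simp only: mult.assoc mult_minus_left)
      finally show "pos_sign e x \<sigma> * res g (insert x \<sigma>) = - (pos_sign e y \<sigma> * (pos_sign e x (insert y \<sigma>) * g (insert x (insert y \<sigma>))))" .
    qed
    also have "\<dots> = - (pos_sign e y \<sigma> * bdry N e S g (insert y \<sigma>))"
      using iS by (simp add: bdry_def sum_negf sum_distrib_left)
    finally show ?thesis using True by (simp add: res_def)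
  next
    case False
    then show ?thesis by (simp add: bdry_def res_def)
  qed
qed

lemma boundaries_S:
  "bdry N e S ` (set_chains S (Suc p) :: ('n set \<Rightarrow> 'k::field) set) \<subseteq>
    {g \<in> set_chains S p. bdry N e S g = (\<lambda>_. 0)}"
  by (rule boundaries_subset_cycles[OF finite_N inj_e S_sub(1) face_system_convex])

text \<open>A chain of degree 0 sits on the empty set, which does not contain \<open>y\<close>, so
  it belongs to the acyclic part.\<close>

lemma homology_zero: "set_homology TYPE('k::field) N e S 0 = 0"
proof -
  have "{g \<in> set_chains S 0. bdry N e S g = (\<lambda>_. 0 :: 'k)} \<subseteq> bdry N e S ` (set_chains S (Suc 0) :: ('n set \<Rightarrow> 'k) set)"
  proof
    fix g :: "'n set \<Rightarrow> 'k" assume g: "g \<in> {g \<in> set_chains S 0. bdry N e S g = (\<lambda>_. 0)}"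
    have "g \<sigma> = 0" if "y \<in> \<sigma>" for \<sigma>
    proof (rule ccontr)
      assume "g \<sigma> \<noteq> 0"
      then have "\<sigma> \<in> S" "card \<sigma> = 0" using g by (auto simp: set_chains_def)
      then show False using that S_sub finite_subset_N[of \<sigma>] card_0_eq[of \<sigma>] by blast
    qed
    then show "g \<in> bdry N e S ` (set_chains S (Suc 0) :: ('n set \<Rightarrow> 'k) set)"
      using acyclic_without_y[of g 0] g by blast
  qed
  then have "{g \<in> set_chains S 0. bdry N e S g = (\<lambda>_. 0 :: 'k)} = bdry N e S ` (set_chains S (Suc 0) :: ('n set \<Rightarrow> 'k) set)"
    by (intro equalityI boundaries_S)
  then show ?thesis by (simp add: set_homology_def)
qed

lemma bdry_chain: 
  fixes g :: "'n set \<Rightarrow> 'k::field"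
  assumes "g \<in> set_chains S (Suc p)"
  shows "bdry N e S g \<in> set_chains S p" "bdry N e S (bdry N e S g) = (\<lambda>_. 0)"
  using boundaries_S assms by blast+

text \<open>The long exact sequence of the acyclic subcomplex \<open>S0\<close>, carried out on
  cycles: the isomorphism is induced by \<open>res\<close>.\<close>

lemma homology_shift: "set_homology TYPE('k::field) N e S (Suc p) = set_homology TYPE('k) N e S' p"
  unfolding set_homology_def
proof (rule codim_eq_relation[where \<rho> = "\<lambda>g h. h = res g"])
  let ?Z = "{g \<in> set_chains S (Suc p). bdry N e S g = (\<lambda>_. 0 :: 'k)}"
  let ?Z' = "{g \<in> set_chains S' p. bdry N e S' g = (\<lambda>_. 0 :: 'k)}"
  show "\<exists>h\<in>?Z'. h = res g" if "g \<in> ?Z" for g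
  proof -
    have g: "g \<in> set_chains S (Suc p)" and cyc: "bdry N e S g = (\<lambda>_. 0)" using that by simp_all
    have "bdry N e S' (res g) = (\<lambda>_. 0)"
      unfolding res_bdry[OF g] cyc by (simp add: res_zero)
    then show ?thesis using res_chain[OF g] by auto
  qed
  show "\<exists>g\<in>?Z. h = res g" if h: "h \<in> ?Z'" for h
  proof -
    have hc: "h \<in> set_chains S' p" using h by simp
    let ?g = "lift h"
    have g: "?g \<in> set_chains S (Suc p)" using hc by (rule lift_chain)
    have "(\<lambda>_. 0) = fscale (-1) (res (bdry N e S ?g))"
      using res_bdry[OF g] h res_lift[OF hc] by simp
    then have r0: "res (bdry N e S ?g) = (\<lambda>_. 0)" by (simp add: fun_eq_iff)
    \<comment> \<open>The boundary of the lift avoids \<open>y\<close>, so it is also the boundary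
      of some \<open>l\<close> without \<open>y\<close>; subtracting \<open>l\<close> makes the lift
      a cycle.\<close>
    obtain l where l: "l \<in> set_chains S (Suc p)" "\<And>\<sigma>. y \<in> \<sigma> \<Longrightarrow> l \<sigma> = 0" "bdry N e S l = bdry N e S ?g"
      using acyclic_without_y[OF bdry_chain(1)[OF g] res_zeroD[OF bdry_chain(1)[OF g] r0] bdry_chain(2)[OF g]] by blast
    have "?g - l \<in> ?Z"
      using fs.subspace_diff[OF subspace_set_chains g l(1)] by (simp add: bdry_diff l(3) fun_eq_iff)
    moreover have "res (?g - l) = h"
      using res_lift[OF hc] res_zero[of l] l(2) by (simp add: res_diff fun_eq_iff)
    ultimately show ?thesis by (intro bexI[of _ "?g - l"]) simp_all
  qed
  show "g \<in> bdry N e S ` set_chains S (Suc (Suc p)) \<longleftrightarrow> h \<in> bdry N e S' ` set_chains S' (Suc p)"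
    if g: "g \<in> ?Z" and h: "h \<in> ?Z'" and gh: "h = res g" for g h
  proof
    assume "g \<in> bdry N e S ` set_chains S (Suc (Suc p))"
    then obtain f where f: "f \<in> set_chains S (Suc (Suc p))" "g = bdry N e S f" by blast
    have "h = bdry N e S' (fscale (-1) (res f))"
      unfolding bdry_scale res_bdry[OF f(1)] gh f(2) by simp
    then show "h \<in> bdry N e S' ` set_chains S' (Suc p)"
      using fs.subspace_scale[OF subspace_set_chains res_chain[OF f(1)], of "-1"] by (rule image_eqI)
  next
    assume "h \<in> bdry N e S' ` set_chains S' (Suc p)"
    then obtain k where k: "k \<in> set_chains S' (Suc p)" "h = bdry N e S' k" by blast
    let ?f = "lift k"
    have f: "?f \<in> set_chains S (Suc (Suc p))" using lift_chain[OF k(1)] .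
    \<comment> \<open>The plus sign compensates the sign in \<open>res_bdry\<close>, so that the
      part with \<open>y\<close> cancels.\<close>
    let ?d = "g + bdry N e S ?f"
    have d: "?d \<in> set_chains S (Suc p)" using fs.subspace_add[OF subspace_set_chains _ bdry_chain(1)[OF f]] g by simp
    have "bdry N e S' (res ?f) = h" using res_lift[OF k(1)] k(2) by simp
    then have "fscale (-1) (res (bdry N e S ?f)) = res g" using res_bdry[OF f] gh by simp
    have "res ?d \<sigma> = 0" for \<sigma>
      using fun_cong[OF \<open>fscale (-1) (res (bdry N e S ?f)) = res g\<close>, of \<sigma>] by (simp add: res_add flip: \<open>fscale (-1) (res (bdry N e S ?f)) = res g\<close>)
    then have "res ?d = (\<lambda>_. 0)" by (rule ext)
    moreover have "bdry N e S ?d = (\<lambda>_. 0)" using g bdry_chain(2)[OF f] by (simp add: bdry_add fun_eq_iff)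
    ultimately obtain l where l: "l \<in> set_chains S (Suc (Suc p))" "bdry N e S l = ?d"
      using acyclic_without_y[OF d res_zeroD[OF d]] by blast
    have "g = bdry N e S (l - ?f)" by (simp add: bdry_diff l(2) fun_eq_iff)
    moreover have "l - ?f \<in> set_chains S (Suc (Suc p))"
      by (rule fs.subspace_diff[OF subspace_set_chains l(1) f])
    ultimately show "g \<in> bdry N e S ` set_chains S (Suc (Suc p))" by (rule image_eqI)
  qed
  show "bdry N e S ` set_chains S (Suc (Suc p)) \<subseteq> ?Z"
    by (rule boundaries_subset_cycles[OF finite_N inj_e S_sub(1) face_system_convex])
  show "bdry N e S' ` set_chains S' (Suc p) \<subseteq> ?Z'"
    by (rule boundaries_subset_cycles[OF finite_N inj_e S_sub(2) face_system_convex])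
  show "fin_dim ?Z" by (rule fin_dim_mono[OF fin_dim_set_chains[OF finite_S(1)]]) blast
  show "fin_dim ?Z'" by (rule fin_dim_mono[OF fin_dim_set_chains[OF finite_S(2)]]) blast
qed (intro subspace_cycles subspace_boundaries | simp add: res_add res_scale)+

end

subsection \<open>Pulling back along a map of vertices\<close>

text \<open>On \<open>\<tau>\<close> the map \<open>f\<close> is injective and, by
  \<open>ord\<close>, compatible with the vertex orders, so pulling back along it is an isomorphism
  of chain complexes that respects signs.\<close>

lemma face_homology_inj:
  fixes f :: "'y \<Rightarrow> 'x"
  assumes fin: "finite N" "finite M" and inj: "inj_on e N" "inj_on d M" and f: "f ` N \<subseteq> M"
    and ord: "\<And>y z. y \<in> N \<Longrightarrow> z \<in> N \<Longrightarrow> f y \<noteq> f z \<Longrightarrow> e y < e z \<longleftrightarrow> d (f y) < d (f z)"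
    and \<tau>: "\<tau> \<subseteq> N" "inj_on f \<tau>"
    and \<Delta>: "\<And>\<alpha> \<beta>. \<alpha> \<in> \<Delta> \<Longrightarrow> \<beta> \<subseteq> \<alpha> \<Longrightarrow> \<beta> \<in> \<Delta>"
    and \<Gamma>: "\<And>\<alpha>. \<alpha> \<subseteq> N \<Longrightarrow> \<alpha> \<in> \<Gamma> \<longleftrightarrow> f ` \<alpha> \<in> \<Delta>"
  shows "set_homology TYPE('k::field) N e (face_system \<Gamma> \<tau>) p = set_homology TYPE('k) M d (face_system \<Delta> (f ` \<tau>)) p"
proof -
  let ?S = "face_system \<Gamma> \<tau>" and ?T = "face_system \<Delta> (f ` \<tau>)"
  have ST: "\<sigma> \<in> ?S \<longleftrightarrow> f ` \<sigma> \<in> ?T" if "\<sigma> \<subseteq> \<tau>" for \<sigma>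
  proof -
    have "f ` (\<tau> - \<sigma>) = f ` \<tau> - f ` \<sigma>" using inj_on_image_set_diff[OF \<tau>(2)] that by blast
    then show ?thesis using \<Gamma>[of "\<tau> - \<sigma>"] \<tau>(1) that by (auto simp: face_system_def)
  qed
  have fin\<tau>: "finite \<tau>" using \<tau>(1) fin(1) finite_subset by blast
  define pull :: "('x set \<Rightarrow> 'k) \<Rightarrow> 'y set \<Rightarrow> 'k"
    where "pull h \<sigma> = (if \<sigma> \<subseteq> \<tau> then h (f ` \<sigma>) else 0)" for h \<sigma>
  have pull_chain: "pull h \<in> set_chains ?S q" if "h \<in> set_chains ?T q" for h q
    unfolding set_chains_def
  proof (intro CollectI allI impI)
    fix \<sigma> assume "pull h \<sigma> \<noteq> 0"
    then have \<sigma>: "\<sigma> \<subseteq> \<tau>" "h (f ` \<sigma>) \<noteq> 0" by (auto simp: pull_def split: if_splits)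
    then show "\<sigma> \<in> ?S \<and> card \<sigma> = q" using that ST[OF \<sigma>(1)] card_image[OF inj_on_subset[OF \<tau>(2) \<sigma>(1)]]
      by (auto simp: set_chains_def)
  qed
  have pull_surj: "\<exists>h\<in>set_chains ?T q. pull h = g" if g: "g \<in> set_chains ?S q" for g q
  proof -
    define h where "h \<alpha> = (if \<alpha> \<subseteq> f ` \<tau> then g (\<tau> \<inter> f -` \<alpha>) else 0)" for \<alpha>
    have restore: "\<tau> \<inter> f -` (f ` \<sigma>) = \<sigma>" if "\<sigma> \<subseteq> \<tau>" for \<sigma> using inj_onD[OF \<tau>(2)] that by blast
    have forth: "f ` (\<tau> \<inter> f -` \<alpha>) = \<alpha>" if "\<alpha> \<subseteq> f ` \<tau>" for \<alpha> using that by blast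
    have "pull h \<sigma> = g \<sigma>" for \<sigma>
    proof (cases "\<sigma> \<subseteq> \<tau>")
      case True
      then show ?thesis using restore[OF True] image_mono[OF True, of f] by (simp add: pull_def h_def)
    next
      case False
      then have "\<sigma> \<notin> ?S" by (simp add: face_system_def)
      then show ?thesis using g False by (auto simp: pull_def set_chains_def)
    qed
    moreover have "h \<in> set_chains ?T q" unfolding set_chains_def
    proof (intro CollectI allI impI)
      fix \<alpha> assume "h \<alpha> \<noteq> 0"
      then have \<alpha>: "\<alpha> \<subseteq> f ` \<tau>" "g (\<tau> \<inter> f -` \<alpha>) \<noteq> 0" by (auto simp: h_def split: if_splits)
      then have "\<tau> \<inter> f -` \<alpha> \<in> ?S" "card (\<tau> \<inter> f -` \<alpha>) = q" using g unfolding set_chains_def by blast+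
      then show "\<alpha> \<in> ?T \<and> card \<alpha> = q"
        using ST[of "\<tau> \<inter> f -` \<alpha>"] card_image[OF inj_on_subset[OF \<tau>(2)], of "\<tau> \<inter> f -` \<alpha>"] forth[OF \<alpha>(1)] by auto
    qed
    ultimately show ?thesis by (intro bexI[of _ h]) auto
  qed
  have pull_inj: "h = (\<lambda>_. 0)" if h: "h \<in> set_chains ?T q" and "pull h = (\<lambda>_. 0)" for h q
  proof
    fix \<alpha>
    show "h \<alpha> = 0"
    proof (cases "\<alpha> \<subseteq> f ` \<tau>")
      case True
      then obtain \<sigma> where "\<sigma> \<subseteq> \<tau>" "\<alpha> = f ` \<sigma>" by (auto simp: subset_image_iff)
      then show ?thesis using fun_cong[OF \<open>pull h = (\<lambda>_. 0)\<close>, of \<sigma>] by (simp add: pull_def)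
    next
      case False
      then have "\<alpha> \<notin> ?T" by (simp add: face_system_def)
      then show ?thesis using h by (auto simp: set_chains_def)
    qed
  qed
  have pull_bdry: "bdry N e ?S (pull h) = pull (bdry M d ?T h)" if h: "h \<in> set_chains ?T q" for h q
  proof
    fix \<sigma>
    show "bdry N e ?S (pull h) \<sigma> = pull (bdry M d ?T h) \<sigma>"
    proof (cases "\<sigma> \<in> ?S")
      case True
      then have \<sigma>: "\<sigma> \<subseteq> \<tau>" "f ` \<sigma> \<in> ?T" using ST by (auto simp: face_system_def)
      have "bdry N e ?S (pull h) \<sigma> = (\<Sum>x\<in>N - \<sigma>. pos_sign e x \<sigma> * pull h (insert x \<sigma>))"
        using True by (simp add: bdry_def)
      also have "\<dots> = (\<Sum>x\<in>\<tau> - \<sigma>. pos_sign e x \<sigma> * pull h (insert x \<sigma>))"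
        using fin(1) \<tau>(1) by (intro sum.mono_neutral_right) (auto simp: pull_def)
      also have "\<dots> = (\<Sum>x\<in>\<tau> - \<sigma>. pos_sign d (f x) (f ` \<sigma>) * h (insert (f x) (f ` \<sigma>)))"
      proof (intro sum.cong refl arg_cong2[where f = "(*)"])
        fix x assume x: "x \<in> \<tau> - \<sigma>"
        have ne: "f z \<noteq> f x" if "z \<in> \<sigma>" for z using inj_onD[OF \<tau>(2), of z x] that x \<sigma> by auto
        have "{w \<in> f ` \<sigma>. d w < d (f x)} = f ` {z \<in> \<sigma>. e z < e x}"
          using ord[of _ x] ne x \<sigma>(1) \<tau>(1) by blast
        moreover have "inj_on f {z \<in> \<sigma>. e z < e x}" using \<sigma>(1) by (auto intro: inj_on_subset[OF \<tau>(2)])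
        ultimately show "pos_sign e x \<sigma> = (pos_sign d (f x) (f ` \<sigma>) :: 'k)"
          by (simp add: pos_sign_def card_image)
        show "pull h (insert x \<sigma>) = h (insert (f x) (f ` \<sigma>))" using x \<sigma>(1) by (simp add: pull_def)
      qed
      also have "\<dots> = (\<Sum>w\<in>f ` (\<tau> - \<sigma>). pos_sign d w (f ` \<sigma>) * h (insert w (f ` \<sigma>)))"
        by (subst sum.reindex) (auto intro: inj_on_subset[OF \<tau>(2)])
      also have "\<dots> = (\<Sum>w\<in>M - f ` \<sigma>. pos_sign d w (f ` \<sigma>) * h (insert w (f ` \<sigma>)))"
      proof (rule sum.mono_neutral_left)
        have eq: "f ` (\<tau> - \<sigma>) = f ` \<tau> - f ` \<sigma>" using inj_on_image_set_diff[OF \<tau>(2)] \<sigma>(1) by blast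
        show "f ` (\<tau> - \<sigma>) \<subseteq> M - f ` \<sigma>" unfolding eq using f \<tau>(1) by blast
        have "h (insert w (f ` \<sigma>)) = 0" if "w \<notin> f ` \<tau>" for w
        proof (rule ccontr)
          assume "h (insert w (f ` \<sigma>)) \<noteq> 0"
          then have "insert w (f ` \<sigma>) \<in> ?T" using h by (auto simp: set_chains_def)
          then show False using that by (simp add: face_system_def)
        qed
        then show "\<forall>w\<in>M - f ` \<sigma> - f ` (\<tau> - \<sigma>). pos_sign d w (f ` \<sigma>) * h (insert w (f ` \<sigma>)) = 0"
          unfolding eq by auto
      qed (use fin(2) in auto)
      finally show ?thesis using \<sigma> by (simp add: pull_def bdry_def)
    next
      case False
      then show ?thesis using ST[of \<sigma>] by (auto simp: bdry_def pull_def)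
    qed
  qed
  have pull_add: "pull (h + k) = pull h + pull k" for h k by (auto simp: pull_def fun_eq_iff)
  have pull_scale: "pull (fscale c h) = fscale c (pull h)" for c h by (auto simp: pull_def)
  have pull0: "pull (\<lambda>_. 0) = (\<lambda>_. 0)" by (auto simp: pull_def)
  have subS: "?S \<subseteq> Pow N" and subT: "?T \<subseteq> Pow M" using \<tau>(1) image_mono[OF \<tau>(1), of f] f
    unfolding face_system_def by blast+
  have convT: "insert x \<sigma> \<in> ?T" if "\<sigma> \<in> ?T" "insert x' (insert x \<sigma>) \<in> ?T" for x x' \<sigma>
    using that \<Delta>[of "f ` \<tau> - \<sigma>" "f ` \<tau> - insert x \<sigma>"] by (auto simp: face_system_def)
  have convS: "insert x \<sigma> \<in> ?S" if "\<sigma> \<in> ?S" "insert x' (insert x \<sigma>) \<in> ?S" for x x' \<sigma>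
  proof -
    have "insert x' (insert x \<sigma>) \<subseteq> \<tau>" using that by (simp add: face_system_def)
    then show ?thesis using that ST[of \<sigma>] ST[of "insert x \<sigma>"] ST[of "insert x' (insert x \<sigma>)"]
        convT[of "f ` \<sigma>" "f x'" "f x"] by simp
  qed
  have finST: "finite ?S" "finite ?T" using finite_subset[OF subS] finite_subset[OF subT] fin by auto
  have "set_homology TYPE('k) M d ?T p = set_homology TYPE('k) N e ?S p"
    unfolding set_homology_def
  proof (rule codim_eq_relation[where \<rho> = "\<lambda>h g. g = pull h"])
    let ?Z = "{g \<in> set_chains ?T p. bdry M d ?T g = (\<lambda>_. 0 :: 'k)}"
    let ?Z' = "{g \<in> set_chains ?S p. bdry N e ?S g = (\<lambda>_. 0 :: 'k)}"
    show B: "bdry M d ?T ` set_chains ?T (Suc p) \<subseteq> ?Z"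
      by (rule boundaries_subset_cycles[OF fin(2) inj(2) subT convT])
    show "bdry N e ?S ` set_chains ?S (Suc p) \<subseteq> ?Z'"
      by (rule boundaries_subset_cycles[OF fin(1) inj(1) subS convS])
    show "fin_dim ?Z" by (rule fin_dim_mono[OF fin_dim_set_chains[OF finST(2)]]) blast
    show "fin_dim ?Z'" by (rule fin_dim_mono[OF fin_dim_set_chains[OF finST(1)]]) blast
    show "\<exists>g\<in>?Z'. g = pull h" if "h \<in> ?Z" for h
      using that pull_chain pull_bdry[of h p] pull0 by auto
    show "\<exists>h\<in>?Z. g = pull h" if g: "g \<in> ?Z'" for g
    proof -
      obtain h where h: "h \<in> set_chains ?T p" "pull h = g" using pull_surj g by blast
      have "pull (bdry M d ?T h) = (\<lambda>_. 0)" using pull_bdry[OF h(1)] g h(2) by simp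
      moreover have "bdry M d ?T h \<sigma> \<noteq> 0 \<Longrightarrow> \<sigma> \<in> ?T" for \<sigma> by (auto simp: bdry_def split: if_splits)
      ultimately have "bdry M d ?T h = (\<lambda>_. 0)"
      proof -
        assume a: "pull (bdry M d ?T h) = (\<lambda>_. 0)"
        have "bdry M d ?T h \<alpha> = 0" for \<alpha>
        proof (cases "\<alpha> \<in> ?T")
          case True
          then obtain \<sigma> where "\<sigma> \<subseteq> \<tau>" "\<alpha> = f ` \<sigma>" by (auto simp: face_system_def subset_image_iff)
          then show ?thesis using fun_cong[OF a, of \<sigma>] by (simp add: pull_def)
        qed (simp add: bdry_def)
        then show ?thesis by auto
      qed
      then show ?thesis using h by blast
    qed
    show "h \<in> bdry M d ?T ` set_chains ?T (Suc p) \<longleftrightarrow> g \<in> bdry N e ?S ` set_chains ?S (Suc p)"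
      if h: "h \<in> ?Z" and g: "g \<in> ?Z'" and gh: "g = pull h" for h g
    proof
      assume "h \<in> bdry M d ?T ` set_chains ?T (Suc p)"
      then obtain k where k: "k \<in> set_chains ?T (Suc p)" "h = bdry M d ?T k" by blast
      then have "g = bdry N e ?S (pull k)" using pull_bdry[OF k(1)] gh by simp
      then show "g \<in> bdry N e ?S ` set_chains ?S (Suc p)" using pull_chain[OF k(1)] by blast
    next
      assume "g \<in> bdry N e ?S ` set_chains ?S (Suc p)"
      then obtain l where l: "l \<in> set_chains ?S (Suc p)" "g = bdry N e ?S l" by blast
      obtain k where k: "k \<in> set_chains ?T (Suc p)" "pull k = l" using pull_surj l(1) by blast
      have eq: "pull h = pull (bdry M d ?T k)" using pull_bdry[OF k(1)] l k gh by simp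
      have "bdry M d ?T k \<in> set_chains ?T p" using B k(1) by blast
      then have "h + fscale (-1) (bdry M d ?T k) \<in> set_chains ?T p"
        using h by (intro fs.subspace_add[OF subspace_set_chains] fs.subspace_scale[OF subspace_set_chains]) simp_all
      moreover have "pull (h + fscale (-1) (bdry M d ?T k)) = (\<lambda>_. 0)"
        unfolding pull_add pull_scale eq by (simp add: fun_eq_iff)
      ultimately have "h + fscale (-1) (bdry M d ?T k) = (\<lambda>_. 0)" by (rule pull_inj)
      then have "h = bdry M d ?T k" by (simp add: fun_eq_iff)
      then show "h \<in> bdry M d ?T ` set_chains ?T (Suc p)" using k(1) by blast
    qed
  qed (intro subspace_cycles subspace_boundaries | simp add: pull_add pull_scale)+
  then show ?thesis by simp
qed

subsection \<open>The Taylor resolution\<close>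

text \<open>Provides a resolution for the choice in the definition of \<open>betti\<close>. The
  generators are all nonfaces, minimal or not, and \<open>d\<close> orders them for the
  signs.\<close>

locale taylor =
  fixes V :: "'x set" and \<Delta> :: "'x set set" and d :: "'x set \<Rightarrow> nat"
  assumes finite_V: "finite V" and \<Delta>: "simplicial_complex V \<Delta>"
    and inj_d: "inj_on d {\<nu>. \<nu> \<subseteq> V \<and> \<nu> \<notin> \<Delta>}"
begin

definition nf :: "'x set set" where "nf = {\<nu>. \<nu> \<subseteq> V \<and> \<nu> \<notin> \<Delta>}"

lemma finite_nf: "finite nf"
  using finite_V by (auto simp: nf_def intro: finite_subset[of _ "Pow V"])

lemma Union_nf: "S \<subseteq> nf \<Longrightarrow> \<Union>S \<subseteq> V" "S \<subseteq> nf \<Longrightarrow> finite (\<Union>S)"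
proof -
  assume "S \<subseteq> nf"
  then show "\<Union>S \<subseteq> V" by (auto simp: nf_def)
  then show "finite (\<Union>S)" using finite_V finite_subset by blast
qed

sublocale labelled_simplex nf d "\<lambda>S. sqf (\<Union>S)"
proof unfold_locales
  show "finite nf" by (rule finite_nf)
  show "inj_on d nf" using inj_d by (simp add: nf_def)
  fix S x assume "S \<subseteq> nf" "x \<in> nf"
  then have "finite (\<Union>S)" "finite (\<Union>(insert x S))" using Union_nf(2)[of S] Union_nf(2)[of "insert x S"] by auto
  then show "mon_le (sqf (\<Union>S)) (sqf (\<Union>(insert x S)))" by (simp add: mon_le_def lookup_sqf)
qed

definition basis :: "nat \<Rightarrow> 'x set set set" where
  "basis i = {S. S \<subseteq> nf \<and> card S = i}"

lemma finite_basis: "finite (basis i)"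
  using finite_nf by (auto simp: basis_def intro: finite_subset[of _ "Pow nf"])

definition enum :: "nat \<Rightarrow> nat \<Rightarrow> 'x set set" where
  "enum i = (SOME f. bij_betw f {..<card (basis i)} (basis i))"

lemma enum: "bij_betw (enum i) {..<card (basis i)} (basis i)"
proof -
  have "\<exists>f. bij_betw f {..<card (basis i)} (basis i)"
    using ex_bij_betw_nat_finite[OF finite_basis, of i] by (simp add: atLeast0LessThan)
  then show ?thesis unfolding enum_def by (rule someI_ex)
qed

lemma enum_mem: "a < card (basis i) \<Longrightarrow> enum i a \<subseteq> nf \<and> card (enum i a) = i"
  using bij_betwE[OF enum[of i]] by (auto simp: basis_def)

lemma enum_inj: "a < card (basis i) \<Longrightarrow> b < card (basis i) \<Longrightarrow> enum i a = enum i b \<longleftrightarrow> a = b"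
  using bij_betw_imp_inj_on[OF enum[of i]] by (auto dest: inj_onD)

lemma enum_surj: "S \<subseteq> nf \<Longrightarrow> card S = i \<Longrightarrow> \<exists>a<card (basis i). enum i a = S"
proof -
  assume "S \<subseteq> nf" "card S = i"
  then have "S \<in> enum i ` {..<card (basis i)}"
    using bij_betw_imp_surj_on[OF enum[of i]] by (simp add: basis_def)
  then show ?thesis by blast
qed

definition label_diff :: "'x set set \<Rightarrow> 'x set set \<Rightarrow> 'x mon" where
  "label_diff T S = sqf (\<Union>T) - sqf (\<Union>S)"

text \<open>The shift is the degree of the least common multiple of the chosen generators. In a
  matrix entry at most one \<open>x\<close> contributes, the generator by which the larger set
  exceeds the smaller one.\<close>

definition taylor_complex :: "('x, 'k::field) free_complex" where
  "taylor_complex = \<lparr>rk = (\<lambda>i. card (basis i)), shift = (\<lambda>i a. card (\<Union>(enum i a))),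
     bnd = (\<lambda>i a b. \<Sum>x\<in>nf - enum i a. if insert x (enum i a) = enum (Suc i) b
       then const (pos_sign d x (enum i a)) * monomial_poly (label_diff (insert x (enum i a)) (enum i a)) else 0),
     aug = (\<lambda>_. 1)\<rparr>"

text \<open>Turns a vector of numbered coordinates into a function on sets of nonfaces, where
  \<open>label_bdry\<close> applies.\<close>

definition cochain :: "nat \<Rightarrow> (nat \<Rightarrow> ('x, 'k::field) mpoly) \<Rightarrow> 'x set set \<Rightarrow> ('x, 'k) mpoly" where
  "cochain i v S = (\<Sum>a<card (basis i). if enum i a = S then v a else 0)"

lemma cochain_enum: "a < card (basis i) \<Longrightarrow> cochain i v (enum i a) = v a"
proof -
  assume a: "a < card (basis i)"
  have "cochain i v (enum i a) = (\<Sum>a'<card (basis i). if a' = a then v a' else 0)"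
    unfolding cochain_def using a by (intro sum.cong refl) (simp add: enum_inj)
  then show ?thesis using a by simp
qed

lemma cochain_outside: "\<not> (S \<subseteq> nf \<and> card S = i) \<Longrightarrow> cochain i v S = 0"
  unfolding cochain_def using enum_mem by (intro sum.neutral) auto

lemma mat_apply_taylor:
  fixes v :: "nat \<Rightarrow> ('x, 'k::field) mpoly"
  assumes a: "a < card (basis i)"
  shows "mat_apply (card (basis i)) (card (basis (Suc i))) (bnd (taylor_complex :: ('x, 'k) free_complex) i) v a
    = label_bdry (cochain (Suc i) v) (enum i a)"
proof -
  let ?S = "enum i a" and ?n = "card (basis (Suc i))"
  let ?t = "\<lambda>x. const (pos_sign d x ?S) * monomial_poly (label_diff (insert x ?S) ?S) :: ('x, 'k) mpoly"
  have "mat_apply (card (basis i)) ?n (bnd (taylor_complex :: ('x, 'k) free_complex) i) v a =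
      (\<Sum>b<?n. (\<Sum>x\<in>nf - ?S. if insert x ?S = enum (Suc i) b then ?t x else 0) * v b)"
    using a by (simp add: mat_apply_def taylor_complex_def)
  also have "\<dots> = (\<Sum>b<?n. \<Sum>x\<in>nf - ?S. ?t x * (if enum (Suc i) b = insert x ?S then v b else 0))"
    unfolding sum_distrib_right by (intro sum.cong refl) auto
  also have "\<dots> = (\<Sum>x\<in>nf - ?S. \<Sum>b<?n. ?t x * (if enum (Suc i) b = insert x ?S then v b else 0))"
    by (rule sum.swap)
  also have "\<dots> = (\<Sum>x\<in>nf - ?S. ?t x * cochain (Suc i) v (insert x ?S))"
    by (simp only: cochain_def sum_distrib_left)
  also have "\<dots> = label_bdry (cochain (Suc i) v) ?S"
    by (simp only: label_bdry_def label_diff_def mult.assoc)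
  finally show ?thesis .
qed

lemma sr_ideal_monomial:
  "\<nu> \<in> nf \<Longrightarrow> f \<in> carrier (poly_ring V) \<Longrightarrow> monomial_poly (sqf \<nu>) * f \<in> sr_ideal V \<Delta>"
proof -
  assume \<nu>: "\<nu> \<in> nf" and f: "f \<in> carrier (poly_ring V)"
  have fin: "finite \<nu>" using Union_nf(2)[of "{\<nu>}"] \<nu> by simp
  show ?thesis unfolding sr_ideal_def carrier_poly_ring
  proof (intro CollectI conjI ballI)
    fix m assume "m \<in> keys (monomial_poly (sqf \<nu>) * f)"
    from in_keys_mult[OF this] obtain l where l: "l \<in> keys f" "m = sqf \<nu> + l"
      by (auto simp: monomial_poly_def)
    then have k: "keys m = \<nu> \<union> keys l" using fin by (simp add: keys_mon_add keys_sqf)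
    show "keys m \<subseteq> V" unfolding k using \<nu> f l by (auto simp: nf_def carrier_poly_ring)
    show "keys m \<notin> \<Delta>" unfolding k using \<nu> \<Delta> by (auto simp: nf_def simplicial_complex_def)
  qed
qed

lemma sr_ideal_sum:
  assumes "\<And>a. a \<in> A \<Longrightarrow> f a \<in> sr_ideal V \<Delta>"
  shows "sum f A \<in> sr_ideal V \<Delta>"
  unfolding sr_ideal_def
proof (intro CollectI conjI ballI)
  show "sum f A \<in> carrier (poly_ring V)" using assms by (intro poly_ring_sum) (simp add: sr_ideal_def)
  fix m assume "m \<in> keys (sum f A)"
  from in_keys_sumD[OF this] show "keys m \<notin> \<Delta>" using assms by (auto simp: sr_ideal_def)
qed

lemma label_diff_keys:
  assumes "S \<subseteq> nf" "x \<in> nf"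
  shows "keys (label_diff (insert x S) S) \<subseteq> V"
    and "mon_degree (label_diff (insert x S) S) + card (\<Union>S) = card (\<Union>(insert x S))"
proof -
  have fin: "finite (\<Union>S)" "finite (\<Union>(insert x S))" and V: "\<Union>(insert x S) \<subseteq> V"
    using Union_nf[of S] Union_nf[of "insert x S"] assms by auto
  have le: "mon_le (sqf (\<Union>S)) (sqf (\<Union>(insert x S)))" using label_mono[OF assms] .
  have eq: "label_diff (insert x S) S + sqf (\<Union>S) = sqf (\<Union>(insert x S))"
    unfolding label_diff_def by (rule mon_le_diff_add[OF le])
  have "keys (label_diff (insert x S) S) \<subseteq> keys (label_diff (insert x S) S + sqf (\<Union>S))" by (simp add: keys_mon_add)
  then show "keys (label_diff (insert x S) S) \<subseteq> V" unfolding eq using V fin keys_sqf[OF fin(2)] by blast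
  show "mon_degree (label_diff (insert x S) S) + card (\<Union>S) = card (\<Union>(insert x S))"
    using arg_cong[OF eq, of mon_degree] fin by (simp add: mon_degree_add mon_degree_sqf)
qed

text \<open>
  If \<open>x\<^sup>b\<close> is not a standard monomial then the label of \<open>S\<close> divides \<open>x\<^sup>b\<close> exactly when that of
  \<open>S \<union> {supp b}\<close> does, so the strand of the complex in multidegree \<open>b\<close> is a cone.
\<close>

lemma taylor_exact:
  fixes c :: "'x set set \<Rightarrow> ('x, 'k::field) mpoly"
  assumes out: "\<And>S. \<not> (S \<subseteq> nf \<and> card S = i) \<Longrightarrow> c S = 0" and car: "\<And>S. c S \<in> carrier (poly_ring V)"
    and cyc: "label_bdry c = (\<lambda>_. 0)" and 0: "i = 0 \<Longrightarrow> c {} \<in> sr_ideal V \<Delta>"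
  shows "\<exists>u\<in>free_mod V (card (basis (Suc i))). label_bdry (cochain (Suc i) u) = c"
proof -
  have "\<exists>c'. label_bdry c' = c \<and> (\<forall>S. \<not> S \<subseteq> nf \<longrightarrow> c' S = 0) \<and>
    (\<forall>S m. lookup (c' S) m \<noteq> 0 \<longrightarrow>
      (\<exists>x\<in>S. lookup (c (S - {x})) (m + (sqf (\<Union>S) - sqf (\<Union>(S - {x})))) \<noteq> 0))"
  proof (rule label_bdry_exact[OF _ cyc])
    show "c S = 0" if "\<not> S \<subseteq> nf" for S using out that by blast
    fix b S assume "coord c b S \<noteq> 0"
    then have le: "mon_le (sqf (\<Union>S)) b" and nz: "lookup (c S) (b - sqf (\<Union>S)) \<noteq> 0"
      by (auto simp: coord_def split: if_splits)
    then have "c S \<noteq> 0" by auto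
    then have S: "S \<subseteq> nf" "card S = i" using out by blast+
    have b: "b = b - sqf (\<Union>S) + sqf (\<Union>S)" using mon_le_diff_add[OF le] by simp
    have "keys (b - sqf (\<Union>S)) \<subseteq> V" using car[of S] nz by (auto simp: carrier_poly_ring in_keys_iff)
    then have "keys (b - sqf (\<Union>S) + sqf (\<Union>S)) \<subseteq> V"
      using Union_nf[OF S(1)] by (auto simp: keys_mon_add keys_sqf)
    then have bV: "keys b \<subseteq> V" using b by simp
    \<comment> \<open>In degree 0 this is the membership of \<open>c {}\<close> in the ideal; in
      higher degree some nonface of \<open>S\<close> lies in the support of
      \<open>b\<close>.\<close>
    have "keys b \<notin> \<Delta>"
    proof (cases "i = 0")
      case True
      then have "S = {}" using S finite_subset[OF S(1) finite_nf] by simp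
      then have "b \<in> keys (c {})" using nz by (simp add: in_keys_iff)
      then show ?thesis using 0[OF True] by (auto simp: sr_ideal_def)
    next
      case False
      then obtain \<nu> where \<nu>: "\<nu> \<in> S" using S by fastforce
      have "\<Union>S \<subseteq> keys b" using le Union_nf(2)[OF S(1)] by (simp add: mon_le_sqf)
      then have "\<nu> \<subseteq> keys b" using \<nu> by blast
      moreover have "\<nu> \<notin> \<Delta>" using \<nu> S(1) by (auto simp: nf_def)
      ultimately show ?thesis using \<Delta> by (auto simp: simplicial_complex_def)
    qed
    then have bn: "keys b \<in> nf" using bV by (simp add: nf_def)
    have "mon_le (sqf (\<Union>(insert (keys b) T))) b" if T: "T \<subseteq> nf" "mon_le (sqf (\<Union>T)) b" for T
    proof -
      have "\<Union>T \<subseteq> keys b" using T Union_nf(2)[OF T(1)] by (simp add: mon_le_sqf)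
      then show ?thesis using Union_nf(2)[of "insert (keys b) T"] T(1) bn by (simp add: mon_le_sqf)
    qed
    then show "\<exists>x\<in>nf. \<forall>T. T \<subseteq> nf \<and> mon_le (sqf (\<Union>T)) b \<longrightarrow> mon_le (sqf (\<Union>(insert x T))) b"
      using bn by blast
  qed
  then obtain c' where c': "label_bdry c' = c" "\<And>S. \<not> S \<subseteq> nf \<Longrightarrow> c' S = 0"
    and mon: "\<And>S m. lookup (c' S) m \<noteq> 0 \<Longrightarrow>
      \<exists>x\<in>S. lookup (c (S - {x})) (m + (sqf (\<Union>S) - sqf (\<Union>(S - {x})))) \<noteq> 0" by (elim exE conjE) simp
  have key: "card S = Suc i \<and> keys m \<subseteq> V" if m: "m \<in> keys (c' S)" for S m
  proof -
    have "c' S \<noteq> 0" using m by auto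
    then have "finite S" using c'(2) finite_subset[OF _ finite_nf] by blast
    obtain x where x: "x \<in> S" "lookup (c (S - {x})) (m + (sqf (\<Union>S) - sqf (\<Union>(S - {x})))) \<noteq> 0"
      using mon[of S m] m by (auto simp: in_keys_iff)
    then have "c (S - {x}) \<noteq> 0" by auto
    then have "card (S - {x}) = i" using out by blast
    then have "card S = Suc i" using card_Suc_Diff1[OF \<open>finite S\<close> x(1)] by simp
    moreover have "keys (m + (sqf (\<Union>S) - sqf (\<Union>(S - {x})))) \<subseteq> V"
      using car[of "S - {x}"] x(2) by (auto simp: carrier_poly_ring in_keys_iff)
    ultimately show ?thesis by (simp add: keys_mon_add)
  qed
  define u where "u a = (if a < card (basis (Suc i)) then c' (enum (Suc i) a) else 0)" for a
  have "u \<in> free_mod V (card (basis (Suc i)))"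
    using key by (auto simp: free_mod_def u_def carrier_poly_ring)
  moreover have "cochain (Suc i) u S = c' S" for S
  proof (cases "S \<subseteq> nf \<and> card S = Suc i")
    case True
    then obtain a where "a < card (basis (Suc i))" "enum (Suc i) a = S" using enum_surj by blast
    then show ?thesis using cochain_enum[of a "Suc i" u] by (simp add: u_def)
  next
    case False
    have "c' S = 0"
    proof (rule ccontr)
      assume "c' S \<noteq> 0"
      then have "keys (c' S) \<noteq> {}" by simp
      then obtain m where "m \<in> keys (c' S)" by blast
      then show False using key c'(2) False \<open>c' S \<noteq> 0\<close> by blast
    qed
    then show ?thesis using cochain_outside[OF False] by simp
  qed
  then have "cochain (Suc i) u = c'" by (rule ext)
  ultimately show ?thesis using c'(1) by blast
qed

lemma cochain_carrier: "v \<in> free_mod V (card (basis i)) \<Longrightarrow> cochain i v S \<in> carrier (poly_ring V)"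
  unfolding cochain_def by (intro poly_ring_sum) (auto simp: free_mod_def)

lemma label_bdry_outside_basis:
  fixes c :: "'x set set \<Rightarrow> ('x, 'k::field) mpoly"
  assumes "\<And>S. \<not> (S \<subseteq> nf \<and> card S = Suc i) \<Longrightarrow> c S = 0" "\<not> (S \<subseteq> nf \<and> card S = i)"
  shows "label_bdry c S = 0"
proof (cases "S \<subseteq> nf")
  case True
  have "c (insert x S) = 0" if "x \<in> nf - S" for x
    using assms that True finite_subset[OF True finite_nf] by simp
  then show ?thesis by (simp add: label_bdry_def)
next
  case False
  then show ?thesis using assms(1) by (intro label_bdry_outside) blast+
qed

lemma basis_0: "basis 0 = {{}}"
  using finite_subset[OF _ finite_nf] by (auto simp: basis_def)

lemma enum_0: "enum 0 0 = {}"
  using enum_mem[of 0 0] basis_0 finite_subset[OF _ finite_nf, of "enum 0 0"] by simp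

lemma taylor_resolution:
  "graded_free_resolution V (sr_ideal V \<Delta>) (taylor_complex :: ('x, 'k::field) free_complex)"
  unfolding graded_free_resolution_def
proof (intro conjI allI impI ballI)
  let ?F = "taylor_complex :: ('x, 'k) free_complex"
  have rk: "rk ?F i = card (basis i)" for i by (simp add: taylor_complex_def)
  have rk0: "rk ?F 0 = 1" by (simp add: rk basis_0)
  have aug: "aug ?F a = 1" for a by (simp add: taylor_complex_def)
  show "aug ?F a \<in> carrier (poly_ring V)" for a by (simp add: aug)
  show "mon_degree m = shift ?F 0 a" if "a < rk ?F 0" "m \<in> keys (aug ?F a)" for a m
  proof -
    have "a = 0" using that(1) rk0 by simp
    then show ?thesis using that(2) enum_0 by (simp add: aug mon_degree_def taylor_complex_def)
  qed
  fix i
  show "bnd ?F i a b \<in> carrier (poly_ring V)" if ab: "a < rk ?F i" "b < rk ?F (Suc i)" for a b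
  proof -
    have "enum i a \<subseteq> nf" using enum_mem ab by (simp add: rk)
    then have mono: "monomial_poly (label_diff (insert x (enum i a)) (enum i a)) \<in> carrier (poly_ring V :: ('x, 'k) mpoly ring)"
      if "x \<in> nf - enum i a" for x
      using label_diff_keys(1) that unfolding monomial_poly_def by (intro poly_ring_single) blast
    have mem_if: "(if c then p else 0) \<in> carrier (poly_ring V)" if "p \<in> carrier (poly_ring V)"
      for c and p :: "('x, 'k) mpoly" using that by simp
    show ?thesis unfolding taylor_complex_def free_complex.simps
      by (intro poly_ring_sum mem_if poly_ring_mult poly_ring_const mono)
  qed
  show "mon_degree m + shift ?F i a = shift ?F (Suc i) b"
    if ab: "a < rk ?F i" "b < rk ?F (Suc i)" and m: "m \<in> keys (bnd ?F i a b)" for a b m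
  proof -
    have S: "enum i a \<subseteq> nf" using enum_mem ab by (simp add: rk)
    have "m \<in> keys (\<Sum>x\<in>nf - enum i a. if insert x (enum i a) = enum (Suc i) b
       then const (pos_sign d x (enum i a)) * monomial_poly (label_diff (insert x (enum i a)) (enum i a)) else 0 :: ('x, 'k) mpoly)"
      using m by (simp add: taylor_complex_def)
    from in_keys_sumD[OF this] obtain x where x: "x \<in> nf - enum i a"
      "m \<in> keys (if insert x (enum i a) = enum (Suc i) b
       then const (pos_sign d x (enum i a)) * monomial_poly (label_diff (insert x (enum i a)) (enum i a)) else 0 :: ('x, 'k) mpoly)"
      by (rule bexE)
    then have eq: "insert x (enum i a) = enum (Suc i) b" by (auto split: if_splits)
    then have "m \<in> keys (const (pos_sign d x (enum i a)) * monomial_poly (label_diff (insert x (enum i a)) (enum i a)) :: ('x, 'k) mpoly)"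
      using x(2) by simp
    then have "m = label_diff (insert x (enum i a)) (enum i a)"
      by (auto simp: monomial_poly_def const_def mult_single split: if_splits)
    then show ?thesis using label_diff_keys(2)[OF S, of x] x(1) eq by (simp add: taylor_complex_def)
  qed
  show "\<exists>v\<in>free_mod V (rk ?F 0). f - (\<Sum>a<rk ?F 0. v a * aug ?F a) \<in> sr_ideal V \<Delta>"
    if "f \<in> carrier (poly_ring V)" for f
    using that by (intro bexI[of _ "\<lambda>a. if a = 0 then f else 0"])
      (auto simp: rk0 aug free_mod_def sr_ideal_def)
  have free_out: "v a = 0" if "v \<in> free_mod V (card (basis i))" "\<not> a < card (basis i)" for v :: "nat \<Rightarrow> ('x, 'k) mpoly" and a i
    using that by (simp add: free_mod_def)
  have mat: "mat_apply (rk ?F i) (rk ?F (Suc i)) (bnd ?F i) v =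
      (\<lambda>a. if a < card (basis i) then label_bdry (cochain (Suc i) v) (enum i a) else 0)"
    for i and v :: "nat \<Rightarrow> ('x, 'k) mpoly"
    using mat_apply_taylor[of _ i v] by (auto simp: rk fun_eq_iff) (simp add: mat_apply_def)
  \<comment> \<open>Translates the matrices into the labelled boundary, so that exactness at every
    module reduces to \<open>taylor_exact\<close>.\<close>
  have cochain_mat: "cochain i (mat_apply (rk ?F i) (rk ?F (Suc i)) (bnd ?F i) v) = label_bdry (cochain (Suc i) v)"
    for i and v :: "nat \<Rightarrow> ('x, 'k) mpoly"
  proof
    fix S
    show "cochain i (mat_apply (rk ?F i) (rk ?F (Suc i)) (bnd ?F i) v) S = label_bdry (cochain (Suc i) v) S"
    proof (cases "S \<subseteq> nf \<and> card S = i")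
      case True
      then obtain a where "a < card (basis i)" "enum i a = S" using enum_surj by blast
      then show ?thesis using cochain_enum[of a i "mat_apply (rk ?F i) (rk ?F (Suc i)) (bnd ?F i) v"] unfolding mat by simp
    next
      case False
      then show ?thesis using cochain_outside label_bdry_outside_basis[of i "cochain (Suc i) v" S] by metis
    qed
  qed
  have cochain_eqD: "v = w" if "cochain i v = cochain i w" "v \<in> free_mod V (card (basis i))" "w \<in> free_mod V (card (basis i))"
    for v w :: "nat \<Rightarrow> ('x, 'k) mpoly" and i
  proof
    fix a show "v a = w a"
    proof (cases "a < card (basis i)")
      case True
      then show ?thesis using cochain_enum[OF True, of v] cochain_enum[OF True, of w] that(1) by simp
    next
      case False
      then show ?thesis using free_out[OF that(2) False] free_out[OF that(3) False] by simp
    qed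
  qed
  have mat_free: "mat_apply (rk ?F i) (rk ?F (Suc i)) (bnd ?F i) v \<in> free_mod V (card (basis i))"
    if "v \<in> free_mod V (card (basis (Suc i)))" for i and v :: "nat \<Rightarrow> ('x, 'k) mpoly"
  proof -
    have "label_bdry (cochain (Suc i) v) (enum i a) \<in> carrier (poly_ring V)" if a: "a < card (basis i)" for a
    proof -
      have S: "enum i a \<subseteq> nf" using enum_mem[OF a] by simp
      show ?thesis unfolding label_bdry_def
      proof (intro poly_ring_sum poly_ring_mult poly_ring_const cochain_carrier[OF \<open>v \<in> _\<close>])
        fix x assume "x \<in> nf - enum i a"
        then show "monomial_poly (sqf (\<Union>(insert x (enum i a))) - sqf (\<Union>(enum i a))) \<in> carrier (poly_ring V)"
          using label_diff_keys(1)[OF S, of x] unfolding monomial_poly_def label_diff_def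
          by (intro poly_ring_single) auto
      qed
    qed
    then show ?thesis unfolding mat by (simp add: free_mod_def)
  qed
  \<comment> \<open>For \<open>i = 0\<close> the relevant kernel is that of the map to the quotient
    ring, hence the extra condition of membership in the ideal.\<close>
  have lift: "\<exists>u\<in>free_mod V (rk ?F (Suc i)). v = mat_apply (rk ?F i) (rk ?F (Suc i)) (bnd ?F i) u"
    if v: "v \<in> free_mod V (card (basis i))" and cyc: "label_bdry (cochain i v) = (\<lambda>_. 0)"
      and 0: "i = 0 \<Longrightarrow> cochain 0 v {} \<in> sr_ideal V \<Delta>" for i and v :: "nat \<Rightarrow> ('x, 'k) mpoly"
  proof -
    obtain u where u: "u \<in> free_mod V (card (basis (Suc i)))" "label_bdry (cochain (Suc i) u) = cochain i v"
      using taylor_exact[of i "cochain i v", OF cochain_outside cochain_carrier[OF v] cyc] 0 by blast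
    then have "cochain i v = cochain i (mat_apply (rk ?F i) (rk ?F (Suc i)) (bnd ?F i) u)" using cochain_mat by metis
    then have "v = mat_apply (rk ?F i) (rk ?F (Suc i)) (bnd ?F i) u" using cochain_eqD v mat_free[OF u(1)] by blast
    then show ?thesis using u(1) rk by metis
  qed
  have card0: "card (basis 0) = 1" by (simp add: basis_0)
  have coch0: "cochain 0 v {} = v 0" for v :: "nat \<Rightarrow> ('x, 'k) mpoly"
    using cochain_enum[of 0 0 v] enum_0 card0 by simp
  have augsum: "(\<Sum>a<rk ?F 0. v a * aug ?F a) = v 0" for v :: "nat \<Rightarrow> ('x, 'k) mpoly"
    by (simp add: rk0 aug)
  show "{v \<in> free_mod V (rk ?F 0). (\<Sum>a<rk ?F 0. v a * aug ?F a) \<in> sr_ideal V \<Delta>} =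
      mat_apply (rk ?F 0) (rk ?F 1) (bnd ?F 0) ` free_mod V (rk ?F 1)" (is "?A = ?B")
  proof
    show "?A \<subseteq> ?B"
    proof
      fix v assume "v \<in> ?A"
      then have v: "v \<in> free_mod V (card (basis 0))" "v 0 \<in> sr_ideal V \<Delta>" unfolding augsum by (simp_all add: rk)
      have "label_bdry (cochain 0 v) S = 0" for S
      proof -
        have "cochain 0 v (insert x S) = 0" if "x \<in> nf - S" for x
        proof (rule cochain_outside, rule notI)
          assume "insert x S \<subseteq> nf \<and> card (insert x S) = 0"
          then show False using finite_subset[OF _ finite_nf, of "insert x S"] by auto
        qed
        then show ?thesis by (simp add: label_bdry_def)
      qed
      then have "label_bdry (cochain 0 v) = (\<lambda>_. 0)" by (rule ext)
      then obtain u where u: "u \<in> free_mod V (rk ?F (Suc 0))" "v = mat_apply (rk ?F 0) (rk ?F (Suc 0)) (bnd ?F 0) u"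
        using lift[of v 0] v coch0 by auto
      then show "v \<in> ?B" by simp
    qed
    show "?B \<subseteq> ?A"
    proof (rule image_subsetI)
      fix u :: "nat \<Rightarrow> ('x, 'k) mpoly" assume u: "u \<in> free_mod V (rk ?F 1)"
      let ?v = "mat_apply (rk ?F 0) (rk ?F (Suc 0)) (bnd ?F 0) u"
      have "?v \<in> free_mod V (rk ?F 0)" using mat_free[of u 0] u by (simp add: rk)
      moreover have "?v 0 = label_bdry (cochain (Suc 0) u) {}" unfolding mat using card0 enum_0 by simp
      moreover have "label_bdry (cochain (Suc 0) u) {} \<in> sr_ideal V \<Delta>"
      proof -
        have "const (pos_sign d x {}) * (monomial_poly (sqf (\<Union>(insert x {})) - sqf (\<Union>{})) * cochain (Suc 0) u (insert x {}))
           \<in> sr_ideal V \<Delta>" if "x \<in> nf - {}" for x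
        proof -
          have "u \<in> free_mod V (card (basis (Suc 0)))" using u by (simp add: rk)
          then have "const (pos_sign d x {}) * cochain (Suc 0) u {x} \<in> carrier (poly_ring V)"
            by (intro poly_ring_mult poly_ring_const cochain_carrier)
          then have "monomial_poly (sqf x) * (const (pos_sign d x {}) * cochain (Suc 0) u {x}) \<in> sr_ideal V \<Delta>"
            using that by (intro sr_ideal_monomial) auto
          then show ?thesis by (simp add: mult.left_commute)
        qed
        then show ?thesis unfolding label_bdry_def by (rule sr_ideal_sum)
      qed
      ultimately show "mat_apply (rk ?F 0) (rk ?F 1) (bnd ?F 0) u \<in> ?A" unfolding augsum by simp
    qed
  qed
  fix i
  show "{v \<in> free_mod V (rk ?F (Suc i)). mat_apply (rk ?F i) (rk ?F (Suc i)) (bnd ?F i) v = (\<lambda>_. 0)} =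
      mat_apply (rk ?F (Suc i)) (rk ?F (Suc (Suc i))) (bnd ?F (Suc i)) ` free_mod V (rk ?F (Suc (Suc i)))" (is "?A = ?B")
  proof
    show "?A \<subseteq> ?B"
    proof
      fix v assume v: "v \<in> ?A"
      have "cochain i (\<lambda>_. 0) = (\<lambda>_. 0 :: ('x, 'k) mpoly)" by (auto simp: cochain_def)
      then have "label_bdry (cochain (Suc i) v) = (\<lambda>_. 0)" using cochain_mat[of i v] v by simp
      then obtain u where "u \<in> free_mod V (rk ?F (Suc (Suc i)))"
        "v = mat_apply (rk ?F (Suc i)) (rk ?F (Suc (Suc i))) (bnd ?F (Suc i)) u"
        using lift[of v "Suc i"] v by (auto simp: rk)
      then show "v \<in> ?B" by simp
    qed
    show "?B \<subseteq> ?A"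
    proof (rule image_subsetI)
      fix u :: "nat \<Rightarrow> ('x, 'k) mpoly" assume u: "u \<in> free_mod V (rk ?F (Suc (Suc i)))"
      let ?v = "mat_apply (rk ?F (Suc i)) (rk ?F (Suc (Suc i))) (bnd ?F (Suc i)) u"
      have v: "?v \<in> free_mod V (card (basis (Suc i)))" using mat_free[of u "Suc i"] u by (simp add: rk)
      have "label_bdry (cochain (Suc i) ?v) = (\<lambda>_. 0)"
        unfolding cochain_mat using cochain_outside by (intro label_bdry_bdry) blast
      then have "mat_apply (rk ?F i) (rk ?F (Suc i)) (bnd ?F i) ?v = (\<lambda>_. 0)"
        unfolding mat[of i ?v] by (simp add: fun_eq_iff)
      then show "?v \<in> ?A" using v by (simp add: rk)
    qed
  qed
qed

end

lemma sr_resolution_exists: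
  fixes V :: "'x set"
  assumes "finite V" "simplicial_complex V \<Delta>"
  shows "\<exists>F. graded_free_resolution V (sr_ideal V \<Delta>) (F :: ('x, 'k::field) free_complex)"
proof -
  have "finite {\<nu>. \<nu> \<subseteq> V \<and> \<nu> \<notin> \<Delta>}" using assms(1) by (auto intro: finite_subset[of _ "Pow V"])
  then obtain d :: "'x set \<Rightarrow> nat" where "inj_on d {\<nu>. \<nu> \<subseteq> V \<and> \<nu> \<notin> \<Delta>}"
    using finite_imp_inj_to_nat_seg by metis
  then interpret taylor V \<Delta> d using assms by unfold_locales
  show ?thesis using taylor_resolution by blast
qed

subsection \<open>Betti numbers of the jet complex\<close>

text \<open>The comparison with the Koszul complex covers every resolution, in particular the one
  chosen by \<open>SOME\<close>; the Taylor resolution shows that the choice is not vacuous.\<close>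

lemma betti_sr_ideal:
  assumes "finite V" "inj_on e V" "simplicial_complex V \<Delta>"
  shows "betti V (sr_ideal V \<Delta> :: ('x, 'k::field) mpoly set) i j =
    (\<Sum>\<tau> | \<tau> \<subseteq> V \<and> card \<tau> = j. set_homology TYPE('k) V e (face_system \<Delta> \<tau>) i)"
proof -
  define F where "F = (SOME F. graded_free_resolution V (sr_ideal V \<Delta>) (F :: ('x, 'k) free_complex))"
  have "graded_free_resolution V (sr_ideal V \<Delta>) F"
    unfolding F_def using sr_resolution_exists[OF assms(1,3)] by (rule someI_ex)
  then interpret sr_resolution V e \<Delta> F using assms by unfold_locales
  show ?thesis using homology_dim_faces[of i j] by (simp add: betti_def F_def[symmetric])
qed

text \<open>
  Indexed by codimension, the homology contributes to row \<open>r\<close> of the Betti matrix.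
\<close>

definition row_homology ::
    "'k::field itself \<Rightarrow> 'n set \<Rightarrow> ('n \<Rightarrow> nat) \<Rightarrow> 'n set set \<Rightarrow> 'n set \<Rightarrow> nat \<Rightarrow> nat" where
  "row_homology k N e \<Delta> \<tau> r =
     (if r \<le> card \<tau> then set_homology k N e (face_system \<Delta> \<tau>) (card \<tau> - r) else 0)"

lemma betti_matrix_sr_ideal:
  assumes "finite V" "inj_on e V" "simplicial_complex V \<Delta>"
  shows "betti_matrix V (sr_ideal V \<Delta> :: ('x, 'k::field) mpoly set) r j =
    (\<Sum>\<tau> | \<tau> \<subseteq> V \<and> card \<tau> = j. row_homology TYPE('k) V e \<Delta> \<tau> r)"
  unfolding betti_matrix_def betti_sr_ideal[OF assms]
  by (auto simp: row_homology_def intro!: sum.cong)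

text \<open>A subset of \<open>\<tau>\<close> cannot have more elements than \<open>\<tau>\<close>.
  Entries with \<open>j < i\<close> are invisible to \<open>betti_matrix\<close> but enter the
  definition of \<open>regularity\<close>.\<close>

lemma betti_sr_ideal_eq_0:
  assumes "finite V" "simplicial_complex V \<Delta>" "j < i"
  shows "betti V (sr_ideal V \<Delta> :: ('x, 'k::field) mpoly set) i j = 0"
proof -
  obtain e :: "'x \<Rightarrow> nat" where e: "inj_on e V" using finite_imp_inj_to_nat_seg[OF assms(1)] by metis
  have "set_homology TYPE('k) V e (face_system \<Delta> \<tau>) i = 0" if \<tau>: "\<tau> \<subseteq> V" "card \<tau> = j" for \<tau>
  proof -
    have "g = (\<lambda>_. 0)" if "g \<in> set_chains (face_system \<Delta> \<tau>) i" for g :: "'x set \<Rightarrow> 'k"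
    proof (rule ext, rule ccontr)
      fix \<sigma> assume "g \<sigma> \<noteq> 0"
      then have "\<sigma> \<subseteq> \<tau>" "card \<sigma> = i" using that by (auto simp: set_chains_def face_system_def)
      then have "i \<le> j" using card_mono[OF finite_subset[OF \<tau>(1) assms(1)], of \<sigma>] \<tau>(2) by simp
      then show False using assms(3) by simp
    qed
    then have "{g \<in> set_chains (face_system \<Delta> \<tau>) i. bdry V e (face_system \<Delta> \<tau>) g = (\<lambda>_. 0 :: 'k)} \<subseteq> {0}"
      by (auto simp: zero_fun_def)
    then have "fs.dim {g \<in> set_chains (face_system \<Delta> \<tau>) i. bdry V e (face_system \<Delta> \<tau>) g = (\<lambda>_. 0 :: 'k)} = 0"
      using fs.dim_le_card[of _ "{}"] by (simp add: fs.span_empty)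
    then show ?thesis by (simp add: set_homology_def)
  qed
  then show ?thesis unfolding betti_sr_ideal[OF assms(1) e assms(2)] by (intro sum.neutral) auto
qed

definition jet_complex :: "nat \<Rightarrow> 'x set \<Rightarrow> 'x set set \<Rightarrow> ('x \<times> nat) set set" where
  "jet_complex s X \<Delta> = {\<sigma>. \<sigma> \<subseteq> jet_vars s X \<and> fst ` \<sigma> \<in> \<Delta>}"

lemma simplicial_jet_complex:
  assumes "simplicial_complex X \<Delta>"
  shows "simplicial_complex (jet_vars s X) (jet_complex s X \<Delta>)"
  using assms unfolding simplicial_complex_def jet_complex_def by (auto dest: image_mono[of _ _ fst])

lemma finite_jet_vars: "finite X \<Longrightarrow> finite (jet_vars s X)"
  by (simp add: jet_vars_def)

text \<open>Lexicographic, so that lifts of different variables are ordered like the variables, as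
  the comparison along the projection requires. The factor \<open>Suc s\<close> leaves room for the
  indices from 0 to \<open>s\<close>.\<close>

definition jet_order :: "nat \<Rightarrow> ('x \<Rightarrow> nat) \<Rightarrow> 'x \<times> nat \<Rightarrow> nat" where
  "jet_order s e = (\<lambda>(x, i). e x * Suc s + i)"

lemma jet_order_less:
  assumes "i \<le> s" "j \<le> s" "e x \<noteq> e y"
  shows "jet_order s e (x, i) < jet_order s e (y, j) \<longleftrightarrow> e x < e y"
proof -
  have "a * Suc s + i < b * Suc s + j" if "a < b" "i \<le> s" for a b i j
  proof -
    have "a * Suc s + i < a * Suc s + Suc s" using that by simp
    also have "\<dots> = Suc a * Suc s" by simp
    also have "\<dots> \<le> b * Suc s" using that by (intro mult_right_mono) auto
    finally show ?thesis by simp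
  qed
  from this[of "e x" "e y" i j] this[of "e y" "e x" j i] show ?thesis
    using assms unfolding jet_order_def by (cases "e x < e y") auto
qed

lemma inj_jet_order:
  assumes "inj_on e X"
  shows "inj_on (jet_order s e) (jet_vars s X)"
proof (rule inj_onI)
  fix u v assume uv: "u \<in> jet_vars s X" "v \<in> jet_vars s X" and eq: "jet_order s e u = jet_order s e v"
  obtain x i y j where [simp]: "u = (x, i)" "v = (y, j)" by fastforce
  have ij: "i \<le> s" "j \<le> s" "x \<in> X" "y \<in> X" using uv by (auto simp: jet_vars_def)
  have "e x = e y"
    using jet_order_less[of i s j e x y] jet_order_less[of j s i e y x] ij eq by fastforce
  then show "u = v" using eq inj_onD[OF assms _ ij(3,4)] by (simp add: jet_order_def)
qed

text \<open>While two elements of \<open>\<tau>\<close> lie over the same variable one of them is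
  deleted, which lowers the size and the homological degree together and so keeps the row. Once the
  projection is injective on \<open>\<tau>\<close>, the two chain complexes are isomorphic.\<close>

lemma row_homology_jet:
  assumes X: "finite X" "inj_on e X" "simplicial_complex X \<Delta>" and \<tau>: "\<tau> \<subseteq> jet_vars s X"
  shows "row_homology TYPE('k::field) (jet_vars s X) (jet_order s e) (jet_complex s X \<Delta>) \<tau> r =
    row_homology TYPE('k) X e \<Delta> (fst ` \<tau>) r"
  using \<tau>
proof (induction "card \<tau>" arbitrary: \<tau> rule: less_induct)
  case less
  let ?N = "jet_vars s X" and ?e = "jet_order s e" and ?\<Gamma> = "jet_complex s X \<Delta>"
  have finN: "finite ?N" and injN: "inj_on ?e ?N" using finite_jet_vars[OF X(1)] inj_jet_order[OF X(2)] by auto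
  have fin: "finite \<tau>" using finite_subset[OF less.prems finN] .
  have down: "\<beta> \<in> \<Delta>" if "\<alpha> \<in> \<Delta>" "\<beta> \<subseteq> \<alpha>" for \<alpha> \<beta> using X(3) that by (auto simp: simplicial_complex_def)
  show ?case
  proof (cases "inj_on fst \<tau>")
    case True
    have "set_homology TYPE('k) ?N ?e (face_system ?\<Gamma> \<tau>) p = set_homology TYPE('k) X e (face_system \<Delta> (fst ` \<tau>)) p" for p
    proof (rule face_homology_inj[OF finN X(1) injN X(2) _ _ less.prems True down])
      show "fst ` ?N \<subseteq> X" by (auto simp: jet_vars_def)
      show "?e y < ?e z \<longleftrightarrow> e (fst y) < e (fst z)" if "y \<in> ?N" "z \<in> ?N" "fst y \<noteq> fst z" for y z
      proof -
        obtain a i b j where [simp]: "y = (a, i)" "z = (b, j)" by fastforce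
        have "e a \<noteq> e b" using that inj_onD[OF X(2), of a b] by (auto simp: jet_vars_def)
        then show ?thesis using jet_order_less[of i s j e a b] that by (simp add: jet_vars_def)
      qed
      show "\<alpha> \<in> ?\<Gamma> \<longleftrightarrow> fst ` \<alpha> \<in> \<Delta>" if "\<alpha> \<subseteq> ?N" for \<alpha> using that by (simp add: jet_complex_def)
    qed
    then show ?thesis by (simp add: row_homology_def card_image[OF True])
  next
    case False
    then obtain y z where yz: "y \<in> \<tau>" "z \<in> \<tau>" "y \<noteq> z" "fst y = fst z" by (auto simp: inj_on_def)
    have \<Gamma>down: "\<beta> \<in> ?\<Gamma>" if "\<alpha> \<in> ?\<Gamma>" "\<beta> \<subseteq> \<alpha>" for \<alpha> \<beta>
      using simplicial_jet_complex[OF X(3), of s] that by (auto simp: simplicial_complex_def)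
    interpret D: dominated_vertex ?N ?e ?\<Gamma> \<tau> y z
    proof (unfold_locales)
      fix \<alpha> assume "\<alpha> \<subseteq> \<tau>" "y \<in> \<alpha>"
      moreover have "z \<in> ?N" using yz(2) less.prems by (rule subsetD[rotated])
      ultimately have "insert z \<alpha> \<subseteq> ?N" using less.prems by simp
      moreover have "fst z \<in> fst ` \<alpha>" unfolding yz(4)[symmetric] using \<open>y \<in> \<alpha>\<close> by (rule imageI)
      then have "fst ` insert z \<alpha> = fst ` \<alpha>" by (simp add: insert_absorb)
      ultimately show "insert z \<alpha> \<in> ?\<Gamma> \<longleftrightarrow> \<alpha> \<in> ?\<Gamma>" by (auto simp: jet_complex_def)
    qed (use finN injN less.prems yz \<Gamma>down in auto)
    have card: "card \<tau> = Suc (card (\<tau> - {y}))" by (rule card.remove[OF fin yz(1)])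
    have "fst y \<in> fst ` (\<tau> - {y})" unfolding yz(4) using yz(2,3) by (intro imageI) auto
    then have im: "fst ` (\<tau> - {y}) = fst ` \<tau>" by (auto simp: image_iff)
    have "row_homology TYPE('k) ?N ?e ?\<Gamma> \<tau> r = row_homology TYPE('k) ?N ?e ?\<Gamma> (\<tau> - {y}) r"
    proof (cases "r \<le> card (\<tau> - {y})")
      case True
      then have "card \<tau> - r = Suc (card (\<tau> - {y}) - r)" "r \<le> card \<tau>" using card by auto
      then show ?thesis using True D.homology_shift by (simp add: row_homology_def)
    next
      case False
      \<comment> \<open>Now \<open>r\<close> is at least \<open>card \<tau>\<close>: equality means
        degree 0, where the homology vanishes, and larger rows are 0 by definition.\<close>
      then have "card \<tau> - r = 0" using card by simp
      then show ?thesis using False by (simp add: row_homology_def D.homology_zero)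
    qed
    also have "\<dots> = row_homology TYPE('k) X e \<Delta> (fst ` (\<tau> - {y})) r"
    proof (rule less.hyps)
      show "card (\<tau> - {y}) < card \<tau>" using card by simp
      show "\<tau> - {y} \<subseteq> ?N" using less.prems by (rule order_trans[OF Diff_subset])
    qed
    finally show ?thesis by (simp only: im)
  qed
qed

section \<open>Counting the sets that lie over a given vertex set\<close>

definition lists_summing :: "nat \<Rightarrow> nat \<Rightarrow> nat list set" where
  "lists_summing j k = {a. length a = j \<and> (\<forall>e \<in> set a. 0 < e) \<and> sum_list a = k}"

lemma finite_lists_summing: "finite (lists_summing j k)"
proof (rule finite_subset)
  show "lists_summing j k \<subseteq> {a. set a \<subseteq> {..k} \<and> length a = j}"
    using member_le_sum_list by (fastforce simp: lists_summing_def)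
qed (rule finite_lists_length_eq, simp)

lemma lifting_matrix_Suc:
  "lifting_matrix s (Suc j) k = (\<Sum>a\<in>{1..k}. ((s + 1) choose a) * lifting_matrix s j (k - a))"
proof -
  have eq: "lists_summing (Suc j) k = (\<lambda>(a, as). a # as) ` Sigma {1..k} (\<lambda>a. lists_summing j (k - a))"
  proof (intro equalityI subsetI)
    fix l assume l: "l \<in> lists_summing (Suc j) k"
    then obtain a as where [simp]: "l = a # as" by (cases l) (auto simp: lists_summing_def)
    have "(a, as) \<in> Sigma {1..k} (\<lambda>a. lists_summing j (k - a))" using l by (auto simp: lists_summing_def)
    then show "l \<in> (\<lambda>(a, as). a # as) ` Sigma {1..k} (\<lambda>a. lists_summing j (k - a))" by force
  qed (auto simp: lists_summing_def)
  have "lifting_matrix s (Suc j) k = (\<Sum>l\<in>lists_summing (Suc j) k. \<Prod>h<Suc j. (s + 1) choose (l ! h))"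
    by (simp add: lifting_matrix_def lists_summing_def)
  also have "\<dots> = (\<Sum>(a, as)\<in>Sigma {1..k} (\<lambda>a. lists_summing j (k - a)). \<Prod>h<Suc j. (s + 1) choose ((a # as) ! h))"
    unfolding eq by (subst sum.reindex) (auto simp: inj_on_def split_def)
  also have "\<dots> = (\<Sum>a\<in>{1..k}. \<Sum>as\<in>lists_summing j (k - a). \<Prod>h<Suc j. (s + 1) choose ((a # as) ! h))"
    by (subst sum.Sigma) (auto simp: finite_lists_summing)
  also have "\<dots> = (\<Sum>a\<in>{1..k}. \<Sum>as\<in>lists_summing j (k - a). ((s + 1) choose a) * (\<Prod>h<j. (s + 1) choose (as ! h)))"
    by (simp only: prod.lessThan_Suc_shift nth_Cons_0 nth_Cons_Suc)
  also have "\<dots> = (\<Sum>a\<in>{1..k}. ((s + 1) choose a) * lifting_matrix s j (k - a))"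
    by (simp only: lifting_matrix_def lists_summing_def sum_distrib_left)
  finally show ?thesis .
qed

lemma lifting_matrix_0: "lifting_matrix s 0 k = (if k = 0 then 1 else 0)"
proof -
  have "{a :: nat list. length a = 0 \<and> (\<forall>e \<in> set a. 0 < e) \<and> sum_list a = k} = (if k = 0 then {[]} else {})"
    by auto
  then show ?thesis by (simp add: lifting_matrix_def)
qed

definition lifts :: "nat \<Rightarrow> 'x set \<Rightarrow> nat \<Rightarrow> ('x \<times> nat) set set" where
  "lifts s \<alpha> k = {\<tau>. \<tau> \<subseteq> \<alpha> \<times> {..s} \<and> fst ` \<tau> = \<alpha> \<and> card \<tau> = k}"

lemma finite_lifts: "finite \<alpha> \<Longrightarrow> finite (lifts s \<alpha> k)"
  by (rule finite_subset[of _ "Pow (\<alpha> \<times> {..s})"]) (auto simp: lifts_def)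

text \<open>A set over \<open>insert x \<beta>\<close> consists of a nonempty set of indices above
  \<open>x\<close>, with \<open>(s + 1) choose a\<close> possibilities of size \<open>a\<close>, and
  a set over \<open>\<beta>\<close>; this is the recursion of the lifting matrix.\<close>

lemma card_lifts:
  assumes "finite \<alpha>"
  shows "card (lifts s \<alpha> k) = lifting_matrix s (card \<alpha>) k"
  using assms
proof (induction \<alpha> arbitrary: k)
  case empty
  have "lifts s ({} :: 'a set) k = (if k = 0 then {{}} else {})" by (auto simp: lifts_def)
  then show ?case by (simp add: lifting_matrix_0)
next
  case (insert x \<beta>)
  let ?P = "\<lambda>a. {A. A \<subseteq> {..s} \<and> card A = a}"
  let ?D = "Sigma {1..k} (\<lambda>a. ?P a \<times> lifts s \<beta> (k - a))"
  let ?f = "\<lambda>(a, A, \<tau>). {x} \<times> A \<union> \<tau>"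
  have "bij_betw ?f ?D (lifts s (insert x \<beta>) k)"
  proof (rule bij_betw_imageI)
    show "inj_on ?f ?D"
    proof (rule inj_onI)
      fix u v assume u: "u \<in> ?D" and v: "v \<in> ?D" and "?f u = ?f v"
      moreover obtain a A \<sigma> where u': "u = (a, A, \<sigma>)" by (rule prod_cases3)
      moreover obtain b B \<tau> where v': "v = (b, B, \<tau>)" by (rule prod_cases3)
      ultimately have eq: "{x} \<times> A \<union> \<sigma> = {x} \<times> B \<union> \<tau>" by simp
      have ab: "a = card A" "b = card B" using u v u' v' by auto
      have "fst ` \<sigma> \<subseteq> \<beta>" "fst ` \<tau> \<subseteq> \<beta>" using u v u' v' by (auto simp: lifts_def)
      then have out: "(x, i) \<notin> \<sigma>" "(x, i) \<notin> \<tau>" for i using insert(2) by force+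
      have "A = {i. (x, i) \<in> {x} \<times> A \<union> \<sigma>}" "B = {i. (x, i) \<in> {x} \<times> B \<union> \<tau>}" using out by auto
      then have AB: "A = B" using eq by simp
      have "\<sigma> = {u \<in> {x} \<times> A \<union> \<sigma>. fst u \<noteq> x}" "\<tau> = {u \<in> {x} \<times> B \<union> \<tau>. fst u \<noteq> x}" using out by auto
      then have "\<sigma> = \<tau>" using eq by simp
      then show "u = v" using AB ab u' v' by simp
    qed
    show "?f ` ?D = lifts s (insert x \<beta>) k"
    proof (intro equalityI subsetI)
      fix \<rho> assume "\<rho> \<in> ?f ` ?D"
      then obtain a A \<tau> where h: "a \<in> {1..k}" "A \<subseteq> {..s}" "card A = a" "\<tau> \<in> lifts s \<beta> (k - a)"
        and \<rho>: "\<rho> = {x} \<times> A \<union> \<tau>" by auto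
      have \<tau>: "\<tau> \<subseteq> \<beta> \<times> {..s}" "fst ` \<tau> = \<beta>" "card \<tau> = k - a" using h by (auto simp: lifts_def)
      have finA: "finite A" "finite \<tau>" using finite_subset[OF h(2)] finite_subset[OF \<tau>(1)] insert(1) by auto
      have "{x} \<times> A \<inter> \<tau> = {}" using \<tau>(1) insert(2) by auto
      then have "card \<rho> = a + (k - a)" using \<rho> h \<tau> finA by (simp add: card_Un_disjoint card_cartesian_product)
      moreover have "A \<noteq> {}" using h by auto
      ultimately show "\<rho> \<in> lifts s (insert x \<beta>) k" using \<rho> h \<tau> by (auto simp: lifts_def image_Un)
    next
      fix \<rho> assume \<rho>: "\<rho> \<in> lifts s (insert x \<beta>) k"
      define A where "A = {i. (x, i) \<in> \<rho>}"
      define \<tau> where "\<tau> = {u \<in> \<rho>. fst u \<noteq> x}"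
      have eq: "\<rho> = {x} \<times> A \<union> \<tau>" by (auto simp: A_def \<tau>_def)
      have A: "A \<subseteq> {..s}" "A \<noteq> {}" using \<rho> by (force simp: lifts_def A_def)+
      have \<tau>: "\<tau> \<subseteq> \<beta> \<times> {..s}" "fst ` \<tau> = \<beta>" using \<rho> insert(2) by (force simp: lifts_def \<tau>_def)+
      have finA: "finite A" "finite \<tau>" using finite_subset[OF A(1)] finite_subset[OF \<tau>(1)] insert(1) by auto
      have "{x} \<times> A \<inter> \<tau> = {}" by (auto simp: \<tau>_def)
      then have "card \<rho> = card A + card \<tau>" unfolding eq using finA by (simp add: card_Un_disjoint card_cartesian_product)
      then have k: "k = card A + card \<tau>" using \<rho> by (simp add: lifts_def)
      have "card A \<ge> 1" using A finA by (simp add: Suc_le_eq card_gt_0_iff)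
      then have "(card A, A, \<tau>) \<in> ?D" using A \<tau> k by (auto simp: lifts_def)
      then show "\<rho> \<in> ?f ` ?D" using eq by (intro image_eqI[of _ _ "(card A, A, \<tau>)"]) auto
    qed
  qed
  then have "card (lifts s (insert x \<beta>) k) = card ?D" by (simp add: bij_betw_same_card)
  also have "\<dots> = (\<Sum>a\<in>{1..k}. card (?P a \<times> lifts s \<beta> (k - a)))"
    using finite_lifts[OF insert(1)] by (intro card_SigmaI) auto
  also have "\<dots> = (\<Sum>a\<in>{1..k}. ((s + 1) choose a) * lifting_matrix s (card \<beta>) (k - a))"
    using insert.IH by (simp add: card_cartesian_product n_subsets)
  finally show ?case using insert(1,2) by (simp add: lifting_matrix_Suc)
qed

theorem betti_matrix_jet_complex:
  assumes X: "finite X" "simplicial_complex X \<Delta>"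
  shows "betti_matrix (jet_vars s X) (sr_ideal (jet_vars s X) (jet_complex s X \<Delta>) :: ('x \<times> nat, 'k::field) mpoly set) =
    inf_mat_mult (betti_matrix X (sr_ideal X \<Delta> :: ('x, 'k) mpoly set)) (lifting_matrix s)"
proof (intro ext)
  fix r k
  obtain e :: "'x \<Rightarrow> nat" where e: "inj_on e X" using finite_imp_inj_to_nat_seg[OF X(1)] by metis
  let ?N = "jet_vars s X"
  let ?h = "\<lambda>\<alpha>. row_homology TYPE('k) X e \<Delta> \<alpha> r"
  have finN: "finite {\<tau>. \<tau> \<subseteq> ?N \<and> card \<tau> = k}"
    using finite_jet_vars[OF X(1)] by (auto intro: finite_subset[of _ "Pow ?N"])
  have le: "card (fst ` \<tau>) \<le> k" if "\<tau> \<subseteq> ?N" "card \<tau> = k" for \<tau>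
    using card_image_le[OF finite_subset[OF that(1) finite_jet_vars[OF X(1)]], of fst] that by simp
  have "betti_matrix ?N (sr_ideal ?N (jet_complex s X \<Delta>) :: ('x \<times> nat, 'k) mpoly set) r k =
     (\<Sum>\<tau> | \<tau> \<subseteq> ?N \<and> card \<tau> = k. row_homology TYPE('k) ?N (jet_order s e) (jet_complex s X \<Delta>) \<tau> r)"
    by (rule betti_matrix_sr_ideal[OF finite_jet_vars[OF X(1)] inj_jet_order[OF e] simplicial_jet_complex[OF X(2)]])
  also have "\<dots> = (\<Sum>\<tau> | \<tau> \<subseteq> ?N \<and> card \<tau> = k. ?h (fst ` \<tau>))"
    using row_homology_jet[OF X(1) e X(2)] by (intro sum.cong) auto
  \<comment> \<open>The sets are grouped by their projection, on which alone the summand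
    depends.\<close>
  also have "\<dots> = (\<Sum>\<alpha>\<in>Pow X. \<Sum>\<tau>\<in>{\<tau> \<in> {\<tau>. \<tau> \<subseteq> ?N \<and> card \<tau> = k}. fst ` \<tau> = \<alpha>}. ?h (fst ` \<tau>))"
    using finN X(1) by (intro sum.group[symmetric]) (auto simp: jet_vars_def)
  also have "\<dots> = (\<Sum>\<alpha>\<in>Pow X. ?h \<alpha> * lifting_matrix s (card \<alpha>) k)"
  proof (intro sum.cong refl)
    fix \<alpha> assume \<alpha>: "\<alpha> \<in> Pow X"
    have "{\<tau> \<in> {\<tau>. \<tau> \<subseteq> ?N \<and> card \<tau> = k}. fst ` \<tau> = \<alpha>} = lifts s \<alpha> k"
      using \<alpha> by (force simp: lifts_def jet_vars_def)
    moreover have "(\<Sum>\<tau>\<in>lifts s \<alpha> k. ?h (fst ` \<tau>)) = (\<Sum>\<tau>\<in>lifts s \<alpha> k. ?h \<alpha>)"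
      by (intro sum.cong refl) (simp add: lifts_def)
    moreover have "finite \<alpha>" using \<alpha> X(1) finite_subset by auto
    ultimately show "(\<Sum>\<tau>\<in>{\<tau> \<in> {\<tau>. \<tau> \<subseteq> ?N \<and> card \<tau> = k}. fst ` \<tau> = \<alpha>}. ?h (fst ` \<tau>)) = ?h \<alpha> * lifting_matrix s (card \<alpha>) k"
      by (simp add: card_lifts)
  qed
  also have "\<dots> = (\<Sum>\<alpha>\<in>{\<alpha> \<in> Pow X. card \<alpha> \<le> k}. ?h \<alpha> * lifting_matrix s (card \<alpha>) k)"
  proof (intro sum.mono_neutral_right ballI)
    fix \<alpha> assume "\<alpha> \<in> Pow X - {\<alpha> \<in> Pow X. card \<alpha> \<le> k}"
    then have "k < card \<alpha>" by auto
    then show "?h \<alpha> * lifting_matrix s (card \<alpha>) k = 0" by (simp only: lifting_matrix_upper mult_0_right)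
  qed (use X(1) in auto)
  also have "\<dots> = (\<Sum>j\<le>k. \<Sum>\<alpha>\<in>{\<alpha> \<in> {\<alpha> \<in> Pow X. card \<alpha> \<le> k}. card \<alpha> = j}. ?h \<alpha> * lifting_matrix s (card \<alpha>) k)"
    using X(1) by (intro sum.group[symmetric]) auto
  also have "\<dots> = (\<Sum>j\<le>k. betti_matrix X (sr_ideal X \<Delta> :: ('x, 'k) mpoly set) r j * lifting_matrix s j k)"
  proof (intro sum.cong refl)
    fix j assume "j \<in> {..k}"
    then have "{\<alpha> \<in> {\<alpha> \<in> Pow X. card \<alpha> \<le> k}. card \<alpha> = j} = {\<alpha>. \<alpha> \<subseteq> X \<and> card \<alpha> = j}" by auto
    then show "(\<Sum>\<alpha>\<in>{\<alpha> \<in> {\<alpha> \<in> Pow X. card \<alpha> \<le> k}. card \<alpha> = j}. ?h \<alpha> * lifting_matrix s (card \<alpha>) k) =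
      betti_matrix X (sr_ideal X \<Delta> :: ('x, 'k) mpoly set) r j * lifting_matrix s j k"
      unfolding betti_matrix_sr_ideal[OF X(1) e X(2)] sum_distrib_right by (intro sum.cong) auto
  qed
  finally show "betti_matrix ?N (sr_ideal ?N (jet_complex s X \<Delta>) :: ('x \<times> nat, 'k) mpoly set) r k =
    inf_mat_mult (betti_matrix X (sr_ideal X \<Delta> :: ('x, 'k) mpoly set)) (lifting_matrix s) r k"
    by (simp add: inf_mat_mult_lifting)
qed

text \<open>The list of \<open>j\<close> ones always contributes; in the recursion it is the summand
  \<open>a = 1\<close>.\<close>

lemma lifting_matrix_diagonal: "lifting_matrix s j j > 0"
proof (induction j)
  case (Suc j)
  have "0 < ((s + 1) choose 1) * lifting_matrix s j (Suc j - 1)" using Suc by simp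
  also have "\<dots> \<le> (\<Sum>a\<in>{1..Suc j}. ((s + 1) choose a) * lifting_matrix s j (Suc j - a))"
    by (rule member_le_sum) auto
  finally show ?case unfolding lifting_matrix_Suc .
qed (simp add: lifting_matrix_0)

lemma betti_rows:
  assumes VD: "finite V" "simplicial_complex V D"
  shows "{int j - int i | i j. betti V (sr_ideal V D :: ('x, 'k::field) mpoly set) i j \<noteq> 0} =
      {int r | r. \<exists>j. betti_matrix V (sr_ideal V D :: ('x, 'k) mpoly set) r j \<noteq> 0}"
  proof (intro equalityI subsetI)
    fix z assume "z \<in> {int j - int i | i j. betti V (sr_ideal V D :: ('x, 'k) mpoly set) i j \<noteq> 0}"
    then obtain i j where z: "z = int j - int i" and nz: "betti V (sr_ideal V D :: ('x, 'k) mpoly set) i j \<noteq> 0" by blast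
    have "i \<le> j" using betti_sr_ideal_eq_0[OF VD, of j i] nz by (metis not_le)
    then have "betti_matrix V (sr_ideal V D :: ('x, 'k) mpoly set) (j - i) j \<noteq> 0" "z = int (j - i)"
      using nz z by (auto simp: betti_matrix_def)
    then show "z \<in> {int r | r. \<exists>j. betti_matrix V (sr_ideal V D :: ('x, 'k) mpoly set) r j \<noteq> 0}" by blast
  next
    fix z assume "z \<in> {int r | r. \<exists>j. betti_matrix V (sr_ideal V D :: ('x, 'k) mpoly set) r j \<noteq> 0}"
    then obtain r j where z: "z = int r" and nz: "betti_matrix V (sr_ideal V D :: ('x, 'k) mpoly set) r j \<noteq> 0" by blast
    then have "r \<le> j" "betti V (sr_ideal V D :: ('x, 'k) mpoly set) (j - r) j \<noteq> 0"
      by (auto simp: betti_matrix_def split: if_splits)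
    moreover from this have "z = int j - int (j - r)" using z by simp
    ultimately show "z \<in> {int j - int i | i j. betti V (sr_ideal V D :: ('x, 'k) mpoly set) i j \<noteq> 0}" by blast
  qed

text \<open>Natural numbers cannot cancel in the matrix product, and the positive diagonal preserves
  every nonzero entry, so the same rows are nonzero on both sides. Both regularities are then
  \<open>Max\<close> of one and the same set of row indices.\<close>

theorem regularity_jet_complex:
  assumes X: "finite X" "simplicial_complex X \<Delta>"
  shows "regularity (jet_vars s X) (sr_ideal (jet_vars s X) (jet_complex s X \<Delta>) :: ('x \<times> nat, 'k::field) mpoly set) =
    regularity X (sr_ideal X \<Delta> :: ('x, 'k) mpoly set)"
proof -
  let ?N = "jet_vars s X" and ?\<Gamma> = "jet_complex s X \<Delta>"
  let ?B = "betti_matrix X (sr_ideal X \<Delta> :: ('x, 'k) mpoly set)"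
  let ?C = "betti_matrix ?N (sr_ideal ?N ?\<Gamma> :: ('x \<times> nat, 'k) mpoly set)"
  have C: "?C r k = (\<Sum>j\<le>k. ?B r j * lifting_matrix s j k)" for r k
    using fun_cong[OF fun_cong[OF betti_matrix_jet_complex[OF X, where s = s and 'k = 'k]], of r k]
    by (simp add: inf_mat_mult_lifting)
  have rows: "(\<exists>k. ?C r k \<noteq> 0) \<longleftrightarrow> (\<exists>j. ?B r j \<noteq> 0)" for r
  proof
    assume "\<exists>j. ?B r j \<noteq> 0"
    then obtain j where "?B r j \<noteq> 0" by blast
    then have "?B r j * lifting_matrix s j j \<noteq> 0" using lifting_matrix_diagonal[of s j] by simp
    then have "?C r j \<noteq> 0" unfolding C by auto
    then show "\<exists>k. ?C r k \<noteq> 0" by blast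
  next
    assume "\<exists>k. ?C r k \<noteq> 0"
    then obtain k where "?C r k \<noteq> 0" by blast
    then have "\<exists>j\<in>{..k}. ?B r j * lifting_matrix s j k \<noteq> 0" unfolding C by (rule contrapos_np) (simp only: bex_simps not_not sum.neutral)
    then show "\<exists>j. ?B r j \<noteq> 0" by (metis mult_0)
  qed
  show ?thesis
    unfolding regularity_def betti_rows[OF X] betti_rows[OF finite_jet_vars[OF X(1)] simplicial_jet_complex[OF X(2)]]
    by (simp only: rows HOL.refl)
qed

section \<open>Krull's height theorem\<close>

locale noetherian_cring = cring R + noetherian_ring R for R (structure)
begin

text \<open>The union of a nonempty chain of ideals is a member of the chain, so Zorn's lemma
  applies to an arbitrary family. The noetherian inductions below are instances.\<close>

lemma maximal_ideal_of_family:
  assumes "L0 \<in> \<A>" and "\<And>L. L \<in> \<A> \<Longrightarrow> ideal L R"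
  shows "\<exists>M\<in>\<A>. \<forall>L\<in>\<A>. M \<subseteq> L \<longrightarrow> L = M"
proof (rule subset_Zorn_nonempty)
  show "\<A> \<noteq> {}" using assms(1) by auto
next
  fix \<C> assume \<C>: "\<C> \<noteq> {}" "subset.chain \<A> \<C>"
  then have "subset.chain {I. ideal I R} \<C>"
    using assms(2) by (auto simp: pred_on.chain_def)
  then have "\<Union>\<C> \<in> \<C>" using ideal_chain_is_trivial \<C>(1) by simp
  then show "\<Union>\<C> \<in> \<A>" using \<C>(2) by (auto simp: pred_on.chain_def)
qed

text \<open>The contraction to \<open>R\<close> of the extension of \<open>L\<close> to the local
  ring at \<open>P\<close>. Ideals with \<open>saturation P L \<subseteq> L\<close> correspond to
  ideals of that local ring, so the height theorem can be proved inside \<open>R\<close>.\<close>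

definition saturation :: "'a set \<Rightarrow> 'a set \<Rightarrow> 'a set" where
  "saturation P L = {r \<in> carrier R. \<exists>u \<in> carrier R - P. u \<otimes> r \<in> L}"

definition minimal_prime_over :: "'a set \<Rightarrow> 'a set \<Rightarrow> bool" where
  "minimal_prime_over P J \<longleftrightarrow> primeideal P R \<and> J \<subseteq> P \<and>
     (\<forall>Q. primeideal Q R \<and> J \<subseteq> Q \<and> Q \<subseteq> P \<longrightarrow> Q = P)"

definition adjoin :: "'a set \<Rightarrow> 'a \<Rightarrow> 'a set" where
  "adjoin L y = {l \<oplus> c \<otimes> y | l c. l \<in> L \<and> c \<in> carrier R}"

lemma idealI_direct:
  assumes "L \<subseteq> carrier R" "\<zero> \<in> L" "\<And>a b. a \<in> L \<Longrightarrow> b \<in> L \<Longrightarrow> a \<oplus> b \<in> L"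
    and "\<And>a r. a \<in> L \<Longrightarrow> r \<in> carrier R \<Longrightarrow> r \<otimes> a \<in> L"
  shows "ideal L R"
proof (rule idealI)
  show "subgroup L (add_monoid R)"
  proof (rule group.subgroupI)
    show "group (add_monoid R)" by (rule a_group)
    fix a assume a: "a \<in> L"
    then have "a \<in> carrier R" using assms(1) by auto
    then have "(\<ominus> \<one>) \<otimes> a = \<ominus> a" by (simp add: l_minus)
    then show "inv\<^bsub>add_monoid R\<^esub> a \<in> L"
      using assms(4)[OF a, of "\<ominus> \<one>"] by (simp add: a_inv_def)
  qed (use assms in auto)
  show "x \<otimes> a \<in> L" "a \<otimes> x \<in> L" if "a \<in> L" "x \<in> carrier R" for a x
    using assms(4)[OF that] that assms(1) m_comm[of x a] by auto
qed (unfold_locales)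

lemma prime_mult_notin:
  assumes "primeideal P R" "u \<in> carrier R - P" "v \<in> carrier R - P"
  shows "u \<otimes> v \<in> carrier R - P"
  using primeideal.I_prime[OF assms(1), of u v] assms(2,3) by auto

lemma prime_one_notin: "primeideal P R \<Longrightarrow> \<one> \<in> carrier R - P"
  by (metis Diff_iff one_closed primeideal.I_notcarr ideal.one_imp_carrier primeideal.axioms(1))

lemma saturationI:
  "r \<in> carrier R \<Longrightarrow> u \<in> carrier R - P \<Longrightarrow> u \<otimes> r \<in> L \<Longrightarrow> r \<in> saturation P L"
  by (auto simp: saturation_def)

lemma ideal_saturation:
  assumes P: "primeideal P R" and "ideal L R"
  shows "ideal (saturation P L) R"
proof -
  interpret L: ideal L R by fact
  show ?thesis
  proof (rule idealI_direct)
    show "saturation P L \<subseteq> carrier R" by (auto simp: saturation_def)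
    show "\<zero> \<in> saturation P L"
      using prime_one_notin[OF P] by (auto simp: saturation_def intro!: bexI[of _ \<one>])
    fix a b assume "a \<in> saturation P L" "b \<in> saturation P L"
    then obtain u v where uv: "u \<in> carrier R - P" "u \<otimes> a \<in> L" "a \<in> carrier R"
       "v \<in> carrier R - P" "v \<otimes> b \<in> L" "b \<in> carrier R" by (auto simp: saturation_def)
    have "(u \<otimes> v) \<otimes> (a \<oplus> b) = v \<otimes> (u \<otimes> a) \<oplus> u \<otimes> (v \<otimes> b)"
      using uv by (auto simp: r_distr m_ac)
    moreover have "\<dots> \<in> L" using uv by (auto intro!: L.I_l_closed L.a_closed)
    ultimately show "a \<oplus> b \<in> saturation P L"
      using prime_mult_notin[OF P uv(1,4)] uv by (intro saturationI[of _ "u \<otimes> v"]) auto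
  next
    fix a r assume "a \<in> saturation P L" and r: "r \<in> carrier R"
    then obtain u where u: "u \<in> carrier R - P" "u \<otimes> a \<in> L" "a \<in> carrier R"
      by (auto simp: saturation_def)
    have "u \<otimes> (r \<otimes> a) = r \<otimes> (u \<otimes> a)" using u r by (auto simp: m_ac)
    then show "r \<otimes> a \<in> saturation P L"
      using u r L.I_l_closed[OF u(2) r] by (intro saturationI[of _ u]) auto
  qed
qed

lemma subset_saturation:
  assumes "primeideal P R" "ideal L R"
  shows "L \<subseteq> saturation P L"
  using prime_one_notin[OF assms(1)] ideal.Icarr[OF assms(2)]
  by (auto simp: saturation_def intro!: bexI[of _ \<one>])

lemma saturation_saturation:
  assumes "primeideal P R"
  shows "saturation P (saturation P L) \<subseteq> saturation P L"
proof
  fix r assume "r \<in> saturation P (saturation P L)"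
  then obtain u v where "r \<in> carrier R" "u \<in> carrier R - P" "v \<in> carrier R - P"
    "v \<otimes> (u \<otimes> r) \<in> L" by (auto simp: saturation_def)
  then show "r \<in> saturation P L"
    using prime_mult_notin[OF assms, of v u] by (intro saturationI[of _ "v \<otimes> u"]) (auto simp: m_assoc)
qed

lemma saturation_mono: "L \<subseteq> M \<Longrightarrow> saturation P L \<subseteq> saturation P M"
  by (auto simp: saturation_def)

lemma saturatedD:
  "saturation P L \<subseteq> L \<Longrightarrow> u \<in> carrier R - P \<Longrightarrow> r \<in> carrier R \<Longrightarrow> u \<otimes> r \<in> L \<Longrightarrow> r \<in> L"
  by (auto simp: saturation_def)

lemma adjoin_mono: "L \<subseteq> M \<Longrightarrow> adjoin L y \<subseteq> adjoin M y"
  by (auto simp: adjoin_def)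

lemma adjoin_ideal:
  assumes "ideal L R" "y \<in> carrier R"
  shows "ideal (adjoin L y) R" "L \<subseteq> adjoin L y" "y \<in> adjoin L y"
proof -
  interpret L: ideal L R by fact
  note y = assms(2)
  show "ideal (adjoin L y) R"
  proof (rule idealI_direct)
    show "adjoin L y \<subseteq> carrier R" using y by (auto simp: adjoin_def)
    have "\<zero> = \<zero> \<oplus> \<zero> \<otimes> y" using y by simp
    then show "\<zero> \<in> adjoin L y" unfolding adjoin_def using L.zero_closed by blast
    fix a b assume "a \<in> adjoin L y" "b \<in> adjoin L y"
    then obtain l c m d where "a = l \<oplus> c \<otimes> y" "b = m \<oplus> d \<otimes> y"
      "l \<in> L" "m \<in> L" "c \<in> carrier R" "d \<in> carrier R" by (auto simp: adjoin_def)
    moreover from this have "a \<oplus> b = (l \<oplus> m) \<oplus> (c \<oplus> d) \<otimes> y"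
      using y by (simp add: l_distr a_ac L.Icarr)
    ultimately show "a \<oplus> b \<in> adjoin L y" unfolding adjoin_def by blast
  next
    fix a r assume "a \<in> adjoin L y" and r: "r \<in> carrier R"
    then obtain l c where "a = l \<oplus> c \<otimes> y" "l \<in> L" "c \<in> carrier R" by (auto simp: adjoin_def)
    moreover from this have "r \<otimes> a = r \<otimes> l \<oplus> (r \<otimes> c) \<otimes> y"
      using y r by (simp add: r_distr m_assoc L.Icarr)
    ultimately show "r \<otimes> a \<in> adjoin L y" unfolding adjoin_def using L.I_l_closed r by blast
  qed
  show "L \<subseteq> adjoin L y"
  proof
    fix l assume "l \<in> L"
    moreover from this have "l = l \<oplus> \<zero> \<otimes> y" using y by (simp add: L.Icarr)
    ultimately show "l \<in> adjoin L y" unfolding adjoin_def by blast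
  qed
  have "y = \<zero> \<oplus> \<one> \<otimes> y" using y by simp
  then show "y \<in> adjoin L y" unfolding adjoin_def using L.zero_closed by blast
qed

text \<open>
  A maximal annihilator of \<open>R/L\<close> is a prime contained in \<open>P\<close>, hence equal to \<open>P\<close>.
\<close>

lemma associated_minimal_prime:
  assumes min: "minimal_prime_over P J" and L: "ideal L R" "J \<subseteq> L" "saturation P L \<subseteq> L"
    and "L \<noteq> carrier R"
  obtains y where "y \<in> carrier R - L" and "\<And>c. c \<in> carrier R \<Longrightarrow> c \<otimes> y \<in> L \<longleftrightarrow> c \<in> P"
proof -
  interpret L: ideal L R by fact
  have P: "primeideal P R" using min by (simp add: minimal_prime_over_def)
  define ann where "ann y = {c \<in> carrier R. c \<otimes> y \<in> L}" for y
  have ann: "ideal (ann y) R" if y: "y \<in> carrier R" for y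
  proof (rule idealI_direct)
    show "ann y \<subseteq> carrier R" "\<zero> \<in> ann y" using y by (auto simp: ann_def)
    show "a \<oplus> b \<in> ann y" if "a \<in> ann y" "b \<in> ann y" for a b
      using that y by (auto simp: ann_def l_distr)
    show "r \<otimes> a \<in> ann y" if "a \<in> ann y" "r \<in> carrier R" for a r
      using that y L.I_l_closed by (auto simp: ann_def m_assoc)
  qed
  obtain y0 where "y0 \<in> carrier R - L" using assms(5) L.Icarr by auto
  then have "ann y0 \<in> ann ` (carrier R - L)" by (rule imageI)
  moreover have "ideal K R" if "K \<in> ann ` (carrier R - L)" for K using that ann by auto
  ultimately have "\<exists>M\<in>ann ` (carrier R - L). \<forall>L\<in>ann ` (carrier R - L). M \<subseteq> L \<longrightarrow> L = M"
    by (rule maximal_ideal_of_family)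
  then obtain M where "M \<in> ann ` (carrier R - L)"
    and max: "\<And>K. K \<in> ann ` (carrier R - L) \<Longrightarrow> M \<subseteq> K \<Longrightarrow> K = M"
    by blast
  then obtain y where y: "y \<in> carrier R" "y \<notin> L" and M: "M = ann y" by auto
  have "primeideal (ann y) R"
  proof (rule primeidealI)
    show "ideal (ann y) R" using ann y by simp
    show "cring R" by (rule is_cring)
    have "\<one> \<notin> ann y" using y by (auto simp: ann_def)
    then show "carrier R \<noteq> ann y" by auto
    fix a b assume ab: "a \<in> carrier R" "b \<in> carrier R" "a \<otimes> b \<in> ann y"
    show "a \<in> ann y \<or> b \<in> ann y"
    proof (rule disjCI)
      assume "b \<notin> ann y"
      \<comment> \<open>Replacing \<open>y\<close> by \<open>b \<otimes> y\<close> can only enlarge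
        the annihilator, so by maximality it stays the same.\<close>
      then have by': "b \<otimes> y \<in> carrier R - L" using ab y by (auto simp: ann_def)
      have "c \<otimes> (b \<otimes> y) = b \<otimes> (c \<otimes> y)" if "c \<in> carrier R" for c
        using that ab y by (simp add: m_ac)
      then have "ann y \<subseteq> ann (b \<otimes> y)" using ab L.I_l_closed by (auto simp: ann_def)
      then have "ann (b \<otimes> y) = ann y" using max[of "ann (b \<otimes> y)"] by' M by auto
      moreover have "a \<in> ann (b \<otimes> y)" using ab y by (auto simp: ann_def m_assoc)
      ultimately show "a \<in> ann y" by simp
    qed
  qed
  moreover have "J \<subseteq> ann y" using L.I_r_closed L(2) y L.Icarr by (auto simp: ann_def)
  moreover have "ann y \<subseteq> P" using saturatedD[OF L(3)] y by (auto simp: ann_def)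
  ultimately have "ann y = P" using min by (auto simp: minimal_prime_over_def)
  then have "c \<otimes> y \<in> L \<longleftrightarrow> c \<in> P" if "c \<in> carrier R" for c using that by (auto simp: ann_def)
  then show ?thesis using that y by blast
qed

text \<open>
  The local ring at a minimal prime over \<open>J\<close> is Artinian modulo \<open>J\<close>, by Noetherian
  induction on the lower bound of the descending chain.
\<close>

lemma saturated_descending_chain:
  assumes min: "minimal_prime_over P J"
    and b: "\<And>n. ideal (b n) R" "\<And>n. saturation P (b n) \<subseteq> b n" "\<And>n. J \<subseteq> b n"
      "\<And>n. b (Suc n) \<subseteq> b n"
    and J: "ideal J R"
  shows "\<exists>n. \<forall>m\<ge>n. b m = b n"
proof (rule ccontr)
  have P: "primeideal P R" using min by (simp add: minimal_prime_over_def)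
  define chain where "chain L b \<longleftrightarrow> (\<forall>n. ideal (b n) R \<and> saturation P (b n) \<subseteq> b n \<and>
    L \<subseteq> b n \<and> b (Suc n) \<subseteq> b n)" for L and b :: "nat \<Rightarrow> 'a set"
  define stable where "stable b \<longleftrightarrow> (\<exists>n. \<forall>m\<ge>n. b m = b n)" for b :: "nat \<Rightarrow> 'a set"
  \<comment> \<open>Lower bounds of unstable chains. Above a strictly larger saturated ideal than a
    maximal member \<open>L\<close>, all chains are stable.\<close>
  define \<A> where "\<A> = {L. ideal L R \<and> J \<subseteq> L \<and> saturation P L \<subseteq> L \<and> (\<exists>b. chain L b \<and> \<not> stable b)}"
  assume "\<not> ?thesis"
  then have "\<not> stable b" by (simp add: stable_def)
  moreover have "chain (saturation P J) b"
    using b saturation_mono[of J _ P] unfolding chain_def by blast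
  ultimately have "saturation P J \<in> \<A>"
    using ideal_saturation[OF P J] subset_saturation[OF P J] saturation_saturation[OF P]
    by (auto simp: \<A>_def)
  moreover have "ideal L R" if "L \<in> \<A>" for L
    using that by (auto simp: \<A>_def primeideal_def)
  ultimately have "\<exists>M\<in>\<A>. \<forall>L\<in>\<A>. M \<subseteq> L \<longrightarrow> L = M"
    by (rule maximal_ideal_of_family)
  then obtain L where L: "L \<in> \<A>" and max: "\<And>M. M \<in> \<A> \<Longrightarrow> L \<subseteq> M \<Longrightarrow> M = L"
    by blast
  then obtain d where d: "chain L d" "\<not> stable d" by (auto simp: \<A>_def)
  have Lid: "ideal L R" "J \<subseteq> L" "saturation P L \<subseteq> L" using L by (auto simp: \<A>_def)
  have did: "ideal (d n) R" "saturation P (d n) \<subseteq> d n" "L \<subseteq> d n" "d (Suc n) \<subseteq> d n" for n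
    using d(1) by (auto simp: chain_def)
  have dmono: "d m \<subseteq> d n" if "n \<le> m" for m n using lift_Suc_antimono_le[of d, OF did(4) that] .
  have "L \<noteq> carrier R"
  proof
    assume "L = carrier R"
    then have "d n = carrier R" for n using did(3)[of n] ideal.Icarr[OF did(1)] by blast
    then show False using d(2) by (simp add: stable_def)
  qed
  then obtain y where y: "y \<in> carrier R" "y \<notin> L"
    and yP: "\<And>c. c \<in> carrier R \<Longrightarrow> c \<otimes> y \<in> L \<longleftrightarrow> c \<in> P"
    using associated_minimal_prime[OF min Lid] by (metis DiffE)
  define L1 where "L1 = saturation P (adjoin L y)"
  have L1: "ideal L1 R" "L \<subseteq> L1" "y \<in> L1"
    using adjoin_ideal[OF Lid(1) y(1)] ideal_saturation[OF P] subset_saturation[OF P]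
    unfolding L1_def by blast+
  have "L1 \<notin> \<A>" using max[of L1] L1 y(2) by auto
  then have stab: "stable b" if "chain L1 b" for b
    using that L1 Lid(2) saturation_saturation[OF P] unfolding \<A>_def L1_def by auto
  \<comment> \<open>Adding \<open>y\<close> to every member gives a chain above \<open>L1\<close>,
    which is strictly larger than \<open>L\<close>, so this chain is stable.\<close>
  define b' where "b' n = saturation P (adjoin (d n) y)" for n
  have "chain L1 b'" unfolding chain_def
  proof (intro allI conjI)
    fix n
    show "ideal (b' n) R" unfolding b'_def
      by (rule ideal_saturation[OF P adjoin_ideal(1)[OF did(1) y(1)]])
    show "saturation P (b' n) \<subseteq> b' n" unfolding b'_def by (rule saturation_saturation[OF P])
    show "L1 \<subseteq> b' n" "b' (Suc n) \<subseteq> b' n" unfolding b'_def L1_def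
      by (intro saturation_mono adjoin_mono did)+
  qed
  from stab[OF this] obtain n1 where n1: "\<And>m. m \<ge> n1 \<Longrightarrow> b' m = b' n1"
    by (auto simp: stable_def)
  \<comment> \<open>From \<open>n2\<close> on, \<open>y\<close> either belongs to every member of
    the chain or to none.\<close>
  obtain n2 where n2: "y \<in> d n2 \<longrightarrow> (\<forall>m. y \<in> d m)" by blast
  define n where "n = max n1 n2"
  have "d m = d n" if m: "n \<le> m" for m
  proof
    show "d m \<subseteq> d n" by (rule dmono) fact
    show "d n \<subseteq> d m"
    proof
      fix r assume r: "r \<in> d n"
      interpret dm: ideal "d m" R by (rule did)
      interpret dn: ideal "d n" R by (rule did)
      interpret L: ideal L R by (rule Lid)
      have "r \<in> b' n" using r adjoin_ideal[OF did(1) y(1)] ideal_saturation[OF P] subset_saturation[OF P]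
        unfolding b'_def by blast
      also have "b' n = b' m" using n1[of n] n1[of m] m by (simp add: n_def)
      finally obtain u s c where u: "u \<in> carrier R - P" and s: "s \<in> d m" and c: "c \<in> carrier R"
        and eq: "u \<otimes> r = s \<oplus> c \<otimes> y" by (auto simp: b'_def saturation_def adjoin_def)
      have r': "r \<in> carrier R" and s': "s \<in> carrier R" using dn.Icarr[OF r] dm.Icarr[OF s] .
      \<comment> \<open>If \<open>y\<close> has left the chain, then \<open>c\<close> is in
        \<open>P\<close> because \<open>d n\<close> is saturated, and \<open>P\<close> annihilates
        \<open>y\<close> modulo \<open>L\<close>.\<close>
      have cy: "c \<otimes> y \<in> d m"
      proof (cases "y \<in> d m")
        case True
        then show ?thesis using c by (rule dm.I_l_closed)
      next
        case False
        then have "y \<notin> d n2" using n2 by auto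
        then have yn: "y \<notin> d n" using dmono[of n2 n] by (auto simp: n_def)
        have "c \<otimes> y = u \<otimes> r \<oplus> \<ominus> s" using eq c y u r' s' by (simp add: a_ac r_neg2 r_neg r_neg1)
        moreover have "\<dots> \<in> d n"
          using u s r dmono[OF m] dn.I_l_closed dn.a_closed dn.a_inv_closed by auto
        ultimately have "c \<otimes> y \<in> d n" by simp
        then have "c \<in> P" using saturatedD[OF did(2)[of n] _ y(1), of c] yn c by blast
        then show ?thesis using yP[OF c] did(3) by blast
      qed
      have "u \<otimes> r \<in> d m" unfolding eq using s cy by (rule dm.a_closed)
      then show "r \<in> d m" using saturatedD[OF did(2) u r'] by simp
    qed
  qed
  then have "stable d" unfolding stable_def by blast
  then show False using d(2) by simp
qed

text \<open>Nakayama's lemma for the local ring at \<open>P\<close>. A largest saturated ideal that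
  contains \<open>b\<close> but not \<open>a\<close> takes the place of the usual determinant
  argument.\<close>

lemma nakayama_saturation:
  assumes P: "primeideal P R" and b: "ideal b R" and a: "ideal a R" and f: "f \<in> P"
    and gen: "\<And>r. r \<in> a \<Longrightarrow> \<exists>u \<in> carrier R - P. \<exists>l \<in> b. \<exists>t \<in> a. u \<otimes> r = l \<oplus> f \<otimes> t"
  shows "a \<subseteq> saturation P b"
proof (rule ccontr)
  assume neg: "\<not> ?thesis"
  interpret P: primeideal P R by fact
  have f': "f \<in> carrier R" using f P.Icarr by auto
  define \<A> where "\<A> = {L. ideal L R \<and> b \<subseteq> L \<and> saturation P L \<subseteq> L \<and> \<not> a \<subseteq> L}"
  have "saturation P b \<in> \<A>"
    using neg ideal_saturation[OF P b] subset_saturation[OF P b] saturation_saturation[OF P]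
    by (auto simp: \<A>_def)
  moreover have "ideal L R" if "L \<in> \<A>" for L
    using that by (auto simp: \<A>_def primeideal_def)
  ultimately have "\<exists>M\<in>\<A>. \<forall>L\<in>\<A>. M \<subseteq> L \<longrightarrow> L = M"
    by (rule maximal_ideal_of_family)
  then obtain L where L: "L \<in> \<A>" and max: "\<And>M. M \<in> \<A> \<Longrightarrow> L \<subseteq> M \<Longrightarrow> M = L"
    by blast
  then obtain y where y: "y \<in> a" "y \<notin> L" by (auto simp: \<A>_def)
  interpret L: ideal L R using L by (auto simp: \<A>_def)
  have Lid: "ideal L R" "b \<subseteq> L" "saturation P L \<subseteq> L" using L by (auto simp: \<A>_def)
  have y': "y \<in> carrier R" using ideal.Icarr[OF a] y by auto
  define L1 where "L1 = saturation P (adjoin L y)"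
  have L1: "ideal L1 R" "L \<subseteq> L1" "y \<in> L1"
    using adjoin_ideal[OF Lid(1) y'] ideal_saturation[OF P] subset_saturation[OF P]
    unfolding L1_def by blast+
  have "L1 \<notin> \<A>" using max[of L1] L1 y(2) by auto
  then have aL1: "a \<subseteq> L1" using L1 Lid(2) saturation_saturation[OF P] unfolding \<A>_def L1_def by auto
  obtain u l t where u: "u \<in> carrier R - P" and l: "l \<in> b" and t: "t \<in> a"
    and eq: "u \<otimes> y = l \<oplus> f \<otimes> t" using gen[OF y(1)] by blast
  obtain v m c where v: "v \<in> carrier R - P" and m: "m \<in> L" and c: "c \<in> carrier R"
    and eq2: "v \<otimes> t = m \<oplus> c \<otimes> y" using aL1 t by (auto simp: L1_def saturation_def adjoin_def)
  have [simp]: "u \<in> carrier R" "v \<in> carrier R" "l \<in> carrier R" "m \<in> carrier R" "t \<in> carrier R"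
    "y \<in> carrier R" "c \<in> carrier R" "f \<in> carrier R"
    using u v l m c f' y' ideal.Icarr[OF b] ideal.Icarr[OF a t] by auto
  have "(v \<otimes> u) \<otimes> y = v \<otimes> (l \<oplus> f \<otimes> t)" by (simp add: m_assoc eq)
  also have "\<dots> = v \<otimes> l \<oplus> f \<otimes> (v \<otimes> t)" by (simp add: r_distr m_ac)
  also have "\<dots> = (v \<otimes> l \<oplus> f \<otimes> m) \<oplus> (f \<otimes> c) \<otimes> y" unfolding eq2 by (simp add: r_distr m_ac a_ac)
  finally have "(v \<otimes> u \<ominus> f \<otimes> c) \<otimes> y = v \<otimes> l \<oplus> f \<otimes> m"
    by (simp add: a_minus_def l_distr l_minus a_assoc r_neg)
  moreover have "\<dots> \<in> L" using l m Lid(2) by (auto intro!: L.a_closed L.I_l_closed)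
  \<comment> \<open>A unit of the local ring: \<open>v\<close> and \<open>u\<close> are outside
    \<open>P\<close> and \<open>f\<close> is inside.\<close>
  moreover have "v \<otimes> u \<ominus> f \<otimes> c \<in> carrier R - P"
  proof -
    have "v \<otimes> u = (v \<otimes> u \<ominus> f \<otimes> c) \<oplus> f \<otimes> c" by (simp add: a_minus_def a_assoc l_neg)
    moreover have "f \<otimes> c \<in> P" using P.I_r_closed[OF f] by simp
    ultimately have "v \<otimes> u \<ominus> f \<otimes> c \<notin> P"
      using prime_mult_notin[OF P v u] P.a_closed by (metis DiffE)
    then show ?thesis by simp
  qed
  ultimately have "y \<in> L" using saturatedD[OF Lid(3) _ y', of "v \<otimes> u \<ominus> f \<otimes> c"] by simp
  then show False using y by simp
qed

text \<open>The maximal ideal of the local ring is nil modulo \<open>J\<close>. Otherwise take a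
  saturated \<open>L\<close> maximal among those without powers of \<open>g\<close>; adjoining an
  element \<open>y\<close> annihilated by \<open>P\<close> brings in some power of \<open>g\<close>,
  and one more factor \<open>g\<close> puts the next power into \<open>L\<close>.\<close>

lemma minimal_prime_over_radical:
  assumes min: "minimal_prime_over P J" and J: "ideal J R" and g: "g \<in> P"
  obtains u k where "u \<in> carrier R - P" "u \<otimes> g [^] (k::nat) \<in> J"
proof -
  interpret P: primeideal P R using min by (simp add: minimal_prime_over_def)
  have P: "primeideal P R" by unfold_locales
  have g': "g \<in> carrier R" using g P.Icarr by auto
  have "\<exists>k. g [^] (k::nat) \<in> saturation P J"
  proof (rule ccontr)
    assume neg: "\<nexists>k. g [^] (k::nat) \<in> saturation P J"
    define \<A> where "\<A> = {L. ideal L R \<and> J \<subseteq> L \<and> saturation P L \<subseteq> L \<and> (\<forall>k. g [^] (k::nat) \<notin> L)}"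
    have "saturation P J \<in> \<A>"
      using neg ideal_saturation[OF P J] subset_saturation[OF P J] saturation_saturation[OF P]
      by (auto simp: \<A>_def)
    moreover have "ideal L R" if "L \<in> \<A>" for L
      using that by (auto simp: \<A>_def primeideal_def)
    ultimately have "\<exists>M\<in>\<A>. \<forall>L\<in>\<A>. M \<subseteq> L \<longrightarrow> L = M"
      by (rule maximal_ideal_of_family)
    then obtain L where L: "L \<in> \<A>" and max: "\<And>M. M \<in> \<A> \<Longrightarrow> L \<subseteq> M \<Longrightarrow> M = L"
      by blast
    have Lid: "ideal L R" "J \<subseteq> L" "saturation P L \<subseteq> L" and gL: "\<And>k. g [^] (k::nat) \<notin> L"
      using L by (auto simp: \<A>_def)
    interpret L: ideal L R by fact
    have "L \<noteq> carrier R" using gL g' by auto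
    then obtain y where y: "y \<in> carrier R" "y \<notin> L"
      and yP: "\<And>c. c \<in> carrier R \<Longrightarrow> c \<otimes> y \<in> L \<longleftrightarrow> c \<in> P"
      using associated_minimal_prime[OF min Lid] by (metis DiffE)
    define L1 where "L1 = saturation P (adjoin L y)"
    have L1: "ideal L1 R" "L \<subseteq> L1" "y \<in> L1"
      using adjoin_ideal[OF Lid(1) y(1)] ideal_saturation[OF P] subset_saturation[OF P]
      unfolding L1_def by blast+
    have "L1 \<notin> \<A>" using max[of L1] L1 y(2) by auto
    then obtain k where "g [^] (k::nat) \<in> L1"
      using L1 Lid(2) saturation_saturation[OF P] unfolding \<A>_def L1_def by auto
    then obtain u l c where u: "u \<in> carrier R - P" and l: "l \<in> L" and c: "c \<in> carrier R"
      and eq: "u \<otimes> g [^] k = l \<oplus> c \<otimes> y" by (auto simp: L1_def saturation_def adjoin_def)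
    have "u \<otimes> g [^] Suc k = g \<otimes> (u \<otimes> g [^] k)" using u g' by (simp add: m_ac)
    also have "\<dots> = g \<otimes> l \<oplus> c \<otimes> (g \<otimes> y)" unfolding eq
      using g' c y L.Icarr[OF l] by (simp add: r_distr m_ac)
    also have "\<dots> \<in> L" using yP[OF g'] g l g' c by (auto intro!: L.a_closed L.I_l_closed)
    finally have "g [^] Suc k \<in> L" using saturatedD[OF Lid(3) u] g' by (metis nat_pow_closed)
    then show False using gL by blast
  qed
  then show ?thesis using that by (auto simp: saturation_def)
qed

text \<open>
  The symbolic powers of the classical proof are replaced by the contractions of the powers
  of a single element of \<open>Q\<close>.
\<close>

theorem principal_ideal_theorem:
  assumes Q': "primeideal Q' R" and Q: "primeideal Q R" and "Q' \<subset> Q" "Q \<subset> P"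
    and f: "f \<in> P" and min: "minimal_prime_over P (adjoin Q' f)"
  shows False
proof -
  interpret P: primeideal P R using min by (simp add: minimal_prime_over_def)
  interpret Q: primeideal Q R by fact
  interpret Q': primeideal Q' R by fact
  have P: "primeideal P R" by unfold_locales
  have idQ': "ideal Q' R" by unfold_locales
  have f': "f \<in> carrier R" using f P.Icarr by auto
  have PQ: "carrier R - P \<subseteq> carrier R - Q" using assms(4) by auto
  have fQ: "f \<in> carrier R - Q"
  proof -
    have "f \<notin> Q"
    proof
      assume "f \<in> Q"
      then have "adjoin Q' f \<subseteq> Q"
        using assms(3) unfolding adjoin_def by (auto intro!: Q.a_closed Q.I_l_closed)
      then have "Q = P" using min Q assms(4) by (auto simp: minimal_prime_over_def)
      then show False using assms(4) by auto
    qed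
    then show ?thesis using f' by simp
  qed
  obtain y where y: "y \<in> Q" "y \<notin> Q'" using assms(3) by auto
  have y': "y \<in> carrier R" using y Q.Icarr by auto
  \<comment> \<open>Locally at \<open>Q\<close> these ideals are generated by \<open>Q'\<close> and
    the powers of \<open>y\<close>, an element that separates the two primes.\<close>
  define a where "a n = saturation Q (adjoin Q' (y [^] n))" for n :: nat
  have aid: "ideal (a n) R" for n
    unfolding a_def using ideal_saturation[OF Q] adjoin_ideal[OF idQ'] y' by auto
  have asat: "saturation Q (a n) \<subseteq> a n" for n
    unfolding a_def by (rule saturation_saturation[OF Q])
  have Q'a: "Q' \<subseteq> a n" for n
    unfolding a_def using subset_saturation[OF Q] adjoin_ideal[OF idQ'] y' by (meson nat_pow_closed subset_trans)
  have ya: "y [^] n \<in> a n" for n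
    unfolding a_def using subset_saturation[OF Q] adjoin_ideal[OF idQ'] y' by (meson nat_pow_closed subsetD)
  have amono: "a (Suc n) \<subseteq> a n" for n unfolding a_def
  proof (rule saturation_mono, rule subsetI)
    fix r assume "r \<in> adjoin Q' (y [^] Suc n)"
    then obtain l c where "r = l \<oplus> c \<otimes> (y [^] n \<otimes> y)" "l \<in> Q'" "c \<in> carrier R"
      by (auto simp: adjoin_def)
    then have "r = l \<oplus> (c \<otimes> y) \<otimes> y [^] n" "l \<in> Q'" "c \<otimes> y \<in> carrier R"
      using y' by (auto simp: m_ac)
    then show "r \<in> adjoin Q' (y [^] n)" unfolding adjoin_def by blast
  qed
  \<comment> \<open>Adding \<open>f\<close> and saturating at the larger prime \<open>P\<close> puts
    the chain above \<open>adjoin Q' f\<close>, where descending chains of saturated ideals are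
    stable.\<close>
  define b where "b n = saturation P (adjoin (a n) f)" for n
  have "\<exists>n. \<forall>m\<ge>n. b m = b n"
  proof (rule saturated_descending_chain[OF min])
    show "ideal (b n) R" "saturation P (b n) \<subseteq> b n" for n
      unfolding b_def using ideal_saturation[OF P] adjoin_ideal[OF aid f'] saturation_saturation[OF P]
      by auto
    show "adjoin Q' f \<subseteq> b n" for n
      using Q'a[of n] subset_saturation[OF P adjoin_ideal(1)[OF aid f']] unfolding b_def adjoin_def by blast
    show "b (Suc n) \<subseteq> b n" for n
      unfolding b_def using amono by (intro saturation_mono) (auto simp: adjoin_def)
    show "ideal (adjoin Q' f) R" by (rule adjoin_ideal[OF idQ' f'])
  qed
  then obtain n where n: "b (Suc n) = b n" by (metis le_add2 plus_1_eq_Suc)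
  \<comment> \<open>Since \<open>f\<close> is outside \<open>Q\<close> and \<open>a n\<close> is
    saturated at \<open>Q\<close>, the cofactor of \<open>f\<close> is itself in \<open>a n\<close>,
    as Nakayama's lemma requires.\<close>
  have "a n \<subseteq> saturation P (a (Suc n))"
  proof (rule nakayama_saturation[OF P aid aid f])
    fix r assume r: "r \<in> a n"
    have "a n \<subseteq> b n" unfolding b_def
      using subset_saturation[OF P adjoin_ideal(1)[OF aid f']] adjoin_ideal(2)[OF aid f'] by blast
    then have "r \<in> b (Suc n)" using r n by auto
    then obtain u s t where u: "u \<in> carrier R - P" and s: "s \<in> a (Suc n)" and t: "t \<in> carrier R"
      and eq: "u \<otimes> r = s \<oplus> t \<otimes> f" by (auto simp: b_def saturation_def adjoin_def)
    interpret an: ideal "a n" R by (rule aid)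
    have s': "s \<in> a n" using s amono by auto
    have "f \<otimes> t = u \<otimes> r \<oplus> \<ominus> s"
      using eq u t f' an.Icarr[OF r] an.Icarr[OF s'] by (simp add: a_ac r_neg2 r_neg r_neg1 m_comm)
    moreover have "\<dots> \<in> a n" using u r s' by (auto intro!: an.I_l_closed)
    ultimately have "t \<in> a n" using saturatedD[OF asat fQ t] by auto
    then show "\<exists>u\<in>carrier R - P. \<exists>l\<in>a (Suc n). \<exists>t\<in>a n. u \<otimes> r = l \<oplus> f \<otimes> t"
      using u s eq t f' by (metis m_comm)
  qed
  then obtain u where u: "u \<in> carrier R - P" "u \<otimes> y [^] n \<in> a (Suc n)"
    using ya[of n] by (auto simp: saturation_def)
  then obtain v l c where v: "v \<in> carrier R - Q" and l: "l \<in> Q'" and c: "c \<in> carrier R"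
    and eq: "v \<otimes> (u \<otimes> y [^] n) = l \<oplus> c \<otimes> y [^] Suc n"
    by (auto simp: a_def saturation_def adjoin_def)
  have [simp]: "u \<in> carrier R" "v \<in> carrier R" "l \<in> carrier R" "y \<in> carrier R" "c \<in> carrier R"
    using u v l c y' by auto
  \<comment> \<open>Cancelling \<open>y [^] n\<close> modulo \<open>Q'\<close> puts
    \<open>v \<otimes> u\<close> into \<open>Q\<close>, although neither factor is there.\<close>
  have "(v \<otimes> u \<ominus> c \<otimes> y) \<otimes> y [^] n = v \<otimes> (u \<otimes> y [^] n) \<ominus> c \<otimes> y [^] Suc n"
    by (simp add: a_minus_def l_distr l_minus m_assoc m_comm[of y])
  also have "\<dots> = l" unfolding eq by (simp add: a_minus_def a_assoc r_neg)
  finally have "(v \<otimes> u \<ominus> c \<otimes> y) \<otimes> y [^] n \<in> Q'" using l by simp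
  moreover have "y [^] n \<notin> Q'" for n :: nat
  proof (induction n)
    case 0
    show ?case using prime_one_notin[OF Q'] by simp
  next
    case (Suc n)
    then show ?case using prime_mult_notin[OF Q', of "y [^] n" y] y by simp
  qed
  ultimately have "v \<otimes> u \<ominus> c \<otimes> y \<in> Q" using Q'.I_prime assms(3) by (meson \<open>c \<in> carrier R\<close> \<open>u \<in> carrier R\<close> \<open>v \<in> carrier R\<close> \<open>y \<in> carrier R\<close> m_closed minus_closed nat_pow_closed psubsetD)
  moreover have "v \<otimes> u = (v \<otimes> u \<ominus> c \<otimes> y) \<oplus> c \<otimes> y" by (simp add: a_minus_def a_assoc l_neg)
  moreover have "c \<otimes> y \<in> Q" using y by (simp add: Q.I_l_closed)
  ultimately have "v \<otimes> u \<in> Q" using Q.a_closed by metis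
  then show False using prime_mult_notin[OF Q v, of u] u(1) PQ by blast
qed

text \<open>Induction on the number of generators. With \<open>Q\<close> maximal below
  \<open>P\<close> and a generator \<open>f\<close> outside \<open>Q\<close>, powers of the other
  generators can be moved into \<open>Q\<close> modulo \<open>f\<close>, up to local units; then
  \<open>Q\<close> is minimal over one generator fewer, and the chain up to \<open>Q\<close> is
  shorter by one.\<close>

theorem krull_height:
  assumes "minimal_prime_over P (genideal R (J \<union> T))" "ideal J R" "finite T" "T \<subseteq> carrier R"
    and "\<And>i. i \<le> l \<Longrightarrow> primeideal (q i) R" "\<And>i. i < l \<Longrightarrow> q i \<subset> q (Suc i)" "q l = P" "J \<subseteq> q 0"
  shows "l \<le> card T"
  using assms
proof (induction "card T" arbitrary: T P l q rule: less_induct)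
  case less
  note min = \<open>minimal_prime_over P (genideal R (J \<union> T))\<close>
  have P: "primeideal P R" and JTP: "genideal R (J \<union> T) \<subseteq> P"
    using min by (auto simp: minimal_prime_over_def)
  have JTc: "J \<union> T \<subseteq> carrier R" using less.prems(2,4) ideal.Icarr by auto
  then have JT: "J \<subseteq> P" "T \<subseteq> P" using JTP genideal_self by blast+
  show ?case
  proof (cases l)
    case (Suc l')
    define \<A> where "\<A> = {Q. primeideal Q R \<and> q l' \<subseteq> Q \<and> Q \<subset> P}"
    have "q l' \<in> \<A>" using less.prems(5)[of l'] less.prems(6)[of l'] less.prems(7) Suc
      by (auto simp: \<A>_def)
    moreover have "ideal L R" if "L \<in> \<A>" for L
      using that by (auto simp: \<A>_def primeideal_def)
    ultimately have "\<exists>M\<in>\<A>. \<forall>L\<in>\<A>. M \<subseteq> L \<longrightarrow> L = M"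
      by (rule maximal_ideal_of_family)
    then obtain Q where "Q \<in> \<A>" and max: "\<And>M. M \<in> \<A> \<Longrightarrow> Q \<subseteq> M \<Longrightarrow> M = Q"
      by blast
    then have Q: "primeideal Q R" "q l' \<subseteq> Q" "Q \<subset> P" by (auto simp: \<A>_def)
    interpret Q: primeideal Q R by fact
    have between: "M = P" if "primeideal M R" "Q \<subset> M" "M \<subseteq> P" for M
      using max[of M] that Q by (auto simp: \<A>_def)
    have "q 0 \<subseteq> q i" if "i \<le> l" for i using that
    proof (induction i)
      case (Suc i)
      then have "q i \<subset> q (Suc i)" using less.prems(6)[of i] by simp
      then show ?case using Suc by simp
    qed simp
    from this[of l'] have JQ: "J \<subseteq> Q" using less.prems(8) Q(2) Suc by auto
    have "\<not> T \<subseteq> Q"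
    proof
      assume "T \<subseteq> Q"
      then have "genideal R (J \<union> T) \<subseteq> Q" using JQ by (intro genideal_minimal) (auto intro: Q.is_ideal)
      then have "Q = P" using min Q by (auto simp: minimal_prime_over_def)
      then show False using Q(3) by simp
    qed
    then obtain f where f: "f \<in> T" "f \<notin> Q" by auto
    have f': "f \<in> carrier R" "f \<in> P" using f JTc JT by auto
    have minQf: "minimal_prime_over P (adjoin Q f)"
      unfolding minimal_prime_over_def
    proof (intro conjI allI impI P)
      interpret P: primeideal P R by (rule P)
      show "adjoin Q f \<subseteq> P" unfolding adjoin_def
        using Q(3) f' by (auto intro!: P.a_closed P.I_l_closed)
      fix M assume M: "primeideal M R \<and> adjoin Q f \<subseteq> M \<and> M \<subseteq> P"
      then have "Q \<subset> M" using adjoin_ideal[OF Q.is_ideal f'(1)] f by auto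
      then show "M = P" using between M by auto
    qed
    \<comment> \<open>Modulo \<open>Q\<close> and \<open>f\<close> every generator is locally
      nilpotent, because \<open>P\<close> is minimal over \<open>adjoin Q f\<close>.\<close>
    have "\<exists>u k a b. u \<in> carrier R - P \<and> b \<in> Q \<and> a \<in> carrier R \<and> u \<otimes> g [^] (k::nat) = b \<oplus> a \<otimes> f"
      if g: "g \<in> T" for g
    proof -
      have "g \<in> P" using g JT by auto
      then obtain u k where "u \<in> carrier R - P" "u \<otimes> g [^] (k::nat) \<in> adjoin Q f"
        using minimal_prime_over_radical[OF minQf] adjoin_ideal[OF Q.is_ideal f'(1)] by metis
      then show ?thesis unfolding adjoin_def by blast
    qed
    then obtain u k a b where uk: "\<And>g. g \<in> T \<Longrightarrow> u g \<in> carrier R - P"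
      "\<And>g. g \<in> T \<Longrightarrow> b g \<in> Q" "\<And>g. g \<in> T \<Longrightarrow> a g \<in> carrier R"
      "\<And>g. g \<in> T \<Longrightarrow> u g \<otimes> g [^] (k g::nat) = b g \<oplus> a g \<otimes> f" by metis
    \<comment> \<open>The components in \<open>Q\<close> of these powers replace the generators
      other than \<open>f\<close>.\<close>
    define T' where "T' = b ` (T - {f})"
    have T': "T' \<subseteq> Q" "finite T'" "T' \<subseteq> carrier R"
      using uk(2) less.prems(3) Q.Icarr by (auto simp: T'_def)
    have card: "card T' < card T"
      using card_image_le[of "T - {f}" b] card_Diff1_less[of T f] less.prems(3) f by (simp add: T'_def)
    have "minimal_prime_over Q (genideal R (J \<union> T'))"
      unfolding minimal_prime_over_def
    proof (intro conjI allI impI Q(1))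
      show "genideal R (J \<union> T') \<subseteq> Q" using JQ T' by (intro genideal_minimal) (auto intro: Q.is_ideal)
      fix Q' assume Q': "primeideal Q' R \<and> genideal R (J \<union> T') \<subseteq> Q' \<and> Q' \<subseteq> Q"
      then interpret Q': primeideal Q' R by simp
      have JT'Q': "J \<subseteq> Q'" "T' \<subseteq> Q'" using Q' genideal_self[of "J \<union> T'"] JTc T' by auto
      \<comment> \<open>A prime inside \<open>P\<close> that contains \<open>Q'\<close> and
        \<open>f\<close> contains a power of every generator, hence all of them. A prime
        \<open>Q'\<close> strictly below \<open>Q\<close> would then contradict the principal ideal
        theorem.\<close>
      have "minimal_prime_over P (adjoin Q' f)"
        unfolding minimal_prime_over_def
      proof (intro conjI allI impI P)
        show "adjoin Q' f \<subseteq> P"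
          using minQf Q' unfolding minimal_prime_over_def adjoin_def by blast
        fix M assume M: "primeideal M R \<and> adjoin Q' f \<subseteq> M \<and> M \<subseteq> P"
        then interpret M: primeideal M R by simp
        have QM: "Q' \<subseteq> M" "f \<in> M" using M adjoin_ideal[OF Q'.is_ideal f'(1)] by auto
        have "g \<in> M" if g: "g \<in> T" for g
        proof (cases "g = f")
          case False
          then have "b g \<in> M" using g JT'Q' QM by (auto simp: T'_def)
          then have "u g \<otimes> g [^] k g \<in> M" unfolding uk(4)[OF g]
            using QM uk(3)[OF g] by (auto intro!: M.a_closed M.I_l_closed)
          then have "u g \<in> M \<or> g [^] k g \<in> M" using uk(1)[OF g] g JTc by (intro M.I_prime) auto
          then have gk: "g [^] k g \<in> M" using uk(1)[OF g] M by auto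
          have "g [^] n \<in> M \<Longrightarrow> g \<in> M" for n :: nat
          proof (induction n)
            case 0
            then show ?case using prime_one_notin[of M] M by simp
          next
            case (Suc n)
            then show ?case using M.I_prime[of "g [^] n" g] g JTc by auto
          qed
          then show ?thesis using gk by blast
        qed (use QM in simp)
        then have "genideal R (J \<union> T) \<subseteq> M"
          using JT'Q' QM by (intro genideal_minimal) (auto intro: M.is_ideal)
        then show "M = P" using min M by (auto simp: minimal_prime_over_def)
      qed
      then show "Q' = Q"
        using principal_ideal_theorem[of Q' Q P f] Q' Q f' by blast
    qed
    moreover have "primeideal ((q(l' := Q)) i) R" if "i \<le> l'" for i
      using that less.prems(5)[of i] Q Suc by auto
    moreover have "(q(l' := Q)) i \<subset> (q(l' := Q)) (Suc i)" if "i < l'" for i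
      using that less.prems(6)[of i] Q(2) Suc by auto
    moreover have "J \<subseteq> (q(l' := Q)) 0" using JQ less.prems(8) by auto
    ultimately have "l' \<le> card T'"
      using less.hyps[OF card, of Q l' "q(l' := Q)"] T' less.prems(2) by simp
    then show ?thesis using card Suc by simp
  qed simp
qed

end

section \<open>Localization\<close>

locale fractions = cring R for R (structure) +
  fixes S :: "'a set"
  assumes S_sub: "S \<subseteq> carrier R" and S_one: "\<one> \<in> S"
    and S_mult: "s \<in> S \<Longrightarrow> t \<in> S \<Longrightarrow> s \<otimes> t \<in> S"
begin

lemma S_carrier [simp]: "s \<in> S \<Longrightarrow> s \<in> carrier R" using S_sub by blast

lemma loc_rel_iff: "((a, s), (b, t)) \<in> loc_rel R S \<longleftrightarrow>
    a \<in> carrier R \<and> s \<in> S \<and> b \<in> carrier R \<and> t \<in> S \<and> (\<exists>u\<in>S. u \<otimes> (t \<otimes> a) = u \<otimes> (s \<otimes> b))"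
  by (simp add: loc_rel_def)

lemma equiv_loc_rel: "equiv (carrier R \<times> S) (loc_rel R S)"
proof (rule equivI)
  show "loc_rel R S \<subseteq> (carrier R \<times> S) \<times> (carrier R \<times> S)" by (auto simp: loc_rel_def)
  show "refl_on (carrier R \<times> S) (loc_rel R S)"
    using S_one by (auto simp: refl_on_def loc_rel_iff)
  show "sym (loc_rel R S)"
  proof (rule symI)
    fix x y assume "(x, y) \<in> loc_rel R S"
    then show "(y, x) \<in> loc_rel R S"
      by (cases x; cases y) (force simp: loc_rel_iff)
  qed
  show "trans (loc_rel R S)"
  proof (rule transI)
    fix x y z assume xy: "(x, y) \<in> loc_rel R S" and yz: "(y, z) \<in> loc_rel R S"
    obtain a s b t c w where [simp]: "x = (a, s)" "y = (b, t)" "z = (c, w)" by (cases x; cases y; cases z)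
    obtain u where u: "u \<in> S" "u \<otimes> (t \<otimes> a) = u \<otimes> (s \<otimes> b)"
      and c: "a \<in> carrier R" "s \<in> S" "b \<in> carrier R" "t \<in> S" using xy by (auto simp: loc_rel_iff)
    obtain v where v: "v \<in> S" "v \<otimes> (w \<otimes> b) = v \<otimes> (t \<otimes> c)"
      and d: "c \<in> carrier R" "w \<in> S" using yz by (auto simp: loc_rel_iff)
    \<comment> \<open>The witness contains the middle denominator \<open>t\<close>, a factor needed
      to apply both relations.\<close>
    have "(u \<otimes> v \<otimes> t) \<otimes> (w \<otimes> a) = v \<otimes> w \<otimes> (u \<otimes> (t \<otimes> a))" using u(1) v(1) c d by (simp add: m_ac)
    also have "\<dots> = u \<otimes> s \<otimes> (v \<otimes> (w \<otimes> b))" unfolding u(2) using u(1) v(1) c d by (simp add: m_ac)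
    also have "\<dots> = (u \<otimes> v \<otimes> t) \<otimes> (s \<otimes> c)" unfolding v(2) using u(1) v(1) c d by (simp add: m_ac)
    finally have "(u \<otimes> v \<otimes> t) \<otimes> (w \<otimes> a) = (u \<otimes> v \<otimes> t) \<otimes> (s \<otimes> c)" .
    moreover have "u \<otimes> v \<otimes> t \<in> S" using u(1) v(1) c(4) by (intro S_mult)
    ultimately show "(x, z) \<in> loc_rel R S" using c d by (auto simp: loc_rel_iff)
  qed
qed

lemma frac_eq_iff:
  assumes "a \<in> carrier R" "s \<in> S" "b \<in> carrier R" "t \<in> S"
  shows "loc_frac R S a s = loc_frac R S b t \<longleftrightarrow> (\<exists>u\<in>S. u \<otimes> (t \<otimes> a) = u \<otimes> (s \<otimes> b))"
  unfolding loc_frac_def using eq_equiv_class_iff[OF equiv_loc_rel, of "(a, s)" "(b, t)"] assms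
  by (simp add: loc_rel_iff)

lemma frac_eqI:
  assumes "a \<in> carrier R" "s \<in> S" "b \<in> carrier R" "t \<in> S" "t \<otimes> a = s \<otimes> b"
  shows "loc_frac R S a s = loc_frac R S b t"
  unfolding frac_eq_iff[OF assms(1-4)] using S_one assms(5) by (intro bexI[of _ \<one>]) simp_all

lemma carrier_localization: "carrier (localization R S) = {loc_frac R S a s | a s. a \<in> carrier R \<and> s \<in> S}"
  by (auto simp: localization_def loc_frac_def quotient_def)

lemma frac_closed: "a \<in> carrier R \<Longrightarrow> s \<in> S \<Longrightarrow> loc_frac R S a s \<in> carrier (localization R S)"
  by (auto simp: carrier_localization)

lemma zero_localization: "\<zero>\<^bsub>localization R S\<^esub> = loc_frac R S \<zero> \<one>"
  and one_localization: "\<one>\<^bsub>localization R S\<^esub> = loc_frac R S \<one> \<one>"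
  by (simp_all add: localization_def)

text \<open>The operation is a union over representatives; independence of the representatives
  collapses it to the class of a single pair. The same holds for the sum.\<close>

lemma mult_frac:
  assumes as: "a \<in> carrier R" "s \<in> S" and bt: "b \<in> carrier R" "t \<in> S"
  shows "loc_frac R S a s \<otimes>\<^bsub>localization R S\<^esub> loc_frac R S b t = loc_frac R S (a \<otimes> b) (s \<otimes> t)"
proof -
  let ?f = "\<lambda>x y. case x of (a, s) \<Rightarrow> case y of (b, t) \<Rightarrow> loc_frac R S (a \<otimes> b) (s \<otimes> t)"
  have cg: "congruent2 (loc_rel R S) (loc_rel R S) ?f"
  proof (rule congruent2_commuteI[OF equiv_loc_rel])
    show "?f y z = ?f z y" if "y \<in> carrier R \<times> S" "z \<in> carrier R \<times> S" for y z
      using that by (auto simp: m_comm)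
    fix y z w assume w: "w \<in> carrier R \<times> S" and yz: "(y, z) \<in> loc_rel R S"
    obtain a s b t c r where [simp]: "y = (a, s)" "z = (b, t)" "w = (c, r)" by (cases y; cases z; cases w)
    obtain u where u: "u \<in> S" "u \<otimes> (t \<otimes> a) = u \<otimes> (s \<otimes> b)"
      and c: "a \<in> carrier R" "s \<in> S" "b \<in> carrier R" "t \<in> S" using yz by (auto simp: loc_rel_iff)
    have d: "c \<in> carrier R" "r \<in> S" using w by auto
    have "u \<otimes> (r \<otimes> t \<otimes> (c \<otimes> a)) = r \<otimes> c \<otimes> (u \<otimes> (t \<otimes> a))" using u(1) c d by (simp add: m_ac)
    also have "\<dots> = u \<otimes> (r \<otimes> s \<otimes> (c \<otimes> b))" unfolding u(2) using u(1) c d by (simp add: m_ac)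
    finally show "?f w y = ?f w z"
      using u(1) c d S_mult by (auto simp: frac_eq_iff)
  qed
  have "loc_frac R S a s \<otimes>\<^bsub>localization R S\<^esub> loc_frac R S b t =
      (\<Union>x\<in>loc_rel R S `` {(a, s)}. \<Union>y\<in>loc_rel R S `` {(b, t)}. ?f x y)"
    unfolding localization_def by (simp add: UN_UN_split_split_eq loc_frac_def[of R S a s] loc_frac_def[of R S b t])
  also have "\<dots> = ?f (a, s) (b, t)"
    using as bt by (intro UN_equiv_class2[OF equiv_loc_rel equiv_loc_rel cg]) auto
  finally show ?thesis by simp
qed

lemma add_frac:
  assumes as: "a \<in> carrier R" "s \<in> S" and bt: "b \<in> carrier R" "t \<in> S"
  shows "loc_frac R S a s \<oplus>\<^bsub>localization R S\<^esub> loc_frac R S b t =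
    loc_frac R S ((t \<otimes> a) \<oplus> (s \<otimes> b)) (s \<otimes> t)"
proof -
  let ?f = "\<lambda>x y. case x of (a, s) \<Rightarrow> case y of (b, t) \<Rightarrow> loc_frac R S ((t \<otimes> a) \<oplus> (s \<otimes> b)) (s \<otimes> t)"
  have cg: "congruent2 (loc_rel R S) (loc_rel R S) ?f"
  proof (rule congruent2_commuteI[OF equiv_loc_rel])
    show "?f y z = ?f z y" if "y \<in> carrier R \<times> S" "z \<in> carrier R \<times> S" for y z
      using that by (auto simp: m_comm a_comm)
    fix y z w assume w: "w \<in> carrier R \<times> S" and yz: "(y, z) \<in> loc_rel R S"
    obtain a s b t c r where [simp]: "y = (a, s)" "z = (b, t)" "w = (c, r)" by (cases y; cases z; cases w)
    obtain u where u: "u \<in> S" "u \<otimes> (t \<otimes> a) = u \<otimes> (s \<otimes> b)"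
      and c: "a \<in> carrier R" "s \<in> S" "b \<in> carrier R" "t \<in> S" using yz by (auto simp: loc_rel_iff)
    have d: "c \<in> carrier R" "r \<in> S" using w by auto
    have "u \<otimes> (r \<otimes> t \<otimes> (s \<otimes> c \<oplus> r \<otimes> a)) = u \<otimes> (r \<otimes> t \<otimes> (s \<otimes> c)) \<oplus> r \<otimes> r \<otimes> (u \<otimes> (t \<otimes> a))"
      using u(1) c d by (simp add: m_ac r_distr)
    also have "\<dots> = u \<otimes> (r \<otimes> s \<otimes> (t \<otimes> c \<oplus> r \<otimes> b))" unfolding u(2) using u(1) c d by (simp add: m_ac r_distr)
    finally show "?f w y = ?f w z"
      using u(1) c d S_mult by (auto simp: frac_eq_iff)
  qed
  have "loc_frac R S a s \<oplus>\<^bsub>localization R S\<^esub> loc_frac R S b t =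
      (\<Union>x\<in>loc_rel R S `` {(a, s)}. \<Union>y\<in>loc_rel R S `` {(b, t)}. ?f x y)"
    unfolding localization_def by (simp add: UN_UN_split_split_eq loc_frac_def[of R S a s] loc_frac_def[of R S b t])
  also have "\<dots> = ?f (a, s) (b, t)"
    using as bt by (intro UN_equiv_class2[OF equiv_loc_rel equiv_loc_rel cg]) auto
  finally show ?thesis by simp
qed

lemma cring_localization: "cring (localization R S)"
proof (rule cringI)
  let ?A = "localization R S"
  note ops = mult_frac add_frac S_mult S_one
  have E: "\<exists>a s. x = loc_frac R S a s \<and> a \<in> carrier R \<and> s \<in> S" if "x \<in> carrier ?A" for x
    using that by (auto simp: carrier_localization)
  show "abelian_group ?A"
  proof (rule abelian_groupI)
    fix x y z assume "x \<in> carrier ?A" "y \<in> carrier ?A" "z \<in> carrier ?A"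
    from E[OF this(1)] E[OF this(2)] E[OF this(3)] obtain a s b t c r
      where c: "a \<in> carrier R" "s \<in> S" "b \<in> carrier R" "t \<in> S" "c \<in> carrier R" "r \<in> S"
      and [simp]: "x = loc_frac R S a s" "y = loc_frac R S b t" "z = loc_frac R S c r" by blast
    show "x \<oplus>\<^bsub>?A\<^esub> y \<in> carrier ?A" using c by (auto simp: ops intro!: frac_closed)
    show "x \<oplus>\<^bsub>?A\<^esub> y \<oplus>\<^bsub>?A\<^esub> z = x \<oplus>\<^bsub>?A\<^esub> (y \<oplus>\<^bsub>?A\<^esub> z)"
      using c by (simp add: ops) (intro frac_eqI, simp_all add: ops r_distr m_ac a_ac)
    show "x \<oplus>\<^bsub>?A\<^esub> y = y \<oplus>\<^bsub>?A\<^esub> x" using c by (simp add: ops m_comm a_comm)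
    show "\<zero>\<^bsub>?A\<^esub> \<oplus>\<^bsub>?A\<^esub> x = x" using c by (simp add: ops zero_localization)
    have "loc_frac R S (\<ominus> a) s \<oplus>\<^bsub>?A\<^esub> x = \<zero>\<^bsub>?A\<^esub>"
      using c by (simp add: ops zero_localization) (intro frac_eqI, simp_all add: ops r_minus l_neg)
    moreover have "loc_frac R S (\<ominus> a) s \<in> carrier ?A" using c by (intro frac_closed) simp_all
    ultimately show "\<exists>y\<in>carrier ?A. y \<oplus>\<^bsub>?A\<^esub> x = \<zero>\<^bsub>?A\<^esub>" by (rule bexI)
  qed (use S_one in \<open>auto simp: zero_localization intro: frac_closed\<close>)
  show "comm_monoid ?A"
  proof (rule comm_monoidI)
    fix x y z assume "x \<in> carrier ?A" "y \<in> carrier ?A" "z \<in> carrier ?A"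
    from E[OF this(1)] E[OF this(2)] E[OF this(3)] obtain a s b t c r
      where c: "a \<in> carrier R" "s \<in> S" "b \<in> carrier R" "t \<in> S" "c \<in> carrier R" "r \<in> S"
      and [simp]: "x = loc_frac R S a s" "y = loc_frac R S b t" "z = loc_frac R S c r" by blast
    show "x \<otimes>\<^bsub>?A\<^esub> y \<in> carrier ?A" using c by (auto simp: ops intro!: frac_closed)
    show "x \<otimes>\<^bsub>?A\<^esub> y \<otimes>\<^bsub>?A\<^esub> z = x \<otimes>\<^bsub>?A\<^esub> (y \<otimes>\<^bsub>?A\<^esub> z)" using c by (simp add: ops m_assoc)
    show "x \<otimes>\<^bsub>?A\<^esub> y = y \<otimes>\<^bsub>?A\<^esub> x" using c by (simp add: ops m_comm)
    show "\<one>\<^bsub>?A\<^esub> \<otimes>\<^bsub>?A\<^esub> x = x" using c by (simp add: ops one_localization)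
  qed (use S_one in \<open>auto simp: one_localization intro: frac_closed\<close>)
  fix x y z assume "x \<in> carrier ?A" "y \<in> carrier ?A" "z \<in> carrier ?A"
  from E[OF this(1)] E[OF this(2)] E[OF this(3)] obtain a s b t c r
    where c: "a \<in> carrier R" "s \<in> S" "b \<in> carrier R" "t \<in> S" "c \<in> carrier R" "r \<in> S"
    and [simp]: "x = loc_frac R S a s" "y = loc_frac R S b t" "z = loc_frac R S c r" by blast
  show "(x \<oplus>\<^bsub>?A\<^esub> y) \<otimes>\<^bsub>?A\<^esub> z = x \<otimes>\<^bsub>?A\<^esub> z \<oplus>\<^bsub>?A\<^esub> y \<otimes>\<^bsub>?A\<^esub> z"
    using c by (simp add: ops l_distr) (intro frac_eqI, simp_all add: ops r_distr m_ac)
qed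

end

section \<open>Germs of functions at a point\<close>

locale local_ring = R: cring R for R (structure) +
  fixes J P :: "'a set"
  assumes ideal_J: "ideal J R" and prime_P: "primeideal P R" and JP: "J \<subseteq> P"
begin

definition denominators :: "'a set set" where
  "denominators = carrier (R Quot J) - (\<lambda>f. J +> f) ` P"

definition germs :: "('a set \<times> 'a set) set ring" where
  "germs = localization (R Quot J) denominators"

text \<open>The canonical map from \<open>R\<close> to the localization of \<open>R/J\<close> at
  \<open>P\<close>, through which the local ring is studied by elements of \<open>R\<close>.\<close>

definition germ :: "'a \<Rightarrow> ('a set \<times> 'a set) set" where
  "germ f = loc_frac (R Quot J) denominators (J +> f) \<one>\<^bsub>R Quot J\<^esub>"

sublocale J: ideal J R by (rule ideal_J)
sublocale P: primeideal P R by (rule prime_P)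
sublocale B: cring "R Quot J" by (rule J.quotient_is_cring[OF R.is_cring])

lemma coset_simps:
  "f \<in> carrier R \<Longrightarrow> J +> f \<in> carrier (R Quot J)"
  "f \<in> carrier R \<Longrightarrow> g \<in> carrier R \<Longrightarrow> (J +> f) \<otimes>\<^bsub>R Quot J\<^esub> (J +> g) = J +> f \<otimes> g"
  "f \<in> carrier R \<Longrightarrow> g \<in> carrier R \<Longrightarrow> (J +> f) \<oplus>\<^bsub>R Quot J\<^esub> (J +> g) = J +> f \<oplus> g"
  "\<one>\<^bsub>R Quot J\<^esub> = J +> \<one>"
  "\<zero>\<^bsub>R Quot J\<^esub> = J +> \<zero>"
proof -
  note hom = ring_hom_memE[OF J.rcos_ring_hom]
  show "f \<in> carrier R \<Longrightarrow> J +> f \<in> carrier (R Quot J)" by (rule hom(1))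
  show "f \<in> carrier R \<Longrightarrow> g \<in> carrier R \<Longrightarrow> (J +> f) \<otimes>\<^bsub>R Quot J\<^esub> (J +> g) = J +> f \<otimes> g"
    by (rule hom(2)[symmetric])
  show "f \<in> carrier R \<Longrightarrow> g \<in> carrier R \<Longrightarrow> (J +> f) \<oplus>\<^bsub>R Quot J\<^esub> (J +> g) = J +> f \<oplus> g"
    by (rule hom(3)[symmetric])
  show "\<one>\<^bsub>R Quot J\<^esub> = J +> \<one>" by (rule hom(4)[symmetric])
  show "\<zero>\<^bsub>R Quot J\<^esub> = J +> \<zero>" by (rule ring_hom_zero[OF J.rcos_ring_hom R.ring_axioms B.ring_axioms, symmetric])
qed

lemma coset_eq_iff:
  assumes "f \<in> carrier R" "g \<in> carrier R"
  shows "J +> f = J +> g \<longleftrightarrow> f \<ominus> g \<in> J"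
  using R.quotient_eq_iff_same_a_r_cos[OF ideal_J assms] by (rule HOL.sym)

lemma in_quotE:
  assumes "z \<in> carrier (R Quot J)"
  obtains f where "f \<in> carrier R" "z = J +> f"
proof -
  have "z \<in> (\<Union>f\<in>carrier R. {J +> f})" using assms by (simp only: A_RCOSETS_def' FactRing_def partial_object.select_convs)
  then show thesis by (elim UN_E) (rule that, assumption, simp only: singleton_iff)
qed

text \<open>Since \<open>J\<close> lies in \<open>P\<close>, a coset of \<open>J\<close> is either
  inside \<open>P\<close> or disjoint from it.\<close>

lemma coset_in_denominators: "f \<in> carrier R \<Longrightarrow> J +> f \<in> denominators \<longleftrightarrow> f \<notin> P"
proof
  assume f: "f \<in> carrier R" "f \<notin> P"
  have "J +> f \<noteq> J +> p" if p: "p \<in> P" for p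
  proof
    assume "J +> f = J +> p"
    then have "f \<ominus> p \<in> J" using coset_eq_iff[OF f(1) P.Icarr[OF p]] by (rule iffD1[rotated])
    then have "f \<ominus> p \<in> P" using JP by (rule subsetD[rotated])
    then have "(f \<ominus> p) \<oplus> p \<in> P" using p by (rule P.a_closed)
    moreover have "(f \<ominus> p) \<oplus> p = f" using f p P.Icarr[OF p] by (simp add: a_minus_def R.a_assoc R.l_neg)
    ultimately show False using f by simp
  qed
  then show "J +> f \<in> denominators" using f by (auto simp: denominators_def coset_simps)
qed (auto simp: denominators_def)

sublocale L: fractions "R Quot J" denominators
proof
  show "denominators \<subseteq> carrier (R Quot J)" by (auto simp: denominators_def)
  show "\<one>\<^bsub>R Quot J\<^esub> \<in> denominators"
    unfolding coset_simps(4) coset_in_denominators[OF R.one_closed]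
    using P.I_notcarr by (rule contrapos_nn) (rule P.one_imp_carrier[symmetric])
  fix s t assume s: "s \<in> denominators" and t: "t \<in> denominators"
  obtain f where f: "f \<in> carrier R" "s = J +> f" using s by (auto simp: denominators_def elim: in_quotE)
  obtain g where g: "g \<in> carrier R" "t = J +> g" using t by (auto simp: denominators_def elim: in_quotE)
  have "f \<notin> P" "g \<notin> P" using s t f g coset_in_denominators by auto
  then have "f \<otimes> g \<notin> P" using P.I_prime f g by blast
  then show "s \<otimes>\<^bsub>R Quot J\<^esub> t \<in> denominators" using f g by (simp add: coset_simps coset_in_denominators)
qed

lemma cring_germs: "cring germs" unfolding germs_def by (rule L.cring_localization)

sublocale A: cring germs by (rule cring_germs)

lemma germ_closed [simp]: "f \<in> carrier R \<Longrightarrow> germ f \<in> carrier germs"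
  unfolding germs_def germ_def by (intro L.frac_closed coset_simps L.S_one)

lemma germ_mult: "f \<in> carrier R \<Longrightarrow> g \<in> carrier R \<Longrightarrow> germ (f \<otimes> g) = germ f \<otimes>\<^bsub>germs\<^esub> germ g"
  unfolding germs_def germ_def by (subst L.mult_frac) (simp_all add: coset_simps(1-3) L.S_one)

lemma germ_add: "f \<in> carrier R \<Longrightarrow> g \<in> carrier R \<Longrightarrow> germ (f \<oplus> g) = germ f \<oplus>\<^bsub>germs\<^esub> germ g"
  unfolding germs_def germ_def by (subst L.add_frac) (simp_all add: coset_simps(1-3) L.S_one)

lemma germ_one: "germ \<one> = \<one>\<^bsub>germs\<^esub>"
  unfolding germs_def germ_def L.one_localization by (simp only: coset_simps)

lemma germ_zero: "germ \<zero> = \<zero>\<^bsub>germs\<^esub>"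
  unfolding germs_def germ_def L.zero_localization by (simp only: coset_simps)

lemma germ_eq_zero_iff:
  assumes "f \<in> carrier R"
  shows "germ f = \<zero>\<^bsub>germs\<^esub> \<longleftrightarrow> (\<exists>u\<in>carrier R - P. u \<otimes> f \<in> J)"
proof -
  have "germ f = \<zero>\<^bsub>germs\<^esub> \<longleftrightarrow> (\<exists>u\<in>denominators. u \<otimes>\<^bsub>R Quot J\<^esub> (J +> f) = J +> \<zero>)"
    unfolding germs_def germ_def L.zero_localization
    using assms coset_simps(1)[OF assms] by (simp add: L.frac_eq_iff L.S_one coset_simps(5)[symmetric])
  also have "\<dots> \<longleftrightarrow> (\<exists>u\<in>carrier R - P. u \<otimes> f \<in> J)"
  proof
    assume "\<exists>u\<in>denominators. u \<otimes>\<^bsub>R Quot J\<^esub> (J +> f) = J +> \<zero>"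
    then obtain u where u: "u \<in> denominators" "u \<otimes>\<^bsub>R Quot J\<^esub> (J +> f) = J +> \<zero>" by blast
    obtain g where g: "g \<in> carrier R" "u = J +> g" using u(1) by (auto simp: denominators_def elim: in_quotE)
    have "J +> g \<otimes> f = J +> \<zero>" using u(2) g assms by (simp add: coset_simps(2))
    then have "g \<otimes> f \<in> J" using coset_eq_iff[of "g \<otimes> f" \<zero>] g assms by (simp add: a_minus_def)
    then show "\<exists>u\<in>carrier R - P. u \<otimes> f \<in> J" using g u coset_in_denominators by blast
  next
    assume "\<exists>u\<in>carrier R - P. u \<otimes> f \<in> J"
    then obtain g where g: "g \<in> carrier R" "g \<notin> P" "g \<otimes> f \<in> J" by blast
    then have "J +> g \<otimes> f = J +> \<zero>" using coset_eq_iff[of "g \<otimes> f" \<zero>] assms by (simp add: a_minus_def)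
    then show "\<exists>u\<in>denominators. u \<otimes>\<^bsub>R Quot J\<^esub> (J +> f) = J +> \<zero>"
      using g assms by (intro bexI[of _ "J +> g"]) (simp_all add: coset_simps(2) coset_in_denominators)
  qed
  finally show ?thesis .
qed

lemma germ_unit:
  assumes "u \<in> carrier R" "u \<notin> P"
  shows "\<exists>w\<in>carrier germs. germ u \<otimes>\<^bsub>germs\<^esub> w = \<one>\<^bsub>germs\<^esub>"
proof (rule bexI)
  let ?w = "loc_frac (R Quot J) denominators \<one>\<^bsub>R Quot J\<^esub> (J +> u)"
  have u: "J +> u \<in> denominators" "J +> u \<in> carrier (R Quot J)"
    using assms coset_in_denominators coset_simps(1) by auto
  show "germ u \<otimes>\<^bsub>germs\<^esub> ?w = \<one>\<^bsub>germs\<^esub>"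
    using u unfolding germs_def germ_def L.one_localization
    by (simp add: L.mult_frac L.S_one) (intro L.frac_eqI, simp_all add: L.S_one)
  show "?w \<in> carrier germs" using u unfolding germs_def by (intro L.frac_closed) auto
qed

text \<open>Every germ is a fraction \<open>a/u\<close>, stated as a product so that cosets and
  classes of pairs no longer appear.\<close>

lemma germs_cases:
  assumes "z \<in> carrier germs"
  obtains a u where "a \<in> carrier R" "u \<in> carrier R" "u \<notin> P" "z \<otimes>\<^bsub>germs\<^esub> germ u = germ a"
proof -
  obtain x s where xs: "x \<in> carrier (R Quot J)" "s \<in> denominators" "z = loc_frac (R Quot J) denominators x s"
    using assms by (auto simp: germs_def L.carrier_localization)
  obtain a where a: "a \<in> carrier R" "x = J +> a" using xs(1) by (rule in_quotE)
  obtain u where u: "u \<in> carrier R" "s = J +> u" using xs(2) by (auto simp: denominators_def elim: in_quotE)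
  have "z \<otimes>\<^bsub>germs\<^esub> germ u = germ a"
    using xs a u unfolding germs_def germ_def
    by (simp add: L.mult_frac L.S_one) (intro L.frac_eqI, simp_all add: L.S_one B.m_comm)
  then show thesis using that a u xs(2) coset_in_denominators by blast
qed

end

section \<open>Regular local rings\<close>

lemma krull_dim_attained:
  assumes "krull_dim R = enat d" "primeideal P R"
  shows "\<exists>q. (\<forall>i\<le>d. primeideal (q i) R) \<and> (\<forall>i<d. q i \<subset> q (Suc i))"
proof -
  define C where "C = {enat n | n. \<exists>P. (\<forall>i \<le> n. primeideal (P i) R) \<and> (\<forall>i < n. P i \<subset> P (Suc i))}"
  have "enat 0 \<in> C" unfolding C_def using assms(2) by (intro CollectI exI[of _ 0] conjI exI[of _ "\<lambda>_. P"]) simp_all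
  then have ne: "C \<noteq> {}" by blast
  have S: "Sup C = enat d" using assms(1) by (simp add: krull_dim_def C_def)
  then have fin: "finite C" using ne unfolding Sup_enat_def by (auto split: if_splits)
  then have "Sup C = Max C" using ne by (simp add: Sup_enat_def)
  then have "enat d \<in> C" using Max_in[OF fin ne] S by simp
  then show ?thesis by (simp add: C_def)
qed

lemma krull_dim_le:
  assumes "\<forall>i\<le>n. primeideal (q i) R" "\<forall>i<n. q i \<subset> q (Suc i)"
  shows "enat n \<le> krull_dim R"
  unfolding krull_dim_def using assms by (intro Sup_upper) blast

text \<open>In a field the zero ideal is the only prime, and it is generated by the empty set, of
  cardinality 0.\<close>

lemma (in field) regular_local_ring: "regular_local_ring R"
proof -
  have trivial: "L = {\<zero>} \<or> L = carrier R" if "ideal L R" for L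
    using all_ideals that by blast
  have maxi: "M = {\<zero>}" if "maximalideal M R" for M
    using trivial[of M] that by (metis maximalideal.I_notcarr maximalideal.axioms(1))
  have prim: "Q = {\<zero>}" if "primeideal Q R" for Q
    using trivial[of Q] that by (metis primeideal.I_notcarr primeideal.axioms(1))
  have zero_prime: "primeideal {\<zero>} R" by (rule maximalideal_prime[OF zeromaximalideal])
  have gen: "genideal R {} = {\<zero>}"
  proof
    show "genideal R {} \<subseteq> {\<zero>}" by (rule genideal_minimal[OF zeroideal]) simp
    show "{\<zero>} \<subseteq> genideal R {}"
      using additive_subgroup.zero_closed[OF ideal.axioms(1)[OF genideal_ideal[of "{}"]]] by simp
  qed
  have "{enat n | n. \<exists>P. (\<forall>i \<le> n. primeideal (P i) R) \<and> (\<forall>i < n. P i \<subset> P (Suc i))} = {0}"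
  proof (intro equalityI subsetI)
    fix x assume "x \<in> {enat n | n. \<exists>P. (\<forall>i \<le> n. primeideal (P i) R) \<and> (\<forall>i < n. P i \<subset> P (Suc i))}"
    then obtain n P where x: "x = enat n" and P: "\<forall>i\<le>n. primeideal (P i) R" "\<forall>i<n. P i \<subset> P (Suc i)" by blast
    have "n = 0"
    proof (rule ccontr)
      assume "n \<noteq> 0"
      then have "P 0 = {\<zero>}" "P 1 = {\<zero>}" "P 0 \<subset> P 1" using P prim by auto
      then show False by simp
    qed
    then show "x \<in> {0}" using x by (simp add: zero_enat_def)
  next
    fix x :: enat assume "x \<in> {0}"
    then show "x \<in> {enat n | n. \<exists>P. (\<forall>i \<le> n. primeideal (P i) R) \<and> (\<forall>i < n. P i \<subset> P (Suc i))}"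
      using zero_prime by (intro CollectI exI[of _ 0] conjI exI[of _ "\<lambda>_. {\<zero>}"]) (simp_all add: zero_enat_def)
  qed
  then have dim: "krull_dim R = 0" by (simp add: krull_dim_def)
  have "noetherian_ring R"
  proof (rule noetherian_ringI)
    fix L assume "ideal L R"
    then consider "L = {\<zero>}" | "L = carrier R" using trivial by blast
    then show "\<exists>A\<subseteq>carrier R. finite A \<and> L = Idl A"
    proof cases
      case 1
      then show ?thesis using gen by (intro exI[of _ "{}"]) simp
    next
      case 2
      then show ?thesis using genideal_one by (intro exI[of _ "{\<one>}"]) simp
    qed
  qed
  moreover have "\<exists>!M. maximalideal M R" using maxi zeromaximalideal by blast
  moreover have "finite ({} :: 'a set) \<and> {} \<subseteq> carrier R \<and> maximalideal (genideal R {}) R \<and> enat (card ({} :: 'a set)) = krull_dim R"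
    using gen zeromaximalideal dim by (simp add: zero_enat_def)
  ultimately show ?thesis unfolding regular_local_ring_def using is_cring by blast
qed

section \<open>Generators of the maximal ideal of a regular local ring\<close>

context noetherian_cring
begin

text \<open>Steinitz exchange modulo the square of the maximal ideal \<open>M\<close>: a coefficient
  of \<open>z\<close> outside \<open>M\<close> is a unit, and its generator can be expressed by
  \<open>z\<close> and the others; if all coefficients are in \<open>M\<close>, then
  \<open>z\<close> lies in \<open>N\<close>, which contains the products of elements of
  \<open>M\<close>.\<close>

lemma exchange:
  assumes N: "ideal N R" and MN: "\<And>x y. x \<in> M \<Longrightarrow> y \<in> M \<Longrightarrow> x \<otimes> y \<in> N"
    and unit: "\<And>c. c \<in> carrier R \<Longrightarrow> c \<notin> M \<Longrightarrow> \<exists>w\<in>carrier R. c \<otimes> w = \<one>" and M: "M \<subseteq> carrier R"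
    and T: "finite T" "T \<subseteq> M" and z: "z \<in> genideal R T"
  shows "z \<in> N \<or> (\<exists>t\<in>T. t \<in> genideal R (insert z (T - {t})))"
  using T z
proof (induction T arbitrary: z)
  case empty
  interpret N: ideal N R by (rule N)
  have "genideal R {} \<subseteq> N" by (rule genideal_minimal[OF N]) simp
  then show ?case using empty by blast
next
  case (insert t T)
  interpret N: ideal N R by (rule N)
  have tT: "t \<in> carrier R" "T \<subseteq> carrier R" "t \<in> M" "T \<subseteq> M" using insert.prems(1) M by auto
  interpret G: ideal "genideal R T" R by (rule genideal_ideal[OF tT(2)])
  have ad: "ideal (adjoin (genideal R T) t) R" "genideal R T \<subseteq> adjoin (genideal R T) t" "t \<in> adjoin (genideal R T) t"
    using adjoin_ideal[OF G.is_ideal tT(1)] by auto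
  have "genideal R (insert t T) \<subseteq> adjoin (genideal R T) t"
    using ad genideal_self[OF tT(2)] by (intro genideal_minimal) auto
  then obtain z' c where z': "z' \<in> genideal R T" and c: "c \<in> carrier R" and eq: "z = z' \<oplus> c \<otimes> t"
    using insert.prems(2) unfolding adjoin_def by blast
  have z'c: "z' \<in> carrier R" using z' by (rule G.Icarr)
  have zc: "z \<in> carrier R" using eq z'c c tT by simp
  show ?case
  proof (cases "c \<in> M")
    case True
    then have ct: "c \<otimes> t \<in> N" using MN tT(3) by blast
    consider "z' \<in> N" | t' where "t' \<in> T" "t' \<in> genideal R (insert z' (T - {t'}))"
      using insert.IH[OF tT(4) z'] by blast
    then show ?thesis
    proof cases
      case 1
      then have "z \<in> N" unfolding eq using ct by (rule N.a_closed)
      then show ?thesis ..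
    next
      case 2
      let ?L = "genideal R (insert z (insert t T - {t'}))"
      have sub: "insert z (insert t T - {t'}) \<subseteq> carrier R" using zc tT by auto
      interpret L: ideal ?L R by (rule genideal_ideal[OF sub])
      have mem: "insert z (insert t T - {t'}) \<subseteq> ?L" by (rule genideal_self[OF sub])
      have "t \<noteq> t'" using 2(1) insert.hyps(2) by blast
      then have "t \<in> ?L" "z \<in> ?L" "T - {t'} \<subseteq> ?L" using mem by auto
      then have "z \<oplus> (\<ominus> c) \<otimes> t \<in> ?L" using c by (intro L.a_closed L.I_l_closed) auto
      moreover have "z \<oplus> (\<ominus> c) \<otimes> t = z'"
        unfolding eq using c tT(1) z'c by (simp add: a_assoc l_minus r_neg)
      ultimately have "genideal R (insert z' (T - {t'})) \<subseteq> ?L"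
        using \<open>T - {t'} \<subseteq> ?L\<close> by (intro genideal_minimal L.is_ideal) auto
      then show ?thesis using 2 by blast
    qed
  next
    case False
    then obtain w where w: "w \<in> carrier R" "c \<otimes> w = \<one>" using unit c by blast
    let ?L = "genideal R (insert z (insert t T - {t}))"
    have sub: "insert z (insert t T - {t}) \<subseteq> carrier R" using zc tT by auto
    interpret L: ideal ?L R by (rule genideal_ideal[OF sub])
    have mem: "insert z (insert t T - {t}) \<subseteq> ?L" by (rule genideal_self[OF sub])
    have "insert t T - {t} = T" using insert.hyps(2) by auto
    then have "genideal R T \<subseteq> ?L" using mem by (intro genideal_minimal L.is_ideal) auto
    then have "w \<otimes> (z \<oplus> \<ominus> z') \<in> ?L" using w(1) z' mem by (intro L.I_l_closed L.a_closed L.a_inv_closed) auto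
    moreover have "z \<oplus> \<ominus> z' = c \<otimes> t" unfolding eq using c tT(1) z'c by (simp add: a_ac r_neg2 r_neg)
    moreover have "w \<otimes> (c \<otimes> t) = t" using w c tT(1) m_assoc[of w c t] m_comm[of w c] by simp
    ultimately show ?thesis by auto
  qed
qed

text \<open>
  If a minimal prime were not contained in \<open>N\<close>, hence in the square of the maximal ideal, one
  of the \<open>d\<close> generators could be replaced by an element of it, and modulo that prime the chain
  of length \<open>d\<close> would contradict the height theorem.
\<close>

lemma regular_minimal_prime:
  assumes M: "maximalideal M R" "M = genideal R T" and T: "finite T" "T \<subseteq> carrier R" "enat (card T) = krull_dim R"
    and N: "ideal N R" and MN: "\<And>x y. x \<in> M \<Longrightarrow> y \<in> M \<Longrightarrow> x \<otimes> y \<in> N"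
    and unit: "\<And>c. c \<in> carrier R \<Longrightarrow> c \<notin> M \<Longrightarrow> \<exists>w\<in>carrier R. c \<otimes> w = \<one>"
  shows "\<exists>q. primeideal q R \<and> q \<subseteq> N"
proof -
  interpret M: maximalideal M R by (rule M(1))
  have Mprime: "primeideal M R" by (rule maximalideal_prime[OF M(1)])
  have below: "Q \<subseteq> M" if Q: "primeideal Q R" for Q
  proof
    interpret Q: primeideal Q R by (rule Q)
    fix c assume c: "c \<in> Q"
    show "c \<in> M"
    proof (rule ccontr)
      assume "c \<notin> M"
      then obtain w where "w \<in> carrier R" "c \<otimes> w = \<one>" using unit c Q.Icarr by blast
      then have "\<one> \<in> Q" using Q.I_r_closed[OF c] by metis
      then show False using Q.one_imp_carrier Q.I_notcarr by metis
    qed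
  qed
  obtain q where q: "\<forall>i\<le>card T. primeideal (q i) R" "\<forall>i<card T. q i \<subset> q (Suc i)"
    using krull_dim_attained[OF T(3)[symmetric] Mprime] by blast
  \<comment> \<open>A chain of maximal length that stopped below \<open>M\<close> could be prolonged
    by \<open>M\<close>.\<close>
  have top: "q (card T) = M"
  proof (rule ccontr)
    assume "q (card T) \<noteq> M"
    then have less: "q (card T) \<subset> M" using below[of "q (card T)"] q(1) by auto
    define q' where "q' i = (if i \<le> card T then q i else M)" for i
    have "enat (Suc (card T)) \<le> krull_dim R"
    proof (rule krull_dim_le[of _ q'])
      show "\<forall>i\<le>Suc (card T). primeideal (q' i) R" using q(1) Mprime by (simp add: q'_def)
      show "\<forall>i<Suc (card T). q' i \<subset> q' (Suc i)"
      proof (intro allI impI)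
        fix i assume "i < Suc (card T)"
        then consider "i < card T" | "i = card T" by linarith
        then show "q' i \<subset> q' (Suc i)" using q(2) less by cases (simp_all add: q'_def)
      qed
    qed
    then show False unfolding T(3)[symmetric] by simp
  qed
  have mono: "q 0 \<subseteq> q i" if "i \<le> card T" for i
    using that q(2) by (induction i) (auto simp: Suc_le_eq)
  have q0M: "q 0 \<subseteq> M" using mono[of "card T"] top by simp
  have TM: "T \<subseteq> M" unfolding M(2) by (rule genideal_self[OF T(2)])
  have "q 0 \<subseteq> N"
  proof
    fix z assume z: "z \<in> q 0"
    have Mc: "M \<subseteq> carrier R" using M.Icarr by blast
    have "z \<in> genideal R T" using z q0M M(2) by blast
    from exchange[OF N _ _ Mc T(1) TM this]
    have "z \<in> N \<or> (\<exists>t\<in>T. t \<in> genideal R (insert z (T - {t})))" using MN unit by presburger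
    then show "z \<in> N"
    proof (elim disjE bexE)
      fix t assume t: "t \<in> T" "t \<in> genideal R (insert z (T - {t}))"
      have sub: "q 0 \<union> (T - {t}) \<subseteq> carrier R" using q0M Mc T(2) by auto
      have mem: "q 0 \<union> (T - {t}) \<subseteq> genideal R (q 0 \<union> (T - {t}))" by (rule genideal_self[OF sub])
      have "genideal R (insert z (T - {t})) \<subseteq> genideal R (q 0 \<union> (T - {t}))"
        using z mem by (intro genideal_minimal[OF genideal_ideal[OF sub]]) auto
      \<comment> \<open>After the exchange, \<open>q 0\<close> and one generator fewer than the
        length of the chain above \<open>q 0\<close> generate \<open>M\<close>.\<close>
      then have Tsub: "T \<subseteq> genideal R (q 0 \<union> (T - {t}))" using t mem by blast
      have MJ: "M \<subseteq> genideal R (q 0 \<union> (T - {t}))" unfolding M(2)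
        by (rule genideal_minimal[OF genideal_ideal[OF sub] Tsub])
      have "genideal R (q 0 \<union> (T - {t})) \<subseteq> M" using q0M TM by (intro genideal_minimal[OF M.is_ideal]) auto
      then have "minimal_prime_over M (genideal R (q 0 \<union> (T - {t})))"
        unfolding minimal_prime_over_def using Mprime MJ by blast
      then have "card T \<le> card (T - {t})"
      proof (rule krull_height[where q = q and l = "card T"])
        show "ideal (q 0) R" using q(1) by (simp add: primeideal.axioms(1))
        show "finite (T - {t})" "T - {t} \<subseteq> carrier R" using T by auto
        show "i \<le> card T \<Longrightarrow> primeideal (q i) R" "i < card T \<Longrightarrow> q i \<subset> q (Suc i)" for i
          using q by blast+
      qed (simp_all add: top)
      moreover have "card (T - {t}) < card T" using T(1) t(1) by (rule card_Diff1_less)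
      ultimately show ?thesis by simp
    qed
  qed
  then show ?thesis using q(1) by blast
qed

end

section \<open>Regularity expressed through germs\<close>

context local_ring
begin

text \<open>If \<open>P\<close> vanishes locally, every nonzero germ is a fraction with numerator
  outside \<open>P\<close>, hence a unit.\<close>

lemma field_germs:
  assumes zero: "\<And>f. f \<in> P \<Longrightarrow> \<exists>u\<in>carrier R - P. u \<otimes> f \<in> J"
  shows "field germs"
proof (rule A.cring_fieldI)
  have nz: "\<one>\<^bsub>germs\<^esub> \<noteq> \<zero>\<^bsub>germs\<^esub>"
  proof
    assume "\<one>\<^bsub>germs\<^esub> = \<zero>\<^bsub>germs\<^esub>"
    then obtain u where "u \<in> carrier R - P" "u \<otimes> \<one> \<in> J"
      using germ_eq_zero_iff[OF R.one_closed] by (auto simp only: germ_one)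
    then show False using JP by auto
  qed
  show "Units germs = carrier germs - {\<zero>\<^bsub>germs\<^esub>}"
  proof (intro equalityI subsetI)
    fix z assume "z \<in> Units germs"
    then show "z \<in> carrier germs - {\<zero>\<^bsub>germs\<^esub>}" using nz by (auto simp: Units_def)
  next
    fix z assume z: "z \<in> carrier germs - {\<zero>\<^bsub>germs\<^esub>}"
    then have zc: "z \<in> carrier germs" by blast
    then obtain a u where au: "a \<in> carrier R" "u \<in> carrier R" "u \<notin> P" "z \<otimes>\<^bsub>germs\<^esub> germ u = germ a"
      by (rule germs_cases)
    obtain w where w: "w \<in> carrier germs" "germ u \<otimes>\<^bsub>germs\<^esub> w = \<one>\<^bsub>germs\<^esub>" using germ_unit au by blast
    have gu: "germ u \<in> carrier germs" using au(2) by simp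
    have "a \<notin> P"
    proof
      assume "a \<in> P"
      then have "germ a = \<zero>\<^bsub>germs\<^esub>" using germ_eq_zero_iff[OF au(1)] zero by blast
      then have "(z \<otimes>\<^bsub>germs\<^esub> germ u) \<otimes>\<^bsub>germs\<^esub> w = \<zero>\<^bsub>germs\<^esub>" using au(4) w(1) by simp
      then have "z = \<zero>\<^bsub>germs\<^esub>" using A.m_assoc[OF zc gu w(1)] w(2) zc by simp
      then show False using z by blast
    qed
    then obtain w' where w': "w' \<in> carrier germs" "germ a \<otimes>\<^bsub>germs\<^esub> w' = \<one>\<^bsub>germs\<^esub>" using germ_unit au(1) by blast
    have y: "germ u \<otimes>\<^bsub>germs\<^esub> w' \<in> carrier germs" using gu w'(1) by simp
    have "z \<otimes>\<^bsub>germs\<^esub> (germ u \<otimes>\<^bsub>germs\<^esub> w') = \<one>\<^bsub>germs\<^esub>"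
      using A.m_assoc[OF zc gu w'(1)] au(4) w'(2) by simp
    then show "z \<in> Units germs" unfolding Units_def
      using zc y A.m_comm[OF zc y] by (intro CollectI conjI bexI[of _ "germ u \<otimes>\<^bsub>germs\<^esub> w'"]) simp_all
  qed
qed

definition extension :: "'a set \<Rightarrow> ('a set \<times> 'a set) set set" where
  "extension K = {z \<in> carrier germs. \<exists>u\<in>carrier R - P. \<exists>a\<in>K. z \<otimes>\<^bsub>germs\<^esub> germ u = germ a}"

lemma extensionI:
  "z \<in> carrier germs \<Longrightarrow> u \<in> carrier R - P \<Longrightarrow> a \<in> K \<Longrightarrow> z \<otimes>\<^bsub>germs\<^esub> germ u = germ a \<Longrightarrow> z \<in> extension K"
  by (auto simp: extension_def)

lemma extensionE:
  assumes "z \<in> extension K"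
  obtains u a where "z \<in> carrier germs" "u \<in> carrier R" "u \<notin> P" "a \<in> K" "z \<otimes>\<^bsub>germs\<^esub> germ u = germ a"
  using assms unfolding extension_def by blast

lemma mult_notin: "u \<in> carrier R \<Longrightarrow> u \<notin> P \<Longrightarrow> v \<in> carrier R \<Longrightarrow> v \<notin> P \<Longrightarrow> u \<otimes> v \<in> carrier R - P"
  using P.I_prime[of u v] by blast

lemma extension_mult:
  assumes x: "x \<in> carrier germs" "u \<in> carrier R" "u \<notin> P" "a \<in> carrier R" "x \<otimes>\<^bsub>germs\<^esub> germ u = germ a"
    and y: "y \<in> carrier germs" "v \<in> carrier R" "v \<notin> P" "b \<in> carrier R" "y \<otimes>\<^bsub>germs\<^esub> germ v = germ b"
    and "a \<otimes> b \<in> K"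
  shows "x \<otimes>\<^bsub>germs\<^esub> y \<in> extension K"
proof (rule extensionI[OF _ mult_notin[OF x(2,3) y(2,3)] assms(11)])
  have "x \<otimes>\<^bsub>germs\<^esub> y \<otimes>\<^bsub>germs\<^esub> germ (u \<otimes> v) = (x \<otimes>\<^bsub>germs\<^esub> germ u) \<otimes>\<^bsub>germs\<^esub> (y \<otimes>\<^bsub>germs\<^esub> germ v)"
    using x(1,2) y(1,2) germ_closed[OF x(2)] germ_closed[OF y(2)] by (simp add: germ_mult A.m_ac)
  then show "x \<otimes>\<^bsub>germs\<^esub> y \<otimes>\<^bsub>germs\<^esub> germ (u \<otimes> v) = germ (a \<otimes> b)"
    using x(4) y(4) by (simp add: x(5) y(5) germ_mult)
qed (use x y in simp)

lemma ideal_extension: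
  assumes "ideal K R"
  shows "ideal (extension K) germs"
proof -
  interpret K: ideal K R by fact
  have N: "r \<otimes>\<^bsub>germs\<^esub> z \<in> extension K" if z: "z \<in> extension K" and r: "r \<in> carrier germs" for z r
  proof -
    obtain u a where ua: "z \<in> carrier germs" "u \<in> carrier R" "u \<notin> P" "a \<in> K" "z \<otimes>\<^bsub>germs\<^esub> germ u = germ a"
      using z by (rule extensionE)
    obtain b v where bv: "b \<in> carrier R" "v \<in> carrier R" "v \<notin> P" "r \<otimes>\<^bsub>germs\<^esub> germ v = germ b"
      using r by (rule germs_cases)
    show ?thesis
      by (rule extension_mult[OF r bv(2,3,1,4) ua(1,2,3) K.Icarr[OF ua(4)] ua(5) K.I_l_closed[OF ua(4) bv(1)]])
  qed
  show ?thesis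
  proof (rule idealI)
    show "subgroup (extension K) (add_monoid germs)"
    proof (rule group.subgroupI)
      show "group (add_monoid germs)" by (rule A.a_group)
      show "extension K \<subseteq> carrier (add_monoid germs)" by (auto simp: extension_def)
      have "\<zero>\<^bsub>germs\<^esub> \<in> extension K"
      proof (rule extensionI)
        show "\<one> \<in> carrier R - P" using P.I_notcarr P.one_imp_carrier by auto
        show "\<zero> \<in> K" by (rule K.zero_closed)
        show "\<zero>\<^bsub>germs\<^esub> \<otimes>\<^bsub>germs\<^esub> germ \<one> = germ \<zero>" by (simp add: germ_zero)
      qed simp
      then show "extension K \<noteq> {}" by blast
      fix z assume z: "z \<in> extension K"
      then have zc: "z \<in> carrier germs" by (simp add: extension_def)
      have "(\<ominus>\<^bsub>germs\<^esub> \<one>\<^bsub>germs\<^esub>) \<otimes>\<^bsub>germs\<^esub> z \<in> extension K" by (rule N[OF z]) simp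
      moreover have "(\<ominus>\<^bsub>germs\<^esub> \<one>\<^bsub>germs\<^esub>) \<otimes>\<^bsub>germs\<^esub> z = \<ominus>\<^bsub>germs\<^esub> z" using zc by (simp add: A.l_minus)
      ultimately show "inv\<^bsub>add_monoid germs\<^esub> z \<in> extension K" by (simp only: a_inv_def)
      fix y assume y: "y \<in> extension K"
      obtain u a where ua: "u \<in> carrier R" "u \<notin> P" "a \<in> K" "z \<otimes>\<^bsub>germs\<^esub> germ u = germ a"
        using z by (rule extensionE)
      obtain v b where vb: "y \<in> carrier germs" "v \<in> carrier R" "v \<notin> P" "b \<in> K" "y \<otimes>\<^bsub>germs\<^esub> germ v = germ b"
        using y by (rule extensionE)
      note c = K.Icarr[OF ua(3)] K.Icarr[OF vb(4)] germ_closed[OF ua(1)] germ_closed[OF vb(2)] ua(1) vb(2)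
      have "z \<oplus>\<^bsub>germs\<^esub> y \<in> extension K"
      proof (rule extensionI[OF _ mult_notin[OF ua(1,2) vb(2,3)]])
        show "v \<otimes> a \<oplus> u \<otimes> b \<in> K" using ua vb by (intro K.a_closed K.I_l_closed)
        have "(z \<oplus>\<^bsub>germs\<^esub> y) \<otimes>\<^bsub>germs\<^esub> germ (u \<otimes> v) =
            germ v \<otimes>\<^bsub>germs\<^esub> (z \<otimes>\<^bsub>germs\<^esub> germ u) \<oplus>\<^bsub>germs\<^esub> germ u \<otimes>\<^bsub>germs\<^esub> (y \<otimes>\<^bsub>germs\<^esub> germ v)"
          using zc vb(1) c by (simp add: germ_mult A.l_distr A.r_distr A.m_ac)
        also have "\<dots> = germ (v \<otimes> a \<oplus> u \<otimes> b)" unfolding ua(4) vb(5) using c by (simp add: germ_mult germ_add)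
        finally show "(z \<oplus>\<^bsub>germs\<^esub> y) \<otimes>\<^bsub>germs\<^esub> germ (u \<otimes> v) = germ (v \<otimes> a \<oplus> u \<otimes> b)" .
      qed (use zc vb(1) in simp)
      then show "z \<otimes>\<^bsub>add_monoid germs\<^esub> y \<in> extension K" by simp
    qed
    fix z r assume z: "z \<in> extension K" and r: "r \<in> carrier germs"
    then have zc: "z \<in> carrier germs" by (simp add: extension_def)
    show "r \<otimes>\<^bsub>germs\<^esub> z \<in> extension K" by (rule N[OF z r])
    then show "z \<otimes>\<^bsub>germs\<^esub> r \<in> extension K" by (simp only: A.m_comm[OF zc r])
  qed (rule A.ring_axioms)
qed

text \<open>Equality of germs holds up to a factor outside \<open>P\<close> and modulo
  \<open>J\<close>; since \<open>J\<close> is inside \<open>K\<close>, only the factor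
  remains.\<close>

lemma germ_in_extension:
  assumes K: "ideal K R" "J \<subseteq> K" and f: "f \<in> carrier R" "germ f \<in> extension K"
  shows "\<exists>v\<in>carrier R - P. v \<otimes> f \<in> K"
proof -
  interpret K: ideal K R by fact
  obtain u a where ua: "u \<in> carrier R" "u \<notin> P" "a \<in> K" "germ f \<otimes>\<^bsub>germs\<^esub> germ u = germ a"
    using f(2) by (rule extensionE)
  have ac: "a \<in> carrier R" using ua(3) by (rule K.Icarr)
  let ?d = "f \<otimes> u \<oplus> \<ominus> a"
  have "germ ?d \<oplus>\<^bsub>germs\<^esub> germ a = germ (f \<otimes> u)"
    using f(1) ua(1) ac by (simp add: germ_add[symmetric] R.a_assoc R.l_neg)
  also have "\<dots> = \<zero>\<^bsub>germs\<^esub> \<oplus>\<^bsub>germs\<^esub> germ a" using f(1) ua ac by (simp add: germ_mult)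
  finally have "germ ?d = \<zero>\<^bsub>germs\<^esub>"
    using f(1) ua(1) ac by (subst (asm) A.add.right_cancel) simp_all
  then obtain v where v: "v \<in> carrier R" "v \<notin> P" "v \<otimes> ?d \<in> J"
    using germ_eq_zero_iff[of ?d] f(1) ua(1) ac by auto
  have "v \<otimes> ?d \<oplus> v \<otimes> a \<in> K" using subsetD[OF K(2) v(3)] K.I_l_closed[OF ua(3) v(1)] by (rule K.a_closed)
  moreover have "v \<otimes> ?d \<oplus> v \<otimes> a = v \<otimes> (?d \<oplus> a)"
    using v(1) f(1) ua(1) ac by (simp only: R.r_distr R.m_closed R.a_inv_closed R.a_closed)
  moreover have "?d \<oplus> a = f \<otimes> u" using f(1) ua(1) ac by (simp add: R.a_assoc R.l_neg)
  ultimately have "(v \<otimes> u) \<otimes> f \<in> K" using v(1) f(1) ua(1) by (simp add: R.m_ac)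
  then show ?thesis using mult_notin[OF v(1,2) ua(1,2)] by blast
qed

text \<open>Elements outside \<open>extension P\<close> are units, so it is the maximal ideal. Its
  products lie in \<open>extension K\<close>, so the latter contains a prime, whose elements are
  then traced back to \<open>R\<close>.\<close>

lemma regular_germs:
  assumes reg: "regular_local_ring germs" and K: "ideal K R" "J \<subseteq> K"
    and PK: "\<And>a b. a \<in> P \<Longrightarrow> b \<in> P \<Longrightarrow> a \<otimes> b \<in> K"
  shows "\<exists>q. primeideal q germs \<and> (\<forall>f\<in>carrier R. germ f \<in> q \<longrightarrow> (\<exists>v\<in>carrier R - P. v \<otimes> f \<in> K))"
proof -
  obtain T where T: "finite T" "T \<subseteq> carrier germs" "maximalideal (genideal germs T) germs"
    "enat (card T) = krull_dim germs" and noeth: "noetherian_ring germs"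
    using reg unfolding regular_local_ring_def by blast
  interpret NC: noetherian_cring germs
    using noeth cring_germs by (simp add: noetherian_cring_def)
  let ?M = "genideal germs T"
  interpret M: maximalideal ?M germs by (rule T(3))
  have unit: "\<exists>w\<in>carrier germs. c \<otimes>\<^bsub>germs\<^esub> w = \<one>\<^bsub>germs\<^esub>" if c: "c \<in> carrier germs" "c \<notin> extension P" for c
  proof -
    obtain a u where au: "a \<in> carrier R" "u \<in> carrier R" "u \<notin> P" "c \<otimes>\<^bsub>germs\<^esub> germ u = germ a"
      using c(1) by (rule germs_cases)
    have "a \<notin> P" using extensionI[OF c(1) _ _ au(4)] au(2,3) c(2) by blast
    then obtain w where w: "w \<in> carrier germs" "germ a \<otimes>\<^bsub>germs\<^esub> w = \<one>\<^bsub>germs\<^esub>" using germ_unit au(1) by blast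
    then have "c \<otimes>\<^bsub>germs\<^esub> (germ u \<otimes>\<^bsub>germs\<^esub> w) = \<one>\<^bsub>germs\<^esub>"
      using A.m_assoc[OF c(1) germ_closed[OF au(2)] w(1)] au(4) by simp
    then show ?thesis using au(2) w(1) by (intro bexI[of _ "germ u \<otimes>\<^bsub>germs\<^esub> w"]) simp_all
  qed
  have "?M \<subseteq> extension P"
  proof
    fix c assume c: "c \<in> ?M"
    show "c \<in> extension P"
    proof (rule ccontr)
      assume "c \<notin> extension P"
      then obtain w where "w \<in> carrier germs" "c \<otimes>\<^bsub>germs\<^esub> w = \<one>\<^bsub>germs\<^esub>" using unit M.Icarr[OF c] by blast
      then have "\<one>\<^bsub>germs\<^esub> \<in> ?M" using M.I_r_closed[OF c] by metis
      then show False using M.one_imp_carrier M.I_notcarr by metis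
    qed
  qed
  moreover have "extension P \<noteq> carrier germs"
  proof
    assume "extension P = carrier germs"
    then have "germ \<one> \<in> extension P" by simp
    then obtain v where "v \<in> carrier R - P" "v \<otimes> \<one> \<in> P"
      using germ_in_extension[OF P.is_ideal JP R.one_closed] by blast
    then show False by simp
  qed
  moreover have "extension P \<subseteq> carrier germs" by (auto simp: extension_def)
  ultimately have M: "extension P = ?M"
    using M.I_maximal[OF ideal_extension[OF P.is_ideal]] by blast
  have "\<exists>q. primeideal q germs \<and> q \<subseteq> extension K"
  proof (rule NC.regular_minimal_prime[OF T(3) HOL.refl T(1,2,4) ideal_extension[OF K(1)]])
    fix x y assume "x \<in> ?M" "y \<in> ?M"
    then have xy: "x \<in> extension P" "y \<in> extension P" by (simp_all only: M)
    obtain u a where ua: "x \<in> carrier germs" "u \<in> carrier R" "u \<notin> P" "a \<in> P" "x \<otimes>\<^bsub>germs\<^esub> germ u = germ a"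
      using xy(1) by (rule extensionE)
    obtain v b where vb: "y \<in> carrier germs" "v \<in> carrier R" "v \<notin> P" "b \<in> P" "y \<otimes>\<^bsub>germs\<^esub> germ v = germ b"
      using xy(2) by (rule extensionE)
    show "x \<otimes>\<^bsub>germs\<^esub> y \<in> extension K"
      by (rule extension_mult[OF ua(1-3) P.Icarr[OF ua(4)] ua(5) vb(1-3) P.Icarr[OF vb(4)] vb(5) PK[OF ua(4) vb(4)]])
  next
    fix c assume "c \<in> carrier germs" "c \<notin> ?M"
    then show "\<exists>w\<in>carrier germs. c \<otimes>\<^bsub>germs\<^esub> w = \<one>\<^bsub>germs\<^esub>" using unit by (simp only: M)
  qed
  then show ?thesis using germ_in_extension[OF K] by blast
qed

end

section \<open>Principal jets of Stanley--Reisner ideals\<close>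

lemma poly_ring_induct [consumes 1, case_names const var add mult]:
  fixes f :: "('x,'k::comm_ring_1) mpoly"
  assumes "f \<in> carrier (poly_ring X)"
    and const: "\<And>c. Q (const c)" and var: "\<And>x. x \<in> X \<Longrightarrow> Q (var x)"
    and add: "\<And>p q. p \<in> carrier (poly_ring X) \<Longrightarrow> q \<in> carrier (poly_ring X) \<Longrightarrow> Q p \<Longrightarrow> Q q \<Longrightarrow> Q (p + q)"
    and mult: "\<And>p q. p \<in> carrier (poly_ring X) \<Longrightarrow> q \<in> carrier (poly_ring X) \<Longrightarrow> Q p \<Longrightarrow> Q q \<Longrightarrow> Q (p * q)"
  shows "Q f"
proof -
  let ?G = "\<lambda>p. p \<in> carrier (poly_ring X) \<and> Q p"
  have one: "?G 1" using const[of 1] poly_ring_const[of 1 X] by (simp add: const_hom.c_one)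
  have zero: "?G 0" using const[of 0] by simp
  have m: "?G (monomial_poly (Poly_Mapping.single x n))" if "x \<in> X" for x n
  proof (induction n)
    case (Suc n)
    have "monomial_poly (Poly_Mapping.single x (Suc n)) = var x * (monomial_poly (Poly_Mapping.single x n) :: ('x,'k) mpoly)"
      unfolding var_def monomial_poly_mult[symmetric] by (simp add: single_add[symmetric])
    then show ?case using Suc var[OF that] by (simp add: mult poly_ring_mult poly_ring_var that)
  qed (use one in \<open>simp add: monomial_poly_def\<close>)
  have mon: "?G (monomial_poly m)" if "keys m \<subseteq> X" for m
  proof -
    have "?G (monomial_poly (\<Sum>x\<in>A. Poly_Mapping.single x (lookup m x)))" if "finite A" "A \<subseteq> X" for A
      using that
    proof (induction A)
      case (insert x A)
      then show ?case using m[of x "lookup m x"]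
        by (auto simp: monomial_poly_mult intro: mult poly_ring_mult)
    qed (use one in \<open>simp add: monomial_poly_def\<close>)
    from this[OF finite_keys that] show ?thesis by (simp only: poly_sum_singles[of m, symmetric])
  qed
  have single: "?G (Poly_Mapping.single m c)" if "keys m \<subseteq> X" for m c
  proof -
    have "Poly_Mapping.single m c = const c * monomial_poly m" by (simp add: const_def monomial_poly_def mult_single)
    then show ?thesis using mon[OF that] const[of c] poly_ring_const[of c X]
      by (auto intro: mult poly_ring_mult)
  qed
  have "?G (\<Sum>m\<in>A. Poly_Mapping.single m (lookup f m))" if "finite A" "A \<subseteq> keys f" for A
    using that
  proof (induction A)
    case (insert m A)
    then have "keys m \<subseteq> X" using assms(1) by (auto simp: carrier_poly_ring)
    then show ?case using insert single[of m "lookup f m"] by (auto intro: add poly_ring_add)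
  qed (use zero in simp)
  from this[OF finite_keys order_refl] show ?thesis by (simp only: poly_sum_singles[of f, symmetric])
qed

lemma (in coeff_hom) subst_const: "subst_poly c h (const a) = c a"
  by (simp add: const_def subst_single)

lemma subst_poly_comp:
  fixes \<phi> :: "'b::comm_semiring_1 \<Rightarrow> 'c::comm_semiring_1" and p :: "('x, 'k::comm_ring_1) mpoly"
  assumes "\<And>a b. \<phi> (a + b) = \<phi> a + \<phi> b" "\<And>a b. \<phi> (a * b) = \<phi> a * \<phi> b" "\<phi> 1 = 1" "\<phi> 0 = 0"
  shows "\<phi> (subst_poly c h p) = subst_poly (\<lambda>a. \<phi> (c a)) (\<lambda>x. \<phi> (h x)) p"
proof -
  have sum: "\<phi> (sum f A) = (\<Sum>a\<in>A. \<phi> (f a))" for f :: "'x mon \<Rightarrow> 'b" and A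
    by (induction A rule: infinite_finite_induct) (simp_all add: assms)
  have prod: "\<phi> (prod f A) = (\<Prod>a\<in>A. \<phi> (f a))" for f :: "'x \<Rightarrow> 'b" and A
    by (induction A rule: infinite_finite_induct) (simp_all add: assms)
  have pow: "\<phi> (a ^ n) = \<phi> a ^ n" for a n by (induction n) (simp_all add: assms)
  show ?thesis by (simp add: subst_poly_def sum prod pow assms(2))
qed

lemma monomial_poly_sum: "monomial_poly (\<Sum>x\<in>A. g x) = (\<Prod>x\<in>A. monomial_poly (g x))"
  by (induction A rule: infinite_finite_induct) (simp_all add: monomial_poly_mult, simp_all add: monomial_poly_def)

lemma var_power: "var x ^ n = monomial_poly (Poly_Mapping.single x n)"
  by (induction n) (simp_all add: var_def monomial_poly_mult[symmetric] single_add[symmetric], simp add: monomial_poly_def)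

lemma monomial_sqf: "finite A \<Longrightarrow> monomial_poly (sqf A) = (\<Prod>x\<in>A. var x)"
  by (subst poly_sum_singles[of "sqf A"]) (simp add: keys_sqf lookup_sqf monomial_poly_sum var_def)

section \<open>Primes of coordinate subspaces\<close>

definition face_prime :: "'x set \<Rightarrow> 'x set \<Rightarrow> ('x, 'k::comm_ring_1) mpoly set" where
  "face_prime X F = {f \<in> carrier (poly_ring X). \<forall>m \<in> keys f. \<not> keys m \<subseteq> F}"

text \<open>
  Killing the variables outside \<open>F\<close> and renaming the others by natural numbers; the
  absence of zero divisors is available only for linearly ordered sets of variables.
\<close>

lemma primeideal_face_prime:
  assumes F: "finite F"
  shows "primeideal (face_prime X F) (poly_ring X :: ('x, 'k::field) mpoly ring)"
proof -
  obtain e :: "'x \<Rightarrow> nat" where e: "inj_on e F" using finite_imp_inj_to_nat_seg[OF F] by metis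
  \<comment> \<open>On the ring in the variables \<open>X\<close> this substitution has the kernel
    \<open>face_prime X F\<close>, and its target has no zero divisors.\<close>
  define h :: "'x \<Rightarrow> (nat, 'k) mpoly" where "h x = (if x \<in> F then var (e x) else 0)" for x
  define push where "push m = (\<Sum>x\<in>keys m. Poly_Mapping.single (e x) (lookup m x))" for m :: "'x mon"
  have ev: "eval_mon h m = (if keys m \<subseteq> F then monomial_poly (push m) else 0)" for m
  proof (cases "keys m \<subseteq> F")
    case True
    then have "eval_mon h m = (\<Prod>x\<in>keys m. monomial_poly (Poly_Mapping.single (e x) (lookup m x)))"
      unfolding eval_mon_def by (intro prod.cong) (auto simp: h_def var_power)
    then show ?thesis using True by (simp add: push_def monomial_poly_sum)
  next
    case False
    then obtain x where x: "x \<in> keys m" "x \<notin> F" by blast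
    then have "h x ^ lookup m x = 0" by (simp add: h_def in_keys_iff power_0_left)
    then have "eval_mon h m = 0" unfolding eval_mon_def using x(1) by (intro prod_zero) auto
    then show ?thesis using False by simp
  qed
  have push: "lookup (push m) (e x) = lookup m x" if m: "keys m \<subseteq> F" and x: "x \<in> F" for m x
  proof -
    have "lookup (push m) (e x) = (\<Sum>y\<in>keys m. if x = y then lookup m y else 0)"
      unfolding push_def lookup_sum lookup_single
      using inj_onD[OF e _ x] m by (intro sum.cong refl) (auto simp: when_def)
    then show ?thesis by (simp add: in_keys_iff)
  qed
  have push_inj: "m = n" if "keys m \<subseteq> F" "keys n \<subseteq> F" "push m = push n" for m n
  proof (rule poly_mapping_eqI)
    fix x show "lookup m x = lookup n x"
    proof (cases "x \<in> F")
      case True then show ?thesis using push[of m x] push[of n x] that by simp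
    next
      case False
      then have "x \<notin> keys m" "x \<notin> keys n" using that by auto
      then show ?thesis by (simp add: in_keys_iff)
    qed
  qed
  \<comment> \<open>Renaming is injective on monomials supported in \<open>F\<close>, so their
    coefficients can be read off the image.\<close>
  have look: "lookup (subst_poly const h f) (push n) = lookup f n" if n: "keys n \<subseteq> F" for f :: "('x, 'k) mpoly" and n
  proof -
    have "lookup (subst_poly const h f) (push n) = (\<Sum>m\<in>keys f. lookup (const (lookup f m) * eval_mon h m) (push n))"
      by (simp add: const_hom.subst_superset[OF finite_keys order_refl] lookup_sum)
    also have "\<dots> = (\<Sum>m\<in>keys f. if n = m then lookup f m else 0)"
    proof (intro sum.cong refl)
      fix m show "lookup (const (lookup f m) * eval_mon h m) (push n) = (if n = m then lookup f m else 0)"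
        using push_inj[OF n, of m] n by (auto simp: ev const_def monomial_poly_def mult_single lookup_single when_def)
    qed
    finally show ?thesis by (simp add: in_keys_iff)
  qed
  have ker: "f \<in> face_prime X F \<longleftrightarrow> subst_poly const h f = 0" if "f \<in> carrier (poly_ring X)" for f :: "('x, 'k) mpoly"
  proof
    assume "f \<in> face_prime X F"
    then show "subst_poly const h f = 0"
      unfolding const_hom.subst_superset[OF finite_keys order_refl]
      by (intro sum.neutral) (auto simp: face_prime_def ev)
  next
    assume z: "subst_poly const h f = 0"
    have "\<not> keys m \<subseteq> F" if "m \<in> keys f" for m using look[of m f] z that by (auto simp: in_keys_iff)
    then show "f \<in> face_prime X F" using that by (simp add: face_prime_def)
  qed
  show ?thesis
  proof (unfold primeideal_poly_ring_iff, intro conjI allI ballI impI)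
    show "ideal (face_prime X F) (poly_ring X :: ('x, 'k) mpoly ring)"
    proof (rule ideal_poly_ringI)
      fix a b :: "('x, 'k) mpoly" assume "a \<in> face_prime X F" "b \<in> face_prime X F"
      then have ab: "a \<in> carrier (poly_ring X)" "b \<in> carrier (poly_ring X)" "subst_poly const h a = 0" "subst_poly const h b = 0"
        using ker by (auto simp: face_prime_def)
      then show "a + b \<in> face_prime X F" using ker[OF poly_ring_add[OF ab(1,2)]] by (simp add: const_hom.subst_add)
    next
      fix a r :: "('x, 'k) mpoly" assume "a \<in> face_prime X F" and r: "r \<in> carrier (poly_ring X)"
      then have a: "a \<in> carrier (poly_ring X)" "subst_poly const h a = 0"
        using ker by (auto simp: face_prime_def)
      then show "r * a \<in> face_prime X F" using ker[OF poly_ring_mult[OF r a(1)]] by (simp add: const_hom.subst_mult)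
    qed (auto simp: face_prime_def)
    show "(1 :: ('x, 'k) mpoly) \<notin> face_prime X F" using ker[of 1] by simp
    fix a b :: "('x, 'k) mpoly"
    assume ab: "a \<in> carrier (poly_ring X)" "b \<in> carrier (poly_ring X)" "a * b \<in> face_prime X F"
    then have "subst_poly const h a * subst_poly const h b = 0"
      using ker[OF poly_ring_mult[OF ab(1,2)]] by (simp add: const_hom.subst_mult)
    then show "a \<in> face_prime X F \<or> b \<in> face_prime X F" using ker ab by auto
  qed
qed

text \<open>A monomial supported on a face \<open>F\<close> stays outside the prime
  \<open>face_prime X F\<close>, which contains the ideal. So the ideal is the intersection of the
  primes of its faces and equals the ideal of its vanishing locus.\<close>

lemma vanishing_ideal_sr_ideal:
  assumes X: "finite X" and \<Delta>: "simplicial_complex X \<Delta>"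
  shows "vanishing_ideal (poly_ring X) (vanishing_locus (poly_ring X) (sr_ideal X \<Delta> :: ('x, 'k::field) mpoly set)) = sr_ideal X \<Delta>"
proof (intro equalityI subsetI)
  fix f :: "('x, 'k) mpoly"
  assume f: "f \<in> vanishing_ideal (poly_ring X) (vanishing_locus (poly_ring X) (sr_ideal X \<Delta>))"
  have "keys m \<notin> \<Delta>" if m: "m \<in> keys f" for m
  proof
    assume mD: "keys m \<in> \<Delta>"
    have "sr_ideal X \<Delta> \<subseteq> (face_prime X (keys m) :: ('x, 'k) mpoly set)"
      using \<Delta> mD by (auto simp: sr_ideal_def face_prime_def simplicial_complex_def)
    then have "f \<in> face_prime X (keys m)"
      using f primeideal_face_prime[OF finite_keys] by (auto simp: vanishing_ideal_def vanishing_locus_def Spec_def)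
    then show False using m by (auto simp: face_prime_def)
  qed
  then show "f \<in> sr_ideal X \<Delta>" using f by (simp add: sr_ideal_def vanishing_ideal_def)
qed (auto simp: vanishing_ideal_def vanishing_locus_def sr_ideal_def)

section \<open>Points of the variety and their local rings\<close>

locale sr_point =
  fixes X :: "'x set" and \<Delta> :: "'x set set" and P :: "('x, 'k::field) mpoly set"
  assumes finite: "finite X" and simplicial: "simplicial_complex X \<Delta>"
    and prime: "primeideal P (poly_ring X)" and above: "sr_ideal X \<Delta> \<subseteq> P"
begin

sublocale P: poly_prime X P by (rule poly_prime.intro[OF prime])

sublocale L: local_ring "poly_ring X" "sr_ideal X \<Delta>" P
  by (intro local_ring.intro local_ring_axioms.intro cring_poly_ring ideal_sr_ideal simplicial prime above)

lemma local_ring_at_eq: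
  "local_ring_at (poly_ring X) (vanishing_locus (poly_ring X) (sr_ideal X \<Delta>)) P = L.germs"
  unfolding local_ring_at_def vanishing_ideal_sr_ideal[OF finite simplicial] Let_def L.germs_def L.denominators_def
  by (rule HOL.refl)

lemma singular_locus_iff:
  "P \<in> singular_locus (poly_ring X) (vanishing_locus (poly_ring X) (sr_ideal X \<Delta>)) \<longleftrightarrow> \<not> regular_local_ring L.germs"
proof -
  have "P \<in> vanishing_locus (poly_ring X) (sr_ideal X \<Delta>)"
    using prime above by (simp add: vanishing_locus_def Spec_def)
  then show ?thesis unfolding singular_locus_def mem_Collect_eq local_ring_at_eq by simp
qed

text \<open>The product of the variables outside \<open>P\<close> is not in the prime
  \<open>P\<close>, hence not in the ideal.\<close>

lemma face_of_prime: "{x \<in> X. var x \<notin> P} \<in> \<Delta>"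
proof (rule ccontr)
  let ?V = "{x \<in> X. var x \<notin> P}"
  assume notin: "?V \<notin> \<Delta>"
  have "monomial_poly (sqf ?V) \<in> (sr_ideal X \<Delta> :: ('x, 'k) mpoly set)"
    using finite notin by (simp add: sr_ideal_def carrier_poly_ring monomial_poly_def keys_sqf)
  then have "(\<Prod>x\<in>?V. var x) \<in> P" using above finite by (auto simp: monomial_sqf)
  moreover have "(\<Prod>x\<in>?V. var x) \<in> carrier (poly_ring X) - P"
    by (rule P.prod_notin) (auto intro: poly_ring_var)
  ultimately show False by blast
qed

text \<open>The outer set is the union of all faces that contain the variables outside
  \<open>P\<close>; that it is a face means that a single facet contains them. Otherwise the product
  of its variables is in the ideal and the prime provided by regularity contains one of them, which
  has a nonzero first-order term and is not locally in \<open>K\<close>.\<close>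

lemma smooth_point:
  assumes "regular_local_ring L.germs"
  shows "{w \<in> X. insert w {x \<in> X. var x \<notin> P} \<in> \<Delta>} \<in> \<Delta>"
proof (rule ccontr)
  let ?V = "{x \<in> X. var x \<notin> P}"
  let ?U = "{w \<in> X. insert w ?V \<in> \<Delta>}"
  assume U: "?U \<notin> \<Delta>"
  \<comment> \<open>Restriction to the coordinate subspace of \<open>insert w ?V\<close>; if
    \<open>w\<close> is not in \<open>?V\<close>, it becomes the new indeterminate
    \<open>t\<close>.\<close>
  define g :: "'x \<Rightarrow> 'x \<Rightarrow> ('x, 'k) mpoly Polynomial.poly"
    where "g w x = (if x \<in> ?V then [:var x:] else if x = w then [:0, 1:] else 0)" for w x
  define \<psi> where "\<psi> w = subst_poly (\<lambda>c. [:const c:]) (g w)" for w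
  have \<psi>_mult: "\<psi> w (a * b) = \<psi> w a * \<psi> w b" and \<psi>_add: "\<psi> w (a + b) = \<psi> w a + \<psi> w b" for w a b
    by (simp_all add: \<psi>_def pconst_hom.subst_mult pconst_hom.subst_add)
  have coeff1: "coeff (\<psi> w (a * b)) 1 = coeff (\<psi> w a) 0 * coeff (\<psi> w b) 1 + coeff (\<psi> w a) 1 * coeff (\<psi> w b) 0" for w a b
    unfolding \<psi>_mult coeff_mult by simp
  have C: "coeff (\<psi> w f) i \<in> carrier (poly_ring X)" if "f \<in> carrier (poly_ring X)" for w f i
    using that
  proof (induction f arbitrary: i rule: poly_ring_induct)
    case (const c)
    then show ?case by (cases i) (simp_all add: \<psi>_def pconst_hom.subst_const poly_ring_const coeff_pCons)
  next
    case (var x)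
    then show ?case unfolding \<psi>_def pconst_hom.subst_var g_def
      by (auto simp: coeff_pCons poly_ring_var split: nat.splits)
  next
    case (add p q)
    then show ?case unfolding \<psi>_add by (simp add: poly_ring_add)
  next
    case (mult p q)
    then show ?case unfolding \<psi>_mult coeff_mult
      by (intro poly_ring_sum poly_ring_mult) auto
  qed
  \<comment> \<open>All variables outside \<open>?V\<close> are in \<open>P\<close>, so setting them
    to 0 changes a polynomial only by an element of \<open>P\<close>.\<close>
  have c0: "f - coeff (\<psi> w f) 0 \<in> P" if "f \<in> carrier (poly_ring X)" for w f
    using that
  proof (induction f rule: poly_ring_induct)
    case (const c)
    then show ?case by (simp add: \<psi>_def pconst_hom.subst_const P.zero)
  next
    case (var x)
    then show ?case unfolding \<psi>_def pconst_hom.subst_var g_def by (simp add: P.zero)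
  next
    case (add p q)
    from P.add[OF add(3,4)] show ?case by (simp add: \<psi>_add algebra_simps)
  next
    case (mult p q)
    have "p * q - coeff (\<psi> w (p * q)) 0 = q * (p - coeff (\<psi> w p) 0) + coeff (\<psi> w p) 0 * (q - coeff (\<psi> w q) 0)"
      unfolding \<psi>_mult by (simp add: coeff_mult algebra_simps)
    then show ?case by (simp only: P.add[OF P.mult[OF mult(3,2)] P.mult[OF mult(4) C[OF mult(1)]]])
  qed
  have c0P: "coeff (\<psi> w f) 0 \<in> P \<longleftrightarrow> f \<in> P" if f: "f \<in> carrier (poly_ring X)" for w f
  proof
    assume "coeff (\<psi> w f) 0 \<in> P"
    from P.add[OF this c0[OF f, of w]] show "f \<in> P" by simp
  next
    assume "f \<in> P"
    from P.diff[OF this c0[OF f, of w]] show "coeff (\<psi> w f) 0 \<in> P" by simp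
  qed
  \<comment> \<open>First-order terms along all directions \<open>w\<close> vanish modulo
    \<open>P\<close>. The ideal of \<open>\<Delta>\<close> is inside \<open>K\<close> because every
    \<open>insert w ?V\<close> is a face, and products of elements of \<open>P\<close> are inside by
    the product rule.\<close>
  define K where "K = {f \<in> P. \<forall>w\<in>?U. coeff (\<psi> w f) 1 \<in> P}"
  have IK: "sr_ideal X \<Delta> \<subseteq> K"
  proof
    fix f :: "('x, 'k) mpoly" assume f: "f \<in> sr_ideal X \<Delta>"
    have "coeff (\<psi> w f) 1 = 0" if w: "w \<in> ?U" for w
    proof -
      have z: "eval_mon (g w) m = 0" if m: "m \<in> keys f" for m
      proof -
        have "keys m \<notin> \<Delta>" "keys m \<subseteq> X" using f m by (auto simp: sr_ideal_def carrier_poly_ring)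
        then have "\<not> keys m \<subseteq> insert w ?V" using w simplicial by (auto simp: simplicial_complex_def)
        then obtain x where x: "x \<in> keys m" "x \<notin> ?V" "x \<noteq> w" by blast
        have "g w x = 0" unfolding g_def by (simp only: x(2,3) if_False)
        then have "g w x ^ lookup m x = 0" using x(1) by (simp add: in_keys_iff power_0_left)
        then show ?thesis unfolding eval_mon_def using x(1) by (intro prod_zero) auto
      qed
      have "\<psi> w f = 0" unfolding \<psi>_def pconst_hom.subst_superset[OF finite_keys order_refl]
        by (intro sum.neutral ballI) (simp only: z mult_zero_right)
      then show ?thesis by simp
    qed
    then show "f \<in> K" using f above P.zero by (auto simp: K_def)
  qed
  have Kideal: "ideal K (poly_ring X)"
  proof (rule ideal_poly_ringI)
    show "K \<subseteq> carrier (poly_ring X)" using P.carrier by (auto simp: K_def)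
    have "\<psi> w 0 = 0" for w by (simp add: \<psi>_def)
    then show "0 \<in> K" using P.zero by (simp add: K_def)
    show "a + b \<in> K" if "a \<in> K" "b \<in> K" for a b using that by (auto simp: K_def \<psi>_add intro: P.add)
    fix a r :: "('x, 'k) mpoly" assume a: "a \<in> K" and r: "r \<in> carrier (poly_ring X)"
    have aP: "a \<in> P" and a1: "\<And>w. w \<in> ?U \<Longrightarrow> coeff (\<psi> w a) 1 \<in> P" using a unfolding K_def by blast+
    have "coeff (\<psi> w (r * a)) 1 \<in> P" if w: "w \<in> ?U" for w
      unfolding coeff1
    proof (rule P.add)
      show "coeff (\<psi> w r) 0 * coeff (\<psi> w a) 1 \<in> P" by (rule P.mult[OF a1[OF w] C[OF r]])
      have "coeff (\<psi> w a) 0 \<in> P" using aP c0P[OF P.carrier[OF aP]] by blast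
      then show "coeff (\<psi> w r) 1 * coeff (\<psi> w a) 0 \<in> P" by (rule P.mult[OF _ C[OF r]])
    qed
    then show "r * a \<in> K" using P.mult[OF aP r] unfolding K_def by blast
  qed
  have PK: "a * b \<in> K" if a: "a \<in> P" and b: "b \<in> P" for a b
  proof -
    note ac = P.carrier[OF a] and bc = P.carrier[OF b]
    have "coeff (\<psi> w (a * b)) 1 \<in> P" for w unfolding coeff1
    proof (rule P.add)
      have "coeff (\<psi> w a) 0 \<in> P" "coeff (\<psi> w b) 0 \<in> P" using a b c0P[OF ac] c0P[OF bc] by auto
      then show "coeff (\<psi> w a) 0 * coeff (\<psi> w b) 1 \<in> P" "coeff (\<psi> w a) 1 * coeff (\<psi> w b) 0 \<in> P"
        by (simp_all add: P.mult' P.mult C ac bc)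
    qed
    then show ?thesis using P.mult[OF b ac] by (simp add: K_def)
  qed
  have "\<exists>q. primeideal q L.germs \<and> (\<forall>f\<in>carrier (poly_ring X). L.germ f \<in> q \<longrightarrow>
      (\<exists>v\<in>carrier (poly_ring X) - P. v \<otimes>\<^bsub>poly_ring X\<^esub> f \<in> K))"
    by (rule L.regular_germs[OF assms Kideal IK]) (simp add: PK)
  then obtain q where q: "primeideal q L.germs"
    and qK: "\<And>f. f \<in> carrier (poly_ring X) \<Longrightarrow> L.germ f \<in> q \<Longrightarrow> \<exists>v\<in>carrier (poly_ring X) - P. v * f \<in> K"
    unfolding poly_ring_simps by blast
  interpret q: primeideal q L.germs by (rule q)
  have factor: "\<exists>x\<in>A. L.germ (var x) \<in> q" if "finite A" "A \<subseteq> X" "L.germ (\<Prod>x\<in>A. var x) \<in> q" for A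
    using that
  proof (induction A)
    case empty
    have "L.germ (1 :: ('x, 'k) mpoly) = \<one>\<^bsub>L.germs\<^esub>" using L.germ_one by simp
    then show ?case using empty q.one_imp_carrier q.I_notcarr by simp
  next
    case (insert x A)
    have c: "var x \<in> carrier (poly_ring X)" "(\<Prod>x\<in>A. var x) \<in> carrier (poly_ring X)"
      using insert.prems(1) by (auto intro: poly_ring_var poly_ring_prod)
    have "L.germ (var x * (\<Prod>x\<in>A. var x)) = L.germ (var x) \<otimes>\<^bsub>L.germs\<^esub> L.germ (\<Prod>x\<in>A. var x)"
      using L.germ_mult[OF c] by simp
    then have "L.germ (var x) \<otimes>\<^bsub>L.germs\<^esub> L.germ (\<Prod>x\<in>A. var x) \<in> q" using insert by simp
    then have "L.germ (var x) \<in> q \<or> L.germ (\<Prod>x\<in>A. var x) \<in> q"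
      by (rule q.I_prime[OF L.germ_closed[OF c(1)] L.germ_closed[OF c(2)]])
    then show ?case using insert by auto
  qed
  have finU: "finite ?U" and UX: "?U \<subseteq> X" using finite by auto
  have "(\<Prod>x\<in>?U. var x :: ('x, 'k) mpoly) = monomial_poly (sqf ?U)" by (rule monomial_sqf[OF finU, symmetric])
  then have UI: "(\<Prod>x\<in>?U. var x :: ('x, 'k) mpoly) \<in> sr_ideal X \<Delta>"
    using U UX by (simp add: sr_ideal_def carrier_poly_ring monomial_poly_def keys_sqf[OF finU])
  have "L.germ (\<Prod>x\<in>?U. var x) = \<zero>\<^bsub>L.germs\<^esub>"
  proof (rule iffD2[OF L.germ_eq_zero_iff])
    show "(\<Prod>x\<in>?U. var x :: ('x, 'k) mpoly) \<in> carrier (poly_ring X)" using UI unfolding sr_ideal_def by blast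
    show "\<exists>u\<in>carrier (poly_ring X) - P. u \<otimes>\<^bsub>poly_ring X\<^esub> (\<Prod>x\<in>?U. var x :: ('x, 'k) mpoly) \<in> sr_ideal X \<Delta>"
    proof (rule bexI)
      show "(1 :: ('x, 'k) mpoly) \<otimes>\<^bsub>poly_ring X\<^esub> (\<Prod>x\<in>?U. var x) \<in> sr_ideal X \<Delta>"
        using UI by (simp only: poly_ring_simps mult_1_left)
    qed (simp add: P.one)
  qed
  then have "L.germ (\<Prod>x\<in>?U. var x) \<in> q" using additive_subgroup.zero_closed[OF ideal.axioms(1)[OF q.is_ideal]] by simp
  from factor[OF finU UX this] obtain w where w: "w \<in> ?U" and gw: "L.germ (var w) \<in> q" by blast
  have wX: "w \<in> X" using w by simp
  from qK[OF poly_ring_var[OF wX] gw] obtain v where v: "v \<in> carrier (poly_ring X)" "v \<notin> P" "v * var w \<in> K" by blast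
  have "v * var w \<in> P" using v(3) by (simp add: K_def)
  \<comment> \<open>This excludes \<open>w\<close> from \<open>?V\<close>, so that \<open>w\<close>
    is sent to the indeterminate.\<close>
  then have "var w \<in> P" using P.primeD v(1,2) poly_ring_var[OF wX] by blast
  then have gw: "g w w = [:0, 1:]" by (simp add: g_def)
  have "coeff (\<psi> w (v * var w)) 1 = coeff (\<psi> w v) 0"
    unfolding coeff1 by (simp add: \<psi>_def pconst_hom.subst_var gw)
  then have "coeff (\<psi> w v) 0 \<in> P" using v(3) w by (auto simp: K_def)
  then show False using c0P[OF v(1)] v(2) by blast
qed

end

text \<open>A function vanishing on \<open>Y\<close> defines a closed set that contains the closure
  of \<open>Y\<close>.\<close>

lemma vanishing_ideal_zariski_closure:
  assumes "Y \<subseteq> Spec R"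
  shows "vanishing_ideal R (zariski_closure R Y) = vanishing_ideal R Y"
proof (intro equalityI subsetI)
  fix f assume "f \<in> vanishing_ideal R (zariski_closure R Y)"
  moreover have "Y \<subseteq> zariski_closure R Y" by (auto simp: zariski_closure_def)
  ultimately show "f \<in> vanishing_ideal R Y" by (auto simp: vanishing_ideal_def)
next
  fix f assume f: "f \<in> vanishing_ideal R Y"
  then have "Y \<subseteq> vanishing_locus R {f}" "{f} \<subseteq> carrier R"
    using assms by (auto simp: vanishing_ideal_def vanishing_locus_def)
  then have "zariski_closure R Y \<subseteq> vanishing_locus R {f}" unfolding zariski_closure_def by blast
  then show "f \<in> vanishing_ideal R (zariski_closure R Y)"
    using f by (auto simp: vanishing_ideal_def vanishing_locus_def)
qed

text \<open>Every monomial of \<open>f\<close> has a factor outside \<open>F\<close>, which is sent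
  into \<open>Q\<close>. The sets \<open>Q\<close> and \<open>S\<close> play the roles of an ideal
  and its ring; plain sets also accommodate polynomials in \<open>t\<close> with coefficients in an
  ideal.\<close>

lemma subst_poly_in_ideal:
  fixes c :: "'k::comm_ring_1 \<Rightarrow> 'b::comm_ring_1"
  assumes Q: "0 \<in> Q" "\<And>a b. a \<in> Q \<Longrightarrow> b \<in> Q \<Longrightarrow> a + b \<in> Q" "\<And>a b. a \<in> Q \<Longrightarrow> b \<in> S \<Longrightarrow> b * a \<in> Q"
    and S: "1 \<in> S" "\<And>a b. a \<in> S \<Longrightarrow> b \<in> S \<Longrightarrow> a * b \<in> S" "\<And>k. c k \<in> S"
    and h: "\<And>x. x \<in> X \<Longrightarrow> h x \<in> S" "\<And>x. x \<in> X \<Longrightarrow> x \<notin> F \<Longrightarrow> h x \<in> Q"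
    and f: "f \<in> face_prime X F"
  shows "subst_poly c h f \<in> Q"
proof -
  have sum: "sum g A \<in> Q" if "\<And>a. a \<in> A \<Longrightarrow> g a \<in> Q" for g :: "'a mon \<Rightarrow> 'b" and A
    using that by (induction A rule: infinite_finite_induct) (auto intro: Q)
  have prod: "prod g A \<in> S" if "\<And>a. a \<in> A \<Longrightarrow> g a \<in> S" for g :: "'a \<Rightarrow> 'b" and A
    using that by (induction A rule: infinite_finite_induct) (auto intro: S)
  have pow: "a ^ n \<in> S" if "a \<in> S" for a n using that by (induction n) (auto intro: S)
  show ?thesis unfolding subst_poly_def
  proof (rule sum)
    fix m assume m: "m \<in> keys f"
    have mX: "keys m \<subseteq> X" and "\<not> keys m \<subseteq> F" using f m by (auto simp: face_prime_def carrier_poly_ring)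
    then obtain x where x: "x \<in> keys m" "x \<notin> F" by blast
    obtain n where n: "lookup m x = Suc n" using x(1) by (metis in_keys_iff not0_implies_Suc)
    have xX: "x \<in> X" using mX x(1) by blast
    have "(\<Prod>x\<in>keys m. h x ^ lookup m x) = h x ^ lookup m x * (\<Prod>x\<in>keys m - {x}. h x ^ lookup m x)"
      by (rule prod.remove[OF finite_keys x(1)])
    then have "c (lookup f m) * (\<Prod>x\<in>keys m. h x ^ lookup m x) =
        (c (lookup f m) * (h x ^ n * (\<Prod>x\<in>keys m - {x}. h x ^ lookup m x))) * h x"
      unfolding n by (simp add: mult_ac)
    moreover have "c (lookup f m) * (h x ^ n * (\<Prod>x\<in>keys m - {x}. h x ^ lookup m x)) \<in> S"
      using mX xX by (intro S pow prod h) auto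
    ultimately show "c (lookup f m) * (\<Prod>x\<in>keys m. h x ^ lookup m x) \<in> Q"
      using Q(3)[OF h(2)[OF xX x(2)]] by simp
  qed
qed

lemma subst_poly_id: "subst_poly const var f = f"
proof (induction f rule: poly_induct)
  case (single m c)
  have ev: "eval_mon var m = monomial_poly m"
    by (subst (2) poly_sum_singles[of m]) (simp add: eval_mon_def var_power monomial_poly_sum)
  show ?case unfolding const_hom.subst_single ev by (simp add: const_def monomial_poly_def mult_single)
qed (simp add: const_hom.subst_add)

section \<open>Jets of coordinate subspaces and jets over regular points\<close>

lemma jet_hom_simps:
  "jet_hom s (f + g) = jet_hom s f + jet_hom s g" "jet_hom s (f * g) = jet_hom s f * jet_hom s g"
  by (simp_all add: jet_hom_def pconst_hom.subst_add pconst_hom.subst_mult)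

lemma coeff_jet_hom_var: "coeff (jet_hom s (var x)) i = (if i \<le> s then var (x, i) else 0)"
  by (simp add: jet_hom_def pconst_hom.subst_var coeff_sum sum.delta)

text \<open>Taking constant coefficients is a homomorphism and so commutes with substitution; the
  bottom coefficient is thereby the map behind \<open>jet_proj\<close>.\<close>

lemma coeff_jet_hom_0:
  fixes f :: "('x, 'k::comm_ring_1) mpoly"
  shows "coeff (jet_hom s f) 0 = subst_poly const (\<lambda>x. var (x, 0)) f"
proof -
  have "coeff (jet_hom s f) 0 = subst_poly (\<lambda>a. coeff [:const a:] 0)
      (\<lambda>x. coeff (\<Sum>j \<le> s. Polynomial.monom (var (x, j)) j) 0) f"
    unfolding jet_hom_def by (rule subst_poly_comp) (simp_all add: coeff_mult_0)
  moreover have "coeff (\<Sum>j \<le> s. Polynomial.monom (var (x, j)) j) 0 = (var (x, 0) :: ('x \<times> nat, 'k) mpoly)" for x :: 'x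
    by (simp add: coeff_sum sum.delta)
  ultimately show ?thesis by simp
qed

lemma coeff_jet_hom_closed:
  assumes "f \<in> carrier (poly_ring X)"
  shows "coeff (jet_hom s f) i \<in> carrier (poly_ring (jet_vars s X))"
  using assms
proof (induction f arbitrary: i rule: poly_ring_induct)
  case (const c)
  then show ?case by (cases i) (simp_all add: jet_hom_def pconst_hom.subst_const poly_ring_const)
next
  case (var x)
  then show ?case by (auto simp: coeff_jet_hom_var jet_vars_def intro: poly_ring_var)
next
  case (add p q)
  then show ?case by (simp add: jet_hom_simps poly_ring_add)
next
  case (mult p q)
  then show ?case unfolding jet_hom_simps coeff_mult by (intro poly_ring_sum poly_ring_mult) auto
qed

lemma sr_ideal_subset_face_prime:
  assumes "simplicial_complex X \<Delta>" "F \<in> \<Delta>"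
  shows "sr_ideal X \<Delta> \<subseteq> face_prime X F"
  using assms by (auto simp: sr_ideal_def face_prime_def simplicial_complex_def)

text \<open>The prime is the generic point of the jets of the coordinate subspace of
  \<open>F\<close>: it contains all lifts of variables outside \<open>F\<close>, hence all
  coefficients of the jets of the ideal.\<close>

lemma face_prime_in_jet_locus:
  assumes X: "finite X" and \<Delta>: "simplicial_complex X \<Delta>" and F: "F \<in> \<Delta>"
  shows "(face_prime (jet_vars s X) (F \<times> {..s}) :: ('x \<times> nat, 'k::field) mpoly set) \<in>
    vanishing_locus (poly_ring (jet_vars s X)) (jet_ideal s X (sr_ideal X \<Delta>))"
proof -
  let ?Q = "face_prime (jet_vars s X) (F \<times> {..s}) :: ('x \<times> nat, 'k) mpoly set"
  let ?S = "poly_ring (jet_vars s X) :: ('x \<times> nat, 'k) mpoly ring"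
  have FX: "F \<subseteq> X" using \<Delta> F by (auto simp: simplicial_complex_def)
  have prime: "primeideal ?Q ?S"
    using finite_subset[OF FX X] by (intro primeideal_face_prime) simp
  interpret Q: poly_prime "jet_vars s X" ?Q by (rule poly_prime.intro[OF prime])
  have coeffs: "coeff (jet_hom s g) j \<in> ?Q" if g: "g \<in> sr_ideal X \<Delta>" for g :: "('x, 'k) mpoly" and j
  proof -
    have "jet_hom s g \<in> {p. \<forall>i. coeff p i \<in> ?Q}"
      unfolding jet_hom_def
    proof (rule subst_poly_in_ideal[where S = "{p. \<forall>i. coeff p i \<in> carrier ?S}" and X = X and F = F])
      show "0 \<in> {p. \<forall>i. coeff p i \<in> ?Q}" using Q.zero by simp
      show "a + b \<in> {p. \<forall>i. coeff p i \<in> ?Q}"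
        if "a \<in> {p. \<forall>i. coeff p i \<in> ?Q}" "b \<in> {p. \<forall>i. coeff p i \<in> ?Q}" for a b
        using that by (simp add: Q.add)
      show "b * a \<in> {p. \<forall>i. coeff p i \<in> ?Q}"
        if "a \<in> {p. \<forall>i. coeff p i \<in> ?Q}" "b \<in> {p. \<forall>i. coeff p i \<in> carrier ?S}" for a b
        using that by (simp add: coeff_mult Q.sum Q.mult)
      show "1 \<in> {p. \<forall>i. coeff p i \<in> carrier ?S}" by (simp add: coeff_1)
      show "a * b \<in> {p. \<forall>i. coeff p i \<in> carrier ?S}"
        if "a \<in> {p. \<forall>i. coeff p i \<in> carrier ?S}" "b \<in> {p. \<forall>i. coeff p i \<in> carrier ?S}" for a b
        using that by (simp add: coeff_mult poly_ring_sum poly_ring_mult)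
      show "[:const k:] \<in> {p. \<forall>i. coeff p i \<in> carrier ?S}" for k
        by (simp add: coeff_pCons poly_ring_const split: nat.splits)
      show "(\<Sum>j\<le>s. Polynomial.monom (var (x, j)) j) \<in> {p. \<forall>i. coeff p i \<in> carrier ?S}" if "x \<in> X" for x
        using that by (simp add: coeff_sum sum.delta poly_ring_var jet_vars_def)
      show "(\<Sum>j\<le>s. Polynomial.monom (var (x, j)) j) \<in> {p. \<forall>i. coeff p i \<in> ?Q}" if x: "x \<in> X" "x \<notin> F" for x
      proof -
        have "var (x, i) \<in> ?Q" if "i \<le> s" for i
          using x that poly_ring_var[of "(x, i)" "jet_vars s X"]
          by (auto simp: face_prime_def jet_vars_def var_def monomial_poly_def)
        then show ?thesis using Q.zero by (simp add: coeff_sum sum.delta)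
      qed
      show "g \<in> face_prime X F" using sr_ideal_subset_face_prime[OF \<Delta> F] g by blast
    qed
    then show ?thesis by blast
  qed
  interpret ring ?S using cring_poly_ring by (rule cring.axioms(1))
  have "jet_ideal s X (sr_ideal X \<Delta>) \<subseteq> ?Q" unfolding jet_ideal_def
    using prime coeffs by (intro genideal_minimal primeideal.axioms(1)) auto
  then show ?thesis using prime by (simp add: vanishing_locus_def Spec_def)
qed

lemma jet_proj_face_prime:
  assumes X: "finite X" and F: "F \<subseteq> X"
  shows "jet_proj X (face_prime (jet_vars s X) (F \<times> {..s}) :: ('x \<times> nat, 'k::field) mpoly set) = face_prime X F"
proof (intro equalityI subsetI)
  let ?Q = "face_prime (jet_vars s X) (F \<times> {..s}) :: ('x \<times> nat, 'k) mpoly set"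
  let ?\<sigma> = "subst_poly const (\<lambda>x. var (x, 0)) :: ('x, 'k) mpoly \<Rightarrow> ('x \<times> nat, 'k) mpoly"
  have finF: "finite F" using finite_subset[OF F X] .
  fix f :: "('x, 'k) mpoly" assume "f \<in> jet_proj X ?Q"
  then have f: "f \<in> carrier (poly_ring X)" "?\<sigma> f \<in> ?Q" by (auto simp: jet_proj_def)
  interpret P: poly_prime X "face_prime X F :: ('x, 'k) mpoly set"
    by (rule poly_prime.intro[OF primeideal_face_prime[OF finF]])
  \<comment> \<open>The composite of \<open>?\<rho>\<close> after \<open>?\<sigma>\<close> is
    \<open>?\<kappa>\<close>, which kills the variables outside \<open>F\<close> and changes a
    polynomial only by an element of the prime of \<open>F\<close>.\<close>
  let ?\<rho> = "subst_poly const (\<lambda>(x, j). if x \<in> F \<and> j = 0 then var x else 0) :: ('x \<times> nat, 'k) mpoly \<Rightarrow> ('x, 'k) mpoly"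
  let ?\<kappa> = "subst_poly const (\<lambda>x. if x \<in> F then var x else 0) :: ('x, 'k) mpoly \<Rightarrow> ('x, 'k) mpoly"
  have "?\<rho> (?\<sigma> f) = subst_poly (\<lambda>a. ?\<rho> (const a)) (\<lambda>x. ?\<rho> (var (x, 0))) f"
    by (rule subst_poly_comp) (simp_all add: const_hom.subst_add const_hom.subst_mult)
  then have comp: "?\<rho> (?\<sigma> f) = ?\<kappa> f" by (simp add: const_hom.subst_const const_hom.subst_var)
  have "?\<rho> (?\<sigma> f) \<in> {0}"
  proof (rule subst_poly_in_ideal[where S = UNIV and X = "jet_vars s X" and F = "F \<times> {..s}"])
    show "?\<sigma> f \<in> ?Q" by (rule f(2))
  qed (auto simp: jet_vars_def split: if_splits)
  then have zero: "?\<kappa> f = 0" using comp by simp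
  have "p - ?\<kappa> p \<in> face_prime X F \<and> ?\<kappa> p \<in> carrier (poly_ring X)" if "p \<in> carrier (poly_ring X)" for p
    using that
  proof (induction p rule: poly_ring_induct)
    case (const c)
    then show ?case by (simp add: const_hom.subst_const P.zero poly_ring_const)
  next
    case (var x)
    have "var x \<in> (face_prime X F :: ('x, 'k) mpoly set)" if "x \<notin> F"
      using that poly_ring_var[OF var] by (auto simp: face_prime_def var_def monomial_poly_def)
    then show ?case by (simp add: const_hom.subst_var P.zero poly_ring_var[OF var])
  next
    case (add p q)
    then have "(p - ?\<kappa> p) + (q - ?\<kappa> q) \<in> face_prime X F" by (intro P.add) auto
    then show ?case using add by (simp add: const_hom.subst_add poly_ring_add algebra_simps)
  next
    case (mult p q)
    then have "q * (p - ?\<kappa> p) + ?\<kappa> p * (q - ?\<kappa> q) \<in> face_prime X F" by (intro P.add P.mult) auto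
    moreover have "q * (p - ?\<kappa> p) + ?\<kappa> p * (q - ?\<kappa> q) = p * q - ?\<kappa> (p * q)"
      by (simp add: const_hom.subst_mult algebra_simps)
    ultimately show ?case using mult by (simp add: const_hom.subst_mult poly_ring_mult)
  qed
  from this[OF f(1)] show "f \<in> face_prime X F" by (simp add: zero)
next
  let ?Q = "face_prime (jet_vars s X) (F \<times> {..s}) :: ('x \<times> nat, 'k) mpoly set"
  have finF: "finite (F \<times> {..s})" using finite_subset[OF F X] by simp
  interpret Q: poly_prime "jet_vars s X" ?Q by (rule poly_prime.intro[OF primeideal_face_prime[OF finF]])
  fix f :: "('x, 'k) mpoly" assume f: "f \<in> face_prime X F"
  have "subst_poly const (\<lambda>x. var (x, 0)) f \<in> ?Q"
  proof (rule subst_poly_in_ideal[where S = "carrier (poly_ring (jet_vars s X))" and X = X and F = F])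
    show "var (x, 0) \<in> ?Q" if "x \<in> X" "x \<notin> F" for x
      using that poly_ring_var[of "(x, 0)" "jet_vars s X"]
      by (auto simp: face_prime_def jet_vars_def var_def monomial_poly_def)
    show "var (x, 0) \<in> carrier (poly_ring (jet_vars s X))" if "x \<in> X" for x
      using that by (intro poly_ring_var) (simp add: jet_vars_def)
  qed (use f in \<open>auto intro: Q.zero Q.add Q.mult poly_ring_const poly_ring_mult\<close>)
  then show "f \<in> jet_proj X ?Q" using f by (simp add: jet_proj_def face_prime_def)
qed

text \<open>The product of the variables of a facet is outside the prime and multiplies the prime
  into the ideal, since a face containing the facet is the facet itself. Hence the local ring is a
  field.\<close>

lemma facet_smooth:
  assumes X: "finite X" and \<Delta>: "simplicial_complex X \<Delta>" and F: "F \<in> \<Delta>"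
    and facet: "\<And>G. G \<in> \<Delta> \<Longrightarrow> F \<subseteq> G \<Longrightarrow> G = F"
  shows "(face_prime X F :: ('x, 'k::field) mpoly set) \<notin>
    singular_locus (poly_ring X) (vanishing_locus (poly_ring X) (sr_ideal X \<Delta>))"
proof -
  have FX: "F \<subseteq> X" using \<Delta> F by (auto simp: simplicial_complex_def)
  have finF: "finite F" using finite_subset[OF FX X] .
  let ?u = "monomial_poly (sqf F) :: ('x, 'k) mpoly"
  have u: "?u \<in> carrier (poly_ring X)" using FX by (simp add: carrier_poly_ring monomial_poly_def keys_sqf[OF finF])
  have u_notin: "?u \<notin> face_prime X F" by (simp add: face_prime_def monomial_poly_def keys_sqf[OF finF])
  have kill: "?u * f \<in> sr_ideal X \<Delta>" if f: "f \<in> face_prime X F" for f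
  proof -
    have "keys m \<notin> \<Delta>" if m: "m \<in> keys (?u * f)" for m
    proof
      assume mD: "keys m \<in> \<Delta>"
      obtain a b where ab: "a \<in> keys ?u" "b \<in> keys f" "m = a + b" using in_keys_mult[OF m] by blast
      then have "keys m = F \<union> keys b" by (simp add: keys_mon_add monomial_poly_def keys_sqf[OF finF])
      moreover from this have "keys m = F" using facet[OF mD] by blast
      ultimately have "keys b \<subseteq> F" by blast
      then show False using f ab(2) unfolding face_prime_def by blast
    qed
    moreover have "?u * f \<in> carrier (poly_ring X)" using f by (intro poly_ring_mult[OF u]) (simp add: face_prime_def)
    ultimately show ?thesis unfolding sr_ideal_def by blast
  qed
  interpret sr_point X \<Delta> "face_prime X F :: ('x, 'k) mpoly set"
    by (intro sr_point.intro X \<Delta> primeideal_face_prime[OF finF] sr_ideal_subset_face_prime[OF \<Delta> F])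
  have "field L.germs"
  proof (rule L.field_germs)
    fix f :: "('x, 'k) mpoly" assume "f \<in> face_prime X F"
    from kill[OF this] show "\<exists>u\<in>carrier (poly_ring X) - face_prime X F. u \<otimes>\<^bsub>poly_ring X\<^esub> f \<in> sr_ideal X \<Delta>"
      unfolding poly_ring_simps by (rule bexI[OF _ DiffI[OF u u_notin]])
  qed
  then have "regular_local_ring L.germs" by (rule field.regular_local_ring)
  then show ?thesis by (simp only: singular_locus_iff not_not HOL.simp_thms)
qed

text \<open>Regularity leaves a single coordinate subspace through the projected point, and the
  variables outside \<open>P\<close> are invertible there. The equations of the jets then force all
  lifts of variables outside the corresponding face into \<open>Q\<close>.\<close>

lemma jets_over_smooth_points:
  fixes Q :: "('x \<times> nat, 'k::field) mpoly set"
  assumes X: "finite X" and \<Delta>: "simplicial_complex X \<Delta>"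
    and Q: "Q \<in> vanishing_locus (poly_ring (jet_vars s X)) (jet_ideal s X (sr_ideal X \<Delta>))"
    and smooth: "jet_proj X Q \<notin> singular_locus (poly_ring X) (vanishing_locus (poly_ring X) (sr_ideal X \<Delta>))"
  shows "sr_ideal (jet_vars s X) (jet_complex s X \<Delta>) \<subseteq> Q"
proof -
  have primeQ: "primeideal Q (poly_ring (jet_vars s X))" and IQ: "jet_ideal s X (sr_ideal X \<Delta>) \<subseteq> Q"
    using Q by (auto simp: vanishing_locus_def Spec_def)
  interpret Q: poly_prime "jet_vars s X" Q by (rule poly_prime.intro[OF primeQ])
  interpret S: ring "poly_ring (jet_vars s X) :: ('x \<times> nat, 'k) mpoly ring"
    using cring_poly_ring by (rule cring.axioms(1))
  have jets: "coeff (jet_hom s g) j \<in> Q" if "g \<in> sr_ideal X \<Delta>" "j \<le> s" for g :: "('x, 'k) mpoly" and j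
  proof -
    have "{coeff (jet_hom s g) j | g j. g \<in> sr_ideal X \<Delta> \<and> j \<le> s} \<subseteq> jet_ideal s X (sr_ideal X \<Delta> :: ('x, 'k) mpoly set)"
      unfolding jet_ideal_def using coeff_jet_hom_closed by (intro S.genideal_self) (auto simp: sr_ideal_def)
    then show ?thesis using that IQ by blast
  qed
  define P where "P = jet_proj X Q"
  have P_iff: "f \<in> P \<longleftrightarrow> f \<in> carrier (poly_ring X) \<and> coeff (jet_hom s f) 0 \<in> Q" for f
    by (simp add: P_def jet_proj_def coeff_jet_hom_0)
  have primeP: "primeideal P (poly_ring X :: ('x, 'k) mpoly ring)"
  proof (unfold primeideal_poly_ring_iff, intro conjI allI ballI impI)
    show "ideal P (poly_ring X :: ('x, 'k) mpoly ring)"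
    proof (rule ideal_poly_ringI)
      fix a b assume "a \<in> P" "b \<in> P"
      then show "a + b \<in> P" by (simp add: P_iff poly_ring_add jet_hom_simps Q.add)
    next
      fix a r :: "('x, 'k) mpoly" assume "a \<in> P" "r \<in> carrier (poly_ring X)"
      then show "r * a \<in> P"
        by (simp add: P_iff poly_ring_mult jet_hom_simps coeff_mult_0 Q.mult coeff_jet_hom_closed)
    qed (auto simp: P_iff Q.zero jet_hom_def)
    show "1 \<notin> P" using Q.one by (simp add: P_iff jet_hom_def)
    fix a b :: "('x, 'k) mpoly"
    assume ab: "a \<in> carrier (poly_ring X)" "b \<in> carrier (poly_ring X)" "a * b \<in> P"
    then have "coeff (jet_hom s a) 0 * coeff (jet_hom s b) 0 \<in> Q" by (simp add: P_iff jet_hom_simps coeff_mult_0)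
    then show "a \<in> P \<or> b \<in> P"
      using Q.primeD[OF _ coeff_jet_hom_closed[OF ab(1)] coeff_jet_hom_closed[OF ab(2)]] ab by (auto simp: P_iff)
  qed
  have "sr_ideal X \<Delta> \<subseteq> P" using jets[of _ 0] by (auto simp: P_iff sr_ideal_def)
  then interpret sr_point X \<Delta> P by (intro sr_point.intro X \<Delta> primeP)
  have "regular_local_ring L.germs" using smooth unfolding P_def[symmetric] singular_locus_iff by simp
  then have F: "{w \<in> X. insert w {x \<in> X. var x \<notin> P} \<in> \<Delta>} \<in> \<Delta>" (is "?F \<in> \<Delta>") by (rule smooth_point)
  let ?V = "{x \<in> X. var x \<notin> P}"
  \<comment> \<open>Induction on the jet index: the coefficient of \<open>t ^ j\<close> in the jet
    of \<open>x\<close> times the product over \<open>?V\<close> has one summand without a lower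
    lift of \<open>x\<close>, namely \<open>var (x, j)\<close> times an element outside
    \<open>Q\<close>.\<close>
  have vars: "var (x, j) \<in> Q" if x: "x \<in> X" "x \<notin> ?F" and "j \<le> s" for x j
    using that(3)
  proof (induction j rule: less_induct)
    case (less j)
    have finV: "finite ?V" using X by simp
    have xV: "insert x ?V \<notin> \<Delta>" using x by blast
    then have "x \<notin> ?V" using face_of_prime by (metis insert_absorb)
    have "monomial_poly (sqf (insert x ?V)) \<in> (sr_ideal X \<Delta> :: ('x, 'k) mpoly set)"
      using xV x(1) finV by (auto simp: sr_ideal_def carrier_poly_ring monomial_poly_def keys_sqf)
    then have "var x * (\<Prod>y\<in>?V. var y) \<in> (sr_ideal X \<Delta> :: ('x, 'k) mpoly set)"
      using finV \<open>x \<notin> ?V\<close> by (simp add: monomial_sqf)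
    from jets[OF this less.prems]
    have in_Q: "(\<Sum>i\<le>j. coeff (jet_hom s (var x)) i * coeff (jet_hom s (\<Prod>y\<in>?V. var y)) (j - i)) \<in> Q"
      by (simp only: jet_hom_simps coeff_mult)
    have eq: "(\<Sum>i\<le>j. coeff (jet_hom s (var x)) i * coeff (jet_hom s (\<Prod>y\<in>?V. var y)) (j - i)) =
        (\<Sum>i<j. coeff (jet_hom s (var x)) i * coeff (jet_hom s (\<Prod>y\<in>?V. var y)) (j - i)) +
        var (x, j) * coeff (jet_hom s (\<Prod>y\<in>?V. var y)) 0" (is "_ = ?A + ?B")
      using less.prems by (simp add: lessThan_Suc_atMost[symmetric] coeff_jet_hom_var)
    have AB: "?A + ?B \<in> Q" using in_Q unfolding eq .
    have Vc: "(\<Prod>y\<in>?V. var y) \<in> carrier (poly_ring X) - P" by (rule P.prod_notin) (auto intro: poly_ring_var)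
    have c: "coeff (jet_hom s (\<Prod>y\<in>?V. var y :: ('x, 'k) mpoly)) i \<in> carrier (poly_ring (jet_vars s X))" for i
      by (rule coeff_jet_hom_closed[OF DiffD1[OF Vc]])
    have "?A \<in> Q"
    proof (rule Q.sum)
      fix i assume i: "i \<in> {..<j}"
      then have "var (x, i) \<in> Q" using less by simp
      then show "coeff (jet_hom s (var x)) i * coeff (jet_hom s (\<Prod>y\<in>?V. var y)) (j - i) \<in> Q"
        using i less.prems Q.mult'[OF _ c] by (simp add: coeff_jet_hom_var)
    qed
    from Q.diff[OF AB this] have "?B \<in> Q" by (simp only: add_diff_cancel_left')
    moreover have "coeff (jet_hom s (\<Prod>y\<in>?V. var y)) 0 \<notin> Q" using Vc by (simp add: P_iff)
    moreover have "var (x, j) \<in> carrier (poly_ring (jet_vars s X))"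
      using x(1) less.prems by (intro poly_ring_var) (simp add: jet_vars_def)
    ultimately show ?case using Q.primeD[OF _ _ c] by blast
  qed
  show ?thesis
  proof
    fix f :: "('x \<times> nat, 'k) mpoly" assume f: "f \<in> sr_ideal (jet_vars s X) (jet_complex s X \<Delta>)"
    have down: "B \<in> \<Delta>" if "A \<in> \<Delta>" "B \<subseteq> A" for A B using \<Delta> that by (auto simp: simplicial_complex_def)
    \<comment> \<open>A monomial in lifts of variables of \<open>?F\<close> projects to a face and
      cannot occur in \<open>f\<close>.\<close>
    have "\<not> keys m \<subseteq> ?F \<times> {..s}" if "m \<in> keys f" for m
    proof
      assume "keys m \<subseteq> ?F \<times> {..s}"
      then have "fst ` keys m \<in> \<Delta>" by (intro down[OF F]) auto
      then show False using f that by (auto simp: sr_ideal_def jet_complex_def carrier_poly_ring)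
    qed
    then have "f \<in> face_prime (jet_vars s X) (?F \<times> {..s})" using f by (auto simp: face_prime_def sr_ideal_def)
    then have "subst_poly const var f \<in> Q"
    proof (rule subst_poly_in_ideal[where S = "carrier (poly_ring (jet_vars s X))", rotated -1])
      show "var y \<in> Q" if "y \<in> jet_vars s X" "y \<notin> ?F \<times> {..s}" for y
        using that vars[of "fst y" "snd y"] by (cases y) (auto simp: jet_vars_def)
    qed (auto intro: Q.zero Q.add Q.mult poly_ring_const poly_ring_mult poly_ring_var)
    then show "f \<in> Q" by (simp only: subst_poly_id)
  qed
qed

section \<open>The ideal of principal jets\<close>

theorem principal_jets_sr_ideal:
  assumes X: "finite X" and \<Delta>: "simplicial_complex X \<Delta>"
  shows "principal_jets s X (sr_ideal X \<Delta> :: ('x, 'k::field) mpoly set) =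
    sr_ideal (jet_vars s X) (jet_complex s X \<Delta>)"
proof -
  let ?S = "poly_ring (jet_vars s X) :: ('x \<times> nat, 'k) mpoly ring"
  let ?Z = "vanishing_locus (poly_ring X) (sr_ideal X \<Delta> :: ('x, 'k) mpoly set)"
  let ?L = "vanishing_locus ?S (jet_ideal s X (sr_ideal X \<Delta>))"
  let ?Y = "?L - {Q \<in> Spec ?S. jet_proj X Q \<in> singular_locus (poly_ring X) ?Z}"
  have "?Y \<subseteq> Spec ?S" by (auto simp: vanishing_locus_def)
  then have eq: "principal_jets s X (sr_ideal X \<Delta> :: ('x, 'k) mpoly set) = vanishing_ideal ?S ?Y"
    unfolding principal_jets_def Let_def jet_locus_def vanishing_ideal_sr_ideal[OF X \<Delta>]
    by (rule vanishing_ideal_zariski_closure)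
  show ?thesis unfolding eq
  proof (intro equalityI subsetI)
    fix f assume f: "f \<in> vanishing_ideal ?S ?Y"
    have "keys m \<notin> jet_complex s X \<Delta>" if m: "m \<in> keys f" for m
    proof
      assume mD: "keys m \<in> jet_complex s X \<Delta>"
      have "\<Delta> \<subseteq> Pow X" using \<Delta> by (simp add: simplicial_complex_def)
      then have "finite \<Delta>" using X finite_subset by auto
      moreover have "fst ` keys m \<in> \<Delta>" using mD by (simp add: jet_complex_def)
      \<comment> \<open>A facet above the projection of \<open>m\<close>; the generic point of its
        jets lies over a regular point and does not contain the monomial \<open>m\<close>.\<close>
      ultimately obtain F where F: "F \<in> \<Delta>" "fst ` keys m \<subseteq> F" and "\<And>G. G \<in> \<Delta> \<Longrightarrow> F \<subseteq> G \<Longrightarrow> F = G"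
        using finite_has_maximal2[of \<Delta> "fst ` keys m"] by auto
      then have facet: "\<And>G. G \<in> \<Delta> \<Longrightarrow> F \<subseteq> G \<Longrightarrow> G = F" by blast
      have FX: "F \<subseteq> X" using \<Delta> F(1) by (auto simp: simplicial_complex_def)
      have "(face_prime (jet_vars s X) (F \<times> {..s}) :: ('x \<times> nat, 'k) mpoly set) \<in> ?Y"
      proof (intro DiffI notI)
        show "(face_prime (jet_vars s X) (F \<times> {..s}) :: ('x \<times> nat, 'k) mpoly set) \<in> ?L"
          by (rule face_prime_in_jet_locus[OF X \<Delta> F(1)])
        assume "(face_prime (jet_vars s X) (F \<times> {..s}) :: ('x \<times> nat, 'k) mpoly set)
          \<in> {Q \<in> Spec ?S. jet_proj X Q \<in> singular_locus (poly_ring X) ?Z}"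
        then show False
          using facet_smooth[OF X \<Delta> F(1) facet, where 'k = 'k] by (simp only: mem_Collect_eq jet_proj_face_prime[OF X FX] HOL.simp_thms)
      qed
      then have "f \<in> face_prime (jet_vars s X) (F \<times> {..s})" using f unfolding vanishing_ideal_def by blast
      moreover have "keys m \<subseteq> F \<times> {..s}" using mD F(2) by (fastforce simp: jet_complex_def jet_vars_def)
      ultimately show False using m by (auto simp: face_prime_def)
    qed
    then show "f \<in> sr_ideal (jet_vars s X) (jet_complex s X \<Delta>)" using f by (simp add: sr_ideal_def vanishing_ideal_def)
  next
    fix f :: "('x \<times> nat, 'k) mpoly" assume f: "f \<in> sr_ideal (jet_vars s X) (jet_complex s X \<Delta>)"
    have "f \<in> Q" if Q: "Q \<in> ?Y" for Q
    proof -
      have "Q \<in> ?L" "Q \<in> Spec ?S" using Q by (auto simp: vanishing_locus_def)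
      then show ?thesis using jets_over_smooth_points[OF X \<Delta>, of Q s] Q f by blast
    qed
    then show "f \<in> vanishing_ideal ?S ?Y" using f by (simp add: vanishing_ideal_def sr_ideal_def)
  qed
qed

theorem theorem7p6:
  fixes X :: "'x set"
    and \<Delta> :: "'x set set"
    and I :: "('x, 'k::field) mpoly set"
    and s :: nat
  assumes "finite X"
    and "simplicial_complex X \<Delta>"
    and "is_stanley_reisner_ideal X \<Delta> I"
  shows "(\<exists>\<Gamma>. simplicial_complex (jet_vars s X) \<Gamma> \<and>
             is_stanley_reisner_ideal (jet_vars s X) \<Gamma> (principal_jets s X I)) \<and>
         betti_matrix (jet_vars s X) (principal_jets s X I) =
           inf_mat_mult (betti_matrix X I) (lifting_matrix s) \<and>
         regularity (jet_vars s X) (principal_jets s X I) = regularity X I"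
proof -
  note X = assms(1) and \<Delta> = assms(2)
  have I: "I = sr_ideal X \<Delta>" by (rule stanley_reisner_eq_sr_ideal[OF assms])
  have jets: "principal_jets s X I = sr_ideal (jet_vars s X) (jet_complex s X \<Delta>)"
    unfolding I by (rule principal_jets_sr_ideal[OF X \<Delta>])
  have \<Gamma>: "simplicial_complex (jet_vars s X) (jet_complex s X \<Delta>)"
    by (rule simplicial_jet_complex[OF \<Delta>])
  have "is_stanley_reisner_ideal (jet_vars s X) (jet_complex s X \<Delta>) (principal_jets s X I)"
    unfolding jets by (rule is_stanley_reisner_sr_ideal[OF finite_jet_vars[OF X] \<Gamma>])
  moreover have "betti_matrix (jet_vars s X) (principal_jets s X I) =
      inf_mat_mult (betti_matrix X I) (lifting_matrix s)"
    unfolding jets unfolding I by (rule betti_matrix_jet_complex[OF X \<Delta>])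
  moreover have "regularity (jet_vars s X) (principal_jets s X I) = regularity X I"
    unfolding jets unfolding I by (rule regularity_jet_complex[OF X \<Delta>])
  ultimately show ?thesis using \<Gamma> by blast
qed

end
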